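(* Let $G$ be a $3$-connected graph. Then $G$ has no $K_{2,4}$ minor if and only if $G \in \widetilde{\mathcal{G}}$ or $G$ is isomorphic to one of the nine graphs $K_5$, $K_{3,3}$, $A$, $A^+$, $B$, $B^+$, $C$, $C^+$, $D$.
   Context: All graphs are simple; minors are taken with parallel edges and loops removed after contraction. For $n \ge 3$ and $r,s \in \{0,1,\ldots,n-3\}$, the graph $G_{n,r,s}$ has vertex set $\{v_1,\ldots,v_n\}$ and consists of the path $v_1v_2\ldots v_n$, the edges $v_1v_{n-i}$ for $1 \le i \le r$, and the edges $v_nv_{1+j}$ for $1 \le j \le s$; $G^+_{n,r,s}$ is $G_{n,r,s}$ plus the edge $v_1v_n$. $\mathcal{G}$ is the set of graphs of the form $G_{n,r,s}$ or $G^+_{n,r,s}$ that are $3$-connected and $K_{2,4}$-minor-free, and $\widetilde{\mathcal{G}}$ is the class of graphs isomorphic to a member of $\mathcal{G}$. The nine exceptional graphs: $K_5$; $K_{3,3}$; $A$ = $K_{3,3}$ plus one edge joining two vertices in the same part; $A^+$ = $K_{3,3}$ plus one edge inside each part; $C^+$ = the graph on $\{v_1,\ldots,v_8\}$ with edges $v_1v_2, v_1v_3, v_2v_3, v_1v_7, v_2v_8, v_3v_6, v_4v_5$ and $v_iv_j$ for $i \in \{4,5\}$, $j \in \{6,7,8\}$; $C = C^+\backslash v_4v_5$; $B^+$ = the graph on $\{w,v_2,v_3,v_4,v_5,v_6,v_8\}$ with edges $wv_2, wv_3, v_2v_3, wv_4, wv_5, v_4v_5, v_4v_6, v_4v_8,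 v_5v_6, v_5v_8, v_3v_6, v_2v_8$; $B = B^+\backslash v_4v_5$; $D$ = the triangular prism (triangles $a_1a_2a_3$, $b_1b_2b_3$ and edges $a_ib_i$) plus a new vertex adjacent to $a_1,a_2,a_3$. *)

theory Defs
  imports "Graph_Theory.Graph_Theory"
begin

text \<open>
  Finite simple graphs are rendered as in the Graph_Theory entry: as finite, loop-free, symmetric
  digraphs without parallel arcs (locale pair_graph), an edge $uv$ being the pair of arcs
  $(u,v)$, $(v,u)$. In particular, \<open>connected\<close>, \<open>subgraph\<close>, \<open>\<restriction>\<close> (induced subgraph), \<open>digraph_iso\<close>
  and the predicates for complete and complete bipartite graphs are those of that entry.
\<close>

definition graph_of :: "'a set \<Rightarrow> ('a \<times> 'a) set \<Rightarrow> 'a pair_pre_digraph" where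
  "graph_of V E = \<lparr> pverts = V, parcs = E \<union> E\<inverse> \<rparr>"

definition add_edge :: "'a pair_pre_digraph \<Rightarrow> 'a \<Rightarrow> 'a \<Rightarrow> 'a pair_pre_digraph" where
  "add_edge G u v = \<lparr> pverts = pverts G, parcs = parcs G \<union> {(u, v), (v, u)} \<rparr>"

definition delete_edge :: "'a pair_pre_digraph \<Rightarrow> 'a \<Rightarrow> 'a \<Rightarrow> 'a pair_pre_digraph" where
  "delete_edge G u v = \<lparr> pverts = pverts G, parcs = parcs G - {(u, v), (v, u)} \<rparr>"

definition k_connected :: "nat \<Rightarrow> 'a pair_pre_digraph \<Rightarrow> bool" where
  "k_connected k G \<longleftrightarrow> card (pverts G) > k \<and>
    (\<forall>S. S \<subseteq> pverts G \<and> card S < k \<longrightarrow> connected (with_proj G \<restriction> (pverts G - S)))"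


text \<open>
  Contraction of the edge $uv$: the merged vertex keeps the name $u$. Parallel edges disappear
  since the arcs form a set; the condition \<open>f a \<noteq> f b\<close> removes the loops.
\<close>

definition contract_edge :: "'a pair_pre_digraph \<Rightarrow> 'a \<Rightarrow> 'a \<Rightarrow> 'a pair_pre_digraph" where
  "contract_edge G u v = (let f = id(v := u) in
     \<lparr> pverts = f ` pverts G, parcs = {(f a, f b) | a b. (a, b) \<in> parcs G \<and> f a \<noteq> f b} \<rparr>)"

text \<open>
  The rule \<open>sub\<close> covers the deletion of edges and vertices; its premise \<open>pair_graph K\<close> ensures
  that the two arcs of an edge are deleted together.
\<close>

inductive reduces_to :: "'a pair_pre_digraph \<Rightarrow> 'a pair_pre_digraph \<Rightarrow> bool"
  for G :: "'a pair_pre_digraph" where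
  refl: "reduces_to G G"
| sub: "reduces_to G H \<Longrightarrow> pair_graph K \<Longrightarrow> subgraph (with_proj K) (with_proj H) \<Longrightarrow> reduces_to G K"
| contract: "reduces_to G H \<Longrightarrow> (u, v) \<in> parcs H \<Longrightarrow> reduces_to G (contract_edge H u v)"

definition is_minor :: "'b pair_pre_digraph \<Rightarrow> 'a pair_pre_digraph \<Rightarrow> bool" where
  "is_minor H G \<longleftrightarrow> (\<exists>M. reduces_to G M \<and> digraph_iso (with_proj M) (with_proj H))"

definition K24_minor_free :: "'a pair_pre_digraph \<Rightarrow> bool" where
  "K24_minor_free G \<longleftrightarrow>
    \<not> (\<exists>H :: nat pair_pre_digraph. K\<^bsub>2,4\<^esub> (with_proj H) \<and> is_minor H G)"


text \<open>The vertex $v_i$ is the natural number $i$.\<close>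

definition Gnrs :: "nat \<Rightarrow> nat \<Rightarrow> nat \<Rightarrow> nat pair_pre_digraph" where
  "Gnrs n r s = graph_of {1..n}
     ({(i, i + 1) | i. 1 \<le> i \<and> i < n} \<union>
      {(1, n - i) | i. 1 \<le> i \<and> i \<le> r} \<union>
      {(n, 1 + j) | j. 1 \<le> j \<and> j \<le> s})"

definition Gnrs_plus :: "nat \<Rightarrow> nat \<Rightarrow> nat \<Rightarrow> nat pair_pre_digraph" where
  "Gnrs_plus n r s = add_edge (Gnrs n r s) 1 n"

definition family_G :: "nat pair_pre_digraph set" where
  "family_G = {H. (\<exists>n r s. n \<ge> 3 \<and> r \<in> {0..n - 3} \<and> s \<in> {0..n - 3} \<and>
                     (H = Gnrs n r s \<or> H = Gnrs_plus n r s)) \<and>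
                  k_connected 3 H \<and> K24_minor_free H}"

definition family_G_tilde :: "'a pair_pre_digraph set" where
  "family_G_tilde = {G. \<exists>H \<in> family_G. digraph_iso (with_proj G) (with_proj H)}"


text \<open>The parts of $K_{3,3}$ are $\{1,2,3\}$ and $\{4,5,6\}$.\<close>

definition graph_K33 :: "nat pair_pre_digraph" where
  "graph_K33 = graph_of {1..6} ({1, 2, 3} \<times> {4, 5, 6})"

definition graph_A :: "nat pair_pre_digraph" where
  "graph_A = add_edge graph_K33 1 2"

definition graph_A_plus :: "nat pair_pre_digraph" where
  "graph_A_plus = add_edge (add_edge graph_K33 1 2) 4 5"

text \<open>In \<open>graph_B_plus\<close> the vertex $w$ is 1; there is no vertex 7.\<close>

definition graph_B_plus :: "nat pair_pre_digraph" where
  "graph_B_plus = graph_of {1, 2, 3, 4, 5, 6, 8}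
     {(1, 2), (1, 3), (2, 3), (1, 4), (1, 5), (4, 5),
      (4, 6), (4, 8), (5, 6), (5, 8), (3, 6), (2, 8)}"

definition graph_B :: "nat pair_pre_digraph" where
  "graph_B = delete_edge graph_B_plus 4 5"

definition graph_C_plus :: "nat pair_pre_digraph" where
  "graph_C_plus = graph_of {1..8}
     ({(1, 2), (1, 3), (2, 3), (1, 7), (2, 8), (3, 6), (4, 5)} \<union> {4, 5} \<times> {6, 7, 8})"

definition graph_C :: "nat pair_pre_digraph" where
  "graph_C = delete_edge graph_C_plus 4 5"

text \<open>In \<open>graph_D\<close>, $a_i$ is $i$, $b_i$ is $i+3$, and the additional vertex is 7.\<close>

definition graph_D :: "nat pair_pre_digraph" where
  "graph_D = graph_of {1..7}
     ({(1, 2), (2, 3), (1, 3)} \<union> {(4, 5), (5, 6), (4, 6)} \<union> {(1, 4), (2, 5), (3, 6)} \<union>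
      {7} \<times> {1, 2, 3})"


lemma pair_graph_graph_of:
  assumes "finite V" "E \<subseteq> V \<times> V" "\<And>x. (x, x) \<notin> E"
  shows "pair_graph (graph_of V E)"
proof
  have "finite E"
    using assms(1,2) by (meson finite_SigmaI finite_subset)
  then show "finite (parcs (graph_of V E))"
    by (simp add: graph_of_def)
  show "symmetric (with_proj (graph_of V E))"
    by (auto simp: graph_of_def symmetric_def sym_def)
  show "finite (pverts (graph_of V E))"
    using assms(1) by (simp add: graph_of_def)
  fix e assume "e \<in> parcs (graph_of V E)"
  then show "fst e \<in> pverts (graph_of V E)" "snd e \<in> pverts (graph_of V E)" "fst e \<noteq> snd e"
    using assms(2,3) by (cases e; auto simp: graph_of_def)+
qed

lemma pair_graph_contract_edge:
  assumes "pair_graph G"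
  shows "pair_graph (contract_edge G u v)"
proof -
  interpret pair_graph G by fact
  define f where "f = id(v := u)"
  have V: "pverts (contract_edge G u v) = f ` pverts G"
    and P: "parcs (contract_edge G u v) = {(f a, f b) | a b. (a, b) \<in> parcs G \<and> f a \<noteq> f b}"
    by (simp_all add: contract_edge_def f_def Let_def)
  show ?thesis
  proof
    have "parcs (contract_edge G u v) \<subseteq> map_prod f f ` parcs G"
      unfolding P by force
    then show "finite (parcs (contract_edge G u v))"
      by (rule finite_subset) (simp add: pair_finite_arcs)
    show "symmetric (with_proj (contract_edge G u v))"
      unfolding symmetric_def with_proj_simps
    proof (rule symI)
      fix x y assume "(x, y) \<in> parcs (contract_edge G u v)"
      then obtain a b where "x = f a" "y = f b" "(a, b) \<in> parcs G" "f a \<noteq> f b"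
        unfolding P by blast
      moreover from this have "(b, a) \<in> parcs G" by (simp add: arcs_symmetric)
      ultimately show "(y, x) \<in> parcs (contract_edge G u v)"
        unfolding P by (metis (mono_tags, lifting) mem_Collect_eq)
    qed
    show "finite (pverts (contract_edge G u v))"
      unfolding V by (simp add: pair_finite_verts)
    fix e assume "e \<in> parcs (contract_edge G u v)"
    then obtain a b where "e = (f a, f b)" "(a, b) \<in> parcs G" "f a \<noteq> f b"
      unfolding P by blast
    then show "fst e \<in> pverts (contract_edge G u v)" "snd e \<in> pverts (contract_edge G u v)"
        "fst e \<noteq> snd e"
      unfolding V using wellformed' by auto
  qed
qed

lemma pair_graph_reduces_to:
  assumes "reduces_to G H" "pair_graph G"
  shows "pair_graph H"
  using assms by induction (auto intro: pair_graph_contract_edge)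

lemma complete_bipartite_graph_K33: "K\<^bsub>3,3\<^esub> (with_proj graph_K33)"
proof -
  have "{1..6::nat} = {1, 2, 3} \<union> {4, 5, 6}" by auto
  then show ?thesis
    unfolding complete_bipartite_digraph_pair_def graph_K33_def graph_of_def converse_Times
    by (intro conjI exI[of _ "{1, 2, 3}"] exI[of _ "{4, 5, 6}"]) simp_all
qed

end

theory Submission
  imports Defs
begin

text \<open>
  A 3-connected graph on at least five vertices has an edge whose contraction is 3-connected, so a
  3-connected graph without $K_{2,4}$ minor arises from a smaller one by splitting a vertex. On at most
  eight vertices, all splits are found by a finite case analysis. On more vertices, splitting a member
  of the family yields a $K_{2,4}$ minor or a triangle with two vertices $q_1, q_2$ of degree 3 and a
  third one of degree at least 4. In the latter case the contraction of $q_1q_2$ is again 3-connected,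
  hence in the family by induction, and undoing it inserts a new vertex into an edge at a vertex of
  degree 3. A case analysis of such insertions shows that the result is in the family or has
  a $K_{2,4}$ minor.
\<close>

section \<open>Bags and minors\<close>

text \<open>The obstacle is a hub of unbounded degree: its neighbours can be distributed over the
  two halves of a split in unboundedly many ways. These splits are never enumerated. It is enough
  that a triangle survives the split; a second contraction, at this triangle, is then undone by an
  insertion at a vertex of degree 3, which has only three essentially different forms, one for each
  neighbour that the new vertex is joined to. A member of the family may have several descriptions,
  since a hub of degree 3 may exchange roles with one of its neighbours; some insertions lead back
  to the family only after other hubs have been chosen. The exceptional graphs end with eight
  vertices, because every 3-connected split of \<open>e_C\<close> or \<open>e_C_plus\<close> has the
  minor; so from nine vertices on only the family has to be carried through the induction. In the
  converse direction the family is minor-free by its definition, and only the nine graphs require a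
  search.\<close>

definition sgraph :: "'a set \<Rightarrow> 'a rel \<Rightarrow> bool" where
  "sgraph V E \<longleftrightarrow> finite V \<and> E \<subseteq> V \<times> V \<and> sym E \<and> irrefl E"

text \<open>Connectedness is expressed by cuts instead of paths: unions, images and contractions of
  connected sets are then handled by restricting or pulling back one cut, without building
  paths.\<close>

definition conn :: "'a rel \<Rightarrow> 'a set \<Rightarrow> bool" where
  "conn E S \<longleftrightarrow> S \<noteq> {} \<and> (\<forall>X. X \<subseteq> S \<and> X \<noteq> {} \<and> X \<noteq> S \<longrightarrow> (\<exists>x\<in>X. \<exists>y\<in>S - X. (x, y) \<in> E))"

definition common :: "'a rel \<Rightarrow> 'a set \<Rightarrow> 'a set \<Rightarrow> 'a set" where
  "common E A B = {v. v \<notin> A \<and> v \<notin> B \<and> (\<exists>x\<in>A. (x, v) \<in> E) \<and> (\<exists>x\<in>B. (x, v) \<in> E)}"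

text \<open>The four bags of the other part may be taken to be single vertices: see \<open>absorb_bag\<close>.\<close>

definition K24 :: "'a rel \<Rightarrow> bool" where
  "K24 E \<longleftrightarrow> (\<exists>A B. A \<inter> B = {} \<and> conn E A \<and> conn E B \<and> card (common E A B) \<ge> 4)"

lemma sgraphD:
  assumes "sgraph V E"
  shows "finite V" "(x, y) \<in> E \<Longrightarrow> x \<in> V" "(x, y) \<in> E \<Longrightarrow> y \<in> V"
    "(x, y) \<in> E \<Longrightarrow> (y, x) \<in> E" "(x, x) \<notin> E" "sym E" "finite E"
  using assms unfolding sgraph_def sym_def irrefl_def
  by (auto intro: finite_subset[of E "V \<times> V"])

lemma connI:
  assumes "S \<noteq> {}"
    and "\<And>X. X \<subseteq> S \<Longrightarrow> X \<noteq> {} \<Longrightarrow> X \<noteq> S \<Longrightarrow> \<exists>x\<in>X. \<exists>y\<in>S - X. (x, y) \<in> E"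
  shows "conn E S"
  using assms unfolding conn_def by blast

lemma connD:
  assumes "conn E S" "X \<subseteq> S" "X \<noteq> {}" "X \<noteq> S"
  obtains x y where "x \<in> X" "y \<in> S - X" "(x, y) \<in> E"
  using assms unfolding conn_def by blast

lemma conn_singleton [simp]: "conn E {x}"
  by (auto simp: conn_def)

lemma conn_nonempty: "conn E S \<Longrightarrow> S \<noteq> {}"
  by (simp add: conn_def)

text \<open>A cut of the union either splits some \<open>g v\<close>, which is connected, or
  consists of whole sets \<open>g v\<close> and thus comes from a cut of \<open>A\<close>. This is
  what lifts connected bags from a quotient to the graph.\<close>

lemma conn_UN:
  assumes "conn F A" and "\<And>v. v \<in> A \<Longrightarrow> conn E (g v)"
    and "\<And>u v. u \<in> A \<Longrightarrow> v \<in> A \<Longrightarrow> (u, v) \<in> F \<Longrightarrow> \<exists>x\<in>g u. \<exists>y\<in>g v. (x, y) \<in> E"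
  shows "conn E (\<Union>v\<in>A. g v)"
proof (rule connI)
  show "(\<Union>v\<in>A. g v) \<noteq> {}"
    using assms(1,2) conn_nonempty by (metis SUP_bot_conv(1) ex_in_conv)
next
  fix X assume X: "X \<subseteq> (\<Union>v\<in>A. g v)" "X \<noteq> {}" "X \<noteq> (\<Union>v\<in>A. g v)"
  show "\<exists>x\<in>X. \<exists>y\<in>(\<Union>v\<in>A. g v) - X. (x, y) \<in> E"
  proof (cases "\<exists>v\<in>A. g v \<inter> X \<noteq> {} \<and> \<not> g v \<subseteq> X")
    case True
    then obtain v where v: "v \<in> A" "g v \<inter> X \<noteq> {}" "\<not> g v \<subseteq> X" by blast
    have "g v \<inter> X \<noteq> g v" using v by blast
    then obtain x y where "x \<in> g v \<inter> X" "y \<in> g v - g v \<inter> X" "(x, y) \<in> E"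
      using connD[OF assms(2)[OF v(1)], of "g v \<inter> X"] v by blast
    then show ?thesis using v by blast
  next
    case False
    define Y where "Y = {v\<in>A. g v \<subseteq> X}"
    have "Y \<subseteq> A" "Y \<noteq> {}" "Y \<noteq> A"
      using X False unfolding Y_def by blast+
    then obtain u v where uv: "u \<in> Y" "v \<in> A - Y" "(u, v) \<in> F"
      using connD[OF assms(1)] by blast
    then obtain x y where "x \<in> g u" "y \<in> g v" "(x, y) \<in> E"
      using assms(3)[of u v] unfolding Y_def by blast
    then show ?thesis using uv False unfolding Y_def by blast
  qed
qed

text \<open>The preimage of a cut is a cut. An edge may also collapse to a point, as happens when
  \<open>f\<close> is a contraction.\<close>

lemma conn_image:
  assumes "conn E A"
    and "\<And>a b. a \<in> A \<Longrightarrow> b \<in> A \<Longrightarrow> (a, b) \<in> E \<Longrightarrow> f a = f b \<or> (f a, f b) \<in> E'"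
  shows "conn E' (f ` A)"
proof (rule connI)
  show "f ` A \<noteq> {}" using conn_nonempty[OF assms(1)] by simp
next
  fix X assume X: "X \<subseteq> f ` A" "X \<noteq> {}" "X \<noteq> f ` A"
  define Y where "Y = {a\<in>A. f a \<in> X}"
  have "Y \<subseteq> A" "Y \<noteq> {}" "Y \<noteq> A" using X unfolding Y_def by blast+
  then obtain u v where "u \<in> Y" "v \<in> A - Y" "(u, v) \<in> E"
    using connD[OF assms(1)] by blast
  then show "\<exists>x\<in>X. \<exists>y\<in>f ` A - X. (x, y) \<in> E'"
    using assms(2)[of u v] unfolding Y_def by (metis (no_types, lifting) DiffD1 DiffD2 DiffI image_eqI mem_Collect_eq)
qed

lemma conn_Un:
  assumes "conn E S" "conn E T" "x \<in> S" "y \<in> T" "x = y \<or> (x, y) \<in> E" "sym E"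
  shows "conn E (S \<union> T)"
proof (rule connI)
  show "S \<union> T \<noteq> {}" using assms by blast
next
  fix X assume X: "X \<subseteq> S \<union> T" "X \<noteq> {}" "X \<noteq> S \<union> T"
  have s: "(y, x) \<in> E" if "(x, y) \<in> E" for x y using assms(6) that by (meson symD)
  show "\<exists>x\<in>X. \<exists>y\<in>S \<union> T - X. (x, y) \<in> E"
  proof (cases "X \<inter> S \<noteq> {} \<and> X \<inter> S \<noteq> S")
    case True
    then show ?thesis using connD[OF assms(1), of "X \<inter> S"] by blast
  next
    case a: False
    show ?thesis
    proof (cases "X \<inter> T \<noteq> {} \<and> X \<inter> T \<noteq> T")
      case True
      then show ?thesis using connD[OF assms(2), of "X \<inter> T"] by blast
    next
      case False
      then have "(S \<subseteq> X \<and> X \<inter> T = {}) \<or> (X \<inter> S = {} \<and> T \<subseteq> X)"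
        using a X by blast
      then have "(x \<in> X \<and> y \<notin> X) \<or> (x \<notin> X \<and> y \<in> X)"
        using assms(3,4) by blast
      then show ?thesis using assms(3-5) s[of x y] by (metis DiffI UnI1 UnI2)
    qed
  qed
qed

lemma conn_insert:
  assumes "conn E S" "y \<in> S" "(x, y) \<in> E" "sym E"
  shows "conn E (insert x S)"
  using conn_Un[OF conn_singleton assms(1), of x x y] assms by auto

text \<open>\<open>K24\<close> mentions no vertex set; this confines the bags to the endpoints of
  edges. The edge at \<open>x\<close> covers a bag with one vertex, where connectedness provides no
  edge.\<close>

lemma conn_Domain:
  assumes "conn E A" "x \<in> A" "(x, v) \<in> E" "y \<in> A"
  shows "y \<in> Domain E"
proof (cases "A = {y}")
  case True then show ?thesis using assms by auto
next
  case False
  then obtain x' y' where "x' \<in> {y}" "(x', y') \<in> E"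
    using connD[OF assms(1), of "{y}"] assms(4) by blast
  then show ?thesis by blast
qed

lemma finite_common: "finite E \<Longrightarrow> finite (common E A B)"
  by (rule finite_subset[of _ "Range E"]) (auto simp: common_def finite_Range)

text \<open>A bag \<open>C\<close> joined to both \<open>A\<close> and \<open>B\<close> can be shrunk to one vertex by moving the rest of a
  path through \<open>C\<close> to \<open>A\<close>.\<close>

lemma absorb_bag:
  assumes "conn E A" "conn E C" "finite C" "sym E" "A \<inter> C = {}"
    and "\<exists>x\<in>A. \<exists>y\<in>C. (x, y) \<in> E" "\<exists>x\<in>B. \<exists>y\<in>C. (x, y) \<in> E"
  shows "\<exists>X c. X \<subseteq> C \<and> c \<in> C - X \<and> conn E (A \<union> X) \<and> (\<exists>x\<in>A \<union> X. (x, c) \<in> E) \<and> (\<exists>x\<in>B. (x, c) \<in> E)"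
proof -
  \<comment> \<open>A maximal \<open>X\<close> is wanted among the parts of \<open>C\<close> that
    extend \<open>A\<close> connectedly and have no neighbour in \<open>B\<close>. A further vertex
    of \<open>C\<close> next to \<open>A\<close> or \<open>X\<close> must then see \<open>B\<close>,
    or it could be added to \<open>X\<close>.\<close>
  define good where "good X \<longleftrightarrow> X \<subseteq> C \<and> conn E (A \<union> X) \<and> (\<forall>c\<in>X. \<forall>x\<in>B. (x, c) \<notin> E)" for X
  have "good {}" using assms(1) by (simp add: good_def)
  moreover have "\<forall>X. good X \<longrightarrow> card X < Suc (card C)"
    using assms(3) by (simp add: good_def card_mono less_Suc_eq_le)
  ultimately have "good (ARG_MAX card X. good X) \<and> (\<forall>Y. good Y \<longrightarrow> card Y \<le> card (ARG_MAX card X. good X))"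
    by (rule arg_max_nat_lemma)
  then obtain X where X: "good X" "\<And>Y. good Y \<Longrightarrow> card Y \<le> card X"
    by blast
  have XC: "X \<subseteq> C" "X \<noteq> C" using X(1) assms(7) unfolding good_def by blast+
  obtain x c where xc: "x \<in> A \<union> X" "c \<in> C - X" "(x, c) \<in> E"
  proof (cases "X = {}")
    case True then show ?thesis using assms(6) that by blast
  next
    case False
    from connD[OF assms(2) XC(1) False XC(2)] show ?thesis using that by (metis UnI2)
  qed
  have "\<exists>x\<in>B. (x, c) \<in> E"
  proof (rule ccontr)
    assume n: "\<not> ?thesis"
    have "conn E (insert c (A \<union> X))"
      using conn_insert[OF _ xc(1) symD[OF assms(4) xc(3)] assms(4)] X(1) unfolding good_def by blast
    then have "good (insert c X)" using X(1) xc n unfolding good_def by auto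
    then have "card (insert c X) \<le> card X" by (rule X(2))
    moreover have "finite X" using XC(1) assms(3) finite_subset by blast
    ultimately show False using xc by simp
  qed
  moreover have "X \<subseteq> C" "conn E (A \<union> X)" using X(1) unfolding good_def by simp_all
  ultimately show ?thesis using xc by (intro exI[of _ X] exI[of _ c]) auto
qed

text \<open>The bags are absorbed one by one. Each step enlarges \<open>A\<close> only inside the
  bag being treated, so the bags still to come stay disjoint from it.\<close>

lemma absorb_bags:
  assumes "finite I" "sym E" "conn E A" "A \<inter> B = {}"
    and "\<And>i. i \<in> I \<Longrightarrow> conn E (g i) \<and> finite (g i) \<and> g i \<inter> A = {} \<and> g i \<inter> B = {}"
    and "\<And>i j. i \<in> I \<Longrightarrow> j \<in> I \<Longrightarrow> i \<noteq> j \<Longrightarrow> g i \<inter> g j = {}"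
    and "\<And>i. i \<in> I \<Longrightarrow> (\<exists>x\<in>A. \<exists>y\<in>g i. (x, y) \<in> E) \<and> (\<exists>x\<in>B. \<exists>y\<in>g i. (x, y) \<in> E)"
  shows "\<exists>X c. X \<subseteq> (\<Union>i\<in>I. g i) \<and> conn E (A \<union> X) \<and>
     (\<forall>i\<in>I. c i \<in> g i - X \<and> (\<exists>x\<in>A \<union> X. (x, c i) \<in> E) \<and> (\<exists>x\<in>B. (x, c i) \<in> E))"
  using assms(1,5-7)
proof (induction I)
  case empty
  then show ?case using assms(3) by (intro exI[of _ "{}"]) auto
next
  case (insert i I)
  have "\<exists>X c. X \<subseteq> (\<Union>i\<in>I. g i) \<and> conn E (A \<union> X) \<and>
     (\<forall>i\<in>I. c i \<in> g i - X \<and> (\<exists>x\<in>A \<union> X. (x, c i) \<in> E) \<and> (\<exists>x\<in>B. (x, c i) \<in> E))"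
    by (rule insert.IH) (use insert.prems in simp_all)
  then obtain X c where X: "X \<subseteq> (\<Union>i\<in>I. g i)" "conn E (A \<union> X)"
     "\<forall>i\<in>I. c i \<in> g i - X \<and> (\<exists>x\<in>A \<union> X. (x, c i) \<in> E) \<and> (\<exists>x\<in>B. (x, c i) \<in> E)"
    by blast
  have i: "conn E (g i)" "finite (g i)" "g i \<inter> A = {}" using insert.prems(1) by auto
  have dj: "g i \<inter> (\<Union>i\<in>I. g i) = {}" using insert.prems(2)[of i] insert.hyps(2) by blast
  have "(A \<union> X) \<inter> g i = {}" using i(3) dj X(1) by blast
  moreover have "\<exists>x\<in>A \<union> X. \<exists>y\<in>g i. (x, y) \<in> E" "\<exists>x\<in>B. \<exists>y\<in>g i. (x, y) \<in> E"
    using insert.prems(3)[of i] by blast+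
  ultimately obtain Y d where Y: "Y \<subseteq> g i" "d \<in> g i - Y" "conn E ((A \<union> X) \<union> Y)"
      "\<exists>x\<in>(A \<union> X) \<union> Y. (x, d) \<in> E" "\<exists>x\<in>B. (x, d) \<in> E"
    using absorb_bag[OF X(2) i(1,2) assms(2), of B] by metis
  show ?case
  proof (intro exI[of _ "X \<union> Y"] exI[of _ "c(i := d)"] conjI ballI)
    show "X \<union> Y \<subseteq> \<Union> (g ` insert i I)" using X(1) Y(1) by blast
    show "conn E (A \<union> (X \<union> Y))" using Y(3) by (simp add: Un_assoc)
  next
    fix j assume j: "j \<in> insert i I"
    show "(c(i := d)) j \<in> g j - (X \<union> Y)"
    proof (cases "j = i")
      case True
      then show ?thesis using X(1) Y(2) dj by auto
    next
      case False
      then have "j \<in> I" using j by simp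
      then have "c j \<in> g j - X" "c j \<notin> g i" using X(3) dj by blast+
      then show ?thesis using False Y(1) by auto
    qed
    show "\<exists>x\<in>A \<union> (X \<union> Y). (x, (c(i := d)) j) \<in> E"
      using j X(3) Y(4) by auto
    show "\<exists>x\<in>B. (x, (c(i := d)) j) \<in> E"
      using j X(3) Y(5) by auto
  qed
qed

text \<open>A minor of a quotient is a minor: the two large bags become unions of sets
  \<open>g v\<close>, and each common neighbour, at first a whole set \<open>g v\<close>, is shrunk
  to a single vertex by \<open>absorb_bags\<close>.\<close>

lemma K24_bags:
  assumes "sym E" "finite E" "F \<subseteq> W \<times> W" "K24 F"
    and g: "\<And>v. v \<in> W \<Longrightarrow> conn E (g v) \<and> finite (g v)"
    and dj: "\<And>u v. u \<in> W \<Longrightarrow> v \<in> W \<Longrightarrow> u \<noteq> v \<Longrightarrow> g u \<inter> g v = {}"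
    and e: "\<And>u v. (u, v) \<in> F \<Longrightarrow> \<exists>x\<in>g u. \<exists>y\<in>g v. (x, y) \<in> E"
  shows "K24 E"
proof -
  obtain A B where AB: "A \<inter> B = {}" "conn F A" "conn F B" "card (common F A B) \<ge> 4"
    using assms(4) unfolding K24_def by blast
  define I where "I = common F A B"
  have "I \<noteq> {}" using AB(4) unfolding I_def by auto
  then obtain v0 where v0: "v0 \<in> common F A B" unfolding I_def by blast
  have AW: "A \<subseteq> W" and BW: "B \<subseteq> W"
    using v0 conn_Domain[OF AB(2)] conn_Domain[OF AB(3)] assms(3) unfolding common_def by blast+
  have IW: "I \<subseteq> W" using assms(3) unfolding I_def common_def by blast
  have finI: "finite I" using AB(4) unfolding I_def by (metis card.infinite not_numeral_le_zero)
  define A' where "A' = (\<Union>v\<in>A. g v)"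
  define B' where "B' = (\<Union>v\<in>B. g v)"
  have cA: "conn E A'" unfolding A'_def by (rule conn_UN[OF AB(2)]) (use AW g e in blast)+
  have cB: "conn E B'" unfolding B'_def by (rule conn_UN[OF AB(3)]) (use BW g e in blast)+
  have d1: "A' \<inter> B' = {}" using dj AB(1) AW BW unfolding A'_def B'_def by blast
  have d2: "g i \<inter> A' = {}" "g i \<inter> B' = {}" if "i \<in> I" for i
    using dj[of i] that IW AW BW unfolding A'_def B'_def I_def common_def by blast+
  have e2: "(\<exists>x\<in>A'. \<exists>y\<in>g i. (x, y) \<in> E) \<and> (\<exists>x\<in>B'. \<exists>y\<in>g i. (x, y) \<in> E)" if "i \<in> I" for i
    using that e unfolding I_def common_def A'_def B'_def by fastforce
  have "\<exists>X c. X \<subseteq> (\<Union>i\<in>I. g i) \<and> conn E (A' \<union> X) \<and>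
     (\<forall>i\<in>I. c i \<in> g i - X \<and> (\<exists>x\<in>A' \<union> X. (x, c i) \<in> E) \<and> (\<exists>x\<in>B'. (x, c i) \<in> E))"
    by (rule absorb_bags[OF finI assms(1) cA d1]) (use d2 e2 g dj IW in blast)+
  then obtain X c where X: "X \<subseteq> (\<Union>i\<in>I. g i)" "conn E (A' \<union> X)"
     "\<forall>i\<in>I. c i \<in> g i - X \<and> (\<exists>x\<in>A' \<union> X. (x, c i) \<in> E) \<and> (\<exists>x\<in>B'. (x, c i) \<in> E)" by blast
  \<comment> \<open>The representatives lie in pairwise disjoint bags, so no common neighbour is
    lost in the count.\<close>
  have "inj_on c I"
  proof (rule inj_onI)
    fix i j assume "i \<in> I" "j \<in> I" "c i = c j"
    then show "i = j" using X(3) dj IW by (metis DiffD1 disjoint_iff subsetD)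
  qed
  moreover have "c ` I \<subseteq> common E (A' \<union> X) B'"
    using X(3) d2 unfolding common_def by blast
  ultimately have "card (common E (A' \<union> X) B') \<ge> card I"
    by (metis card_image card_mono finite_common assms(2))
  moreover have "X \<inter> B' = {}" using X(1) d2(2) unfolding disjoint_iff by (metis UN_E subsetD)
  then have "(A' \<union> X) \<inter> B' = {}" using d1 by (simp add: Int_Un_distrib2)
  ultimately show ?thesis unfolding K24_def using X(2) cB AB(4) I_def by (metis le_trans)
qed

lemma K24_mono:
  assumes "K24 F" "F \<subseteq> E" "sym E" "finite E"
  shows "K24 E"
  using K24_bags[OF assms(3,4), of F UNIV "\<lambda>v. {v}"] assms by auto

section \<open>Isomorphism of edge relations\<close>

definition giso :: "'a set \<Rightarrow> 'a rel \<Rightarrow> 'b set \<Rightarrow> 'b rel \<Rightarrow> bool" where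
  "giso V E W F \<longleftrightarrow> (\<exists>f. bij_betw f V W \<and> (\<forall>u\<in>V. \<forall>v\<in>V. (u, v) \<in> E \<longleftrightarrow> (f u, f v) \<in> F))"

lemma giso_sym:
  assumes "giso V E W F" shows "giso W F V E"
proof -
  obtain f where f: "bij_betw f V W" "\<forall>u\<in>V. \<forall>v\<in>V. (u, v) \<in> E \<longleftrightarrow> (f u, f v) \<in> F"
    using assms unfolding giso_def by blast
  show ?thesis unfolding giso_def
  proof (intro exI[of _ "inv_into V f"] conjI ballI)
    show "bij_betw (inv_into V f) W V" using f(1) by (rule bij_betw_inv_into)
    fix u v assume "u \<in> W" "v \<in> W"
    then have "u \<in> f ` V" "v \<in> f ` V" using f(1) by (simp_all add: bij_betw_def)
    then have "inv_into V f u \<in> V" "inv_into V f v \<in> V"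
      "f (inv_into V f u) = u" "f (inv_into V f v) = v"
      by (auto simp: inv_into_into f_inv_into_f)
    then show "(u, v) \<in> F \<longleftrightarrow> (inv_into V f u, inv_into V f v) \<in> E"
      using f(2) by metis
  qed
qed

lemma giso_trans:
  assumes "giso V E W F" "giso W F X H" shows "giso V E X H"
proof -
  obtain f where f: "bij_betw f V W" "\<forall>u\<in>V. \<forall>v\<in>V. (u, v) \<in> E \<longleftrightarrow> (f u, f v) \<in> F"
    using assms unfolding giso_def by blast
  obtain g where g: "bij_betw g W X" "\<forall>u\<in>W. \<forall>v\<in>W. (u, v) \<in> F \<longleftrightarrow> (g u, g v) \<in> H"
    using assms unfolding giso_def by blast
  show ?thesis unfolding giso_def
  proof (intro exI[of _ "g \<circ> f"] conjI ballI)
    show "bij_betw (g \<circ> f) V X" using f(1) g(1) by (rule bij_betw_trans)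
    fix u v assume "u \<in> V" "v \<in> V"
    moreover from this have "f u \<in> W" "f v \<in> W" using f(1) bij_betwE by blast+
    ultimately show "(u, v) \<in> E \<longleftrightarrow> ((g \<circ> f) u, (g \<circ> f) v) \<in> H" using f(2) g(2) by simp
  qed
qed

lemma giso_card: "giso V E W F \<Longrightarrow> card V = card W"
  unfolding giso_def using bij_betw_same_card by blast

lemma K24_giso:
  assumes "giso V E W F" "E \<subseteq> V \<times> V" "sym F" "finite F" "K24 E"
  shows "K24 F"
proof -
  obtain f where f: "bij_betw f V W" "\<forall>u\<in>V. \<forall>v\<in>V. (u, v) \<in> E \<longleftrightarrow> (f u, f v) \<in> F"
    using assms(1) unfolding giso_def by blast
  have inj: "inj_on f V" using f(1) by (rule bij_betw_imp_inj_on)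
  show ?thesis
  proof (rule K24_bags[of F E V "\<lambda>v. {f v}"])
    show "{f u} \<inter> {f v} = {}" if "u \<in> V" "v \<in> V" "u \<noteq> v" for u v
      using inj that by (auto simp: inj_on_def)
    show "\<exists>x\<in>{f u}. \<exists>y\<in>{f v}. (x, y) \<in> F" if "(u, v) \<in> E" for u v
      using that f(2) assms(2) by blast
  qed (use assms in simp_all)
qed

lemma giso_K24:
  assumes "giso V E W F" "sgraph V E" "F \<subseteq> W \<times> W" "K24 F"
  shows "K24 E"
  using K24_giso[OF giso_sym[OF assms(1)]] sgraphD[OF assms(2)] assms(3,4) by blast

section \<open>3-connectedness and contraction of an edge\<close>

definition con3 :: "'a set \<Rightarrow> 'a rel \<Rightarrow> bool" where
  "con3 V E \<longleftrightarrow> card V > 3 \<and> (\<forall>S. S \<subseteq> V \<and> card S < 3 \<longrightarrow> conn E (V - S))"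

text \<open>The merged vertex keeps the name \<open>y\<close>.\<close>

definition contr :: "'a rel \<Rightarrow> 'a \<Rightarrow> 'a \<Rightarrow> 'a rel" where
  "contr E x y = {(u, v). u \<noteq> x \<and> v \<noteq> x \<and>
     ((u, v) \<in> E \<or> (u = y \<and> v \<noteq> y \<and> (x, v) \<in> E) \<or> (v = y \<and> u \<noteq> y \<and> (u, x) \<in> E))}"

lemma sgraph_contr:
  assumes "sgraph V E" "y \<in> V" "x \<noteq> y"
  shows "sgraph (V - {x}) (contr E x y)"
  unfolding sgraph_def
proof (intro conjI)
  show "finite (V - {x})" using sgraphD(1)[OF assms(1)] by simp
  show "contr E x y \<subseteq> (V - {x}) \<times> (V - {x})"
    using sgraphD(2,3)[OF assms(1)] assms(2,3) unfolding contr_def by auto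
  show "sym (contr E x y)"
    using sgraphD(4)[OF assms(1)] unfolding contr_def sym_def by auto
  show "irrefl (contr E x y)"
    using sgraphD(5)[OF assms(1)] unfolding contr_def irrefl_def by auto
qed

text \<open>The merged vertex is represented by the bag of both endpoints of the contracted edge,
  every other vertex by itself.\<close>

lemma K24_contr:
  assumes "sgraph V E" "(x, y) \<in> E" "K24 (contr E x y)"
  shows "K24 E"
proof (rule K24_bags[of E "contr E x y" "V - {x}" "\<lambda>v. if v = y then {x, y} else {v}"])
  note s = sgraphD[OF assms(1)]
  have xy: "x \<noteq> y" "y \<in> V" using s(3,5) assms(2) by blast+
  show "sym E" "finite E" using s by blast+
  show "contr E x y \<subseteq> (V - {x}) \<times> (V - {x})"
    using sgraph_contr[OF assms(1) xy(2,1)] unfolding sgraph_def by blast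
  show "K24 (contr E x y)" by fact
  have "conn E {x, y}" using conn_insert[OF conn_singleton, of y y x E] assms(2) s(6) by simp
  then show "conn E (if v = y then {x, y} else {v}) \<and> finite (if v = y then {x, y} else {v})" for v
    by simp
  show "(if u = y then {x, y} else {u}) \<inter> (if v = y then {x, y} else {v}) = {}"
    if "u \<in> V - {x}" "v \<in> V - {x}" "u \<noteq> v" for u v
    using that by auto
  show "\<exists>p\<in>if u = y then {x, y} else {u}. \<exists>q\<in>if v = y then {x, y} else {v}. (p, q) \<in> E"
    if "(u, v) \<in> contr E x y" for u v
    using that unfolding contr_def by auto
qed

section \<open>Contractible edges\<close>

text \<open>If a vertex remained outside \<open>X\<close> and \<open>N\<close>, deleting
  \<open>N - X\<close> would separate it from \<open>X\<close>. All later uses of 3-connectedness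
  against small separators go through this form, in which \<open>N\<close> may overlap
  \<open>X\<close>.\<close>

lemma con3_cut:
  assumes "con3 V E" "X \<subseteq> V" "X \<noteq> {}" "N \<subseteq> V" "card N < 3"
    and "\<And>x v. x \<in> X \<Longrightarrow> (x, v) \<in> E \<Longrightarrow> v \<in> X \<union> N"
  shows "V \<subseteq> X \<union> N"
proof (rule ccontr)
  assume n: "\<not> ?thesis"
  have "finite V" using assms(1) unfolding con3_def by (metis card.infinite not_less_zero)
  then have "finite N" using assms(4) finite_subset by blast
  then have "card (N - X) \<le> card N" by (intro card_mono) auto
  then have "card (N - X) < 3" using assms(5) by linarith
  moreover have "N - X \<subseteq> V" using assms(4) by blast
  ultimately have "conn E (V - (N - X))" using assms(1) unfolding con3_def by blast
  moreover have "X \<subseteq> V - (N - X)" "X \<noteq> V - (N - X)" using assms(2) n by blast+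
  ultimately obtain x y where "x \<in> X" "y \<in> V - (N - X) - X" "(x, y) \<in> E"
    using connD[of E _ X] assms(3) by metis
  then show False using assms(6)[of x y] by blast
qed

lemma card_lt3 [simp]: "card {a, b} < 3" "card {a} < 3"
  by (simp_all add: card_insert_if)

text \<open>Otherwise the neighbours of \<open>v\<close> form a separator of at most two vertices
  around \<open>v\<close>, and by \<open>con3_cut\<close> there are at most three vertices in
  all.\<close>

lemma con3_deg:
  assumes "con3 V E" "sgraph V E" "v \<in> V"
  shows "card (E `` {v}) \<ge> 3"
proof (rule ccontr)
  assume n: "\<not> ?thesis"
  have "V \<subseteq> {v} \<union> E `` {v}"
    by (rule con3_cut[OF assms(1)]) (use n assms sgraphD(3)[OF assms(2)] in auto)
  moreover have "finite (E `` {v})" using sgraphD(7)[OF assms(2)] by (rule finite_Image)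
  ultimately have "card V \<le> card (insert v (E `` {v}))" by (auto intro: card_mono)
  also have "\<dots> \<le> Suc (card (E `` {v}))" by (rule card_insert_le_m1) auto
  finally show False using n assms(1) unfolding con3_def by linarith
qed

text \<open>A set \<open>S\<close> of at most two vertices that separates the contraction contains
  \<open>y\<close>; otherwise it would separate the graph itself, with \<open>x\<close> put on the
  side of \<open>y\<close>. Then \<open>insert x S\<close> separates the graph, so it has three
  elements and equals \<open>{x, y, z}\<close>.\<close>

lemma separation_of_contr:
  assumes "con3 V E" "sgraph V E" "card V \<ge> 5" "(x, y) \<in> E" "\<not> con3 (V - {x}) (contr E x y)"
  shows "\<exists>z X. z \<in> V \<and> z \<noteq> x \<and> z \<noteq> y \<and> X \<subseteq> V - {x, y, z} \<and> X \<noteq> {} \<and> X \<noteq> V - {x, y, z} \<and>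
    E `` X \<subseteq> X \<union> {x, y, z}"
proof -
  note s = sgraphD[OF assms(2)]
  have xy: "x \<noteq> y" "x \<in> V" "y \<in> V" using s assms(4) by blast+
  have "card (V - {x}) > 3" using assms(3) s(1) xy by simp
  then obtain S where S: "S \<subseteq> V - {x}" "card S < 3" "\<not> conn (contr E x y) (V - {x} - S)"
    using assms(5) unfolding con3_def by blast
  have finS: "finite S" using S(1) s(1) by (meson finite_Diff finite_subset)
  have "card (V - {x} - S) > 0"
    using card_Diff_subset[OF finS S(1)] S(2) \<open>card (V - {x}) > 3\<close> by linarith
  then have "V - {x} - S \<noteq> {}" by (metis card.empty less_irrefl)
  then obtain X where X: "X \<subseteq> V - {x} - S" "X \<noteq> {}" "X \<noteq> V - {x} - S"
     "\<And>u v. u \<in> X \<Longrightarrow> v \<in> V - {x} - S - X \<Longrightarrow> (u, v) \<notin> contr E x y"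
    using S(3) unfolding conn_def by blast
  show ?thesis
  proof (cases "y \<in> S")
    case False
    \<comment> \<open>\<open>x\<close> joins the side of the merged vertex.\<close>
    define Y where "Y = (if y \<in> X then insert x X else X)"
    have "conn E (V - S)" using assms(1) S(1,2) unfolding con3_def by blast
    moreover have "Y \<subseteq> V - S" "Y \<noteq> {}" "Y \<noteq> V - S"
      using X(1-3) S(1) xy False unfolding Y_def by (auto split: if_splits)
    ultimately obtain u v where uv: "u \<in> Y" "v \<in> V - S - Y" "(u, v) \<in> E"
      using connD by metis
    then have "\<exists>u\<in>X. \<exists>v\<in>V - {x} - S - X. (u, v) \<in> contr E x y"
      using xy False s(4) X(1) unfolding Y_def contr_def by (cases "u = x"; cases "v = x"; auto split: if_splits)
    then show ?thesis using X(4) by blast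
  next
    case True
    have "\<not> conn E (V - insert x S)"
    proof
      assume "conn E (V - insert x S)"
      moreover have "X \<subseteq> V - insert x S" "X \<noteq> V - insert x S" using X(1,3) by blast+
      ultimately obtain u v where "u \<in> X" "v \<in> V - insert x S - X" "(u, v) \<in> E"
        using connD X(2) by metis
      then show False using X(1) X(4)[of u v] unfolding contr_def by blast
    qed
    then have "card (insert x S) \<ge> 3" using assms(1) S(1) xy(2) unfolding con3_def
      by (metis Diff_subset dual_order.trans insert_subset not_less)
    moreover have "card (insert x S) = Suc (card S)" using finS S(1) by (intro card_insert_disjoint) auto
    ultimately have "card S = 2" using S(2) by linarith
    then obtain z where z: "S = {y, z}" "z \<noteq> y"
      using True by (auto simp: card_2_iff doubleton_eq_iff)
    have "E `` X \<subseteq> X \<union> {x, y, z}"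
    proof
      fix v assume "v \<in> E `` X"
      then obtain u where u: "u \<in> X" "(u, v) \<in> E" by blast
      then have "v \<in> V" using s(3) by blast
      then show "v \<in> X \<union> {x, y, z}"
        using X(4)[of u v] u X(1) z unfolding contr_def by blast
    qed
    then show ?thesis using z X S(1) by (intro exI[of _ z] exI[of _ X]) auto
  qed
qed

text \<open>Thomassen's argument, by descent on the size of a separated part \<open>X\<close>. If no
  edge is contractible, a separator \<open>{x, y, z}\<close> yields an edge from \<open>z\<close>
  into \<open>X\<close>, and the separator belonging to that edge cuts off a strictly smaller part
  of \<open>X\<close>.\<close>

theorem contractible_edge:
  assumes "con3 V E" "sgraph V E" "card V \<ge> 5"
  shows "\<exists>x y. (x, y) \<in> E \<and> con3 (V - {x}) (contr E x y)"
proof (rule ccontr)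
  assume neg: "\<not> ?thesis"
  note s = sgraphD[OF assms(2)]
  define sep where "sep x y z X \<longleftrightarrow> (x, y) \<in> E \<and> z \<in> V \<and> z \<noteq> x \<and> z \<noteq> y \<and> X \<subseteq> V - {x, y, z} \<and>
     X \<noteq> {} \<and> X \<noteq> V - {x, y, z} \<and> E `` X \<subseteq> X \<union> {x, y, z}" for x y z X
  have ex: "\<exists>z X. sep x y z X" if "(x, y) \<in> E" for x y
    using separation_of_contr[OF assms that] neg that unfolding sep_def by blast
  have no: "\<forall>x y z X. sep x y z X \<longrightarrow> card X \<noteq> n" for n
  proof (induction n rule: less_induct)
    case (less n)
    show ?case
    proof (intro allI impI notI)
      fix x y z X assume sp: "sep x y z X" and n: "card X = n"
      then have xy: "(x, y) \<in> E" "z \<in> V" "z \<noteq> x" "z \<noteq> y" "X \<subseteq> V - {x, y, z}" "X \<noteq> {}"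
        "X \<noteq> V - {x, y, z}" "E `` X \<subseteq> X \<union> {x, y, z}" unfolding sep_def by blast+
      have V: "x \<in> V" "y \<in> V" "x \<noteq> y" using s xy(1) by blast+
      have "\<exists>v\<in>X. (v, z) \<in> E"
      proof (rule ccontr)
        assume c: "\<not> ?thesis"
        have "V \<subseteq> X \<union> {x, y}"
          by (rule con3_cut[OF assms(1)]) (use xy V c in \<open>auto simp: Image_def\<close>)
        then show False using xy(2-5) by blast
      qed
      then obtain v where v: "v \<in> X" "(z, v) \<in> E" using s(4) by blast
      obtain w D where "sep z v w D" using ex[OF v(2)] by blast
      then have D: "w \<in> V" "w \<noteq> z" "w \<noteq> v" "D \<subseteq> V - {z, v, w}" "D \<noteq> {}" "D \<noteq> V - {z, v, w}"
        "E `` D \<subseteq> D \<union> {z, v, w}" unfolding sep_def by blast+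
      have D': "E `` (V - {z, v, w} - D) \<subseteq> (V - {z, v, w} - D) \<union> {z, v, w}"
        using D(7) s(3,4) by blast
      \<comment> \<open>The adjacent vertices \<open>x\<close> and \<open>y\<close> do not lie on
        opposite sides of \<open>{z, v, w}\<close>; \<open>C\<close> is a side that contains neither
        of them.\<close>
      obtain C where C: "C \<subseteq> V - {z, v, w}" "C \<noteq> {}" "C \<noteq> V - {z, v, w}"
        "E `` C \<subseteq> C \<union> {z, v, w}" "x \<notin> C" "y \<notin> C"
      proof (cases "x \<in> D \<or> y \<in> D")
        case False
        then show ?thesis using D that[of D] by blast
      next
        case True
        have "x \<notin> V - {z, v, w} - D" "y \<notin> V - {z, v, w} - D"
          using True D(7) D' xy(1) s(4) V by blast+
        then show ?thesis using that[of "V - {z, v, w} - D"] D D' by blast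
      qed
      have "\<exists>u\<in>C. (u, v) \<in> E"
      proof (rule ccontr)
        assume c: "\<not> ?thesis"
        have "V \<subseteq> C \<union> {z, w}"
          by (rule con3_cut[OF assms(1)]) (use C D(1) xy(2) c in \<open>auto simp: Image_def\<close>)
        then show False using C(1) xy(5) v(1) D(3) by blast
      qed
      then obtain u where u: "u \<in> C" "(u, v) \<in> E" by blast
      \<comment> \<open>As a neighbour of \<open>v\<close>, which lies in \<open>X\<close>, the
        vertex \<open>u\<close> belongs to \<open>X\<close> or to \<open>{x, y, z}\<close>; as a
        member of \<open>C\<close> it is none of these three.\<close>
      have "u \<in> X"
        using u v(1) xy(8) s(4) C(1,5,6) by blast
      have "sep z v w (C \<inter> X)"
        unfolding sep_def
      proof (intro conjI)
        show "(z, v) \<in> E" "w \<in> V" "w \<noteq> z" "w \<noteq> v" by fact+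
        show "C \<inter> X \<subseteq> V - {z, v, w}" using C(1) by blast
        show "C \<inter> X \<noteq> {}" using u(1) \<open>u \<in> X\<close> by blast
        \<comment> \<open>At most one of \<open>x\<close> and \<open>y\<close> equals
          \<open>w\<close>, so the other is a vertex off the separator that \<open>C\<close>
          misses.\<close>
        have "x \<noteq> v" "y \<noteq> v" using v(1) xy(5) by blast+
        then have "x \<in> V - {z, v, w} \<or> y \<in> V - {z, v, w}" using V xy(3,4) by auto
        then show "C \<inter> X \<noteq> V - {z, v, w}" using C(5,6) by blast
        show "E `` (C \<inter> X) \<subseteq> C \<inter> X \<union> {z, v, w}"
        proof
          fix t assume "t \<in> E `` (C \<inter> X)"
          then have "t \<in> C \<union> {z, v, w}" "t \<in> X \<union> {x, y, z}" using C(4) xy(8) by blast+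
          then show "t \<in> C \<inter> X \<union> {z, v, w}" using C(5,6) by blast
        qed
      qed
      moreover have "card (C \<inter> X) < n"
      proof -
        have "finite X" using xy(5) s(1) by (meson finite_Diff finite_subset)
        moreover have "C \<inter> X \<subset> X" using v(1) C(1) by blast
        ultimately show ?thesis using n psubset_card_mono by blast
      qed
      ultimately show False using less.IH by blast
    qed
  qed
  have "E \<noteq> {}"
  proof
    assume "E = {}"
    moreover obtain v where "v \<in> V" using assms(3) by fastforce
    ultimately show False using con3_deg[OF assms(1,2), of v] by simp
  qed
  then obtain x y where "(x, y) \<in> E" by auto
  then show False using ex no by blast
qed

text \<open>The side \<open>X\<close> contains \<open>d\<close> but neither \<open>r\<close> nor
  \<open>s\<close>. Apart from \<open>d\<close> it then has no neighbour of \<open>q1\<close> or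
  \<open>q2\<close>, so \<open>d\<close> and \<open>z\<close> would separate the rest of it. Hence
  \<open>X\<close> is only \<open>{d}\<close>, and \<open>d\<close> has degree at most 3.\<close>

lemma triangle_contr_aux:
  assumes "con3 V E" "sgraph V E"
    and "E `` {q1} \<subseteq> {q2, d, r}" "E `` {q2} \<subseteq> {q1, d, s}" "card (E `` {d}) \<ge> 4"
    and X: "X \<subseteq> V - {q2, q1, z}" "d \<in> X" "E `` X \<subseteq> X \<union> {q2, q1, z}" and "q1 \<in> V" "q1 \<noteq> z" "z \<in> V"
    and Y: "r \<notin> X" "s \<notin> X"
  shows False
proof (cases "X = {d}")
  case True
  then have "E `` {d} \<subseteq> {q2, q1, z}" using X(3) sgraphD(5)[OF assms(2)] by blast
  then have "card (E `` {d}) \<le> card {q2, q1, z}" by (simp add: card_mono)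
  also have "\<dots> \<le> 3" by (simp add: card_insert_if)
  finally show False using assms(5) by simp
next
  case False
  have "V \<subseteq> (X - {d}) \<union> {d, z}"
  proof (rule con3_cut[OF assms(1)])
    show "X - {d} \<subseteq> V" "X - {d} \<noteq> {}" "{d, z} \<subseteq> V" "card {d, z} < 3"
      using X(1,2) False assms(11) by auto
    fix x v assume x: "x \<in> X - {d}" "(x, v) \<in> E"
    then have "v \<in> X \<union> {q2, q1, z}" using X(3) by blast
    moreover have "v \<noteq> q1" "v \<noteq> q2"
      using x assms(3,4) Y sgraphD(4)[OF assms(2)] X(1) by blast+
    ultimately show "v \<in> (X - {d}) \<union> {d, z}" by blast
  qed
  then show False using assms(9,10) X(1,2) by blast
qed

text \<open>Both sides of a separator \<open>{q2, q1, z}\<close> contain neighbours of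
  \<open>q1\<close> and of \<open>q2\<close>, as two vertices do not separate the graph. So
  \<open>d\<close> lies on one side and \<open>r\<close>, \<open>s\<close> on the other, which
  \<open>triangle_contr_aux\<close> excludes because \<open>d\<close> has degree at least 4.\<close>

theorem triangle_contr:
  assumes "con3 V E" "sgraph V E" "card V \<ge> 5"
    and "E `` {q1} = {q2, d, r}" "E `` {q2} = {q1, d, s}" "card (E `` {d}) \<ge> 4"
  shows "con3 (V - {q2}) (contr E q2 q1)"
proof (rule ccontr)
  assume n: "\<not> ?thesis"
  note s = sgraphD[OF assms(2)]
  have e: "(q1, q2) \<in> E" "(q2, q1) \<in> E" "(q1, d) \<in> E" "(q2, d) \<in> E" using assms(4,5) by blast+
  have q: "(q2, q1) \<in> E" "q1 \<in> V" "q2 \<in> V" "d \<in> V" "q1 \<noteq> q2" "d \<noteq> q1" "d \<noteq> q2"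
    using e s(2)[OF e(3)] s(3)[OF e(3)] s(2)[OF e(2)] s(5) by auto
  obtain z X where X: "z \<in> V" "z \<noteq> q2" "z \<noteq> q1" "X \<subseteq> V - {q2, q1, z}" "X \<noteq> {}" "X \<noteq> V - {q2, q1, z}"
    "E `` X \<subseteq> X \<union> {q2, q1, z}"
    using separation_of_contr[OF assms(1-3) q(1) n] by blast
  define Y where "Y = V - {q2, q1, z} - X"
  have Y: "Y \<subseteq> V - {q2, q1, z}" "Y \<noteq> {}" "E `` Y \<subseteq> Y \<union> {q2, q1, z}"
    using X s(3,4) unfolding Y_def by blast+
  have nb: "(\<exists>x\<in>Z. (q1, x) \<in> E) \<and> (\<exists>x\<in>Z. (q2, x) \<in> E)"
    if Z: "Z \<subseteq> V - {q2, q1, z}" "Z \<noteq> {}" "E `` Z \<subseteq> Z \<union> {q2, q1, z}" for Z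
  proof (rule ccontr)
    assume c: "\<not> ?thesis"
    \<comment> \<open>If one of \<open>q1\<close> and \<open>q2\<close> has no neighbour in
      \<open>Z\<close>, the other one together with \<open>z\<close> cuts \<open>Z\<close>
      off.\<close>
    have "V \<subseteq> Z \<union> {q2, z} \<or> V \<subseteq> Z \<union> {q1, z}"
    proof (cases "\<exists>x\<in>Z. (q1, x) \<in> E")
      case False
      have "V \<subseteq> Z \<union> {q2, z}"
        by (rule con3_cut[OF assms(1)]) (use Z X(1) q False s(4) card_lt3(1)[of q2 z] in blast)+
      then show ?thesis by blast
    next
      case True
      have "V \<subseteq> Z \<union> {q1, z}"
        by (rule con3_cut[OF assms(1)]) (use Z X(1) q c True s(4) card_lt3(1)[of q1 z] in blast)+
      then show ?thesis by blast
    qed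
    then show False using Z(1) q X(2,3) by blast
  qed
  have nX: "(\<exists>x\<in>X. (q1, x) \<in> E) \<and> (\<exists>x\<in>X. (q2, x) \<in> E)" by (rule nb) fact+
  have nY: "(\<exists>x\<in>Y. (q1, x) \<in> E) \<and> (\<exists>x\<in>Y. (q2, x) \<in> E)" by (rule nb) fact+
  have dj: "X \<inter> Y = {}" "q1 \<notin> X" "q2 \<notin> X" "q1 \<notin> Y" "q2 \<notin> Y" using X(4) Y_def by blast+
  have sub: "E `` {q1} \<subseteq> {q2, d, r}" "E `` {q2} \<subseteq> {q1, d, s}" using assms(4,5) by simp_all
  show False
  proof (cases "d \<in> X")
    case True
    then have "r \<notin> X" "s \<notin> X" using nY dj sub by blast+
    then show False using triangle_contr_aux[OF assms(1,2) sub assms(6) X(4) True X(7) q(2)] X(1,3) by blast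
  next
    case False
    then have "r \<in> X" "s \<in> X" using nX dj sub by blast+
    then have "d \<in> Y" "r \<notin> Y" "s \<notin> Y" using nY dj sub by blast+
    then show False using triangle_contr_aux[OF assms(1,2) sub assms(6) Y(1) _ Y(3) q(2)] X(1,3) by blast
  qed
qed

section \<open>Digraphs as edge relations\<close>

lemma pair_graph_sgraph:
  assumes "pair_graph G" shows "sgraph (pverts G) (parcs G)"
proof -
  interpret pair_graph G by fact
  show ?thesis unfolding sgraph_def
  proof (intro conjI)
    show "finite (pverts G)" by (rule pair_finite_verts)
    show "parcs G \<subseteq> pverts G \<times> pverts G" using in_arcsD1 in_arcsD2 by auto
    show "sym (parcs G)" using pair_sym_arcs by (simp add: symmetric_def)
    show "irrefl (parcs G)" unfolding irrefl_def using pair_no_loops by fastforce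
  qed
qed

lemma sgraph_pair_graph:
  assumes "sgraph (pverts G) (parcs G)" shows "pair_graph G"
proof
  note s = sgraphD[OF assms]
  show "finite (parcs G)" "finite (pverts G)" by (rule s)+
  show "symmetric (with_proj G)" using s(6) by (simp add: symmetric_def)
  fix e assume "e \<in> parcs G"
  then show "fst e \<in> pverts G" "snd e \<in> pverts G" "fst e \<noteq> snd e"
    using s(2,3,5) by (metis prod.collapse)+
qed

text \<open>The vertices of \<open>S\<close> reachable from \<open>u\<close> form a set that no edge
  leaves inside \<open>S\<close>, which a cut condition forces to be all of \<open>S\<close>;
  conversely a path from one side of a cut to the other crosses it.\<close>

lemma connected_iff_conn:
  assumes "pair_graph G"
  shows "connected (with_proj G \<restriction> S) \<longleftrightarrow> conn (parcs G) S"
proof -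
  note s = sgraphD[OF pair_graph_sgraph[OF assms]]
  have "arcs_ends (with_proj G \<restriction> S) = {(u, v). (u, v) \<in> parcs G \<and> u \<in> S \<and> v \<in> S}"
    by (auto simp: arcs_ends_conv induce_subgraph_def)
  then have ends: "symcl (arcs_ends (with_proj G \<restriction> S)) = {(u, v). (u, v) \<in> parcs G \<and> u \<in> S \<and> v \<in> S}"
    unfolding symcl_def using s(4) by auto
  let ?R = "rtrancl_on S {(u, v). (u, v) \<in> parcs G \<and> u \<in> S \<and> v \<in> S}"
  have *: "connected (with_proj G \<restriction> S) \<longleftrightarrow> S \<noteq> {} \<and> (\<forall>u\<in>S. \<forall>v\<in>S. (u, v) \<in> ?R)"
    unfolding connected_conv ends by simp
  show ?thesis
  proof
    assume c: "connected (with_proj G \<restriction> S)"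
    show "conn (parcs G) S"
    proof (rule connI)
      show "S \<noteq> {}" using c * by blast
      fix X assume X: "X \<subseteq> S" "X \<noteq> {}" "X \<noteq> S"
      then obtain u v where uv: "u \<in> X" "v \<in> S - X" by blast
      then have "(u, v) \<in> ?R" using c * X(1) by blast
      then have "v \<notin> X \<longrightarrow> (\<exists>x\<in>X. \<exists>y\<in>S - X. (x, y) \<in> parcs G)"
      proof (induction rule: rtrancl_on_induct)
        case base then show ?case using uv(1) by blast
      next
        case (step y z) then show ?case by blast
      qed
      then show "\<exists>x\<in>X. \<exists>y\<in>S - X. (x, y) \<in> parcs G" using uv(2) by blast
    qed
  next
    assume c: "conn (parcs G) S"
    have "(u, v) \<in> ?R" if uv: "u \<in> S" "v \<in> S" for u v
    proof (rule ccontr)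
      assume n: "(u, v) \<notin> ?R"
      define X where "X = {w \<in> S. (u, w) \<in> ?R}"
      have "X \<subseteq> S" "X \<noteq> {}" "X \<noteq> S" using uv n unfolding X_def by auto
      then obtain x y where xy: "x \<in> X" "y \<in> S - X" "(x, y) \<in> parcs G" using connD[OF c] by metis
      then have "(u, x) \<in> ?R" "x \<in> S" "y \<in> S" unfolding X_def by blast+
      then have "(u, y) \<in> ?R" using xy(3) rtrancl_on_into_rtrancl_on[of u x S _ y] by blast
      then show False using xy(2) unfolding X_def by blast
    qed
    then show "connected (with_proj G \<restriction> S)" using * conn_nonempty[OF c] by blast
  qed
qed

lemma k_connected_iff_con3:
  assumes "pair_graph G"
  shows "k_connected 3 G \<longleftrightarrow> con3 (pverts G) (parcs G)"
  unfolding k_connected_def con3_def connected_iff_conn[OF assms] by blast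

text \<open>A digraph isomorphism carries separate maps for vertices, arcs, heads and tails. For
  pair graphs heads and tails are projections, so the arc map is the vertex map applied to both
  ends, and only the vertex map remains.\<close>

lemma digraph_iso_iff_giso:
  assumes "pair_graph G" "pair_graph H"
  shows "digraph_iso (with_proj G) (with_proj H) \<longleftrightarrow> giso (pverts G) (parcs G) (pverts H) (parcs H)"
proof
  note sG = sgraphD[OF pair_graph_sgraph[OF assms(1)]]
  note sH = sgraphD[OF pair_graph_sgraph[OF assms(2)]]
  assume "digraph_iso (with_proj G) (with_proj H)"
  then obtain f where f: "pre_digraph.digraph_isomorphism (with_proj G) f" "with_proj H = app_iso f (with_proj G)"
    unfolding digraph_iso_def by blast
  have v: "pverts H = iso_verts f ` pverts G" and a: "parcs H = iso_arcs f ` parcs G"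
    and t: "iso_tail f = fst" "iso_head f = snd"
    using arg_cong[OF f(2), of verts] arg_cong[OF f(2), of arcs] arg_cong[OF f(2), of tail] arg_cong[OF f(2), of head]
    by simp_all
  have i: "inj_on (iso_verts f) (pverts G)" and e: "\<And>a. a \<in> parcs G \<Longrightarrow> iso_verts f (fst a) = fst (iso_arcs f a) \<and> iso_verts f (snd a) = snd (iso_arcs f a)"
    using f(1) t unfolding pre_digraph.digraph_isomorphism_def by simp_all
  have e': "iso_arcs f (u, w) = (iso_verts f u, iso_verts f w)" if "(u, w) \<in> parcs G" for u w
    using e[OF that] by (metis fst_conv prod.collapse snd_conv)
  show "giso (pverts G) (parcs G) (pverts H) (parcs H)"
    unfolding giso_def
  proof (intro exI[of _ "iso_verts f"] conjI ballI)
    show "bij_betw (iso_verts f) (pverts G) (pverts H)" using i v by (simp add: bij_betw_def)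
    fix u w assume uw: "u \<in> pverts G" "w \<in> pverts G"
    show "(u, w) \<in> parcs G \<longleftrightarrow> (iso_verts f u, iso_verts f w) \<in> parcs H"
    proof
      assume "(u, w) \<in> parcs G"
      then show "(iso_verts f u, iso_verts f w) \<in> parcs H" using e' a by (metis imageI)
    next
      assume "(iso_verts f u, iso_verts f w) \<in> parcs H"
      then obtain x y where xy: "(x, y) \<in> parcs G" "iso_arcs f (x, y) = (iso_verts f u, iso_verts f w)"
        using a by (metis (no_types, lifting) imageE prod.collapse)
      then have "iso_verts f x = iso_verts f u" "iso_verts f y = iso_verts f w" using e' by simp_all
      then have "x = u" "y = w" using i uw sG(2,3)[OF xy(1)] by (auto dest: inj_onD)
      then show "(u, w) \<in> parcs G" using xy(1) by simp
    qed
  qed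
next
  note sG = sgraphD[OF pair_graph_sgraph[OF assms(1)]]
  note sH = sgraphD[OF pair_graph_sgraph[OF assms(2)]]
  interpret G: pair_graph G by fact
  assume "giso (pverts G) (parcs G) (pverts H) (parcs H)"
  then obtain f where f: "bij_betw f (pverts G) (pverts H)"
    "\<forall>u\<in>pverts G. \<forall>v\<in>pverts G. (u, v) \<in> parcs G \<longleftrightarrow> (f u, f v) \<in> parcs H"
    unfolding giso_def by blast
  define h where "h = \<lparr>iso_verts = f, iso_arcs = map_prod f f, iso_head = snd, iso_tail = fst\<rparr>"
  have inj: "inj_on f (pverts G)" "f ` pverts G = pverts H" using f(1) by (auto simp: bij_betw_def)
  have "inj_on (map_prod f f) (parcs G)"
  proof (rule inj_onI)
    fix p q assume "p \<in> parcs G" "q \<in> parcs G" "map_prod f f p = map_prod f f q"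
    then show "p = q" using inj(1) sG(2,3) by (cases p; cases q) (auto dest: inj_onD)
  qed
  moreover have "wf_digraph (with_proj G)" by unfold_locales
  ultimately have "pre_digraph.digraph_isomorphism (with_proj G) h"
    unfolding pre_digraph.digraph_isomorphism_def h_def using inj(1) by simp
  moreover have "map_prod f f ` parcs G = parcs H"
  proof (intro equalityI subsetI)
    fix p assume "p \<in> map_prod f f ` parcs G"
    then obtain u v where uv: "(u, v) \<in> parcs G" "p = (f u, f v)" by auto
    show "p \<in> parcs H" using f(2) uv sG(2,3)[OF uv(1)] by simp
  next
    fix p assume p: "p \<in> parcs H"
    obtain x y where xy: "p = (x, y)" by fastforce
    then have "x \<in> f ` pverts G" "y \<in> f ` pverts G" using sH(2,3) p inj(2) by blast+
    then obtain u v where "u \<in> pverts G" "v \<in> pverts G" "x = f u" "y = f v" by blast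
    then have "(u, v) \<in> parcs G" "p = map_prod f f (u, v)" using f(2) p xy by auto
    then show "p \<in> map_prod f f ` parcs G" by blast
  qed
  then have "with_proj H = app_iso h (with_proj G)"
    unfolding app_iso_def h_def with_proj_def using inj(2) by simp
  ultimately show "digraph_iso (with_proj G) (with_proj H)" unfolding digraph_iso_def by blast
qed

lemma parcs_contract_edge:
  "parcs (contract_edge G u v) = {((id(v := u)) a, (id(v := u)) b) | a b. (a, b) \<in> parcs G \<and> (id(v := u)) a \<noteq> (id(v := u)) b}"
  by (simp add: contract_edge_def Let_def)

text \<open>The minor is pulled back along every reduction step: by monotonicity for subgraphs, by
  expanding the merged vertex to a bag of two for contractions.\<close>

lemma K24_reduces_to:
  assumes "reduces_to G M" "pair_graph G" "K24 (parcs M)"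
  shows "K24 (parcs G)"
  using assms(1,3)
proof induction
  case refl then show ?case .
next
  case (sub H K)
  have "pair_graph H" using pair_graph_reduces_to[OF sub.hyps(1) assms(2)] .
  note s = sgraphD[OF pair_graph_sgraph[OF this]]
  have "parcs K \<subseteq> parcs H" using sub.hyps(3) unfolding subgraph_def by simp
  then have "K24 (parcs H)" using K24_mono[OF sub.prems _ s(6,7)] by blast
  then show ?case by (rule sub.IH)
next
  case (contract H u v)
  have pg: "pair_graph H" using pair_graph_reduces_to[OF contract.hyps(1) assms(2)] .
  note s = sgraphD[OF pair_graph_sgraph[OF pg]]
  \<comment> \<open>\<open>contract_edge\<close> keeps the name of its first vertex argument and
    \<open>contr\<close> that of its second, hence the exchanged order.\<close>
  have "parcs (contract_edge H u v) \<subseteq> contr (parcs H) v u"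
  proof
    fix p assume "p \<in> parcs (contract_edge H u v)"
    then obtain a b where "p = ((id(v := u)) a, (id(v := u)) b)" "(a, b) \<in> parcs H" "(id(v := u)) a \<noteq> (id(v := u)) b"
      unfolding parcs_contract_edge by blast
    then show "p \<in> contr (parcs H) v u"
      using s(5) contract.hyps(2) unfolding contr_def by (auto split: if_splits)
  qed
  moreover have "u \<in> pverts H" "v \<noteq> u" using s contract.hyps(2) by auto
  then have "sgraph (pverts H - {v}) (contr (parcs H) v u)" by (rule sgraph_contr[OF pair_graph_sgraph[OF pg]])
  note s' = sgraphD[OF this]
  ultimately have "K24 (contr (parcs H) v u)" using K24_mono[OF contract.prems _ s'(6,7)] by blast
  then have "K24 (parcs H)" using K24_contr[OF pair_graph_sgraph[OF pg]] s(4)[OF contract.hyps(2)] by blast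
  then show ?case by (rule contract.IH)
qed

lemma K24_if_minor:
  assumes "pair_graph G" "K\<^bsub>2,4\<^esub> (with_proj (H :: 'b pair_pre_digraph))" "is_minor H G"
  shows "K24 (parcs G)"
proof -
  obtain M where M: "reduces_to G M" "digraph_iso (with_proj M) (with_proj H)"
    using assms(3) unfolding is_minor_def by blast
  have pM: "pair_graph M" using M(1) assms(1) by (rule pair_graph_reduces_to)
  have pH: "pair_graph H" using assms(2) by (rule pair_graphI_complete_bipartite)
  obtain U W where UW: "pverts H = U \<union> W" "U \<inter> W = {}" "card U = 2" "card W = 4" "parcs H = U \<times> W \<union> W \<times> U"
    using assms(2) unfolding complete_bipartite_digraph_pair_def by blast
  obtain a b where ab: "U = {a, b}" "a \<noteq> b" using UW(3) by (auto simp: card_2_iff)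
  have "common (parcs H) {a} {b} = W" using UW(2,5) ab unfolding common_def by auto
  then have "K24 (parcs H)" unfolding K24_def using UW(4) ab(2)
    by (intro exI[of _ "{a}"] exI[of _ "{b}"]) auto
  then have "K24 (parcs M)"
    using giso_K24[OF _ pair_graph_sgraph[OF pM]] M(2) digraph_iso_iff_giso[OF pM pH]
      pair_graph_sgraph[OF pH] unfolding sgraph_def by blast
  then show ?thesis using K24_reduces_to[OF M(1) assms(1)] by blast
qed

text \<open>As long as a bag has two vertices, one of its edges is contracted: the bag stays
  connected, loses a vertex and keeps the common neighbours in \<open>C\<close>.\<close>

lemma reduces_to_contract_set:
  assumes "pair_graph G" "reduces_to G H" "conn (parcs H) A" "conn (parcs H) B" "A \<inter> B = {}"
    "finite C" "C \<subseteq> common (parcs H) A B" "finite A" "finite B"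
  shows "\<exists>M a b. reduces_to G M \<and> a \<noteq> b \<and> C \<subseteq> common (parcs M) {a} {b}"
  using assms(2-)
proof (induction "card A + card B" arbitrary: H A B rule: less_induct)
  case less
  \<comment> \<open>Stated for arbitrary bags and with the induction hypothesis as a premise, so
    that it applies to either of the two bags.\<close>
  have step: "\<exists>M a b. reduces_to G M \<and> a \<noteq> b \<and> C \<subseteq> common (parcs M) {a} {b}"
    if A: "conn (parcs H) A" "conn (parcs H) B" "A \<inter> B = {}" "C \<subseteq> common (parcs H) A B" "finite A" "finite B"
      "card A + card B = n" "card A > 1"
    and IH: "\<And>H A B. card A + card B < n \<Longrightarrow> reduces_to G H \<Longrightarrow> conn (parcs H) A \<Longrightarrow> conn (parcs H) B \<Longrightarrow>
      A \<inter> B = {} \<Longrightarrow> C \<subseteq> common (parcs H) A B \<Longrightarrow> finite A \<Longrightarrow> finite B \<Longrightarrow>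
      \<exists>M a b. reduces_to G M \<and> a \<noteq> b \<and> C \<subseteq> common (parcs M) {a} {b}" for A B n
  proof -
    obtain x where x: "x \<in> A" using conn_nonempty[OF A(1)] by blast
    moreover have "{x} \<noteq> A" using A(8) by auto
    ultimately obtain y where y: "y \<in> A" "y \<noteq> x" "(x, y) \<in> parcs H" using connD[OF A(1), of "{x}"] by blast
    let ?f = "id(y := x)" and ?H = "contract_edge H x y"
    have e: "(?f a, ?f b) \<in> parcs ?H" if "(a, b) \<in> parcs H" "?f a \<noteq> ?f b" for a b
      unfolding parcs_contract_edge using that by blast
    have fA: "?f ` A = A - {y}" using x y(1,2) by auto
    have fB: "?f ` B = B" using A(3) y(1) by auto
    have "conn (parcs ?H) (?f ` A)" "conn (parcs ?H) (?f ` B)"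
      using conn_image[OF A(1), of ?f "parcs ?H"] conn_image[OF A(2), of ?f "parcs ?H"] e by blast+
    moreover have "C \<subseteq> common (parcs ?H) (A - {y}) B"
    proof
      fix c assume "c \<in> C"
      then have c: "c \<notin> A" "c \<notin> B" "\<exists>u\<in>A. (u, c) \<in> parcs H" "\<exists>u\<in>B. (u, c) \<in> parcs H"
        using A(4) unfolding common_def by blast+
      have *: "(?f u, c) \<in> parcs ?H" if "u \<in> A \<union> B" "(u, c) \<in> parcs H" for u
      proof -
        have fc: "?f c = c" using c(1) y(1) by auto
        have "?f u \<in> A \<union> B" using that(1) x by auto
        then have "?f u \<noteq> ?f c" using c(1,2) fc by auto
        then show ?thesis using e[OF that(2)] fc by simp
      qed
      then show "c \<in> common (parcs ?H) (A - {y}) B"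
      proof -
        obtain u where u: "u \<in> A" "(u, c) \<in> parcs H" using c(3) by blast
        then have 1: "?f u \<in> A - {y}" "(?f u, c) \<in> parcs ?H" using *[of u] fA by blast+
        obtain w where w: "w \<in> B" "(w, c) \<in> parcs H" using c(4) by blast
        then have 2: "?f w \<in> B" "(?f w, c) \<in> parcs ?H" using *[of w] fB by blast+
        show ?thesis unfolding common_def using c(1,2) 1 2 by blast
      qed
    qed
    moreover have "reduces_to G ?H" using less.prems(1) y(3) by (rule reduces_to.contract)
    moreover have "card (A - {y}) + card B < n" using A(5,7,8) y(1) by auto
    ultimately show ?thesis using IH[of "A - {y}" B ?H] A(3,5,6) unfolding fA fB by (metis Diff_disjoint Int_Diff finite_Diff Diff_empty Int_commute)
  qed
  show ?case
  proof (cases "card A > 1")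
    case True
    show ?thesis by (rule step[of A B]) (use less True in blast)+
  next
    case a: False
    show ?thesis
    proof (cases "card B > 1")
      case True
      have "C \<subseteq> common (parcs H) B A" using less.prems(6) unfolding common_def by blast
      then show ?thesis
        by (rule step[of B A, rotated 3]) (use less True in \<open>auto simp: add.commute Int_commute\<close>)
    next
      case False
      have "card A \<noteq> 0" "card B \<noteq> 0" using less.prems conn_nonempty by (metis card_0_eq)+
      then have "card A = 1" "card B = 1" using a False by linarith+
      then obtain a b where "A = {a}" "B = {b}" by (meson card_1_singletonE)
      then show ?thesis using less.prems by blast
    qed
  qed
qed

lemma minor_if_K24:
  assumes "pair_graph G" "K24 (parcs G)"
  shows "\<exists>H :: nat pair_pre_digraph. K\<^bsub>2,4\<^esub> (with_proj H) \<and> is_minor H G"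
proof -
  note s = sgraphD[OF pair_graph_sgraph[OF assms(1)]]
  obtain A B where AB: "A \<inter> B = {}" "conn (parcs G) A" "conn (parcs G) B" "card (common (parcs G) A B) \<ge> 4"
    using assms(2) unfolding K24_def by blast
  then obtain C where C: "C \<subseteq> common (parcs G) A B" "card C = 4" "finite C" by (metis obtain_subset_with_card_n)
  then obtain c where "c \<in> common (parcs G) A B" by fastforce
  then have "A \<subseteq> pverts G" "B \<subseteq> pverts G"
    using conn_Domain[OF AB(2)] conn_Domain[OF AB(3)] s(2) unfolding common_def by (blast elim: DomainE)+
  then have "finite A" "finite B" using s(1) finite_subset by blast+
  then obtain M a b where M: "reduces_to G M" "a \<noteq> b" "C \<subseteq> common (parcs M) {a} {b}"
    using reduces_to_contract_set[OF assms(1) reduces_to.refl AB(2,3,1) C(3,1)] by blast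
  have pM: "pair_graph M" using M(1) assms(1) by (rule pair_graph_reduces_to)
  note sM = sgraphD[OF pair_graph_sgraph[OF pM]]
  define K where "K = \<lparr>pverts = {a, b} \<union> C, parcs = {a, b} \<times> C \<union> C \<times> {a, b}\<rparr>"
  have dj: "{a, b} \<inter> C = {}" using M(3) unfolding common_def by blast
  have pK: "pair_graph K"
    by (rule sgraph_pair_graph) (use dj C(3) in \<open>auto simp: sgraph_def K_def sym_def irrefl_def\<close>)
  have ed: "(a, c) \<in> parcs M" "(b, c) \<in> parcs M" if "c \<in> C" for c using M(3) that unfolding common_def by blast+
  obtain c0 where "c0 \<in> C" using C(2) by fastforce
  have sub: "pverts K \<subseteq> pverts M" "parcs K \<subseteq> parcs M"
    unfolding K_def using ed sM(2)[OF ed(1)] sM(2)[OF ed(2)] sM(3)[OF ed(1)] sM(4) \<open>c0 \<in> C\<close> by auto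
  have "subgraph (with_proj K) (with_proj M)"
  proof -
    interpret K: pair_graph K by fact
    interpret M: pair_graph M by fact
    have "wf_digraph (with_proj K)" "wf_digraph (with_proj M)" by unfold_locales
    then show ?thesis using sub unfolding subgraph_def compatible_def by simp
  qed
  then have redK: "reduces_to G K" using M(1) pK reduces_to.sub by blast
  \<comment> \<open>\<open>K24_minor_free\<close> quantifies over graphs on natural numbers, so the
    graph found is renamed injectively.\<close>
  obtain g :: "'a \<Rightarrow> nat" where g: "inj_on g ({a, b} \<union> C)"
    using finite_imp_inj_to_nat_seg[of "{a, b} \<union> C"] C(3) by auto
  define H where "H = \<lparr>pverts = g ` ({a, b} \<union> C), parcs = g ` {a, b} \<times> g ` C \<union> g ` C \<times> g ` {a, b}\<rparr>"
  have dj': "g ` {a, b} \<inter> g ` C = {}" using inj_on_image_Int[OF g, of "{a, b}" C] dj by auto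
  have H24: "K\<^bsub>2,4\<^esub> (with_proj H)"
    unfolding complete_bipartite_digraph_pair_def
  proof (rule conjI, goal_cases)
    case 1
    show "finite (pverts H)" using C(3) by (simp add: H_def)
  next
    case 2
    show ?case
  proof (rule exI[of _ "g ` {a, b}"], rule exI[of _ "g ` C"], intro conjI)
    show "pverts H = g ` {a, b} \<union> g ` C" "parcs H = g ` {a, b} \<times> g ` C \<union> g ` C \<times> g ` {a, b}"
      by (simp_all add: H_def image_Un)
    show "g ` {a, b} \<inter> g ` C = {}" by (rule dj')
    show "card (g ` {a, b}) = 2" using card_image[of g "{a, b}"] g M(2) by (simp add: inj_on_def)
    show "card (g ` C) = 4" using card_image[of g C] g C(2) by (simp add: inj_on_def)
  qed
  qed
  have pH: "pair_graph H" using H24 by (rule pair_graphI_complete_bipartite)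
  have "giso (pverts K) (parcs K) (pverts H) (parcs H)"
    unfolding giso_def
  proof (intro exI[of _ g] conjI ballI)
    show "bij_betw g (pverts K) (pverts H)" using g by (simp add: bij_betw_def K_def H_def)
    fix u v assume uv: "u \<in> pverts K" "v \<in> pverts K"
    have *: "g x \<in> g ` X \<longleftrightarrow> x \<in> X" if "x \<in> {a, b} \<union> C" "X = {a, b} \<or> X = C" for x X
      using inj_on_image_mem_iff[OF g that(1), of X] that(2) by blast
    have "g u \<in> g ` {a, b} \<longleftrightarrow> u \<in> {a, b}" "g u \<in> g ` C \<longleftrightarrow> u \<in> C"
       "g v \<in> g ` {a, b} \<longleftrightarrow> v \<in> {a, b}" "g v \<in> g ` C \<longleftrightarrow> v \<in> C"
      using *[of u "{a, b}"] *[of u C] *[of v "{a, b}"] *[of v C] uv by (simp_all add: K_def subset_insertI2)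
    then show "(u, v) \<in> parcs K \<longleftrightarrow> (g u, g v) \<in> parcs H" unfolding K_def H_def by simp
  qed
  then have "digraph_iso (with_proj K) (with_proj H)" using digraph_iso_iff_giso[OF pK pH] by blast
  then show ?thesis using H24 redK unfolding is_minor_def by blast
qed

theorem K24_minor_free_iff:
  assumes "pair_graph G"
  shows "K24_minor_free G \<longleftrightarrow> \<not> K24 (parcs G)"
  using K24_if_minor[OF assms] minor_if_K24[OF assms] unfolding K24_minor_free_def by blast

section \<open>Executable verification of a minor in an edge list\<close>

definition adj :: "(nat \<times> nat) list \<Rightarrow> nat \<Rightarrow> nat \<Rightarrow> bool" where
  "adj P u v \<longleftrightarrow> (u, v) \<in> set P \<or> (v, u) \<in> set P"

definition adj_set :: "(nat \<times> nat) list \<Rightarrow> nat list \<Rightarrow> nat \<Rightarrow> bool" where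
  "adj_set P A v \<longleftrightarrow> list_ex (\<lambda>x. adj P x v) A"

text \<open>The order of the list serves as the proof of connectedness: every vertex has to be
  adjacent to an earlier one, and these are collected in \<open>S\<close>.\<close>

fun conn_list :: "(nat \<times> nat) list \<Rightarrow> nat list \<Rightarrow> nat list \<Rightarrow> bool" where
  "conn_list P S [] \<longleftrightarrow> S \<noteq> []"
| "conn_list P S (x # xs) \<longleftrightarrow> (S = [] \<or> adj_set P S x) \<and> conn_list P (x # S) xs"

definition K24_check :: "nat \<Rightarrow> (nat \<times> nat) list \<Rightarrow> nat list \<Rightarrow> nat list \<Rightarrow> bool" where
  "K24_check n P A B \<longleftrightarrow> conn_list P [] A \<and> conn_list P [] B \<and> list_all (\<lambda>x. x \<notin> set B) A \<and>
     length (filter (\<lambda>v. v \<notin> set A \<and> v \<notin> set B \<and> adj_set P A v \<and> adj_set P B v) [0..<n]) \<ge> 4"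

definition symc :: "'a rel \<Rightarrow> 'a rel" where
  "symc R = R \<union> R\<inverse>"

lemma symc_iff [simp]: "(x, y) \<in> symc R \<longleftrightarrow> (x, y) \<in> R \<or> (y, x) \<in> R"
  by (simp add: symc_def)

lemma sym_symc [simp]: "sym (symc R)"
  by (auto simp: sym_def)

lemma finite_symc [simp]: "finite R \<Longrightarrow> finite (symc R)"
  by (simp add: symc_def)

lemma conn_list_sound:
  assumes "conn_list P S xs" "S = [] \<or> conn (symc (set P)) (set S)"
  shows "conn (symc (set P)) (set S \<union> set xs)"
  using assms
proof (induction xs arbitrary: S)
  case Nil then show ?case by simp
next
  case (Cons x xs)
  have "conn (symc (set P)) (set (x # S))"
  proof (cases "S = []")
    case False
    then obtain y where "y \<in> set S" "(x, y) \<in> symc (set P)"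
      using Cons.prems(1) by (auto simp: adj_set_def adj_def list_ex_iff)
    then show ?thesis using conn_insert[of _ "set S" y x] Cons.prems(2) False by simp
  qed simp
  then show ?case using Cons.IH[of "x # S"] Cons.prems(1) by simp
qed

lemma K24_check_sound:
  assumes "K24_check n P A B" shows "K24 (symc (set P))"
proof -
  let ?L = "filter (\<lambda>v. v \<notin> set A \<and> v \<notin> set B \<and> adj_set P A v \<and> adj_set P B v) [0..<n]"
  have "conn (symc (set P)) (set A)" "conn (symc (set P)) (set B)" "set A \<inter> set B = {}"
    using assms conn_list_sound[of P "[]"] unfolding K24_check_def by (auto simp: list_all_iff)
  moreover have "set ?L \<subseteq> common (symc (set P)) (set A) (set B)"
    by (auto simp: common_def adj_set_def adj_def list_ex_iff)
  then have "card (set ?L) \<le> card (common (symc (set P)) (set A) (set B))"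
    by (intro card_mono finite_common) auto
  moreover have "card (set ?L) = length ?L" by (rule distinct_card) simp
  moreover have "length ?L \<ge> 4" using assms unfolding K24_check_def by blast
  ultimately have "card (common (symc (set P)) (set A) (set B)) \<ge> 4" by linarith
  then show ?thesis unfolding K24_def
    using \<open>conn (symc (set P)) (set A)\<close> \<open>conn (symc (set P)) (set B)\<close> \<open>set A \<inter> set B = {}\<close> by blast
qed

section \<open>Paths as lists of vertices\<close>

fun pe :: "'a list \<Rightarrow> 'a rel" where
  "pe (x # y # zs) = insert (x, y) (pe (y # zs))"
| "pe _ = {}"

lemma pe_append: "pe (xs @ y # ys) = pe (xs @ [y]) \<union> pe (y # ys)"
proof (induction xs)
  case (Cons x xs) then show ?case by (cases xs) auto
qed simp

lemma pe_append_edge: "pe (xs @ [x, y]) = insert (x, y) (pe (xs @ [x]))"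
  using pe_append[of xs x "[y]"] by auto

lemma pe_set: "(x, y) \<in> pe xs \<Longrightarrow> x \<in> set xs \<and> y \<in> set xs"
  by (induction xs rule: pe.induct) auto

lemma finite_pe [simp]: "finite (pe xs)"
  by (induction xs rule: pe.induct) auto

lemma pe_rev: "pe (rev xs) = (pe xs)\<inverse>"
proof (induction xs rule: pe.induct)
  case (1 x y zs) then show ?case using pe_append_edge[of "rev zs" y x] by auto
qed auto

lemma pe_map: "pe (map f xs) = map_prod f f ` pe xs"
  by (induction xs rule: pe.induct) auto

lemma pe_subset_append1: "pe (xs @ ys) \<subseteq> E \<Longrightarrow> pe xs \<subseteq> E"
proof (induction xs rule: pe.induct)
qed auto

lemma pe_subset_append2: "pe (xs @ ys) \<subseteq> E \<Longrightarrow> pe ys \<subseteq> E"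
proof (induction xs)
  case (Cons x xs) then show ?case by (cases "xs @ ys") auto
qed simp

lemma pe_last_hd:
  assumes "pe (xs @ ys) \<subseteq> E" "xs \<noteq> []" "ys \<noteq> []" shows "(last xs, hd ys) \<in> E"
proof -
  have "xs @ ys = butlast xs @ last xs # hd ys # tl ys" using assms(2,3) by simp
  then show ?thesis using assms(1) pe_append[of "butlast xs" "last xs" "hd ys # tl ys"] by auto
qed

lemma conn_pe:
  assumes "xs \<noteq> []" "pe xs \<subseteq> E" "sym E" shows "conn E (set xs)"
  using assms
proof (induction xs rule: pe.induct)
  case (1 x y zs)
  then have "conn E (insert x (set (y # zs)))" by (intro conn_insert[of E _ y]) auto
  then show ?case by simp
qed auto

text \<open>The indices of \<open>bags\<close> are the vertices of a quotient, and \<open>P\<close>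
  lists some of its edges, each witnessed by an edge between two bags. As \<open>P\<close> is a
  fixed list of numbers, the minor is verified by evaluation although the paths in the bags have
  unknown lengths.\<close>

lemma K24_path_bags:
  assumes "sym E" "finite E" "distinct (concat bags)" "\<And>c. c \<in> set bags \<Longrightarrow> c \<noteq> [] \<and> pe c \<subseteq> E"
    and "K24_check (length bags) P A B"
    and "list_all (\<lambda>(u, v). u < length bags \<and> v < length bags \<and> (\<exists>x\<in>set (bags ! u). \<exists>y\<in>set (bags ! v). (x, y) \<in> E)) P"
  shows "K24 E"
proof (rule K24_bags[OF assms(1,2), of "symc (set P)" "{..<length bags}" "\<lambda>v. set (bags ! v)"])
  have s: "(x, y) \<in> E \<Longrightarrow> (y, x) \<in> E" for x y using assms(1) by (meson symD)
  show "symc (set P) \<subseteq> {..<length bags} \<times> {..<length bags}"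
    using assms(6) by (auto simp: list_all_iff symc_def)
  show "K24 (symc (set P))" by (rule K24_check_sound) fact
  show "conn E (set (bags ! v)) \<and> finite (set (bags ! v))" if "v \<in> {..<length bags}" for v
    using conn_pe[OF _ _ assms(1)] assms(4)[of "bags ! v"] that by simp
  show "set (bags ! u) \<inter> set (bags ! v) = {}"
    if uv: "u \<in> {..<length bags}" "v \<in> {..<length bags}" "u \<noteq> v" for u v
  proof -
    have "[] \<notin> set bags" using assms(4) by blast
    then have "distinct bags" using assms(3) by (simp add: distinct_concat_iff removeAll_id)
    then have "bags ! u \<noteq> bags ! v" using uv by (simp add: nth_eq_iff_index_eq)
    then show ?thesis using assms(3) uv unfolding distinct_concat_iff by simp
  qed
  show "\<exists>x\<in>set (bags ! u). \<exists>y\<in>set (bags ! v). (x, y) \<in> E" if "(u, v) \<in> symc (set P)" for u v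
    using that assms(6) s by (fastforce simp: list_all_iff)
qed

lemma K24_path_bagsI:
  assumes "sym E" "finite E" "K24_check (length bags) P A B" "distinct (concat bags)"
    "list_all (\<lambda>c. c \<noteq> [] \<and> pe c \<subseteq> E) bags"
    and "list_all (\<lambda>(u, v). u < length bags \<and> v < length bags \<and> (\<exists>x\<in>set (bags ! u). \<exists>y\<in>set (bags ! v). (x, y) \<in> E)) P"
  shows "K24 E"
  by (rule K24_path_bags[OF assms(1,2,4) _ assms(3,6)]) (use assms(5) in \<open>auto simp: list_all_iff\<close>)

lemma hd_last_bexI:
  "xs \<noteq> [] \<Longrightarrow> P (hd xs) \<Longrightarrow> \<exists>x\<in>set xs. P x" "xs \<noteq> [] \<Longrightarrow> P (last xs) \<Longrightarrow> \<exists>x\<in>set xs. P x"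
  using hd_in_set last_in_set by blast+

text \<open>In the certificates below, a graph is contracted onto the listed bags, each of which is the vertex
  set of a path, and \<open>K24_check\<close> finds the minor in the quotient.\<close>

lemma K24_cert_next_hub:
  assumes "sym E" "finite E" "distinct (concat [[a], [b], P, [v], [x], D, Q])"
    "pe P \<subseteq> E" "pe D \<subseteq> E" "pe Q \<subseteq> E" "P \<noteq> []" "D \<noteq> []" "Q \<noteq> []"
    "\<exists>p\<in>set P. (a, p) \<in> E" "\<exists>p\<in>set P. (b, p) \<in> E" "(last P, v) \<in> E" "(v, hd D) \<in> E" "(v, x) \<in> E" "(x, hd D) \<in> E" "(x, b) \<in> E"
    "\<exists>d\<in>set D. (a, d) \<in> E" "(last D, hd Q) \<in> E" "\<exists>p\<in>set Q. (a, p) \<in> E" "\<exists>p\<in>set Q. (b, p) \<in> E"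
  shows "K24 E"
proof -
  have s: "(x, y) \<in> E \<longleftrightarrow> (y, x) \<in> E" for x y using assms(1) by (meson symD)
  show ?thesis
    \<comment> \<open>The large bags are \<open>D\<close> and \<open>b\<close> with
      \<open>P\<close>; they share the neighbours \<open>a\<close>, \<open>v\<close>,
      \<open>x\<close> and \<open>Q\<close>.\<close>
    by (rule K24_path_bagsI[OF assms(1,2) _ assms(3), of "[(0,2),(1,2),(2,3),(3,4),(3,5),(4,5),(4,1),(5,0),(5,6),(6,0),(6,1)]" "[5]" "[1,2]"])
       (use assms(4-) s in \<open>auto simp: K24_check_def adj_set_def adj_def upt_rec intro: hd_last_bexI\<close>)
qed

text \<open>A segment \<open>P\<close> precedes the predecessor \<open>u\<close> of
  \<open>v\<close>. The bags \<open>b\<close> with \<open>P\<close> and \<open>x\<close> with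
  \<open>D\<close> share \<open>a\<close>, \<open>u\<close>, \<open>v\<close> and
  \<open>Q\<close>.\<close>

lemma K24_cert_prev_next_1:
  assumes "sym E" "finite E" "distinct (concat [[a], [b], P, [u], [v], [x], D, Q])"
    "pe P \<subseteq> E" "pe D \<subseteq> E" "pe Q \<subseteq> E" "P \<noteq> []" "D \<noteq> []" "Q \<noteq> []"
    "\<exists>p\<in>set P. (a, p) \<in> E" "\<exists>p\<in>set P. (b, p) \<in> E" "(last P, u) \<in> E" "(u, b) \<in> E" "(u, v) \<in> E" "(u, x) \<in> E"
    "(v, x) \<in> E" "(v, b) \<in> E" "(x, hd D) \<in> E"
    "\<exists>d\<in>set D. (a, d) \<in> E" "(last D, hd Q) \<in> E" "\<exists>p\<in>set Q. (a, p) \<in> E" "\<exists>p\<in>set Q. (b, p) \<in> E"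
  shows "K24 E"
proof -
  have s: "(x, y) \<in> E \<longleftrightarrow> (y, x) \<in> E" for x y using assms(1) by (meson symD)
  show ?thesis
    by (rule K24_path_bagsI[OF assms(1,2) _ assms(3), of "[(0,2),(1,2),(2,3),(3,1),(3,4),(3,5),(4,5),(4,1),(5,6),(6,0),(6,7),(7,0),(7,1)]" "[1,2]" "[5,6]"])
       (use assms(4-) s in \<open>auto simp: K24_check_def adj_set_def adj_def upt_rec intro: hd_last_bexI\<close>)
qed

text \<open>The predecessor of \<open>v\<close> is the end \<open>p\<close> of the path, and the
  hubs are adjacent: \<open>b\<close> and \<open>x\<close> with \<open>D\<close> share
  \<open>a\<close>, \<open>p\<close>, \<open>v\<close> and \<open>Q\<close>.\<close>

lemma K24_cert_prev_next_2:
  assumes "sym E" "finite E" "distinct (concat [[a], [b], [p], [v], [x], D, Q])"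
    "pe D \<subseteq> E" "pe Q \<subseteq> E" "D \<noteq> []" "Q \<noteq> []" "(a, b) \<in> E"
    "(a, p) \<in> E" "(b, p) \<in> E" "(p, v) \<in> E" "(p, x) \<in> E"
    "(v, x) \<in> E" "(v, b) \<in> E" "(x, hd D) \<in> E"
    "\<exists>d\<in>set D. (a, d) \<in> E" "(last D, hd Q) \<in> E" "\<exists>p\<in>set Q. (a, p) \<in> E" "\<exists>p\<in>set Q. (b, p) \<in> E"
  shows "K24 E"
proof -
  have s: "(x, y) \<in> E \<longleftrightarrow> (y, x) \<in> E" for x y using assms(1) by (meson symD)
  show ?thesis
    by (rule K24_path_bagsI[OF assms(1,2) _ assms(3), of "[(0,1),(0,2),(1,2),(2,3),(2,4),(3,4),(3,1),(4,5),(5,0),(5,6),(6,0),(6,1)]" "[1]" "[4,5]"])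
       (use assms(4-) s in \<open>auto simp: K24_check_def adj_set_def adj_def upt_rec intro: hd_last_bexI\<close>)
qed

text \<open>The segment \<open>C\<close> after \<open>x\<close> sees \<open>b\<close>: the bags
  \<open>a\<close> with \<open>p\<close> and \<open>b\<close> with \<open>C\<close> share
  \<open>v\<close>, \<open>x\<close>, \<open>D\<close> and \<open>Q\<close>.\<close>

lemma K24_cert_prev_next_3:
  assumes "sym E" "finite E" "distinct (concat [[a], [b], [p], [v], [x], C, D, Q])"
    "pe C \<subseteq> E" "pe D \<subseteq> E" "pe Q \<subseteq> E" "C \<noteq> []" "D \<noteq> []" "Q \<noteq> []"
    "(a, p) \<in> E" "(b, p) \<in> E" "(p, v) \<in> E" "(p, x) \<in> E"
    "(v, x) \<in> E" "(v, b) \<in> E" "(x, hd C) \<in> E" "\<exists>d\<in>set C. (b, d) \<in> E" "(last C, hd D) \<in> E"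
    "\<exists>d\<in>set D. (a, d) \<in> E" "(last D, hd Q) \<in> E" "\<exists>p\<in>set Q. (a, p) \<in> E" "\<exists>p\<in>set Q. (b, p) \<in> E"
  shows "K24 E"
proof -
  have s: "(x, y) \<in> E \<longleftrightarrow> (y, x) \<in> E" for x y using assms(1) by (meson symD)
  show ?thesis
    by (rule K24_path_bagsI[OF assms(1,2) _ assms(3), of "[(0,2),(1,2),(2,3),(2,4),(3,4),(3,1),(4,5),(5,1),(5,6),(6,0),(6,7),(7,0),(7,1)]" "[0,2]" "[1,5]"])
       (use assms(4-) s in \<open>auto simp: K24_check_def adj_set_def adj_def upt_rec intro: hd_last_bexI\<close>)
qed

text \<open>The segment \<open>C\<close> after \<open>x\<close> sees \<open>a\<close>: the bags
  \<open>x\<close> with \<open>C\<close> and \<open>b\<close> with \<open>Q\<close> share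
  \<open>a\<close>, \<open>p\<close>, \<open>v\<close> and \<open>D\<close>.\<close>

lemma K24_cert_prev_next_4:
  assumes "sym E" "finite E" "distinct (concat [[a], [b], [p], [v], [x], C, D, Q])"
    "pe C \<subseteq> E" "pe D \<subseteq> E" "pe Q \<subseteq> E" "C \<noteq> []" "D \<noteq> []" "Q \<noteq> []"
    "(a, p) \<in> E" "(b, p) \<in> E" "(p, v) \<in> E" "(p, x) \<in> E"
    "(v, x) \<in> E" "(v, b) \<in> E" "(x, hd C) \<in> E" "\<exists>d\<in>set C. (a, d) \<in> E" "(last C, hd D) \<in> E"
    "\<exists>d\<in>set D. (a, d) \<in> E" "(last D, hd Q) \<in> E" "\<exists>p\<in>set Q. (a, p) \<in> E" "\<exists>p\<in>set Q. (b, p) \<in> E"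
  shows "K24 E"
proof -
  have s: "(x, y) \<in> E \<longleftrightarrow> (y, x) \<in> E" for x y using assms(1) by (meson symD)
  show ?thesis
    by (rule K24_path_bagsI[OF assms(1,2) _ assms(3), of "[(0,2),(1,2),(2,3),(2,4),(3,4),(3,1),(4,5),(5,0),(5,6),(6,0),(6,7),(7,0),(7,1)]" "[4,5]" "[1,7]"])
       (use assms(4-) s in \<open>auto simp: K24_check_def adj_set_def adj_def upt_rec intro: hd_last_bexI\<close>)
qed

text \<open>The bags \<open>a\<close> and \<open>b\<close> with \<open>C\<close> share
  \<open>p\<close>, \<open>x\<close>, \<open>D\<close> and \<open>Q\<close>.\<close>

lemma K24_cert_first_hub_next:
  assumes "sym E" "finite E" "distinct (concat [[a], [b], [p], [x], C, D, Q])"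
    "pe C \<subseteq> E" "pe D \<subseteq> E" "pe Q \<subseteq> E" "C \<noteq> []" "D \<noteq> []" "Q \<noteq> []"
    "(a, p) \<in> E" "(b, p) \<in> E" "(p, x) \<in> E" "(x, a) \<in> E"
    "(x, hd C) \<in> E" "\<exists>d\<in>set C. (b, d) \<in> E" "(last C, hd D) \<in> E"
    "\<exists>d\<in>set D. (a, d) \<in> E" "(last D, hd Q) \<in> E" "\<exists>p\<in>set Q. (a, p) \<in> E" "\<exists>p\<in>set Q. (b, p) \<in> E"
  shows "K24 E"
proof -
  have s: "(x, y) \<in> E \<longleftrightarrow> (y, x) \<in> E" for x y using assms(1) by (meson symD)
  show ?thesis
    by (rule K24_path_bagsI[OF assms(1,2) _ assms(3), of "[(0,2),(1,2),(2,3),(3,0),(3,4),(4,1),(4,5),(5,0),(5,6),(6,0),(6,1)]" "[0]" "[1,4]"])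
       (use assms(4-) s in \<open>auto simp: K24_check_def adj_set_def adj_def upt_rec intro: hd_last_bexI\<close>)
qed

text \<open>The bags \<open>a\<close> with \<open>p\<close> and \<open>b\<close> with
  \<open>C\<close> share \<open>x\<close>, \<open>u\<close>, \<open>D\<close> and
  \<open>Q\<close>.\<close>

lemma K24_cert_first_next_hub:
  assumes "sym E" "finite E" "distinct (concat [[a], [b], [p], [x], [u], C, D, Q])"
    "pe C \<subseteq> E" "pe D \<subseteq> E" "pe Q \<subseteq> E" "C \<noteq> []" "D \<noteq> []" "Q \<noteq> []"
    "(a, p) \<in> E" "(p, x) \<in> E" "(p, u) \<in> E" "(x, u) \<in> E" "(x, b) \<in> E"
    "(u, b) \<in> E" "(u, hd C) \<in> E" "\<exists>d\<in>set C. (b, d) \<in> E" "(last C, hd D) \<in> E"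
    "\<exists>d\<in>set D. (a, d) \<in> E" "(last D, hd Q) \<in> E" "\<exists>p\<in>set Q. (a, p) \<in> E" "\<exists>p\<in>set Q. (b, p) \<in> E"
  shows "K24 E"
proof -
  have s: "(x, y) \<in> E \<longleftrightarrow> (y, x) \<in> E" for x y using assms(1) by (meson symD)
  show ?thesis
    by (rule K24_path_bagsI[OF assms(1,2) _ assms(3), of "[(0,2),(2,3),(2,4),(3,4),(3,1),(4,1),(4,5),(5,1),(5,6),(6,0),(6,7),(7,0),(7,1)]" "[0,2]" "[1,5]"])
       (use assms(4-) s in \<open>auto simp: K24_check_def adj_set_def adj_def upt_rec intro: hd_last_bexI\<close>)
qed

section \<open>Inserting a vertex into a member of the family\<close>

text \<open>The hubs \<open>a\<close> and \<open>b\<close> are $v_1$ and $v_n$, and the path \<open>p # Bs @ Os @ As @ [q]\<close> is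
  $v_2 \ldots v_{n-1}$. Inner path vertices are adjacent to \<open>b\<close> only (\<open>Bs\<close>), to both hubs
  (\<open>Os\<close>) or to \<open>a\<close> only (\<open>As\<close>). Two vertices in \<open>Os\<close> would give a $K_{2,4}$ minor, and an inner
  vertex adjacent to no hub would have degree 2.\<close>

definition famR :: "'a \<Rightarrow> 'a \<Rightarrow> 'a \<Rightarrow> 'a list \<Rightarrow> 'a list \<Rightarrow> 'a list \<Rightarrow> 'a \<Rightarrow> bool \<Rightarrow> 'a rel" where
  "famR a b p Bs Os As q ab = pe (p # Bs @ Os @ As @ [q]) \<union> {a} \<times> set (p # Os @ As @ [q]) \<union>
     {b} \<times> set (p # Bs @ Os @ [q]) \<union> (if ab then {(a, b)} else {})"

definition is_fam where
  "is_fam V E a b p Bs Os As q ab \<longleftrightarrow> distinct (a # b # p # Bs @ Os @ As @ [q]) \<and> length Os \<le> 1 \<and>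
     V = set (a # b # p # Bs @ Os @ As @ [q]) \<and> E = symc (famR a b p Bs Os As q ab)"

definition Fam :: "'a set \<Rightarrow> 'a rel \<Rightarrow> bool" where
  "Fam V E \<longleftrightarrow> (\<exists>a b p Bs Os As q ab. is_fam V E a b p Bs Os As q ab)"

text \<open>The inverse of the contraction of an edge \<open>xp\<close> in a triangle \<open>xpd\<close> where \<open>x\<close> and \<open>p\<close> have
  degree 3: the edge \<open>ps\<close> is subdivided by \<open>x\<close>, and \<open>x\<close> is joined to \<open>d\<close>.\<close>

definition dbl :: "'a rel \<Rightarrow> 'a \<Rightarrow> 'a \<Rightarrow> 'a \<Rightarrow> 'a \<Rightarrow> 'a rel" where
  "dbl E p x d s = (E - {(p, s), (s, p)}) \<union> symc {(x, p), (x, d), (x, s)}"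

lemma symc_mono: "R \<subseteq> S \<Longrightarrow> symc R \<subseteq> symc S"
  by (auto simp: symc_def)

lemma symc_eqI: "R \<subseteq> symc S \<Longrightarrow> S \<subseteq> symc R \<Longrightarrow> symc R = symc S"
  by (auto simp: symc_def)

text \<open>\<open>R\<close> is directed and \<open>symc\<close> adds both directions, so the edge
  to be subdivided has to be kept apart from \<open>R\<close> in either direction; removing it then
  leaves \<open>R\<close> untouched.\<close>

lemma dbl_symc:
  assumes "(p, s) \<notin> R" "(s, p) \<notin> R"
  shows "dbl (symc (insert (p, s) R)) p x d s = symc (R \<union> {(x, p), (x, d), (x, s)})"
  using assms by (auto simp: dbl_def symc_def)

lemma dbl_symc':
  assumes "symc R = symc (insert (p, s) R')" "(p, s) \<notin> R'" "(s, p) \<notin> R'"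
  shows "dbl (symc R) p x d s = symc (R' \<union> {(x, p), (x, d), (x, s)})"
  using assms dbl_symc by metis

text \<open>The description is symmetric under exchanging the hubs and reversing the path, so later
  arguments can be confined to the side of \<open>b\<close>.\<close>

lemma is_fam_rev:
  assumes "is_fam V E a b p Bs Os As q ab"
  shows "is_fam V E b a q (rev As) (rev Os) (rev Bs) p ab"
proof -
  have "pe (q # rev As @ rev Os @ rev Bs @ [p]) = (pe (p # Bs @ Os @ As @ [q]))\<inverse>"
    using pe_rev[of "p # Bs @ Os @ As @ [q]"] by simp
  then have "symc (famR b a q (rev As) (rev Os) (rev Bs) p ab) = symc (famR a b p Bs Os As q ab)"
    unfolding famR_def by (intro symc_eqI) auto
  then show ?thesis using assms unfolding is_fam_def by auto
qed

text \<open>A hub \<open>b\<close> of degree 3 exchanges roles with its neighbour \<open>c\<close>: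
  with hubs \<open>a\<close> and \<open>c\<close> the path runs over \<open>p\<close>,
  \<open>b\<close>, \<open>q\<close> and then backwards over \<open>As\<close> to \<open>A\<close>.
  The new hubs are adjacent exactly if \<open>c\<close> saw \<open>a\<close>, that is, if
  \<open>c\<close> comes from \<open>Os\<close>.\<close>

lemma is_fam_small_b:
  assumes "is_fam V E a b p Bs Os (A # As) q ab" "(Bs = [] \<and> Os = [c] \<and> \<not> ab) \<or> (Bs = [c] \<and> Os = [] \<and> \<not> ab)"
  shows "is_fam V E a c p [b] [] (q # rev As) A (Bs = [])"
proof -
  have *: "pe (q # rev As @ [A]) = (pe (A # As @ [q]))\<inverse>"
    using pe_rev[of "A # As @ [q]"] by simp
  from assms(2) have "symc (famR a c p [b] [] (q # rev As) A (Bs = [])) = symc (famR a b p Bs Os (A # As) q ab)"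
  proof
    assume "Bs = [] \<and> Os = [c] \<and> \<not> ab"
    then show ?thesis unfolding famR_def by (intro symc_eqI) (auto simp: * )
  next
    assume "Bs = [c] \<and> Os = [] \<and> \<not> ab"
    then show ?thesis unfolding famR_def by (intro symc_eqI) (auto simp: * )
  qed
  then show ?thesis using assms unfolding is_fam_def by auto
qed

section \<open>Wheels\<close>

definition is_wheel :: "'a set \<Rightarrow> 'a rel \<Rightarrow> 'a \<Rightarrow> 'a list \<Rightarrow> bool" where
  "is_wheel V E c vs \<longleftrightarrow> distinct (c # vs) \<and> length vs \<ge> 3 \<and> V = set (c # vs) \<and>
     E = symc (pe vs \<union> {(last vs, hd vs)} \<union> {c} \<times> set vs)"

lemma is_wheel_rotate1:
  assumes "is_wheel V E c (v # vs)" shows "is_wheel V E c (vs @ [v])"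
proof -
  have "length vs \<ge> 2" using assms unfolding is_wheel_def by simp
  then obtain w ws where vs: "vs = w # ws" "ws \<noteq> []" by (cases vs; cases "tl vs") auto
  have "symc (pe (vs @ [v]) \<union> {(last (vs @ [v]), hd (vs @ [v]))} \<union> {c} \<times> set (vs @ [v])) =
      symc (pe (v # vs) \<union> {(last (v # vs), hd (v # vs))} \<union> {c} \<times> set (v # vs))"
  proof -
    have ne: "vs \<noteq> []" using vs by simp
    then have 1: "pe (vs @ [v]) = insert (last vs, v) (pe vs)"
      using pe_append_edge[of "butlast vs" "last vs" v] append_butlast_last_id[OF ne] by (metis append.assoc append_Cons append_Nil)
    have 2: "pe (v # vs) = insert (v, hd vs) (pe vs)" using vs by simp
    have 3: "last (vs @ [v]) = v" "hd (vs @ [v]) = hd vs" "last (v # vs) = last vs" "hd (v # vs) = v" "set (vs @ [v]) = set (v # vs)"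
      using ne by auto
    show ?thesis unfolding 1 2 3 by (intro symc_eqI) auto
  qed
  then show ?thesis using assms unfolding is_wheel_def by auto
qed

lemma is_wheel_rotate: "is_wheel V E c (xs @ ys) \<Longrightarrow> is_wheel V E c (ys @ xs)"
proof (induction xs arbitrary: ys)
  case (Cons x xs)
  have "is_wheel V E c (xs @ (ys @ [x]))" using is_wheel_rotate1[of V E c x "xs @ ys"] Cons.prems by simp
  then show ?case using Cons.IH[of "ys @ [x]"] by simp
qed simp

lemma is_wheel_rev:
  assumes "is_wheel V E c vs" shows "is_wheel V E c (rev vs)"
proof -
  have "vs \<noteq> []" using assms unfolding is_wheel_def by auto
  then have "symc (pe (rev vs) \<union> {(last (rev vs), hd (rev vs))} \<union> {c} \<times> set (rev vs)) =
      symc (pe vs \<union> {(last vs, hd vs)} \<union> {c} \<times> set vs)"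
    by (intro symc_eqI) (auto simp: pe_rev last_rev hd_rev)
  then show ?thesis using assms unfolding is_wheel_def by simp
qed

text \<open>If \<open>Os\<close> and \<open>As\<close> are empty and the hubs are adjacent,
  \<open>a\<close> is just a rim vertex between \<open>q\<close> and \<open>p\<close>. The rotations
  of the rim are invisible in a description with two hubs, hence the separate notion.\<close>

lemma is_wheel_iff_fam:
  "is_wheel V E b (a # p # Bs @ [q]) \<longleftrightarrow> is_fam V E a b p Bs [] [] q True"
proof -
  have "symc (pe (a # p # Bs @ [q]) \<union> {(last (a # p # Bs @ [q]), hd (a # p # Bs @ [q]))} \<union> {b} \<times> set (a # p # Bs @ [q])) =
    symc (famR a b p Bs [] [] q True)"
    unfolding famR_def by (intro symc_eqI) auto
  then show ?thesis unfolding is_wheel_def is_fam_def by auto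
qed

lemma is_wheel_Fam:
  assumes "is_wheel V E c vs" shows "Fam V E"
proof -
  have l: "length vs \<ge> 3" using assms unfolding is_wheel_def by simp
  then obtain a p ws where 1: "vs = a # p # ws" "ws \<noteq> []"
    by (cases vs; cases "tl vs"; cases "tl (tl vs)") auto
  then have "vs = a # p # butlast ws @ [last ws]" by simp
  then show ?thesis using assms is_wheel_iff_fam unfolding Fam_def by metis
qed

lemma is_fam_finite_sym:
  "is_fam V E a b p Bs Os As q ab \<Longrightarrow> finite V \<and> finite E \<and> sym E"
  unfolding is_fam_def famR_def by auto

lemma is_fam_facts:
  assumes "is_fam V E a b p Bs Os As q ab"
  shows "pe (p # Bs @ Os @ As @ [q]) \<subseteq> E" "y \<in> set (p # Os @ As @ [q]) \<Longrightarrow> (a, y) \<in> E"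
    "y \<in> set (p # Bs @ Os @ [q]) \<Longrightarrow> (b, y) \<in> E" "ab \<Longrightarrow> (a, b) \<in> E" "sym E" "finite E"
    "distinct (a # b # p # Bs @ Os @ As @ [q])" "V = set (a # b # p # Bs @ Os @ As @ [q])" "length Os \<le> 1"
proof -
  have E: "E = symc (famR a b p Bs Os As q ab)" using assms unfolding is_fam_def by blast
  show "pe (p # Bs @ Os @ As @ [q]) \<subseteq> E" unfolding E famR_def symc_def by blast
  show "y \<in> set (p # Os @ As @ [q]) \<Longrightarrow> (a, y) \<in> E" unfolding E famR_def symc_def by blast
  show "y \<in> set (p # Bs @ Os @ [q]) \<Longrightarrow> (b, y) \<in> E" unfolding E famR_def symc_def by blast
  show "ab \<Longrightarrow> (a, b) \<in> E" unfolding E famR_def symc_def by simp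
  show "sym E" "finite E" using is_fam_finite_sym[OF assms] by blast+
  show "distinct (a # b # p # Bs @ Os @ As @ [q])" "V = set (a # b # p # Bs @ Os @ As @ [q])" "length Os \<le> 1"
    using assms unfolding is_fam_def by blast+
qed

section \<open>Insertions that stay in the family or create the minor\<close>

lemma dbl_edges:
  "(y, z) \<in> E \<Longrightarrow> {y, z} \<noteq> {p, s} \<Longrightarrow> (y, z) \<in> dbl E p x d s"
  "(x, p) \<in> dbl E p x d s" "(x, d) \<in> dbl E p x d s" "(x, s) \<in> dbl E p x d s"
  "(p, x) \<in> dbl E p x d s" "(d, x) \<in> dbl E p x d s" "(s, x) \<in> dbl E p x d s"
  by (auto simp: dbl_def)

lemma pe_dbl: "pe xs \<subseteq> E \<Longrightarrow> p \<notin> set xs \<or> s \<notin> set xs \<Longrightarrow> pe xs \<subseteq> dbl E p x d s"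
  by (auto simp: dbl_def dest: pe_set)

lemma dbl_sym_finite: "sym E \<Longrightarrow> finite E \<Longrightarrow> sym (dbl E p x d s) \<and> finite (dbl E p x d s)"
  by (auto simp: dbl_def sym_def)

text \<open>Isolates the path edge after \<open>v\<close>, the one that disappears when a vertex is
  inserted there.\<close>

lemma famR_split:
  "famR a b p (Bs1 @ v # Bs2) Os As q ab = insert (v, hd (Bs2 @ Os @ As @ [q]))
     (pe (p # Bs1 @ [v]) \<union> pe (Bs2 @ Os @ As @ [q]) \<union> {a} \<times> set (p # Os @ As @ [q]) \<union>
     {b} \<times> set (p # (Bs1 @ v # Bs2) @ Os @ [q]) \<union> (if ab then {(a, b)} else {}))"
proof -
  have "pe (v # Bs2 @ Os @ As @ [q]) = insert (v, hd (Bs2 @ Os @ As @ [q])) (pe (Bs2 @ Os @ As @ [q]))"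
    by (cases "Bs2 @ Os @ As @ [q]") auto
  then show ?thesis using pe_append[of "p # Bs1" v "Bs2 @ Os @ As @ [q]"] unfolding famR_def by auto
qed

text \<open>The new vertex subdivides the path after \<open>v\<close> and sees the hub
  \<open>b\<close>, so it is one more member of \<open>Bs\<close>.\<close>

lemma is_fam_dbl_path:
  assumes "is_fam V E a b p (Bs1 @ v # Bs2) Os As q ab" "x \<notin> V"
  shows "is_fam (insert x V) (dbl E v x b (hd (Bs2 @ Os @ As @ [q]))) a b p (Bs1 @ v # x # Bs2) Os As q ab"
proof -
  define T where "T = Bs2 @ Os @ As @ [q]"
  define R where "R = pe (p # Bs1 @ [v]) \<union> pe T \<union> {a} \<times> set (p # Os @ As @ [q]) \<union>
     {b} \<times> set (p # (Bs1 @ v # Bs2) @ Os @ [q]) \<union> (if ab then {(a, b)} else {})"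
  note f = is_fam_facts[OF assms(1)]
  have E: "E = symc (insert (v, hd T) R)"
    using assms(1) unfolding is_fam_def famR_split R_def T_def by blast
  have d: "distinct (a # b # p # Bs1 @ v # T)" using f(7) unfolding T_def by simp
  have hT: "hd T \<in> set T" unfolding T_def by (metis Nil_is_append_conv hd_in_set list.distinct(1))
  have n: "(v, hd T) \<notin> R" "(hd T, v) \<notin> R"
    using d hT pe_set[of v "hd T" "p # Bs1 @ [v]"] pe_set[of "hd T" v "p # Bs1 @ [v]"]
      pe_set[of v "hd T" T] pe_set[of "hd T" v T] unfolding R_def by (auto split: if_splits)
  have "dbl E v x b (hd T) = symc (R \<union> {(x, v), (x, b), (x, hd T)})"
    unfolding E by (rule dbl_symc[OF n])
  also have "\<dots> = symc (famR a b p (Bs1 @ v # x # Bs2) Os As q ab)"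
  proof (rule symc_eqI)
    have 1: "famR a b p (Bs1 @ v # x # Bs2) Os As q ab = insert (x, hd T) (insert (v, x) R \<union> {(b, x)})"
      using famR_split[of a b p "Bs1 @ [v]" x Bs2 Os As q ab] pe_append_edge[of "p # Bs1" v x]
      unfolding R_def T_def by auto
    show "R \<union> {(x, v), (x, b), (x, hd T)} \<subseteq> symc (famR a b p (Bs1 @ v # x # Bs2) Os As q ab)"
      unfolding 1 by (auto simp: symc_def)
    show "famR a b p (Bs1 @ v # x # Bs2) Os As q ab \<subseteq> symc (R \<union> {(x, v), (x, b), (x, hd T)})"
      unfolding 1 by (auto simp: symc_def)
  qed
  finally show ?thesis using assms f(7-9) unfolding is_fam_def T_def by auto
qed

lemma is_fam_dbl_first:
  assumes "is_fam V E a b p Bs Os As q ab" "x \<notin> V"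
  shows "is_fam (insert x V) (dbl E p x b (hd (Bs @ Os @ As @ [q]))) a b p (x # Bs) Os As q ab"
proof -
  define T where "T = Bs @ Os @ As @ [q]"
  define R where "R = pe T \<union> {a} \<times> set (p # Os @ As @ [q]) \<union>
     {b} \<times> set (p # Bs @ Os @ [q]) \<union> (if ab then {(a, b)} else {})"
  note f = is_fam_facts[OF assms(1)]
  have ne: "T \<noteq> []" unfolding T_def by simp
  have peT: "pe (y # T) = insert (y, hd T) (pe T)" for y using ne by (cases T) auto
  have E: "E = symc (insert (p, hd T) R)"
    using assms(1) peT[of p] unfolding is_fam_def famR_def R_def T_def by auto
  have d: "distinct (a # b # p # T)" using f(7) unfolding T_def by simp
  have hT: "hd T \<in> set T" using ne by (rule hd_in_set)
  have n: "(p, hd T) \<notin> R" "(hd T, p) \<notin> R"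
    using d hT pe_set[of p "hd T" T] pe_set[of "hd T" p T] unfolding R_def by (auto split: if_splits)
  have "dbl E p x b (hd T) = symc (R \<union> {(x, p), (x, b), (x, hd T)})"
    unfolding E by (rule dbl_symc[OF n])
  also have "\<dots> = symc (famR a b p (x # Bs) Os As q ab)"
  proof (rule symc_eqI)
    have 1: "famR a b p (x # Bs) Os As q ab = insert (x, hd T) (insert (p, x) R \<union> {(b, x)})"
      using peT[of x] unfolding R_def T_def famR_def by auto
    show "R \<union> {(x, p), (x, b), (x, hd T)} \<subseteq> symc (famR a b p (x # Bs) Os As q ab)"
      unfolding 1 by (auto simp: symc_def)
    show "famR a b p (x # Bs) Os As q ab \<subseteq> symc (R \<union> {(x, p), (x, b), (x, hd T)})"
      unfolding 1 by (auto simp: symc_def)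
  qed
  finally show ?thesis using assms f(7-9) unfolding is_fam_def T_def by auto
qed

text \<open>The first path vertex \<open>f\<close> after \<open>Bs\<close> sees \<open>a\<close>.
  The path falls into the part before \<open>v\<close>, the part \<open>?D\<close> from the
  successor of \<open>v\<close> up to \<open>f\<close>, and the rest \<open>?Q\<close>, as
  \<open>K24_cert_next_hub\<close> requires.\<close>

lemma K24_dbl_next_hub:
  assumes "is_fam V E a b p (Bs1 @ v # Bs2) Os As q ab" "x \<notin> V" "Os @ As \<noteq> []"
  shows "K24 (dbl E v x (hd (Bs2 @ Os @ As @ [q])) b)"
proof -
  obtain f R where fR: "Os @ As = f # R" using assms(3) by (cases "Os @ As") auto
  note F = is_fam_facts[OF assms(1)]
  let ?D = "Bs2 @ [f]" and ?Q = "R @ [q]"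
  have h: "hd (Bs2 @ Os @ As @ [q]) = hd ?D" using fR by (metis append.assoc append_Cons append_Nil hd_append2 list.sel(1) hd_append)
  have path: "pe ((p # Bs1) @ [v] @ ?D @ ?Q) \<subseteq> E"
    using F(1) fR by (metis append.assoc append_Cons append_Nil)
  have dist: "distinct (a # b # (p # Bs1) @ [v] @ ?D @ ?Q)"
    using F(7) fR by (metis append.assoc append_Cons append_Nil)
  have V: "set ((p # Bs1) @ [v] @ ?D @ ?Q) \<subseteq> V" "a \<in> V" "b \<in> V" using F(8) fR
    by (auto simp flip: append_assoc)
  have aD: "(a, f) \<in> E" using F(2)[of f] fR by (metis UnI1 append.assoc list.set_intros(1) list.set_intros(2) set_append)
  note p1 = pe_subset_append1[OF path] pe_subset_append2[OF path]
  have p: "pe (p # Bs1) \<subseteq> E" "pe ?D \<subseteq> E" "pe ?Q \<subseteq> E" "(last (p # Bs1), v) \<in> E" "(v, hd ?D) \<in> E" "(last ?D, hd ?Q) \<in> E"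
    using p1 pe_subset_append2[OF p1(2)] pe_subset_append1[OF pe_subset_append2[OF p1(2)]]
      pe_subset_append2[OF pe_subset_append2[OF p1(2)]] pe_last_hd[OF path] pe_last_hd[OF p1(2)]
      pe_last_hd[OF pe_subset_append2[OF p1(2)]] by (auto simp: hd_append)
  have ne: "a \<noteq> b" "a \<noteq> v" "b \<noteq> v" "p \<noteq> v" "p \<noteq> b" "f \<noteq> v" "f \<noteq> b" "q \<noteq> v" "q \<noteq> b"
     "b \<notin> set (p # Bs1)" "b \<notin> set ?D" "b \<notin> set ?Q" "v \<notin> set (p # Bs1)" "v \<notin> set ?D"
    using dist by auto
  have l: "last (p # Bs1) \<in> set (p # Bs1)" "hd ?D \<in> set ?D" "hd ?Q \<in> set ?Q"
    by (rule last_in_set, simp, intro hd_in_set, simp, intro hd_in_set, simp)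
  have ne2: "last (p # Bs1) \<noteq> b" "hd ?D \<noteq> b" "hd ?Q \<noteq> b" using ne l by metis+
  have x: "x \<notin> set (a # b # (p # Bs1) @ [v] @ ?D @ ?Q)" using assms(2) V by auto
  let ?E = "dbl E v x (hd ?D) b"
  have keep: "(y, z) \<in> ?E" if "(y, z) \<in> E" "y \<noteq> b \<and> z \<noteq> b \<or> y \<noteq> v \<and> z \<noteq> v" for y z
    using that by (auto simp: dbl_def)
  show ?thesis
    unfolding h
  proof (rule K24_cert_next_hub[where a = a and b = b and P = "p # Bs1" and v = v and x = x and D = ?D and Q = ?Q])
    show "sym ?E" "finite ?E" using dbl_sym_finite[OF F(5,6)] by blast+
    show "distinct (concat [[a], [b], p # Bs1, [v], [x], ?D, ?Q])" using dist x by auto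
    show "pe (p # Bs1) \<subseteq> ?E" "pe ?D \<subseteq> ?E" "pe ?Q \<subseteq> ?E" by (rule pe_dbl; use p ne in blast)+
    show "\<exists>y\<in>set (p # Bs1). (a, y) \<in> ?E" "\<exists>y\<in>set (p # Bs1). (b, y) \<in> ?E"
      using keep[of a p] keep[of b p] F(2,3)[of p] ne by auto
    show "(last (p # Bs1), v) \<in> ?E" "(v, hd ?D) \<in> ?E" "(last ?D, hd ?Q) \<in> ?E" "\<exists>y\<in>set ?D. (a, y) \<in> ?E"
      using keep p(4-6) ne ne2 aD by auto
    show "(v, x) \<in> ?E" "(x, hd ?D) \<in> ?E" "(x, b) \<in> ?E" by (rule dbl_edges)+
    show "\<exists>y\<in>set ?Q. (a, y) \<in> ?E" "\<exists>y\<in>set ?Q. (b, y) \<in> ?E"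
      using keep[of a q] keep[of b q] F(2,3)[of q] ne by auto
  qed simp_all
qed

lemma path_split:
  assumes "pe (xs @ ys) \<subseteq> E" "xs \<noteq> []" "ys \<noteq> []"
  shows "pe xs \<subseteq> E" "pe ys \<subseteq> E" "(last xs, hd ys) \<in> E"
  using pe_subset_append1[OF assms(1)] pe_subset_append2[OF assms(1)] pe_last_hd[OF assms] by auto

text \<open>The minor depends on whether the predecessor of \<open>v\<close> is the end
  \<open>p\<close>, and if so, on whether the hubs are adjacent and whether the successor of
  \<open>v\<close> is still in \<open>Bs\<close>; the four cases correspond to the four certificates
  \<open>K24_cert_prev_next_1\<close> to \<open>K24_cert_prev_next_4\<close>.\<close>

lemma K24_dbl_prev_next:
  assumes "is_fam V E a b p (Bs1 @ v # Bs2) Os As q ab" "x \<notin> V" "Os @ As \<noteq> []" "card V \<ge> 7"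
  shows "K24 (dbl E v x (last (p # Bs1)) (hd (Bs2 @ Os @ As @ [q])))"
proof -
  obtain f R where fR: "Os @ As = f # R" using assms(3) by (cases "Os @ As") auto
  note F = is_fam_facts[OF assms(1)]
  let ?D = "Bs2 @ [f]" and ?Q = "R @ [q]" and ?u = "last (p # Bs1)"
  have h: "hd (Bs2 @ Os @ As @ [q]) = hd ?D" using fR by (metis append.assoc append_Cons append_Nil hd_append2 list.sel(1) hd_append)
  have path: "pe ((p # Bs1) @ [v] @ ?D @ ?Q) \<subseteq> E"
    using F(1) fR by (metis append.assoc append_Cons append_Nil)
  have dist: "distinct (a # b # (p # Bs1) @ [v] @ ?D @ ?Q)"
    using F(7) fR by (metis append.assoc append_Cons append_Nil)
  have Vs: "V = set (a # b # (p # Bs1) @ [v] @ ?D @ ?Q)" using F(8) fR by (metis append.assoc append_Cons append_Nil)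
  have aD: "(a, f) \<in> E" using F(2)[of f] fR by (metis UnI1 append.assoc list.set_intros(1) list.set_intros(2) set_append)
  have aR: "(a, y) \<in> E" if "y \<in> set R" for y
  proof -
    have "y \<in> set (Os @ As)" using that fR by simp
    then show ?thesis using F(2)[of y] by auto
  qed
  note s1 = path_split[OF path]
  note s2 = path_split[OF s1(2)]
  note s3 = path_split[OF s2(2)]
  have p: "pe (p # Bs1) \<subseteq> E" "pe ?D \<subseteq> E" "pe ?Q \<subseteq> E" "(?u, v) \<in> E" "(v, hd ?D) \<in> E" "(last ?D, hd ?Q) \<in> E"
    using s1 s2 s3 by (auto simp: hd_append)
  have ne: "a \<noteq> b" "a \<noteq> v" "b \<noteq> v" "p \<noteq> v" "p \<noteq> b" "f \<noteq> v" "f \<noteq> b" "q \<noteq> v" "q \<noteq> b" "p \<notin> set ?D" "q \<notin> set ?D"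
     "v \<notin> set (p # Bs1)" "v \<notin> set ?D" "v \<notin> set ?Q" "a \<notin> set ?D" "b \<notin> set ?D" "set (p # Bs1) \<inter> set ?D = {}" "set ?Q \<inter> set ?D = {}"
    using dist by auto
  have l: "?u \<in> set (p # Bs1)" "hd ?D \<in> set ?D" "hd ?Q \<in> set ?Q"
    by (rule last_in_set, simp, intro hd_in_set, simp, intro hd_in_set, simp)
  have "hd ?D \<noteq> a" "hd ?D \<noteq> b" "hd ?D \<noteq> p" "hd ?D \<noteq> q" "?u \<noteq> v"
    using ne l by metis+
  moreover have "hd ?D \<noteq> v" "v \<noteq> hd ?D" using l(2) ne(13) by metis+
  moreover have "hd ?Q \<noteq> v" using l(3) ne(14) by metis
  moreover have "?u \<noteq> hd ?D" using l ne(17) by (metis disjoint_iff)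
  moreover have "hd ?Q \<noteq> hd ?D" using l ne(18) by (metis disjoint_iff)
  ultimately have ne2: "hd ?D \<noteq> a" "hd ?D \<noteq> b" "hd ?D \<noteq> p" "hd ?D \<noteq> q" "?u \<noteq> v" "?u \<noteq> hd ?D" "hd ?Q \<noteq> v" "hd ?Q \<noteq> hd ?D" "hd ?D \<noteq> v" "v \<noteq> hd ?D"
    by blast+
  have x: "x \<notin> set (a # b # (p # Bs1) @ [v] @ ?D @ ?Q)" using assms(2) Vs by auto
  let ?E = "dbl E v x ?u (hd ?D)"
  have keep: "(y, z) \<in> ?E" if "(y, z) \<in> E" "y \<noteq> v \<and> z \<noteq> v \<or> y \<noteq> hd ?D \<and> z \<noteq> hd ?D" for y z
    using that by (auto simp: dbl_def)
  have sf: "sym ?E" "finite ?E" using dbl_sym_finite[OF F(5,6)] by blast+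
  have sy: "(y, z) \<in> E \<Longrightarrow> (z, y) \<in> E" for y z using F(5) by (meson symD)
  have bv: "(v, b) \<in> ?E" using keep[of v b] sy[OF F(3)[of v]] ne ne2 by auto
  have xe: "(v, x) \<in> ?E" "(?u, x) \<in> ?E" "(x, hd ?D) \<in> ?E" by (rule dbl_edges)+
  have uv: "(?u, v) \<in> ?E" using keep[OF p(4)] ne2 by blast
  have pQ: "pe ?D \<subseteq> ?E" "pe ?Q \<subseteq> ?E" "pe (p # Bs1) \<subseteq> ?E" by (rule pe_dbl; use p ne in blast)+
  have aq: "(a, q) \<in> ?E" "(b, q) \<in> ?E" "(a, p) \<in> ?E" "(b, p) \<in> ?E" "(a, f) \<in> ?E"
    using keep F(2,3)[of q] F(2,3)[of p] aD ne ne2 by auto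
  have dq: "(last ?D, hd ?Q) \<in> ?E" using keep[OF p(6)] ne ne2 by auto
  show ?thesis
    unfolding h
  proof (cases "Bs1 = []")
    case False
    have split: "p # Bs1 = (p # butlast Bs1) @ [?u]" using False by simp
    have path1: "pe ((p # butlast Bs1) @ [?u]) \<subseteq> E" using p(1) split by metis
    note q1 = path_split[OF path1]
    have "set (p # butlast Bs1) \<subseteq> set (p # Bs1)" by (auto dest: in_set_butlastD)
    then have vn: "v \<notin> set (p # butlast Bs1)" using ne by blast
    have ub: "(?u, b) \<in> ?E" using keep[of ?u b] sy[OF F(3)[of ?u]] False ne ne2 by auto
    have "last (p # butlast Bs1) \<in> set (p # butlast Bs1)" by (rule last_in_set) simp
    then have vn2: "last (p # butlast Bs1) \<noteq> v" using vn by metis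
    show "K24 ?E"
    proof (rule K24_cert_prev_next_1[where a = a and b = b and P = "p # butlast Bs1" and u = ?u and v = v and x = x and D = ?D and Q = ?Q])
      have "distinct (a # b # ((p # butlast Bs1) @ [?u]) @ [v] @ ?D @ ?Q)" "x \<notin> set (a # b # ((p # butlast Bs1) @ [?u]) @ [v] @ ?D @ ?Q)"
        using dist x split by metis+
      then show "distinct (concat [[a], [b], p # butlast Bs1, [?u], [v], [x], ?D, ?Q])" by auto
      show "pe (p # butlast Bs1) \<subseteq> ?E" by (rule pe_dbl) (use q1 vn in auto)
      show "\<exists>y\<in>set (p # butlast Bs1). (a, y) \<in> ?E" "\<exists>y\<in>set (p # butlast Bs1). (b, y) \<in> ?E" using aq by auto
      show "(last (p # butlast Bs1), ?u) \<in> ?E" using keep[of "last (p # butlast Bs1)" ?u] q1(3) ne2 vn2 by auto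
    qed (use sf pQ aq dq ub bv xe uv in auto)
  next
    case True
    then have u: "?u = p" by simp
    show "K24 ?E"
    proof (cases ab)
      case True
      then have "(a, b) \<in> ?E" using keep F(4) ne by blast
      then show ?thesis
        by - (rule K24_cert_prev_next_2[where a = a and b = b and p = p and v = v and x = x and D = ?D and Q = ?Q];
          (use sf pQ aq dq bv xe uv u dist x \<open>Bs1 = []\<close> in auto))
    next
      case nab: False
      show ?thesis
      proof (cases "Bs2 = []")
        case True
        \<comment> \<open>Otherwise the graph has only the six vertices \<open>a\<close>,
          \<open>b\<close>, \<open>p\<close>, \<open>v\<close>, \<open>f\<close>, \<open>q\<close>.
          This is where seven vertices are needed.\<close>
        have "R \<noteq> []"
        proof
          assume "R = []"
          then have "V = set [a, b, p, v, f, q]" using Vs True \<open>Bs1 = []\<close> by auto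
          then have "card V \<le> length [a, b, p, v, f, q]" using card_length by metis
          then show False using assms(4) by simp
        qed
        then obtain r R' where R: "R = r # R'" by (cases R) auto
        have pathQ: "pe (R @ [q]) \<subseteq> E" by (rule p(3))
        note w = path_split[OF pathQ \<open>R \<noteq> []\<close>]
        have ra: "(a, r) \<in> ?E" using keep[of a r] aR[of r] R ne ne2 True dist by auto
        have "last R \<in> set R" using \<open>R \<noteq> []\<close> by (rule last_in_set)
        then have lr: "last R \<noteq> v" "last R \<noteq> f" using dist by auto
        have rq: "(last R, q) \<in> ?E" using keep[of "last R" q] w(3) lr ne by auto
        show ?thesis
          by (rule K24_cert_prev_next_4[where a = a and b = b and p = p and v = v and x = x and C = "[f]" and D = R and Q = "[q]"])
            (use sf aq dq bv xe uv u dist x \<open>Bs1 = []\<close> True ra rq R w ne pe_dbl[of R E v "hd ?D"] in \<open>auto\<close>)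
      next
        case False
        then obtain c C where Bs2: "Bs2 = c # C" by (cases Bs2) auto
        have path3: "pe (Bs2 @ (f # R) @ [q]) \<subseteq> E" using s2(2) by simp
        note w1 = path_split[OF path3 False]
        have w2: "pe (f # R) \<subseteq> E" "(last (f # R), q) \<in> E" using path_split[of "f # R" "[q]"] w1(2) by auto
        have hc: "hd ?D = c" using Bs2 by simp
        have bc: "(b, c) \<in> ?E" using keep[of b c] F(3)[of c] Bs2 ne by auto
        have "last Bs2 \<in> set Bs2" using False by (rule last_in_set)
        then have lb: "last Bs2 \<noteq> v" "f \<noteq> v" using dist by auto
        have bf: "(last Bs2, f) \<in> ?E" using keep[of "last Bs2" f] w1(3) lb by auto
        have "last (f # R) \<in> set (f # R)" by (rule last_in_set) simp
        then have "last (f # R) \<noteq> v" using dist by auto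
        then have rq: "(last (f # R), q) \<in> ?E" using keep[of "last (f # R)" q] w2(2) ne by auto
        have pp: "pe Bs2 \<subseteq> ?E" "pe (f # R) \<subseteq> ?E" by (rule pe_dbl; use w1 w2 dist in auto)+
        show ?thesis
          by (rule K24_cert_prev_next_3[where a = a and b = b and p = p and v = v and x = x and C = Bs2 and D = "f # R" and Q = "[q]"])
            (use sf aq bv xe uv u dist x \<open>Bs1 = []\<close> bc bf rq hc Bs2 pp in \<open>auto\<close>)
      qed
    qed
  qed
qed

text \<open>The inner path is cut into a part \<open>C\<close> that sees \<open>b\<close> and a
  later part \<open>D\<close> that sees \<open>a\<close>; \<open>q\<close> sees both hubs and is the
  last segment of \<open>K24_cert_first_hub_next\<close>.\<close>

lemma K24_dbl_first_hub_next:
  assumes "is_fam V E a b p Bs Os As q ab" "x \<notin> V" "Bs @ Os @ As = C @ D" "C \<noteq> []" "D \<noteq> []"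
    "\<exists>c\<in>set C. (b, c) \<in> E" "\<exists>c\<in>set D. (a, c) \<in> E"
  shows "K24 (dbl E p x a (hd (Bs @ Os @ As @ [q])))"
proof -
  note F = is_fam_facts[OF assms(1)]
  have T: "Bs @ Os @ As @ [q] = C @ D @ [q]" using assms(3) by (metis append.assoc)
  have h: "hd (Bs @ Os @ As @ [q]) = hd C" unfolding T using assms(4) by simp
  let ?E = "dbl E p x a (hd C)"
  have path: "pe ([p] @ C @ D @ [q]) \<subseteq> E" using F(1) T by simp
  have dist: "distinct (a # b # p # C @ D @ [q])" using F(7) unfolding T .
  have V: "V = set (a # b # p # C @ D @ [q])" using F(8) unfolding T .
  note s1 = path_split[OF path] 
  have s2: "pe C \<subseteq> E" "pe D \<subseteq> E" "(last C, hd D) \<in> E" "(last D, q) \<in> E"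
    using path_split[OF s1(2)] path_split[of D "[q]" E] assms(4,5) by (auto simp: hd_append)
  have l: "hd C \<in> set C" "last C \<in> set C" "hd D \<in> set D" "last D \<in> set D" using assms(4,5) by auto
  have ne: "p \<notin> set C" "p \<notin> set D" "p \<noteq> q" "a \<noteq> p" "b \<noteq> p" "last C \<noteq> p" "hd D \<noteq> p" "last D \<noteq> p" "hd C \<noteq> a" "hd C \<noteq> b" "hd C \<noteq> p"
    using dist l by auto
  have keep: "(y, z) \<in> ?E" if "(y, z) \<in> E" "y \<noteq> p \<and> z \<noteq> p \<or> y \<noteq> hd C \<and> z \<noteq> hd C" for y z
    using that by (auto simp: dbl_def)
  have k: "\<exists>c\<in>set C. (b, c) \<in> ?E" "\<exists>c\<in>set D. (a, c) \<in> ?E" "(last C, hd D) \<in> ?E" "(last D, q) \<in> ?E"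
    using keep assms(6,7) s2(3,4) ne by blast+
  have aq: "(a, q) \<in> ?E" "(b, q) \<in> ?E" "(a, p) \<in> ?E" "(b, p) \<in> ?E"
    using keep F(2,3)[of q] F(2,3)[of p] ne by auto
  have pp: "pe C \<subseteq> ?E" "pe D \<subseteq> ?E" by (rule pe_dbl; use s2 ne in blast)+
  have sf: "sym ?E" "finite ?E" using dbl_sym_finite[OF F(5,6)] by blast+
  have xe: "(p, x) \<in> ?E" "(x, a) \<in> ?E" "(x, hd C) \<in> ?E" by (rule dbl_edges)+
  have x: "x \<notin> set (a # b # p # C @ D @ [q])" using assms(2) V by blast
  show ?thesis
    unfolding h
    by (rule K24_cert_first_hub_next[where a = a and b = b and p = p and x = x and C = C and D = D and Q = "[q]"])
      (use sf dist x pp assms(4,5) aq xe k in auto)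
qed

text \<open>The inner path is again cut into parts that see \<open>b\<close> and \<open>a\<close>,
  but its first vertex \<open>u\<close> is kept apart: \<open>x\<close> is joined to it, and it
  becomes a common neighbour of the large bags.\<close>

lemma K24_dbl_first_next_hub:
  assumes "is_fam V E a b p Bs Os As q ab" "x \<notin> V" "Bs @ Os @ As = u # C @ D" "C \<noteq> []" "D \<noteq> []"
    "(b, u) \<in> E" "\<exists>c\<in>set C. (b, c) \<in> E" "\<exists>c\<in>set D. (a, c) \<in> E"
  shows "K24 (dbl E p x u b)"
proof -
  note F = is_fam_facts[OF assms(1)]
  have T: "Bs @ Os @ As @ [q] = u # C @ D @ [q]" using assms(3) by (metis append.assoc append_Cons)
  let ?E = "dbl E p x u b"
  have path: "pe ([p, u] @ C @ D @ [q]) \<subseteq> E" using F(1) T by simp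
  have dist: "distinct (a # b # p # u # C @ D @ [q])" using F(7) unfolding T .
  have V: "V = set (a # b # p # u # C @ D @ [q])" using F(8) unfolding T .
  note s1 = path_split[OF path]
  have s2: "pe C \<subseteq> E" "pe D \<subseteq> E" "(u, hd C) \<in> E" "(last C, hd D) \<in> E" "(last D, q) \<in> E" "(p, u) \<in> E"
    using path_split[OF s1(2)] path_split[of D "[q]" E] assms(4,5) s1 by (auto simp: hd_append)
  have l: "hd C \<in> set C" "last C \<in> set C" "hd D \<in> set D" "last D \<in> set D" using assms(4,5) by auto
  have ne: "p \<notin> set C" "p \<notin> set D" "p \<noteq> q" "a \<noteq> p" "b \<noteq> p" "u \<noteq> p" "last C \<noteq> p" "hd D \<noteq> p" "last D \<noteq> p" "hd C \<noteq> a" "hd C \<noteq> b" "hd C \<noteq> p"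
     "a \<noteq> b" "u \<noteq> b"
    using dist l by auto
  have keep: "(y, z) \<in> ?E" if "(y, z) \<in> E" "y \<noteq> p \<and> z \<noteq> p \<or> y \<noteq> b \<and> z \<noteq> b" for y z
    using that by (auto simp: dbl_def)
  have sy: "(y, z) \<in> E \<Longrightarrow> (z, y) \<in> E" for y z using F(5) by (meson symD)
  have k: "\<exists>c\<in>set C. (b, c) \<in> ?E" "\<exists>c\<in>set D. (a, c) \<in> ?E" "(last C, hd D) \<in> ?E" "(last D, q) \<in> ?E"
     "(u, hd C) \<in> ?E" "(u, b) \<in> ?E" "(p, u) \<in> ?E"
    using keep assms(6-8) s2(3-6) ne sy[OF assms(6)] by blast+
  have aq: "(a, q) \<in> ?E" "(b, q) \<in> ?E" "(a, p) \<in> ?E"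
    using keep F(2,3)[of q] F(2)[of p] ne by auto
  have pp: "pe C \<subseteq> ?E" "pe D \<subseteq> ?E" by (rule pe_dbl; use s2 ne in blast)+
  have sf: "sym ?E" "finite ?E" using dbl_sym_finite[OF F(5,6)] by blast+
  have xe: "(p, x) \<in> ?E" "(x, u) \<in> ?E" "(x, b) \<in> ?E" by (rule dbl_edges)+
  have x: "x \<notin> set (a # b # p # u # C @ D @ [q])" using assms(2) V by blast
  show ?thesis
    by (rule K24_cert_first_next_hub[where a = a and b = b and p = p and x = x and u = u and C = C and D = D and Q = "[q]"])
      (use sf dist x pp assms(4,5) aq xe k in auto)
qed

text \<open>The result has hubs \<open>a\<close> and \<open>c\<close>: the path runs over
  \<open>p\<close>, \<open>x\<close>, \<open>b\<close>, \<open>q\<close> and backwards over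
  \<open>As\<close> to \<open>A\<close>, and \<open>b\<close>, which sees both new hubs, becomes the
  member of \<open>Os\<close>.\<close>

lemma dbl_end_overlap:
  assumes "is_fam V E a b p [] [c] (A # As) q True" "x \<notin> V"
  shows "is_fam (insert x V) (dbl E p x c b) a c p [x] [b] (q # rev As) A True"
proof -
  have *: "pe (q # rev As @ [A]) = (pe (A # As @ [q]))\<inverse>" using pe_rev[of "A # As @ [q]"] by simp
  define R where "R = insert (p, c) (pe (c # A # As @ [q])) \<union> {a} \<times> set (p # c # A # As @ [q]) \<union> {b} \<times> {c, q} \<union> {(a, b)}"
  have d: "distinct (a # b # p # c # A # As @ [q])" and V: "V = set (a # b # p # c # A # As @ [q])"
    using assms(1) unfolding is_fam_def by auto
  have E: "E = symc (famR a b p [] [c] (A # As) q True)" using assms(1) unfolding is_fam_def by blast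
  have 1: "symc (famR a b p [] [c] (A # As) q True) = symc (insert (p, b) R)"
    unfolding famR_def R_def by (intro symc_eqI) auto
  have n: "(p, b) \<notin> R" "(b, p) \<notin> R"
    using d pe_set[of p b "c # A # As @ [q]"] pe_set[of b p "c # A # As @ [q]"] unfolding R_def by auto
  have "dbl E p x c b = symc (R \<union> {(x, p), (x, c), (x, b)})"
    unfolding E by (rule dbl_symc'[OF 1 n])
  also have "\<dots> = symc (famR a c p [x] [b] (q # rev As) A True)"
    unfolding famR_def R_def by (intro symc_eqI) (auto simp: * )
  finally show ?thesis using d V assms(2) unfolding is_fam_def by auto
qed

text \<open>Again \<open>c\<close> replaces \<open>b\<close> as a hub. Whether \<open>b\<close> sees
  \<open>a\<close> decides if it enters \<open>Os\<close> or \<open>Bs\<close>; the new hubs are not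
  adjacent, because \<open>c\<close> was in \<open>Bs\<close>.\<close>

lemma dbl_end_single:
  assumes "is_fam V E a b p [c] [] (A # As) q ab" "x \<notin> V"
  shows "is_fam (insert x V) (dbl E p x c b) a c p (if ab then [x] else [x, b]) (if ab then [b] else []) (q # rev As) A False"
proof -
  have *: "pe (q # rev As @ [A]) = (pe (A # As @ [q]))\<inverse>" using pe_rev[of "A # As @ [q]"] by simp
  define R where "R = insert (p, c) (pe (c # A # As @ [q])) \<union> {a} \<times> set (p # A # As @ [q]) \<union> {b} \<times> {c, q} \<union> (if ab then {(a, b)} else {})"
  have d: "distinct (a # b # p # c # A # As @ [q])" and V: "V = set (a # b # p # c # A # As @ [q])"
    using assms(1) unfolding is_fam_def by auto
  have E: "E = symc (famR a b p [c] [] (A # As) q ab)" using assms(1) unfolding is_fam_def by blast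
  have 1: "symc (famR a b p [c] [] (A # As) q ab) = symc (insert (p, b) R)"
    unfolding famR_def R_def by (intro symc_eqI) auto
  have n: "(p, b) \<notin> R" "(b, p) \<notin> R"
    using d pe_set[of p b "c # A # As @ [q]"] pe_set[of b p "c # A # As @ [q]"] unfolding R_def by (auto split: if_splits)
  have "dbl E p x c b = symc (R \<union> {(x, p), (x, c), (x, b)})"
    unfolding E by (rule dbl_symc'[OF 1 n])
  also have "\<dots> = symc (famR a c p (if ab then [x] else [x, b]) (if ab then [b] else []) (q # rev As) A False)"
    unfolding famR_def R_def by (cases ab; intro symc_eqI) (auto simp: * )
  finally show ?thesis using d V assms(2) unfolding is_fam_def by auto
qed

lemma is_wheel_dbl:
  assumes "is_wheel V E c (v # w # vs)" "x \<notin> V"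
  shows "is_wheel (insert x V) (dbl E v x c w) c (v # x # w # vs)"
proof -
  define R where "R = pe (w # vs) \<union> {(last (w # vs), v)} \<union> {c} \<times> set (v # w # vs)"
  have d: "distinct (c # v # w # vs)" and V: "V = set (c # v # w # vs)" and l: "length vs \<ge> 1"
    and E: "E = symc (insert (v, w) R)"
    using assms(1) unfolding is_wheel_def R_def by auto
  have "last (w # vs) \<noteq> w" "last (w # vs) \<noteq> v" using d l last_in_set[of vs] by (cases vs; auto)+
  then have n: "(v, w) \<notin> R" "(w, v) \<notin> R"
    using d pe_set[of v w "w # vs"] pe_set[of w v "w # vs"] unfolding R_def by auto
  have "dbl E v x c w = symc (R \<union> {(x, v), (x, c), (x, w)})"
    unfolding E by (rule dbl_symc[OF n])
  also have "\<dots> = symc (pe (v # x # w # vs) \<union> {(last (v # x # w # vs), hd (v # x # w # vs))} \<union> {c} \<times> set (v # x # w # vs))"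
    unfolding R_def by (intro symc_eqI) auto
  finally show ?thesis using d V l assms(2) unfolding is_wheel_def by auto
qed

text \<open>When a spoke is subdivided, its rim vertex \<open>v\<close> can be read as the second
  hub: it sees \<open>x\<close> and its two rim neighbours \<open>w\<close> and \<open>u\<close>,
  which are the first two vertices and the last vertex of the path along the rest of the rim. Here
  \<open>w\<close> sees both hubs.\<close>

lemma is_fam_dbl_wheel:
  assumes "is_wheel V E c (v # w # vs @ [u])" "x \<notin> V"
  shows "is_fam (insert x V) (dbl E v x w c) c v x [] [w] vs u False"
proof -
  define R where "R = insert (v, w) (pe (w # vs @ [u])) \<union> {(u, v)} \<union> {c} \<times> set (w # vs @ [u])"
  have d: "distinct (c # v # w # vs @ [u])" and V: "V = set (c # v # w # vs @ [u])"
    and E: "E = symc (insert (c, v) R)"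
    using assms(1) unfolding is_wheel_def R_def by auto
  have E': "symc (insert (c, v) R) = symc (insert (v, c) R)" by (auto simp: symc_def)
  have n: "(v, c) \<notin> R" "(c, v) \<notin> R"
    using d pe_set[of v c "w # vs @ [u]"] pe_set[of c v "w # vs @ [u]"] unfolding R_def by auto
  have "dbl E v x w c = symc (R \<union> {(x, v), (x, w), (x, c)})"
    unfolding E by (rule dbl_symc'[OF E' n])
  also have "\<dots> = symc (famR c v x [] [w] vs u False)"
    unfolding R_def famR_def by (intro symc_eqI) auto
  finally show ?thesis using d V assms(2) unfolding is_fam_def by auto
qed

lemma is_fam_map:
  assumes "is_fam V E a b p Bs Os As q ab" "inj_on g V"
  shows "is_fam (g ` V) (map_prod g g ` E) (g a) (g b) (g p) (map g Bs) (map g Os) (map g As) (g q) ab"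
proof -
  have d: "distinct (a # b # p # Bs @ Os @ As @ [q])" and V: "V = set (a # b # p # Bs @ Os @ As @ [q])"
   and E: "E = symc (famR a b p Bs Os As q ab)"
    using assms(1) unfolding is_fam_def by auto
  have "distinct (map g (a # b # p # Bs @ Os @ As @ [q]))" using d assms(2) unfolding V distinct_map by blast
  moreover have "map_prod g g ` E = symc (famR (g a) (g b) (g p) (map g Bs) (map g Os) (map g As) (g q) ab)"
  proof -
    have 1: "map_prod g g ` symc R = symc (map_prod g g ` R)" for R :: "'a rel" by (auto simp: symc_def)
    have 2: "pe (g p # map g Bs @ map g Os @ map g As @ [g q]) = map_prod g g ` pe (p # Bs @ Os @ As @ [q])"
      using pe_map[of g "p # Bs @ Os @ As @ [q]"] by simp
    have 3: "map_prod g g ` ({y} \<times> set ys) = {g y} \<times> set (map g ys)" for y ys by auto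
    show ?thesis unfolding E 1 famR_def 2 image_Un 3 by simp
  qed
  ultimately show ?thesis using assms(1) V unfolding is_fam_def by auto
qed

lemma Fam_giso:
  assumes "giso V E W F" "Fam W F" "E \<subseteq> V \<times> V" "F \<subseteq> W \<times> W"
  shows "Fam V E"
proof -
  obtain f where f: "bij_betw f W V" "\<forall>u\<in>W. \<forall>v\<in>W. (u, v) \<in> F \<longleftrightarrow> (f u, f v) \<in> E"
    using giso_sym[OF assms(1)] unfolding giso_def by blast
  have V: "V = f ` W" and i: "inj_on f W" using f(1) by (auto simp: bij_betw_def)
  have "E = map_prod f f ` F"
  proof (intro equalityI subsetI)
    fix e assume e: "e \<in> E"
    then obtain u v where "e = (f u, f v)" "u \<in> W" "v \<in> W" using assms(3) V by blast
    then show "e \<in> map_prod f f ` F" using f(2) e by force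
  next
    fix e assume "e \<in> map_prod f f ` F"
    then obtain u v where "e = (f u, f v)" "(u, v) \<in> F" by auto
    then show "e \<in> E" using f(2) assms(4) by blast
  qed
  then show ?thesis using assms(2) is_fam_map[OF _ i] V unfolding Fam_def by metis
qed

definition K24_or_Fam :: "'a set \<Rightarrow> 'a rel \<Rightarrow> bool" where
  "K24_or_Fam V E \<longleftrightarrow> K24 E \<or> Fam V E"

lemma K24_or_Fam_giso:
  assumes "giso V E W F" "sgraph V E" "F \<subseteq> W \<times> W" "K24_or_Fam W F"
  shows "K24_or_Fam V E"
  using assms giso_K24[OF assms(1-3)] Fam_giso[OF assms(1) _ _ assms(3)]
  unfolding K24_or_Fam_def sgraph_def by blast

lemma sgraph_dbl:
  assumes "sgraph V E" "x \<notin> V" "p \<in> V" "d \<in> V" "s \<in> V"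
  shows "sgraph (insert x V) (dbl E p x d s)"
  using assms by (auto simp: sgraph_def dbl_def symc_def sym_def irrefl_def)

text \<open>The transposition of \<open>p\<close> and \<open>x\<close> maps one graph to the other:
  both vertices see \<open>d\<close> and each other, and of \<open>r\<close> and \<open>s\<close>
  one belongs to \<open>p\<close> and one to \<open>x\<close>. So for each \<open>d\<close> it is
  enough to treat one of the two edges that may be subdivided.\<close>

lemma dbl_swap:
  assumes "sgraph V E" "x \<notin> V" "E `` {p} = {d, r, s}" "d \<noteq> r" "d \<noteq> s" "r \<noteq> s"
    "K24_or_Fam (insert x V) (dbl E p x d r)"
  shows "K24_or_Fam (insert x V) (dbl E p x d s)"
proof -
  note S = sgraphD[OF assms(1)]
  have N: "(p, z) \<in> E \<longleftrightarrow> z = d \<or> z = r \<or> z = s" for z using assms(3) by auto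
  have N': "(z, p) \<in> E \<longleftrightarrow> z = d \<or> z = r \<or> z = s" for z using N S(4) by blast
  have V: "p \<in> V" "d \<in> V" "r \<in> V" "s \<in> V" using S(2,3) N by blast+
  have X: "(x, z) \<notin> E" "(z, x) \<notin> E" for z using S(2,3) assms(2) by blast+
  have ne: "p \<noteq> d" "p \<noteq> r" "p \<noteq> s" "x \<noteq> p" "x \<noteq> d" "x \<noteq> r" "x \<noteq> s" using S(5) N V assms(2) by blast+
  define f where "f = (\<lambda>z. if z = p then x else if z = x then p else z)"
  have fx: "f p = x" "f x = p" "\<And>z. z \<noteq> p \<Longrightarrow> z \<noteq> x \<Longrightarrow> f z = z" using ne unfolding f_def by auto
  have "giso (insert x V) (dbl E p x d s) (insert x V) (dbl E p x d r)"
    unfolding giso_def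
  proof (intro exI[of _ f] conjI ballI)
    have ff: "f (f z) = z" for z using ne(4) unfolding f_def by auto
    have "f ` insert x V \<subseteq> insert x V" using V unfolding f_def by auto
    then have m: "f z \<in> insert x V" if "z \<in> insert x V" for z using that by blast
    show "bij_betw f (insert x V) (insert x V)"
      by (rule bij_betw_byWitness[where f' = f]) (use ff m in auto)
    fix y z
    consider "y = p" | "y = x" | "y \<noteq> p" "y \<noteq> x" by blast
    then show "(y, z) \<in> dbl E p x d s \<longleftrightarrow> (f y, f z) \<in> dbl E p x d r"
    proof cases
      case 1
      then show ?thesis using ne assms(4-6) unfolding dbl_def f_def by (auto simp: N N' X)
    next
      case 2
      then show ?thesis using ne assms(4-6) unfolding dbl_def f_def by (auto simp: N N' X)
    next
      case 3
      then show ?thesis using ne assms(4-6) unfolding dbl_def f_def by (auto simp: N N' X)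
    qed
  qed
  moreover have "sgraph (insert x V) (dbl E p x d s)" "sgraph (insert x V) (dbl E p x d r)"
    using sgraph_dbl[OF assms(1,2)] V by blast+
  ultimately show ?thesis using K24_or_Fam_giso assms(7) unfolding sgraph_def by blast
qed

lemma card3_eq:
  assumes "card N = 3" "{u, w, b} \<subseteq> N" "u \<noteq> w" "u \<noteq> b" "w \<noteq> b"
  shows "N = {u, w, b}"
proof -
  have "finite N" using assms(1) by (metis card.infinite zero_neq_numeral)
  then have "{u, w, b} = N" by (rule card_subset_eq) (use assms in auto)
  then show ?thesis by simp
qed

text \<open>For each \<open>d\<close> the more convenient \<open>s\<close> is taken. Joining
  \<open>x\<close> to the hub extends the family; joining it to a neighbour on the path gives a
  minor.\<close>

lemma dbl_path_vertex:
  assumes "is_fam V E a b p (Bs1 @ v # Bs2) Os As q ab" "x \<notin> V" "Os @ As \<noteq> []" "card V \<ge> 7"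
    and "card (E `` {v}) = 3" "d \<in> E `` {v}"
  shows "\<exists>s\<in>E `` {v}. s \<noteq> d \<and> K24_or_Fam (insert x V) (dbl E v x d s)"
proof -
  note F = is_fam_facts[OF assms(1)]
  let ?T = "Bs2 @ Os @ As @ [q]" and ?u = "last (p # Bs1)"
  have sy: "(y, z) \<in> E \<Longrightarrow> (z, y) \<in> E" for y z using F(5) by (meson symD)
  have path: "pe ((p # Bs1) @ [v] @ ?T) \<subseteq> E" using F(1) by simp
  have "(?u, v) \<in> E" "pe ([v] @ ?T) \<subseteq> E" using path_split(2,3)[OF path] by simp_all
  moreover from this have "(v, hd ?T) \<in> E" using path_split(3)[of "[v]" ?T E] by simp
  moreover have "(b, v) \<in> E" using F(3)[of v] by simp
  ultimately have e: "(v, ?u) \<in> E" "(v, hd ?T) \<in> E" "(v, b) \<in> E" using sy by blast+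
  have l: "?u \<in> set (p # Bs1)" "hd ?T \<in> set ?T" by (rule last_in_set, simp, intro hd_in_set, simp)
  have "distinct (a # b # (p # Bs1) @ v # ?T)" using F(7) by simp
  then have ne: "?u \<noteq> hd ?T" "?u \<noteq> b" "hd ?T \<noteq> b" using l by (auto simp del: last.simps)
  have N: "E `` {v} = {?u, hd ?T, b}" by (rule card3_eq[OF assms(5) _ ne]) (use e in auto)
  then consider "d = ?u" | "d = hd ?T" | "d = b" using assms(6) by blast
  then show ?thesis
  proof cases
    case 1
    then show ?thesis using K24_dbl_prev_next[OF assms(1-4)] N ne unfolding K24_or_Fam_def by (intro bexI[of _ "hd ?T"]) auto
  next
    case 2
    then show ?thesis using K24_dbl_next_hub[OF assms(1-3)] N ne unfolding K24_or_Fam_def by (intro bexI[of _ b]) auto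
  next
    case 3
    then show ?thesis using is_fam_dbl_path[OF assms(1,2)] N ne unfolding K24_or_Fam_def Fam_def by (intro bexI[of _ "hd ?T"]) auto
  qed
qed

text \<open>Joining \<open>x\<close> to the hub gives a larger wheel, joining it to a rim neighbour
  a member in which \<open>v\<close> is a hub. For the other rim neighbour the rim is reversed and
  rotated first.\<close>

lemma dbl_wheel:
  assumes "is_wheel V E c (v # vs)" "x \<notin> V" "card (E `` {v}) = 3" "d \<in> E `` {v}"
  shows "\<exists>s\<in>E `` {v}. s \<noteq> d \<and> K24_or_Fam (insert x V) (dbl E v x d s)"
proof -
  have dist: "distinct (c # v # vs)" and len: "length vs \<ge> 2" and V: "V = set (c # v # vs)"
    and E: "E = symc (pe (v # vs) \<union> {(last (v # vs), v)} \<union> {c} \<times> set (v # vs))"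
    using assms(1) unfolding is_wheel_def by auto
  obtain w us where vs: "vs = w # us" "us \<noteq> []" using len by (cases vs; cases "tl vs") auto
  then obtain u ms where us: "vs = w # ms @ [u]" by (metis rev_exhaust)
  have ne: "u \<noteq> w" "u \<noteq> c" "w \<noteq> c" using dist us by auto
  have e: "{u, w, c} \<subseteq> E `` {v}" unfolding E us by auto
  have N: "E `` {v} = {u, w, c}" by (rule card3_eq[OF assms(3) e ne])
  then consider "d = u" | "d = w" | "d = c" using assms(4) by blast
  then show ?thesis
  proof cases
    case 1
    have "is_wheel V E c (rev vs @ [v])" using is_wheel_rev[OF assms(1)] by simp
    then have "is_wheel V E c (v # u # rev ms @ [w])" using is_wheel_rotate[of V E c "rev vs" "[v]"] us by simp
    from is_fam_dbl_wheel[OF this assms(2)] show ?thesis using 1 N ne unfolding K24_or_Fam_def Fam_def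
      by (intro bexI[of _ c]) auto
  next
    case 2
    have "is_wheel V E c (v # w # ms @ [u])" using assms(1) us by simp
    from is_fam_dbl_wheel[OF this assms(2)] show ?thesis using 2 N ne unfolding K24_or_Fam_def Fam_def
      by (intro bexI[of _ c]) auto
  next
    case 3
    have "is_wheel V E c (v # w # ms @ [u])" using assms(1) us by simp
    from is_wheel_Fam[OF is_wheel_dbl[OF this assms(2)]] show ?thesis using 3 N ne unfolding K24_or_Fam_def
      by (intro bexI[of _ w]) auto
  qed
qed

text \<open>Joining \<open>x\<close> to \<open>b\<close> extends \<open>Bs\<close>, joining it to
  \<open>a\<close> gives a minor. Joining it to the next path vertex gives a minor if at least two
  inner vertices see \<open>b\<close>, and otherwise a member with other hubs.\<close>

lemma dbl_end_vertex:
  assumes "is_fam V E a b p Bs Os As q ab" "x \<notin> V" "Bs @ Os \<noteq> []" "Os @ As \<noteq> []" "card V \<ge> 7"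
    and "card (E `` {p}) = 3" "d \<in> E `` {p}"
  shows "\<exists>s\<in>E `` {p}. s \<noteq> d \<and> K24_or_Fam (insert x V) (dbl E p x d s)"
proof -
  note F = is_fam_facts[OF assms(1)]
  let ?T = "Bs @ Os @ As @ [q]"
  have sy: "(y, z) \<in> E \<Longrightarrow> (z, y) \<in> E" for y z using F(5) by (meson symD)
  have path: "pe ([p] @ ?T) \<subseteq> E" using F(1) by simp
  have "(p, hd ?T) \<in> E" using path_split(3)[OF path] by simp
  moreover have "(a, p) \<in> E" "(b, p) \<in> E" using F(2,3)[of p] by simp_all
  ultimately have e: "(p, a) \<in> E" "(p, hd ?T) \<in> E" "(p, b) \<in> E" using sy by blast+
  have l: "hd ?T \<in> set ?T" by (intro hd_in_set) simp
  have ne: "a \<noteq> hd ?T" "a \<noteq> b" "hd ?T \<noteq> b" using l F(7) by auto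
  have N: "E `` {p} = {a, hd ?T, b}" by (rule card3_eq[OF assms(6) _ ne]) (use e in auto)
  have cV: "card V = 4 + length Bs + length Os + length As"
    using distinct_card[OF F(7)] F(8) by simp
  have O: "Os = [] \<or> (\<exists>c. Os = [c])" using F(9) by (cases Os) auto
  consider "d = a" | "d = hd ?T" | "d = b" using assms(7) N by blast
  then show ?thesis
  proof cases
    case 1
    have "K24 (dbl E p x a (hd ?T))"
    proof (cases "Bs = []")
      case True
      then obtain c where c: "Os = [c]" using O assms(3) by auto
      then have "As \<noteq> []" using cV assms(5) True by auto
      then show ?thesis
        by (intro K24_dbl_first_hub_next[OF assms(1,2), of "[c]" As])
          (use c True F(2)[of "hd As"] F(3)[of c] in \<open>auto intro!: bexI[of _ "hd As"]\<close>)
    next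
      case False
      have "hd (Os @ As) \<in> set (Os @ As)" using assms(4) by (rule hd_in_set)
      then show ?thesis
        by (intro K24_dbl_first_hub_next[OF assms(1,2), of Bs "Os @ As"])
          (use False assms(4) F(2)[of "hd (Os @ As)"] F(3)[of "hd Bs"] in
            \<open>auto intro: bexI[of _ "hd Bs"] bexI[of _ "hd (Os @ As)"]\<close>)
    qed
    then show ?thesis using 1 N ne unfolding K24_or_Fam_def by (intro bexI[of _ "hd ?T"]) auto
  next
    case 3
    then show ?thesis using is_fam_dbl_first[OF assms(1,2)] N ne unfolding K24_or_Fam_def Fam_def by (intro bexI[of _ "hd ?T"]) auto
  next
    case 2
    have "K24_or_Fam (insert x V) (dbl E p x (hd ?T) b)"
    proof (cases Bs)
      case Nil
      then obtain c where c: "Os = [c]" using O assms(3) by auto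
      then have "As \<noteq> []" using cV assms(5) Nil by auto
      then obtain A As' where As: "As = A # As'" by (cases As) auto
      show ?thesis
      proof (cases ab)
        case True
        then show ?thesis using dbl_end_overlap[of V E a b p c A As' q x] assms(1,2) c As Nil
          unfolding K24_or_Fam_def Fam_def by auto
      next
        case False
        then have "is_fam V E a c p [b] [] (q # rev As') A True"
          using is_fam_small_b[of V E a b p Bs Os A As' q ab c] assms(1) c As Nil by simp
        from is_fam_dbl_first[OF this assms(2)] show ?thesis using c Nil unfolding K24_or_Fam_def Fam_def by auto
      qed
    next
      case B: (Cons B Bs')
      show ?thesis
      proof (cases "Bs' = []")
        case True
        show ?thesis
        proof (cases "Os = []")
          case O: True
          then obtain A As' where As: "As = A # As'" using assms(4) by (cases As) auto
          then show ?thesis using dbl_end_single[of V E a b p B A As' q ab x] assms(1,2) B True O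
            unfolding K24_or_Fam_def Fam_def by auto
        next
          case False
          then obtain c where c: "Os = [c]" using O by auto
          then have "As \<noteq> []" using cV assms(5) B True by auto
          then have "K24 (dbl E p x B b)"
            by (intro K24_dbl_first_next_hub[OF assms(1,2), of B "[c]" As])
              (use c B True F(2)[of "hd As"] F(3)[of c] F(3)[of B] in \<open>auto intro!: bexI[of _ "hd As"]\<close>)
          then show ?thesis using B unfolding K24_or_Fam_def by simp
        qed
      next
        case False
        have "hd (Os @ As) \<in> set (Os @ As)" using assms(4) by (rule hd_in_set)
        then have "K24 (dbl E p x B b)"
          by (intro K24_dbl_first_next_hub[OF assms(1,2), of B Bs' "Os @ As"])
            (use B False assms(4) F(2)[of "hd (Os @ As)"] F(3)[of "hd Bs'"] F(3)[of B] in
              \<open>auto intro: bexI[of _ "hd Bs'"] bexI[of _ "hd (Os @ As)"]\<close>)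
        then show ?thesis using B unfolding K24_or_Fam_def by simp
      qed
    qed
    then show ?thesis using 2 N ne by (intro bexI[of _ b]) auto
  qed
qed

lemma dbl_half:
  assumes "is_fam V E a b p Bs Os As q ab" "x \<notin> V" "Bs @ Os \<noteq> []" "Os @ As \<noteq> []" "card V \<ge> 7"
    and "card (E `` {v}) = 3" "d \<in> E `` {v}" "v = b \<or> v = p \<or> v \<in> set Bs"
  shows "\<exists>s\<in>E `` {v}. s \<noteq> d \<and> K24_or_Fam (insert x V) (dbl E v x d s)"
proof -
  note F = is_fam_facts[OF assms(1)]
  have sy: "(y, z) \<in> E \<Longrightarrow> (z, y) \<in> E" for y z using F(5) by (meson symD)
  have cV: "card V = 4 + length Bs + length Os + length As"
    using distinct_card[OF F(7)] F(8) by simp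
  consider "v = p" | "v \<in> set Bs" | "v = b" using assms(8) by blast
  then show ?thesis
  proof cases
    case 1
    then show ?thesis using dbl_end_vertex[OF assms(1-5)] assms(6,7) by blast
  next
    case 2
    then obtain Bs1 Bs2 where "Bs = Bs1 @ v # Bs2" by (meson split_list)
    then show ?thesis using dbl_path_vertex[of V E a b p Bs1 v Bs2 Os As q ab x d] assms by blast
  next
    case 3
    let ?l = "p # Bs @ Os @ [q] @ (if ab then [a] else [])"
    have "set ?l \<subseteq> E `` {b}" using F(3) sy[OF F(4)] by (auto split: if_splits)
    moreover have "finite (E `` {b})" using F(6) by (rule finite_Image)
    ultimately have "card (set ?l) \<le> 3" using assms(6) 3 card_mono by metis
    moreover have "distinct ?l" using F(7) by (auto split: if_splits)
    ultimately have "length ?l \<le> 3" using distinct_card by metis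
    \<comment> \<open>Degree 3 leaves \<open>b\<close> at most one neighbour besides
      \<open>p\<close> and \<open>q\<close>. As \<open>Bs @ Os\<close> is nonempty, it is an inner
      vertex \<open>c\<close>, and \<open>is_fam_small_b\<close> turns \<open>b\<close> into a path
      vertex.\<close>
    then have "length Bs + length Os + (if ab then 1 else 0) \<le> 1" by (auto split: if_splits)
    then obtain c where c: "(Bs = [] \<and> Os = [c] \<and> \<not> ab) \<or> (Bs = [c] \<and> Os = [] \<and> \<not> ab)"
      using assms(3) by (cases Bs; cases Os) (auto split: if_splits)
    then have "As \<noteq> []" using cV assms(5) by auto
    then obtain A As' where As: "As = A # As'" by (cases As) auto
    have "is_fam V E a c p ([] @ b # []) [] (q # rev As') A (Bs = [])"
      using is_fam_small_b[of V E a b p Bs Os A As' q ab c] assms(1) c As by simp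
    from dbl_path_vertex[OF this assms(2)] show ?thesis using assms 3 by simp
  qed
qed

text \<open>A vertex of degree 3 is not in \<open>Os\<close>, whose members see four vertices, so up
  to reversal it belongs to the side of \<open>b\<close>. If one side of the description is missing,
  the graph is a wheel and is treated as such.\<close>

lemma dbl_main:
  assumes "sgraph V E" "Fam V E" "x \<notin> V" "card V \<ge> 7" "\<And>v. v \<in> V \<Longrightarrow> card (E `` {v}) \<ge> 3"
    and "card (E `` {v}) = 3" "d \<in> E `` {v}"
  shows "\<exists>s\<in>E `` {v}. s \<noteq> d \<and> K24_or_Fam (insert x V) (dbl E v x d s)"
proof -
  have vV: "v \<in> V" using sgraphD(2)[OF assms(1)] assms(7) by blast
  have wheel: ?thesis if w: "is_fam V E a b p Bs [] [] q ab" for a b p Bs q ab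
  proof -
    note F = is_fam_facts[OF w]
    \<comment> \<open>Otherwise \<open>a\<close> sees only \<open>p\<close> and \<open>q\<close>,
      against the degree condition.\<close>
    have ab
    proof (rule ccontr)
      assume nab: "\<not> ab"
      have "a \<notin> set (p # Bs @ [q])" using F(7) by auto
      then have "(a, y) \<notin> pe (p # Bs @ [q])" "(y, a) \<notin> pe (p # Bs @ [q])" for y
        using pe_set by metis+
      then have "E `` {a} \<subseteq> {p, q}"
        using w nab unfolding is_fam_def famR_def by auto
      then have "card (E `` {a}) \<le> card {p, q}" by (simp add: card_mono)
      then show False using assms(5)[of a] F(8) card_lt3(1)[of p q] by auto
    qed
    then have wh: "is_wheel V E b (a # p # Bs @ [q])" using w is_wheel_iff_fam by metis
    show ?thesis
    proof (cases "v = b")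
      case True
      have "set (a # p # Bs @ [q]) \<subseteq> E `` {b}" using wh unfolding is_wheel_def by auto
      moreover have "finite (E `` {b})" using F(6) by (rule finite_Image)
      ultimately have "card (set (a # p # Bs @ [q])) \<le> 3" using assms(6) True card_mono by metis
      moreover have "card (set (a # p # Bs @ [q])) = 3 + length Bs" using F(7) by (subst distinct_card) auto
      moreover have "card V = 4 + length Bs" using distinct_card[OF F(7)] F(8) by simp
      ultimately show ?thesis using assms(4) by simp
    next
      case False
      then have "v \<in> set (a # p # Bs @ [q])" using vV F(8) by auto
      then obtain X Y where "a # p # Bs @ [q] = X @ v # Y" by (meson split_list)
      then have "is_wheel V E b (v # Y @ X)" using is_wheel_rotate[of V E b X "v # Y"] wh by simp
      then show ?thesis using dbl_wheel assms(3,6,7) by metis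
    qed
  qed
  obtain a b p Bs Os As q ab where fam: "is_fam V E a b p Bs Os As q ab" using assms(2) unfolding Fam_def by blast
  note F = is_fam_facts[OF fam]
  note fam' = is_fam_rev[OF fam]
  show ?thesis
  proof (cases "Os @ As = [] \<or> Bs @ Os = []")
    case True
    then show ?thesis using wheel fam fam' by auto
  next
    case False
    have O: "Os = [] \<or> (\<exists>c. Os = [c])" using F(9) by (cases Os) auto
    show ?thesis
    proof (cases "v \<in> set Os")
      case True
      then have Os: "Os = [v]" using O by auto
      have sy: "(y, z) \<in> E \<Longrightarrow> (z, y) \<in> E" for y z using F(5) by (meson symD)
      have path: "pe ((p # Bs) @ [v] @ (As @ [q])) \<subseteq> E" using F(1) Os by simp
      have "(last (p # Bs), v) \<in> E" "pe ([v] @ (As @ [q])) \<subseteq> E" using path_split(2,3)[OF path] by simp_all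
      moreover from this have "(v, hd (As @ [q])) \<in> E" using path_split(3)[of "[v]" "As @ [q]" E] by simp
      moreover have "(b, v) \<in> E" "(a, v) \<in> E" using F(2,3)[of v] Os by simp_all
      ultimately have "(v, last (p # Bs)) \<in> E" "(v, hd (As @ [q])) \<in> E" "(v, b) \<in> E" "(v, a) \<in> E" using sy by blast+
      then have sub: "{a, b, last (p # Bs), hd (As @ [q])} \<subseteq> E `` {v}" by blast
      have l: "last (p # Bs) \<in> set (p # Bs)" "hd (As @ [q]) \<in> set (As @ [q])" by (rule last_in_set, simp, intro hd_in_set, simp)
      then have ne: "a \<noteq> b" "last (p # Bs) \<notin> {a, b}" "hd (As @ [q]) \<notin> {a, b, last (p # Bs)}"
        using F(7) Os by (auto simp del: last.simps)
      note sub
      moreover have "finite (E `` {v})" using F(6) by (rule finite_Image)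
      ultimately have "card {a, b, last (p # Bs), hd (As @ [q])} \<le> 3" using assms(6) card_mono by metis
      then show ?thesis using ne by auto
    next
      case nO: False
      show ?thesis
      proof (cases "v = b \<or> v = p \<or> v \<in> set Bs")
        case True
        then show ?thesis using dbl_half[OF fam assms(3)] False assms(4,6,7) by blast
      next
        case nb: False
        then have "v = a \<or> v = q \<or> v \<in> set (rev As)" using vV F(8) nO by auto
        then have "v = a \<or> v = q \<or> v \<in> set (rev As)" by simp
        moreover have "rev As @ rev Os \<noteq> []" "rev Os @ rev Bs \<noteq> []" using False by auto
        ultimately show ?thesis using dbl_half[OF fam' assms(3) _ _ assms(4,6,7)] by blast
      qed
    qed
  qed
qed

text \<open>\<open>dbl_main\<close> provides some third vertex for the given \<open>d\<close>, and
  \<open>dbl_swap\<close> passes to the prescribed one.\<close>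

theorem doubling:
  assumes "sgraph V E" "Fam V E" "x \<notin> V" "card V \<ge> 7" "\<And>v. v \<in> V \<Longrightarrow> card (E `` {v}) \<ge> 3"
    and "E `` {p} = {d, r, s}" "d \<noteq> r" "d \<noteq> s" "r \<noteq> s"
  shows "K24_or_Fam (insert x V) (dbl E p x d s)"
proof -
  have "card (E `` {p}) = 3" "d \<in> E `` {p}" using assms(6-9) by auto
  from dbl_main[OF assms(1-5) this] obtain s0 where s0: "s0 \<in> {d, r, s}" "s0 \<noteq> d" "K24_or_Fam (insert x V) (dbl E p x d s0)"
    unfolding assms(6) by blast
  then show ?thesis using dbl_swap[OF assms(1,3,6-9)] by blast
qed

text \<open>The bound on the degree of \<open>d\<close> is what keeps the contraction of
  \<open>q1 q2\<close> 3-connected, see \<open>triangle_contr\<close>.\<close>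

definition tri :: "'a rel \<Rightarrow> bool" where
  "tri E \<longleftrightarrow> (\<exists>d q1 q2. (q1, q2) \<in> E \<and> (q1, d) \<in> E \<and> (q2, d) \<in> E \<and>
     card (E `` {q1}) = 3 \<and> card (E `` {q2}) = 3 \<and> card (E `` {d}) \<ge> 4)"

lemma card3_third:
  assumes "card N = 3" "a \<in> N" "b \<in> N" "a \<noteq> b"
  obtains c where "N = {a, b, c}" "c \<noteq> a" "c \<noteq> b"
proof -
  have "finite N" using assms(1) by (metis card.infinite zero_neq_numeral)
  then have "card (N - {a, b}) = 1" using assms by (simp add: card_Diff_subset)
  then obtain c where "N - {a, b} = {c}" by (meson card_1_singletonE)
  then show ?thesis using assms that[of c] by blast
qed

text \<open>The contraction of \<open>q1 q2\<close> is 3-connected, hence in the family by the last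
  premise, and the graph is recovered from it as a doubling at \<open>q1\<close> towards
  \<open>d\<close>.\<close>

lemma tri_Fam:
  assumes "sgraph V E" "con3 V E" "\<not> K24 E" "card V \<ge> 8" "tri E"
    and "\<And>x y. (x, y) \<in> E \<Longrightarrow> con3 (V - {x}) (contr E x y) \<Longrightarrow> Fam (V - {x}) (contr E x y)"
  shows "Fam V E"
proof -
  note S = sgraphD[OF assms(1)]
  obtain d q1 q2 where e: "(q1, q2) \<in> E" "(q1, d) \<in> E" "(q2, d) \<in> E"
    and c: "card (E `` {q1}) = 3" "card (E `` {q2}) = 3" "card (E `` {d}) \<ge> 4"
    using assms(5) unfolding tri_def by blast
  have ne: "q1 \<noteq> q2" "q1 \<noteq> d" "q2 \<noteq> d" using e S(5) by metis+
  have V: "q1 \<in> V" "q2 \<in> V" "d \<in> V" using S(2)[OF e(1)] S(3)[OF e(1)] S(3)[OF e(2)] by auto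
  obtain r where r: "E `` {q1} = {q2, d, r}" "r \<noteq> q2" "r \<noteq> d"
    using card3_third[OF c(1), of q2 d] e ne by auto
  obtain s where s: "E `` {q2} = {q1, d, s}" "s \<noteq> q1" "s \<noteq> d"
    using card3_third[OF c(2), of q1 d] e ne S(4) by auto
  have sy: "(y, z) \<in> E \<longleftrightarrow> (z, y) \<in> E" for y z using S(4) by blast
  have N1: "(q1, z) \<in> E \<longleftrightarrow> z = q2 \<or> z = d \<or> z = r" "(z, q1) \<in> E \<longleftrightarrow> z = q2 \<or> z = d \<or> z = r" for z
    using r(1) sy by auto
  have N2: "(q2, z) \<in> E \<longleftrightarrow> z = q1 \<or> z = d \<or> z = s" "(z, q2) \<in> E \<longleftrightarrow> z = q1 \<or> z = d \<or> z = s" for z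
    using s(1) sy by auto
  have rV: "r \<in> V" "s \<in> V" "r \<noteq> q1" "s \<noteq> q2" using N1(1)[of r] N2(1)[of s] S(3,5) by blast+
  \<comment> \<open>If \<open>r\<close> and \<open>s\<close> coincided, \<open>d\<close> and
    \<open>r\<close> would cut off \<open>q1\<close> and \<open>q2\<close>, and there would be only
    four vertices.\<close>
  have rs: "r \<noteq> s"
  proof
    assume rs: "r = s"
    have "V \<subseteq> {q1, q2} \<union> {d, r}"
      by (rule con3_cut[OF assms(2)]) (use V rV N1 N2 rs in auto)
    then have "card V \<le> card {q1, q2, d, r}" by (intro card_mono) auto
    also have "\<dots> \<le> length [q1, q2, d, r]" using card_length[of "[q1, q2, d, r]"] by simp
    finally show False using assms(4) by simp
  qed
  let ?V = "V - {q2}" and ?E = "contr E q2 q1"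
  have c3: "con3 ?V ?E" using triangle_contr[OF assms(2,1) _ r(1) s(1) c(3)] assms(4) by simp
  have sg: "sgraph ?V ?E" using sgraph_contr[OF assms(1) V(1)] ne(1) by auto
  have F: "Fam ?V ?E" using assms(6)[OF _ c3] sy e(1) by blast
  have cV: "card ?V \<ge> 7" using assms(4) V(2) S(1) by simp
  have N: "?E `` {q1} = {d, r, s}"
    unfolding contr_def using ne r(2,3) s(2,3) rV(3,4) by (auto simp: N1 N2)
  have "K24_or_Fam (insert q2 ?V) (dbl ?E q1 q2 d s)"
    by (rule doubling[OF sg F _ cV con3_deg[OF c3 sg] N]) (use r s rs in auto)
  \<comment> \<open>In the contraction \<open>q1\<close> has inherited the neighbour
    \<open>s\<close> of \<open>q2\<close>; subdividing this edge by \<open>q2\<close> and joining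
    \<open>q2\<close> to \<open>d\<close> restores the graph.\<close>
  moreover have "dbl ?E q1 q2 d s = E"
  proof -
    have ne': "q2 \<noteq> q1" "d \<noteq> q1" "d \<noteq> q2" "q1 \<noteq> r" "q1 \<noteq> s" "q2 \<noteq> r" "q2 \<noteq> s" "d \<noteq> r" "d \<noteq> s" "s \<noteq> r"
      using ne r(2,3) s(2,3) rV(3,4) rs by auto
    have "(u, v) \<in> dbl ?E q1 q2 d s \<longleftrightarrow> (u, v) \<in> E" for u v
    proof -
      consider "u = q1" | "u = q2" | "v = q1" "u \<noteq> q1" "u \<noteq> q2" | "v = q2" "u \<noteq> q1" "u \<noteq> q2"
        | "u \<noteq> q1" "u \<noteq> q2" "v \<noteq> q1" "v \<noteq> q2" by blast
      then show ?thesis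
        by cases (use ne ne' r(2,3) s(2,3) rV(3,4) rs in \<open>auto simp: dbl_def contr_def N1 N2\<close>)
    qed
    then show ?thesis by auto
  qed
  moreover have "insert q2 ?V = V" using V by blast
  ultimately show ?thesis using assms(3) unfolding K24_or_Fam_def by simp
qed

lemma giso_tri:
  assumes "giso V E W F" "sgraph V E" "sgraph W F" "tri F"
  shows "tri E"
proof -
  obtain f where f: "bij_betw f W V" "\<forall>u\<in>W. \<forall>v\<in>W. (u, v) \<in> F \<longleftrightarrow> (f u, f v) \<in> E"
    using giso_sym[OF assms(1)] unfolding giso_def by blast
  note SE = sgraphD[OF assms(2)] and SF = sgraphD[OF assms(3)]
  have c: "card (E `` {f u}) = card (F `` {u})" if "u \<in> W" for u
  proof -
    have "E `` {f u} = f ` (F `` {u})"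
    proof (intro equalityI subsetI)
      fix z assume "z \<in> E `` {f u}"
      then have z: "(f u, z) \<in> E" by blast
      then have "z \<in> f ` W" using SE(3) f(1) by (auto simp: bij_betw_def)
      then show "z \<in> f ` (F `` {u})" using f(2) z that by auto
    next
      fix z assume "z \<in> f ` (F `` {u})"
      then obtain w where "z = f w" "(u, w) \<in> F" by auto
      then show "z \<in> E `` {f u}" using f(2) that SF(3) by blast
    qed
    moreover have "inj_on f (F `` {u})"
      using f(1) SF(3) by (auto simp: bij_betw_def intro: inj_on_subset)
    ultimately show ?thesis by (simp add: card_image)
  qed
  obtain d q1 q2 where e: "(q1, q2) \<in> F" "(q1, d) \<in> F" "(q2, d) \<in> F"
    and cc: "card (F `` {q1}) = 3" "card (F `` {q2}) = 3" "card (F `` {d}) \<ge> 4"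
    using assms(4) unfolding tri_def by blast
  have W: "q1 \<in> W" "q2 \<in> W" "d \<in> W" using SF(2,3) e by blast+
  show ?thesis unfolding tri_def
    by (intro exI[of _ "f d"] exI[of _ "f q1"] exI[of _ "f q2"]) (use e cc W c f(2) in auto)
qed

type_synonym edges = "(nat \<times> nat) list"

section \<open>Certified splits of small graphs\<close>

text \<open>A split tree certifies a case analysis of the ways to split a vertex \<open>y\<close> into adjacent vertices \<open>y\<close>
  and \<open>n\<close>, with \<open>P\<close> the edges known to be present and \<open>U\<close> the undecided ones. \<open>Br v u\<close> branches on
  the edge \<open>vu\<close>: if it is absent, then \<open>u\<close> is adjacent to the other half of the split vertex. The
  leaves are a $K_{2,4}$ minor with the two large bags given (\<open>K\<close>), an isomorphism with the \<open>k\<close>-th listed graph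
  (\<open>I k\<close>), a vertex of degree at most 2 (\<open>D\<close>), and a triangle as in \<open>tri\<close> (\<open>T\<close>), which is
  admissible only if \<open>tr\<close> holds.\<close>

datatype split_tree = K "nat list" "nat list" | Br nat nat split_tree split_tree
  | I nat "nat list" | D nat | T nat nat nat

definition nbrs :: "nat \<Rightarrow> edges \<Rightarrow> nat \<Rightarrow> nat list" where
  "nbrs n P v = filter (adj P v) [0..<n]"

definition no_edge_at :: "edges \<Rightarrow> nat \<Rightarrow> bool" where
  "no_edge_at U v \<longleftrightarrow> list_all (\<lambda>(x, y). x \<noteq> v \<and> y \<noteq> v) U"

definition remove_edge :: "nat \<Rightarrow> nat \<Rightarrow> edges \<Rightarrow> edges" where
  "remove_edge x y U = filter (\<lambda>(u, v). \<not> (u = x \<and> v = y)) U"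

definition iso_check :: "nat \<Rightarrow> edges \<Rightarrow> edges \<Rightarrow> nat list \<Rightarrow> bool" where
  "iso_check n P Q s \<longleftrightarrow> length s = n \<and> distinct s \<and> list_all (\<lambda>x. x < n) s \<and>
     list_all (\<lambda>(u, v). u < n \<and> v < n) P \<and>
     list_all (\<lambda>(u, v). adj Q (s ! u) (s ! v)) P \<and>
     (let P' = map (\<lambda>(u, v). (s ! u, s ! v)) P in list_all (\<lambda>(u, v). adj P' u v) Q)"

text \<open>A leaf must be valid for every graph between \<open>P\<close> and \<open>P @ U\<close>
  that the branches allow. So the minor is verified in \<open>P\<close>, the degree in
  \<open>D\<close> is bounded with \<open>P @ U\<close> and that of \<open>d\<close> in
  \<open>T\<close> with \<open>P\<close> alone; an exact degree requires that no undecided edge is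
  left at the vertex, and an isomorphism that none is left at all. If \<open>v u\<close> is present,
  the edge from the other half to \<open>u\<close> remains undecided.\<close>

fun tree_check :: "bool \<Rightarrow> nat \<Rightarrow> nat \<Rightarrow> nat list \<Rightarrow> edges list \<Rightarrow> edges \<Rightarrow> edges \<Rightarrow> split_tree \<Rightarrow> bool" where
  "tree_check tr n y N L P U (K A B) \<longleftrightarrow> K24_check (Suc n) P A B"
| "tree_check tr n y N L P U (D v) \<longleftrightarrow> v \<le> n \<and> length (nbrs (Suc n) (P @ U) v) \<le> 2"
| "tree_check tr n y N L P U (T d q1 q2) \<longleftrightarrow> tr \<and> d \<le> n \<and> adj P q1 q2 \<and> adj P q1 d \<and> adj P q2 d \<and>
     no_edge_at U q1 \<and> no_edge_at U q2 \<and> length (nbrs (Suc n) P q1) = 3 \<and> length (nbrs (Suc n) P q2) = 3 \<and>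
     length (nbrs (Suc n) P d) \<ge> 4"
| "tree_check tr n y N L P U (I k s) \<longleftrightarrow> U = [] \<and> k < length L \<and> iso_check (Suc n) P (L ! k) s"
| "tree_check tr n y N L P U (Br v u t1 t2) \<longleftrightarrow> u \<in> set N \<and> (v = y \<or> v = n) \<and>
     tree_check tr n y N L ((v, u) # P) (remove_edge v u U) t1 \<and>
     (let w = (if v = y then n else y) in
       tree_check tr n y N L ((w, u) # P) (remove_edge w u (remove_edge v u U)) t2)"

text \<open>For small graphs the outcome must be a member of \<open>L\<close>, as all graphs are
  listed there. The triangle is an outcome for larger graphs only, where it takes the place of such
  a list.\<close>

definition good :: "bool \<Rightarrow> edges list \<Rightarrow> 'a set \<Rightarrow> 'a rel \<Rightarrow> bool" where
  "good tr L V E \<longleftrightarrow> K24 E \<or> (tr \<and> tri E) \<or> (\<exists>Q\<in>set L. giso V E {0..<card V} (symc (set Q)))"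

lemma adj_iff: "adj P u v \<longleftrightarrow> (u, v) \<in> symc (set P)"
  by (simp add: adj_def)

lemma iso_check_sound:
  assumes "iso_check n P Q s"
  shows "giso {0..<n} (symc (set P)) {0..<n} (symc (set Q))"
  unfolding giso_def
proof (intro exI[of _ "\<lambda>i. s ! i"] conjI ballI)
  have s: "length s = n" "distinct s" "\<And>x. x \<in> set s \<Longrightarrow> x < n"
    using assms unfolding iso_check_def by (auto simp: list_all_iff)
  have "set s \<subseteq> {0..<n}" using s(3) by auto
  moreover have "card (set s) = n" using s distinct_card by metis
  ultimately have ss: "set s = {0..<n}" by (intro card_subset_eq) auto
  show "bij_betw (\<lambda>i. s ! i) {0..<n} {0..<n}"
    by (rule bij_betw_nth[OF s(2)]) (simp_all add: s(1) ss lessThan_atLeast0)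
  have inj: "s ! u = s ! v \<longleftrightarrow> u = v" if "u < n" "v < n" for u v
    using nth_eq_iff_index_eq[OF s(2)] s(1) that by simp
  have P: "(u, v) \<in> set P \<Longrightarrow> u < n \<and> v < n" "(u, v) \<in> set P \<Longrightarrow> (s ! u, s ! v) \<in> symc (set Q)" for u v
    using assms unfolding iso_check_def by (auto simp: list_all_iff adj_iff)
  have Q: "(u, v) \<in> set Q \<Longrightarrow> (u, v) \<in> symc (set (map (\<lambda>(u, v). (s ! u, s ! v)) P))" for u v
    using assms unfolding iso_check_def Let_def by (auto simp: list_all_iff adj_iff)
  fix u v assume uv: "u \<in> {0..<n}" "v \<in> {0..<n}"
  show "(u, v) \<in> symc (set P) \<longleftrightarrow> (s ! u, s ! v) \<in> symc (set Q)"
  proof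
    assume "(u, v) \<in> symc (set P)"
    then show "(s ! u, s ! v) \<in> symc (set Q)" using P(2)[of u v] P(2)[of v u] by auto
  next
    assume "(s ! u, s ! v) \<in> symc (set Q)"
    then have "(s ! u, s ! v) \<in> symc (set (map (\<lambda>(u, v). (s ! u, s ! v)) P))"
      using Q[of "s ! u" "s ! v"] Q[of "s ! v" "s ! u"] by auto
    then obtain u' v' where "(u', v') \<in> set P" "(s ! u = s ! u' \<and> s ! v = s ! v') \<or> (s ! u = s ! v' \<and> s ! v = s ! u')"
      by auto
    then show "(u, v) \<in> symc (set P)" using inj P(1)[of u' v'] uv by auto
  qed
qed

text \<open>The last conjunct is what a split guarantees: each former neighbour of the split vertex
  is adjacent to at least one half.\<close>

definition tree_inv :: "nat \<Rightarrow> nat \<Rightarrow> nat list \<Rightarrow> edges \<Rightarrow> edges \<Rightarrow> nat rel \<Rightarrow> bool" where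
  "tree_inv n y N P U E \<longleftrightarrow> set P \<subseteq> E \<and> E \<subseteq> symc (set P \<union> set U) \<and>
     (\<forall>u\<in>set N. (y, u) \<in> E \<or> (n, u) \<in> E)"

lemma nbrs_set: "set (nbrs n P v) = {w. w < n \<and> (v, w) \<in> symc (set P)}" "distinct (nbrs n P v)"
  by (auto simp: nbrs_def adj_iff)

text \<open>The graph is fixed, and the induction on the tree follows the branch that fits it; the
  invariant passes to that branch.\<close>

lemma tree_check_sound:
  assumes "sgraph {0..<Suc n} E" "\<And>v. v \<le> n \<Longrightarrow> card (E `` {v}) \<ge> 3"
    and "tree_check tr n y N L P U t" "tree_inv n y N P U E"
  shows "good tr L {0..<Suc n} E"
  using assms(3,4)
proof (induction t arbitrary: P U)
  note S = sgraphD[OF assms(1)]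
  have im: "E `` {v} \<subseteq> {0..<Suc n}" for v using S(3) by blast
  have PE: "symc (set P) \<subseteq> E" if "tree_inv n y N P U E" for P U
    using that S(4) unfolding tree_inv_def symc_def by auto
  {
    case (K A B)
    have "K24 (symc (set P))" by (rule K24_check_sound) (use K.prems(1) in simp)
    then have "K24 E" using K24_mono[OF _ PE[OF K.prems(2)] S(6,7)] by blast
    then show ?case unfolding good_def by blast
  next
    case (Br v u t1 t2)
    define w where "w = (if v = y then n else y)"
    have u: "u \<in> set N" "v = y \<or> v = n" and c: "tree_check tr n y N L ((v, u) # P) (remove_edge v u U) t1"
      "tree_check tr n y N L ((w, u) # P) (remove_edge w u (remove_edge v u U)) t2"
      using Br.prems(1) unfolding w_def by (simp_all add: Let_def)
    have I: "set P \<subseteq> E" "E \<subseteq> symc (set P \<union> set U)" "\<forall>u\<in>set N. (y, u) \<in> E \<or> (n, u) \<in> E"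
      using Br.prems(2) unfolding tree_inv_def by blast+
    have rm: "set (remove_edge a b X) = set X - {(a, b)}" for a b X unfolding remove_edge_def by auto
    show ?case
    proof (cases "(v, u) \<in> E")
      case True
      have "E \<subseteq> symc (insert (v, u) (set P) \<union> (set U - {(v, u)}))" using I(2) by (auto simp: symc_def)
      then have "tree_inv n y N ((v, u) # P) (remove_edge v u U) E"
        using I True unfolding tree_inv_def rm by simp
      then show ?thesis using Br.IH(1)[OF c(1)] by blast
    next
      case False
      then have w: "(w, u) \<in> E" using I(3) u unfolding w_def by auto
      have "(u, v) \<notin> E" using False S(4) by blast
      then have "E \<subseteq> symc (insert (w, u) (set P) \<union> (set U - {(v, u)} - {(w, u)}))"
        using I(2) False by (auto simp: symc_def)
      then have "tree_inv n y N ((w, u) # P) (remove_edge w u (remove_edge v u U)) E"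
        using I w unfolding tree_inv_def rm by simp
      then show ?thesis using Br.IH(2)[OF c(2)] by blast
    qed
  next
    case (I k s)
    have *: "U = []" "k < length L" "iso_check (Suc n) P (L ! k) s" using I.prems(1) by simp_all
    then have "E = symc (set P)" using I.prems(2) PE[OF I.prems(2)] unfolding tree_inv_def by auto
    then have "giso {0..<Suc n} E {0..<card {0..<Suc n}} (symc (set (L ! k)))"
      using iso_check_sound[OF *(3)] by simp
    then show ?case unfolding good_def using *(2) nth_mem by blast
  next
    case (D v)
    have "E `` {v} \<subseteq> set (nbrs (Suc n) (P @ U) v)"
      using D.prems(2) im[of v] unfolding nbrs_set tree_inv_def by auto
    then have "card (E `` {v}) \<le> length (nbrs (Suc n) (P @ U) v)"
      by (meson card_length card_mono finite_set le_trans)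
    then show ?case using D.prems(1) assms(2)[of v] by simp
  next
    case (T d q1 q2)
    note PE = PE[OF T.prems(2)]
    have sub: "set (nbrs (Suc n) P v) \<subseteq> E `` {v}" for v using PE unfolding nbrs_set by blast
    have fin: "finite (E `` {v})" for v using S(7) by (rule finite_Image)
    have eq: "E `` {v} = set (nbrs (Suc n) P v)" if "no_edge_at U v" for v
    proof -
      have "(v, z) \<in> symc (set P)" if "(v, z) \<in> E" for z
      proof -
        have "(v, z) \<in> symc (set P \<union> set U)" using that T.prems(2) unfolding tree_inv_def by blast
        moreover have "(v, z) \<notin> set U" "(z, v) \<notin> set U"
          using \<open>no_edge_at U v\<close> unfolding no_edge_at_def by (auto simp: list_all_iff)
        ultimately show ?thesis by auto
      qed
      then show ?thesis using sub[of v] im[of v] unfolding nbrs_set by auto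
    qed
    have cd: "card (set (nbrs (Suc n) P v)) = length (nbrs (Suc n) P v)" for v
      using distinct_card[OF nbrs_set(2)] by blast
    have "card (E `` {q1}) = 3" "card (E `` {q2}) = 3" using T.prems(1) eq cd by auto
    moreover have "card (E `` {d}) \<ge> 4" using T.prems(1) cd[of d] card_mono[OF fin sub, of d] by simp
    moreover have "(q1, q2) \<in> E" "(q1, d) \<in> E" "(q2, d) \<in> E" using T.prems(1) PE by (auto simp: adj_iff)
    moreover have tr using T.prems(1) by simp
    ultimately show ?case unfolding good_def tri_def by blast
  }
qed

text \<open>By symmetry of the two halves, the first neighbour of the split vertex may be assumed to be adjacent
  to \<open>y\<close>.\<close>

definition split_check :: "bool \<Rightarrow> nat \<Rightarrow> edges list \<Rightarrow> edges \<Rightarrow> nat \<Rightarrow> split_tree \<Rightarrow> bool" where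
  "split_check tr n L Q y t \<longleftrightarrow> (let N = nbrs n Q y in N \<noteq> [] \<and>
     tree_check tr n y N L ((y, hd N) # (y, n) # filter (\<lambda>(u, v). u \<noteq> y \<and> v \<noteq> y) Q)
       (remove_edge y (hd N) (concat (map (\<lambda>u. [(y, u), (n, u)]) N))) t)"

definition graph_check :: "bool \<Rightarrow> nat \<Rightarrow> edges list \<Rightarrow> edges \<Rightarrow> split_tree list \<Rightarrow> bool" where
  "graph_check tr n L Q ts \<longleftrightarrow> length ts = n \<and> list_all (\<lambda>(u, v). u < n \<and> v < n) Q \<and>
     list_all (\<lambda>y. split_check tr n L Q y (ts ! y)) [0..<n]"

lemma giso_image:
  assumes "sgraph V E" "bij_betw g V W"
  shows "sgraph W (map_prod g g ` E)" "giso V E W (map_prod g g ` E)"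
    "u \<in> V \<Longrightarrow> card ((map_prod g g ` E) `` {g u}) = card (E `` {u})"
proof -
  note S = sgraphD[OF assms(1)]
  have i: "inj_on g V" and W: "g ` V = W" using assms(2) by (auto simp: bij_betw_def)
  have iff: "(g u, g v) \<in> map_prod g g ` E \<longleftrightarrow> (u, v) \<in> E" if "u \<in> V" "v \<in> V" for u v
  proof
    assume "(g u, g v) \<in> map_prod g g ` E"
    then obtain a b where ab: "(a, b) \<in> E" "g a = g u" "g b = g v" by auto
    then have "a = u" "b = v" using i S(2,3)[OF ab(1)] that by (auto dest: inj_onD)
    then show "(u, v) \<in> E" using ab(1) by simp
  qed force
  show "giso V E W (map_prod g g ` E)" unfolding giso_def
    by (rule exI[of _ g]) (simp add: assms(2) iff)
  show "sgraph W (map_prod g g ` E)" unfolding sgraph_def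
  proof (intro conjI)
    show "finite W" using S(1) W by blast
    show "map_prod g g ` E \<subseteq> W \<times> W" using S(2,3) W by auto
    show "sym (map_prod g g ` E)" using S(4) unfolding sym_def by force
    show "irrefl (map_prod g g ` E)" unfolding irrefl_def
    proof (intro allI notI)
      fix z assume "(z, z) \<in> map_prod g g ` E"
      then obtain a b where ab: "(a, b) \<in> E" "g a = g b" by auto
      then have "a = b" using i S(2,3)[OF ab(1)] by (auto dest: inj_onD)
      then show False using ab(1) S(5) by blast
    qed
  qed
  assume u: "u \<in> V"
  have "(map_prod g g ` E) `` {g u} = g ` (E `` {u})"
  proof (intro equalityI subsetI)
    fix z assume "z \<in> (map_prod g g ` E) `` {g u}"
    then obtain a b where ab: "(a, b) \<in> E" "g a = g u" "z = g b" by auto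
    then have "a = u" using i S(2)[OF ab(1)] u by (auto dest: inj_onD)
    then show "z \<in> g ` (E `` {u})" using ab by auto
  qed force
  moreover have "inj_on g (E `` {u})" using i S(3) by (auto intro: inj_on_subset)
  ultimately show "card ((map_prod g g ` E) `` {g u}) = card (E `` {u})" by (simp add: card_image)
qed

lemma good_giso:
  assumes "giso V E W F" "sgraph V E" "sgraph W F" "good tr L W F"
  shows "good tr L V E"
  using assms(4) giso_K24[OF assms(1,2)] giso_tri[OF assms(1-3)] giso_card[OF assms(1)]
    giso_trans[OF assms(1)] assms(3) unfolding good_def sgraph_def by metis

text \<open>The labelling \<open>g\<close> extends the labelling \<open>f\<close> of the
  contraction: the two halves receive \<open>y\<close>, the label of the merged vertex, and the new
  label \<open>n\<close>. Premise \<open>h\<close> expresses the normalisation built into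
  \<open>split_check\<close>.\<close>

lemma split_sound_aux:
  assumes "sgraph V E" "con3 V E" "(x0, y0) \<in> E"
    and f: "bij_betw f (V - {x0}) {0..<n}"
      "\<And>u v. u \<in> V - {x0} \<Longrightarrow> v \<in> V - {x0} \<Longrightarrow> (u, v) \<in> contr E x0 y0 \<longleftrightarrow> (f u, f v) \<in> symc (set Q)"
    and g: "bij_betw g V {0..<Suc n}" "\<And>v. v \<in> V - {x0, y0} \<Longrightarrow> g v = f v"
      "(g x0 = n \<and> g y0 = y) \<or> (g x0 = y \<and> g y0 = n)"
    and y: "y = f y0" and Q: "list_all (\<lambda>(u, v). u < n \<and> v < n) Q"
    and c: "split_check tr n L Q y t" and h: "(y, hd (nbrs n Q y)) \<in> map_prod g g ` E"
  shows "good tr L V E"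
proof -
  note S = sgraphD[OF assms(1)]
  define E' where "E' = map_prod g g ` E"
  define N where "N = nbrs n Q y"
  note G = giso_image[OF assms(1) g(1), folded E'_def]
  note S' = sgraphD[OF G(1)]
  have V: "x0 \<in> V" "y0 \<in> V" "x0 \<noteq> y0" using S assms(3) by blast+
  have yn: "y < n" using f(1) V y by (auto simp: bij_betw_def)
  have ff: "f ` (V - {x0}) = {0..<n}" "inj_on f (V - {x0})" using f(1) by (auto simp: bij_betw_def)
  have gE: "(g u, g v) \<in> E'" if "(u, v) \<in> E" for u v using that unfolding E'_def by force
  have Qn: "(u, v) \<in> set Q \<Longrightarrow> u < n \<and> v < n" for u v using Q by (auto simp: list_all_iff)
  have outer: "\<exists>w\<in>V - {x0, y0}. f w = u" if "u < n" "u \<noteq> y" for u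
  proof -
    have "u \<in> f ` (V - {x0})" using ff(1) that by simp
    then show ?thesis using that y by auto
  qed
  have fy: "f w \<noteq> y" if "w \<in> V - {x0, y0}" for w using that ff(2) V y by (auto dest: inj_onD)
  have nbN: "f w \<in> set N \<longleftrightarrow> (x0, w) \<in> E \<or> (y0, w) \<in> E" if w: "w \<in> V - {x0, y0}" for w
  proof -
    have "(y0, w) \<in> contr E x0 y0 \<longleftrightarrow> (y, f w) \<in> symc (set Q)"
      using f(2)[of y0 w] V w y by auto
    moreover have "(y0, w) \<in> contr E x0 y0 \<longleftrightarrow> (x0, w) \<in> E \<or> (y0, w) \<in> E"
      using w V S(5) unfolding contr_def by auto
    moreover have "f w < n" using ff(1) w by auto
    ultimately show ?thesis unfolding N_def nbrs_set by simp
  qed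
  have NE: "(y, u) \<in> E' \<or> (n, u) \<in> E'" if "u \<in> set N" for u
  proof -
    have "u < n" "(y, u) \<in> symc (set Q)" using that unfolding N_def nbrs_set by auto
    moreover have "u \<noteq> y"
    proof
      assume "u = y"
      then have "(y0, y0) \<in> contr E x0 y0" using calculation(2) f(2)[of y0 y0] V y by auto
      then show False using S(5) unfolding contr_def by auto
    qed
    ultimately obtain w where w: "w \<in> V - {x0, y0}" "f w = u" using outer by blast
    then have "(x0, w) \<in> E \<or> (y0, w) \<in> E" using nbN[of w] that by blast
    then have "(g x0, u) \<in> E' \<or> (g y0, u) \<in> E'" using gE g(2)[OF w(1)] w(2) by metis
    then show ?thesis using g(3) by auto
  qed
  let ?P = "(y, hd N) # (y, n) # filter (\<lambda>(u, v). u \<noteq> y \<and> v \<noteq> y) Q"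
  let ?U = "remove_edge y (hd N) (concat (map (\<lambda>u. [(y, u), (n, u)]) N))"
  have U: "set ?U = (\<Union>u\<in>set N. {(y, u), (n, u)}) - {(y, hd N)}"
    unfolding remove_edge_def by auto
  have t: "tree_check tr n y N L ?P ?U t" using c unfolding split_check_def N_def by (simp add: Let_def)
  have inv: "tree_inv n y N ?P ?U E'"
    unfolding tree_inv_def
  proof (intro conjI ballI)
    have "(y, n) \<in> E'" using gE[OF assms(3)] g(3) S'(4) by auto
    moreover have "(u, v) \<in> E'" if q: "(u, v) \<in> set Q" "u \<noteq> y" "v \<noteq> y" for u v
    proof -
      obtain u' v' where u': "u' \<in> V - {x0, y0}" "f u' = u" and v': "v' \<in> V - {x0, y0}" "f v' = v"
        using outer Qn[OF q(1)] q(2,3) by metis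
      then have "(u', v') \<in> contr E x0 y0" using f(2)[of u' v'] q(1) by auto
      then have "(u', v') \<in> E" using u' v' unfolding contr_def by auto
      then show ?thesis using gE g(2) u' v' by metis
    qed
    ultimately show "set ?P \<subseteq> E'" using h unfolding N_def E'_def[symmetric] by auto
    show "E' \<subseteq> symc (set ?P \<union> set ?U)"
    proof
      have one: "(g a, g b) \<in> symc (set ?P \<union> set ?U)" if ab: "(a, b) \<in> E" "b \<noteq> x0" "b \<noteq> y0" for a b
      proof -
        have bV: "b \<in> V - {x0, y0}" "a \<in> V" using ab S(2,3) by blast+
        show ?thesis
        proof (cases "a = x0 \<or> a = y0")
          case True
          then have "f b \<in> set N" using nbN[OF bV(1)] ab(1) by blast
          moreover have "g a = y \<or> g a = n" using True g(3) by auto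
          ultimately show ?thesis using g(2)[OF bV(1)] unfolding U by auto
        next
          case False
          then have a: "a \<in> V - {x0, y0}" using bV by blast
          then have "(a, b) \<in> contr E x0 y0" using ab bV unfolding contr_def by auto
          then have "(f a, f b) \<in> symc (set Q)" using f(2)[of a b] a bV by auto
          then show ?thesis using g(2)[OF a] g(2)[OF bV(1)] fy[OF a] fy[OF bV(1)] by auto
        qed
      qed
      fix z assume "z \<in> E'"
      then obtain a b where ab: "(a, b) \<in> E" "z = (g a, g b)" unfolding E'_def by auto
      consider "b \<noteq> x0" "b \<noteq> y0" | "a \<noteq> x0" "a \<noteq> y0" | "a \<in> {x0, y0}" "b \<in> {x0, y0}" by blast
      then show "z \<in> symc (set ?P \<union> set ?U)"
      proof cases
        case 1 then show ?thesis using one[OF ab(1)] ab(2) by simp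
      next
        case 2 then show ?thesis using one[of b a] S(4)[OF ab(1)] ab(2) by auto
      next
        case 3
        have "a \<noteq> b" using ab(1) S(5) by blast
        then show ?thesis using 3 ab(2) g(3) by auto
      qed
    qed
    fix u assume "u \<in> set N" then show "(y, u) \<in> E' \<or> (n, u) \<in> E'" by (rule NE)
  qed
  have "card (E' `` {v}) \<ge> 3" if "v \<le> n" for v
  proof -
    have "v \<in> g ` V" using g(1) that by (auto simp: bij_betw_def)
    then show ?thesis using G(3) con3_deg[OF assms(2,1)] by auto
  qed
  then have "good tr L {0..<Suc n} E'" by (rule tree_check_sound[OF G(1) _ t inv])
  then show ?thesis using good_giso[OF G(2) assms(1) G(1)] by blast
qed

text \<open>If \<open>y0\<close> is adjacent to the first listed neighbour, it keeps the label
  \<open>y\<close> and \<open>x0\<close> receives \<open>n\<close>. Otherwise \<open>x0\<close> is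
  adjacent to it and takes over the label \<open>y\<close>.\<close>

theorem split_sound:
  assumes "sgraph V E" "con3 V E" "(x0, y0) \<in> E"
    and "giso (V - {x0}) (contr E x0 y0) {0..<n} (symc (set Q))" "graph_check tr n L Q ts"
  shows "good tr L V E"
proof -
  note S = sgraphD[OF assms(1)]
  obtain f where f: "bij_betw f (V - {x0}) {0..<n}"
      "\<forall>u\<in>V - {x0}. \<forall>v\<in>V - {x0}. (u, v) \<in> contr E x0 y0 \<longleftrightarrow> (f u, f v) \<in> symc (set Q)"
    using assms(4) unfolding giso_def by blast
  have V: "x0 \<in> V" "y0 \<in> V" "x0 \<noteq> y0" using S assms(3) by blast+
  define y where "y = f y0"
  have ff: "f ` (V - {x0}) = {0..<n}" "inj_on f (V - {x0})" using f(1) by (auto simp: bij_betw_def)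
  have yn: "y < n" using ff(1) V unfolding y_def by auto
  have Q: "list_all (\<lambda>(u, v). u < n \<and> v < n) Q" and c: "split_check tr n L Q y (ts ! y)"
    using assms(5) yn unfolding graph_check_def by (auto simp: list_all_iff)
  let ?u = "hd (nbrs n Q y)"
  have "nbrs n Q y \<noteq> []" using c unfolding split_check_def by (simp add: Let_def)
  then have "?u \<in> set (nbrs n Q y)" by (rule hd_in_set)
  then have u: "?u < n" "(y, ?u) \<in> symc (set Q)" unfolding nbrs_set by blast+
  then obtain w where w: "w \<in> V - {x0}" "f w = ?u" using ff(1) by (metis atLeastLessThan_iff imageE zero_le)
  have cw: "(y0, w) \<in> contr E x0 y0" using f(2) w u(2) V unfolding y_def by auto
  then have wy: "w \<noteq> y0" using S(5) unfolding contr_def by auto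
  have split: "{0..<Suc n} = insert n {0..<n}" by auto
  show ?thesis
  proof (cases "(y0, w) \<in> E")
    case True
    define g where "g = f(x0 := n)"
    have "bij_betw g V {0..<Suc n}"
    proof -
      have "g ` V = insert n {0..<n}" using ff(1) V unfolding g_def by auto
      moreover have "inj_on g V" using ff unfolding g_def inj_on_def by (auto 4 4)
      ultimately show ?thesis unfolding split bij_betw_def by blast
    qed
    moreover have "(y, ?u) \<in> map_prod g g ` E"
    proof -
      have "map_prod g g (y0, w) = (y, ?u)" using V w unfolding g_def y_def by auto
      then show ?thesis using True by (metis imageI)
    qed
    ultimately show ?thesis
      by (intro split_sound_aux[OF assms(1-3) f(1) _ _ _ _ y_def Q c, of g])
        (use f(2) V in \<open>auto simp: g_def y_def\<close>)
  next
    case False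
    then have xw: "(x0, w) \<in> E" using cw V unfolding contr_def by auto
    define g where "g = f(x0 := y, y0 := n)"
    have "bij_betw g V {0..<Suc n}"
    proof -
      have "f ` (V - {x0, y0}) = {0..<n} - {y}"
        using ff V unfolding y_def by (auto dest: inj_onD)
      moreover have "g ` V = insert y (insert n (f ` (V - {x0, y0})))" using V unfolding g_def by auto
      ultimately have gV: "g ` V = insert n {0..<n}" using yn by auto
      have "inj_on g V"
      proof (rule eq_card_imp_inj_on)
        show "finite V" by (rule S(1))
        have "card (V - {x0}) = n" using f(1) bij_betw_same_card by fastforce
        then have "card V = Suc n" using V(1) S(1) by (metis card_Suc_Diff1)
        then show "card (g ` V) = card V" unfolding gV by simp
      qed
      with gV show ?thesis unfolding split bij_betw_def by blast
    qed
    moreover have "(y, ?u) \<in> map_prod g g ` E"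
    proof -
      have "map_prod g g (x0, w) = (y, ?u)" using V w wy unfolding g_def by auto
      then show ?thesis using xw by (metis imageI)
    qed
    ultimately show ?thesis
      by (intro split_sound_aux[OF assms(1-3) f(1) _ _ _ _ y_def Q c, of g])
        (use f(2) V in \<open>auto simp: g_def y_def\<close>)
  qed
qed

section \<open>Splits of large members of the family\<close>

lemma pe_snoc:
  assumes "L \<noteq> []" shows "pe (L @ [v]) = insert (last L, v) (pe L)"
  using pe_append_edge[of "butlast L" "last L" v] append_butlast_last_id[OF assms]
  by (metis append.assoc append_Cons append_Nil)

lemma pe_nbrs:
  assumes "distinct (L @ v # Z)"
  shows "(v, z) \<in> pe (L @ v # Z) \<longleftrightarrow> Z \<noteq> [] \<and> z = hd Z"
    "(z, v) \<in> pe (L @ v # Z) \<longleftrightarrow> L \<noteq> [] \<and> z = last L"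
proof -
  have 1: "(v, z) \<notin> pe (L @ [v])" for z
  proof (cases "L = []")
    case False
    then have "pe (L @ [v]) = insert (last L, v) (pe L)" by (rule pe_snoc)
    then show ?thesis using assms pe_set[of v z L] False last_in_set[of L] by auto
  qed simp
  have 2: "(z, v) \<in> pe (L @ [v]) \<longleftrightarrow> L \<noteq> [] \<and> z = last L" for z
  proof (cases "L = []")
    case False
    then have "pe (L @ [v]) = insert (last L, v) (pe L)" by (rule pe_snoc)
    then show ?thesis using assms pe_set[of z v L] False by auto
  qed simp
  have 3: "pe (v # Z) = (if Z = [] then {} else insert (v, hd Z) (pe Z))" by (cases Z) auto
  have 4: "(v, z) \<notin> pe Z" "(z, v) \<notin> pe Z" for z using assms pe_set[of v z Z] pe_set[of z v Z] by auto
  show "(v, z) \<in> pe (L @ v # Z) \<longleftrightarrow> Z \<noteq> [] \<and> z = hd Z"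
    unfolding pe_append[of L v Z] 3 using 1 4 by auto
  have "Z \<noteq> [] \<Longrightarrow> v \<noteq> hd Z" using assms by (cases Z) auto
  then show "(z, v) \<in> pe (L @ v # Z) \<longleftrightarrow> L \<noteq> [] \<and> z = last L"
    unfolding pe_append[of L v Z] 3 using 2 4 by auto
qed

text \<open>Splitting the path list at \<open>v\<close> names the neighbours on the path as
  \<open>last L\<close> and \<open>hd Z\<close>, which avoids a case distinction on the segment that
  contains \<open>v\<close>.\<close>

lemma is_fam_nbrs:
  assumes "is_fam V E a b p Bs Os As q ab" "p # Bs @ Os @ As @ [q] = L @ v # Z"
  shows "E `` {v} = (if L = [] then {} else {last L}) \<union> (if Z = [] then {} else {hd Z}) \<union>
    (if v \<in> set (p # Os @ As @ [q]) then {a} else {}) \<union> (if v \<in> set (p # Bs @ Os @ [q]) then {b} else {})"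
proof -
  have d: "distinct (a # b # L @ v # Z)" using is_fam_facts(7)[OF assms(1)] assms(2) by simp
  have E: "E = symc (pe (L @ v # Z) \<union> {a} \<times> set (p # Os @ As @ [q]) \<union>
     {b} \<times> set (p # Bs @ Os @ [q]) \<union> (if ab then {(a, b)} else {}))"
    using assms unfolding is_fam_def famR_def by simp
  have ne: "v \<noteq> a" "v \<noteq> b" using d by auto
  have "(v, z) \<in> E \<longleftrightarrow> (L \<noteq> [] \<and> z = last L) \<or> (Z \<noteq> [] \<and> z = hd Z) \<or> (z = a \<and> v \<in> set (p # Os @ As @ [q])) \<or>
     (z = b \<and> v \<in> set (p # Bs @ Os @ [q]))" for z
  proof -
    have "distinct (L @ v # Z)" using d by simp
    note pe = pe_nbrs[OF this, of z]
    show ?thesis unfolding E symc_iff Un_iff pe using ne by auto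
  qed
  then show ?thesis by auto
qed

text \<open>The locale is interpreted twice, for a description of the contraction and for its
  reversal, so that facts proved at the side of \<open>b\<close> become available at the side of
  \<open>a\<close>.\<close>

locale split_of_fam =
  fixes V :: "'a set" and E :: "'a rel" and x y a b p :: 'a and Bs Os As :: "'a list" and q :: 'a and ab :: bool
  assumes sg: "sgraph V E" and c3: "con3 V E" and xy: "(x, y) \<in> E"
    and fam: "is_fam (V - {x}) (contr E x y) a b p Bs Os As q ab"
begin

lemmas S = sgraphD[OF sg]
lemmas F = is_fam_facts[OF fam]

lemma x_neq_y: "x \<noteq> y"
  using S(5) xy by metis

lemma edge_away: "u \<noteq> x \<Longrightarrow> v \<noteq> x \<Longrightarrow> u \<noteq> y \<Longrightarrow> v \<noteq> y \<Longrightarrow> (u, v) \<in> E \<longleftrightarrow> (u, v) \<in> contr E x y"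
  unfolding contr_def by auto

lemma nbr_y: "u \<noteq> x \<Longrightarrow> u \<noteq> y \<Longrightarrow> (u, y) \<in> contr E x y \<longleftrightarrow> (u, x) \<in> E \<or> (u, y) \<in> E"
  unfolding contr_def using x_neq_y by auto

lemma nbrs_away: "u \<noteq> x \<Longrightarrow> u \<noteq> y \<Longrightarrow> y \<notin> contr E x y `` {u} \<Longrightarrow> E `` {u} = contr E x y `` {u}"
  using S(4) x_neq_y unfolding contr_def by auto

text \<open>Undoing the contraction replaces a neighbour \<open>y\<close> of \<open>h\<close> by
  \<open>x\<close>, by \<open>y\<close> or by both, so the degree does not drop.\<close>

lemma degree_ge:
  assumes "h \<in> V - {x}" "h \<noteq> y"
  shows "card (contr E x y `` {h}) \<le> card (E `` {h})"
proof (rule card_inj_on_le)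
  let ?f = "\<lambda>z. if z = y \<and> (h, y) \<notin> E then x else z"
  have xN: "x \<notin> contr E x y `` {h}" by (simp add: contr_def)
  show "inj_on ?f (contr E x y `` {h})"
  proof (rule inj_onI)
    fix z1 z2 assume "z1 \<in> contr E x y `` {h}" "z2 \<in> contr E x y `` {h}" "?f z1 = ?f z2"
    then show "z1 = z2" using xN by (cases "z1 = y"; cases "z2 = y"; cases "(h, y) \<in> E") auto
  qed
  show "?f ` (contr E x y `` {h}) \<subseteq> E `` {h}"
  proof
    fix w assume "w \<in> ?f ` (contr E x y `` {h})"
    then obtain z where z: "(h, z) \<in> contr E x y" "w = ?f z" by auto
    show "w \<in> E `` {h}"
    proof (cases "z = y")
      case True
      then show ?thesis using nbr_y[of h] assms z by auto
    next
      case False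
      moreover have "z \<noteq> x" using z(1) xN by auto
      ultimately show ?thesis using edge_away[of h z] assms z by auto
    qed
  qed
  show "finite (E `` {h})" using S(7) by (rule finite_Image)
qed

text \<open>Vertices that do not see \<open>y\<close> keep their neighbours, so the two vertices of
  degree 3 must avoid \<open>y\<close> and its neighbours. The third vertex only has to differ from
  \<open>y\<close>, since its degree cannot drop.\<close>

lemma far_triangle:
  assumes "u1 \<in> V - {x, y}" "u2 \<in> V - {x, y}" "h \<in> V - {x, y}"
    and "(u1, u2) \<in> contr E x y" "(u1, h) \<in> contr E x y" "(u2, h) \<in> contr E x y"
    and "card (contr E x y `` {u1}) = 3" "card (contr E x y `` {u2}) = 3" "card (contr E x y `` {h}) \<ge> 4"
    and "(u1, y) \<notin> contr E x y" "(u2, y) \<notin> contr E x y"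
  shows "tri E"
  unfolding tri_def
proof (rule exI[of _ h], rule exI[of _ u1], rule exI[of _ u2], intro conjI)
  show "(u1, u2) \<in> E" "(u1, h) \<in> E" "(u2, h) \<in> E" using assms edge_away by auto
  show "card (E `` {u1}) = 3" "card (E `` {u2}) = 3" using nbrs_away[of u1] nbrs_away[of u2] assms by auto
  show "card (E `` {h}) \<ge> 4" using degree_ge[of h] assms(3,9) by simp
qed

lemma degree_b: "card (contr E x y `` {b}) \<ge> 2 + length Bs + length Os + (if ab then 1 else 0)"
proof -
  let ?l = "p # Bs @ Os @ [q] @ (if ab then [a] else [])"
  have "(b, a) \<in> contr E x y" if ab using F(4)[OF that] F(5) by (meson symD)
  then have "set ?l \<subseteq> contr E x y `` {b}" using F(3) by auto
  moreover have "finite (contr E x y `` {b})" using F(6) by (rule finite_Image)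
  ultimately have "card (set ?l) \<le> card (contr E x y `` {b})" by (simp only: card_mono)
  moreover have "distinct ?l" using F(7) by auto
  then have "card (set ?l) = length ?l" by (rule distinct_card)
  ultimately show ?thesis by (auto split: if_splits)
qed

lemma card_vertices: "card (V - {x}) = 4 + length Bs + length Os + length As"
  using distinct_card[OF F(7)] F(8) by simp

text \<open>The triangle on \<open>b\<close> and the first two path vertices survives if \<open>y\<close> is not close to them.\<close>

lemma first_triangle:
  assumes "Bs = B # Bs'" "length Bs + length Os \<ge> 2" "y \<noteq> a" "y \<noteq> b" "y \<noteq> p" "y \<noteq> B" "y \<noteq> hd (Bs' @ Os @ As @ [q])"
  shows "tri E"
proof -
  let ?T = "Bs' @ Os @ As @ [q]"
  have d: "distinct (a # b # p # B # ?T)" and V: "set (a # b # p # B # ?T) \<subseteq> V - {x}" using F(7,8) assms(1) by auto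
  have "hd ?T \<in> set ?T" by (intro hd_in_set) simp
  then have ne: "hd ?T \<noteq> p" "hd ?T \<noteq> b" using d by auto
  have np: "contr E x y `` {p} = {B, a, b}" using is_fam_nbrs[OF fam, of "[]" p "B # ?T"] assms(1) by auto
  have nB: "contr E x y `` {B} = {p, hd ?T, b}" using is_fam_nbrs[OF fam, of "[p]" B ?T] assms(1) d by auto
  show ?thesis
  proof (rule far_triangle[of p B b])
    show "p \<in> V - {x, y}" "B \<in> V - {x, y}" "b \<in> V - {x, y}" using V assms by auto
    show "card (contr E x y `` {p}) = 3" unfolding np using d by auto
    show "card (contr E x y `` {B}) = 3" unfolding nB using d ne by auto
    show "card (contr E x y `` {b}) \<ge> 4" using degree_b assms(2) by linarith
  qed (use np nB assms in auto)
qed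

text \<open>Two consecutive members of \<open>Bs\<close> form a triangle with \<open>b\<close>. This
  is used when \<open>y\<close> is near the start of the path or is the hub
  \<open>a\<close>.\<close>

lemma inner_triangle:
  assumes "Bs = Bs1 @ B # B' # Bs2" "y \<noteq> b" "y \<noteq> B" "y \<noteq> B'" "y \<noteq> last (p # Bs1)" "y \<noteq> hd (Bs2 @ Os @ As @ [q])"
  shows "tri E"
proof -
  let ?T = "Bs2 @ Os @ As @ [q]"
  have d: "distinct (a # b # (p # Bs1) @ B # B' # ?T)" and V: "set (a # b # p # Bs1 @ B # B' # ?T) \<subseteq> V - {x}" using F(7,8) assms(1) by auto
  have "hd ?T \<in> set ?T" "last (p # Bs1) \<in> set (p # Bs1)" by (intro hd_in_set, simp, rule last_in_set, simp)
  then have ne: "hd ?T \<noteq> B" "hd ?T \<noteq> b" "last (p # Bs1) \<noteq> B'" "last (p # Bs1) \<noteq> b"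
    using d by (auto simp del: last.simps)
  have nB: "contr E x y `` {B} = {last (p # Bs1), B', b}"
    using is_fam_nbrs[OF fam, of "p # Bs1" B "B' # ?T"] assms(1) d by auto
  have nB': "contr E x y `` {B'} = {B, hd ?T, b}"
    using is_fam_nbrs[OF fam, of "p # Bs1 @ [B]" B' ?T] assms(1) d by auto
  show ?thesis
  proof (rule far_triangle[of B B' b])
    show "B \<in> V - {x, y}" "B' \<in> V - {x, y}" "b \<in> V - {x, y}" using V assms by auto
    show "card (contr E x y `` {B}) = 3" unfolding nB using d ne by auto
    show "card (contr E x y `` {B'}) = 3" unfolding nB' using d ne by auto
    show "card (contr E x y `` {b}) \<ge> 4" using degree_b assms(1) by auto
  qed (use nB nB' assms in auto)
qed

end

lemma split_of_fam_rev:
  "split_of_fam V E x y a b p Bs Os As q ab \<Longrightarrow> split_of_fam V E x y b a q (rev As) (rev Os) (rev Bs) p ab"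
  by (simp add: split_of_fam_def is_fam_rev)

text \<open>The large bags are the two path edges \<open>c0 c1\<close> and \<open>c3 q\<close>. They
  share the segments \<open>M\<close> and \<open>R\<close>, which close a cycle through them, and
  the two halves \<open>x\<close> and \<open>a\<close> of the split hub.\<close>

lemma K24_cert_hub:
  assumes "sym E" "finite E" "distinct (concat [[c0, c1], M, [c3, q], R, [x], [a]])"
    "pe M \<subseteq> E" "pe R \<subseteq> E" "M \<noteq> []" "R \<noteq> []" "(c0, c1) \<in> E" "(c1, hd M) \<in> E" "(last M, c3) \<in> E" "(c3, q) \<in> E"
    "(q, hd R) \<in> E" "(last R, c0) \<in> E" "(c0, x) \<in> E \<or> (c1, x) \<in> E" "(c0, a) \<in> E \<or> (c1, a) \<in> E"
    "(c3, x) \<in> E \<or> (q, x) \<in> E" "(c3, a) \<in> E \<or> (q, a) \<in> E"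
  shows "K24 E"
proof -
  have s: "(x, y) \<in> E \<longleftrightarrow> (y, x) \<in> E" for x y using assms(1) by (meson symD)
  show ?thesis
    by (rule K24_path_bagsI[OF assms(1,2) _ assms(3), of "[(0,1),(1,2),(2,3),(3,0),(0,4),(0,5),(2,4),(2,5)]" "[0]" "[2]"])
       (use assms(4-) s in \<open>auto simp: K24_check_def adj_set_def adj_def upt_rec intro: hd_last_bexI\<close>)
qed

context split_of_fam
begin

text \<open>If each of the pairs \<open>c0\<close>, \<open>c1\<close> and \<open>c3\<close>,
  \<open>q\<close> sees both halves of the hub, there is a minor. Otherwise one pair forms a
  triangle with the only half that it sees, unless that half has degree 3; in this case the other
  half sees the other pair and much of the rest, and forms a triangle with that pair. Four members
  of \<open>As\<close> leave room for a nonempty \<open>M\<close> between the pairs.\<close>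

lemma hub_split:
  assumes ya: "y = a" and len: "length As \<ge> 4"
  shows "K24 E \<or> tri E"
proof -
  obtain c0 c1 M c3 where As: "As = c0 # c1 # M @ [c3]" and M: "M \<noteq> []"
  proof -
    obtain c0 c1 R where R: "As = c0 # c1 # R" using len by (cases As; cases "tl As") auto
    then obtain M c3 where "R = M @ [c3]" using len by (cases R rule: rev_cases) auto
    moreover from this have "M \<noteq> []" using R len by auto
    ultimately show ?thesis using that[of c0 c1 M c3] R by simp
  qed
  define F' where "F' = contr E x y"
  let ?L = "p # Bs @ Os"
  have dist: "distinct (a # b # ?L @ c0 # c1 # M @ [c3, q])" using F(7) As by simp
  have Vs: "set (a # b # ?L @ c0 # c1 # M @ [c3, q]) = V - {x}" using F(8) As by auto
  have xn: "x \<notin> set (a # b # ?L @ c0 # c1 # M @ [c3, q])" using Vs by blast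
  have l: "last ?L \<in> set ?L" "hd M \<in> set M" "last M \<in> set M" using M by (intro last_in_set, simp, auto)
  define pL hM lM where d: "pL = last ?L" "hM = hd M" "lM = last M"
  have ne: "pL \<notin> {a, b, x, c0, c1, c3, q}" "hM \<notin> {a, b, x, c0, c1, c3, q}" "lM \<notin> {a, b, x, c0, c1, c3, q}" "pL \<noteq> hM"
  proof -
    have "set ?L \<inter> {a, b, x, c0, c1, c3, q} = {}" "set M \<inter> {a, b, x, c0, c1, c3, q} = {}" "set ?L \<inter> set M = {}"
      using dist xn by auto
    then show "pL \<notin> {a, b, x, c0, c1, c3, q}" "hM \<notin> {a, b, x, c0, c1, c3, q}" "lM \<notin> {a, b, x, c0, c1, c3, q}" "pL \<noteq> hM"
      using l unfolding d by (metis disjoint_iff)+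
  qed
  have ne1: "distinct [a, b, x, c0, c1, c3, q]" using dist xn by auto
  have n0: "F' `` {c0} = {last ?L, c1, a}"
    using is_fam_nbrs[OF fam, of ?L c0 "c1 # M @ [c3, q]"] dist unfolding As F'_def by auto
  have n1: "F' `` {c1} = {c0, hd M, a}"
    using is_fam_nbrs[OF fam, of "?L @ [c0]" c1 "M @ [c3, q]"] dist M unfolding As F'_def by auto
  have n3: "F' `` {c3} = {last M, q, a}"
    using is_fam_nbrs[OF fam, of "?L @ c0 # c1 # M" c3 "[q]"] dist M unfolding As F'_def by auto
  have nq: "F' `` {q} = {c3, a, b}"
    using is_fam_nbrs[OF fam, of "?L @ c0 # c1 # M @ [c3]" q "[]"] dist unfolding As F'_def by auto
  \<comment> \<open>Only the hub \<open>a\<close> has been split, so elsewhere a neighbourhood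
    agrees with that in the contraction, except that the hub may be replaced by one or both
    halves.\<close>
  have E1: "E `` {c} = (F' `` {c} - {a}) \<union> (E `` {c} \<inter> {x, a})" if "c \<in> V - {x}" "c \<noteq> a" for c
  proof (intro equalityI subsetI)
    fix z assume "z \<in> E `` {c}"
    then show "z \<in> (F' `` {c} - {a}) \<union> (E `` {c} \<inter> {x, a})"
      using edge_away[of c z] that ya unfolding F'_def by auto
  next
    fix z assume "z \<in> (F' `` {c} - {a}) \<union> (E `` {c} \<inter> {x, a})"
    moreover have "(c, x) \<notin> F'" unfolding F'_def contr_def by simp
    ultimately show "z \<in> E `` {c}"
      using edge_away[of c z] that ya unfolding F'_def by auto
  qed
  have hub: "(c, x) \<in> E \<or> (c, a) \<in> E" if "c \<in> set As \<or> c = q" for c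
  proof -
    have "(a, c) \<in> contr E x y" using F(2)[of c] that by auto
    then have "(c, y) \<in> contr E x y" using F(5) ya by (meson symD)
    then show ?thesis using nbr_y[of c] that ya dist xn As by auto
  qed
  have sy: "(u, v) \<in> E \<Longrightarrow> (v, u) \<in> E" for u v using S(4) .
  have away: "(u, v) \<in> E" if "(u, v) \<in> contr E x y" "u \<noteq> a" "v \<noteq> a" for u v
    using that ya unfolding contr_def by auto
  have path: "pe (p # Bs @ Os @ As @ [q]) \<subseteq> E"
  proof
    fix z assume z: "z \<in> pe (p # Bs @ Os @ As @ [q])"
    obtain u v where uv: "z = (u, v)" by fastforce
    have "u \<in> set (p # Bs @ Os @ As @ [q])" "v \<in> set (p # Bs @ Os @ As @ [q])" using pe_set z uv by metis+
    then have "u \<noteq> a" "v \<noteq> a" using F(7) by auto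
    then show "z \<in> E" using away[of u v] F(1) z uv by blast
  qed
  note M_ne = M
  define prs where "prs = {(c0, c1), (c3, q)}"
  have deg3: "card (E `` {u}) = 3 \<and> card (E `` {v}) = 3"
    if pr: "(u, v) \<in> prs" "h = x \<and> h' = a \<or> h = a \<and> h' = x" "(u, h') \<notin> E" "(v, h') \<notin> E" for u v h h'
  proof -
    have one: "E `` {c} \<inter> {x, a} = {h}" if "(c, h') \<notin> E" "c \<in> set As \<or> c = q" for c
      using hub[OF that(2)] that(1) \<open>h = x \<and> h' = a \<or> h = a \<and> h' = x\<close> by auto
    have h: "h = x \<or> h = a" using pr(2) by blast
    have hx: "h \<notin> {b, c0, c1, c3, q, pL, hM, lM}" using h ne ne1 by auto
    have e: "card {pL, c1, h} = 3" "card {c0, hM, h} = 3" "card {lM, q, h} = 3" "card {c3, b, h} = 3"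
      using ne ne1 hx by auto
    have cV: "c0 \<in> V - {x}" "c1 \<in> V - {x}" "c3 \<in> V - {x}" "q \<in> V - {x}" using Vs by auto
    have df: "{pL, c1, a} - {a} = {pL, c1}" "{c0, hM, a} - {a} = {c0, hM}" "{lM, q, a} - {a} = {lM, q}" "{c3, a, b} - {a} = {c3, b}"
      using ne ne1 by auto
    consider "u = c0" "v = c1" | "u = c3" "v = q" using pr(1) unfolding prs_def by blast
    then show ?thesis
    proof cases
      case 1
      have "E `` {c0} = {pL, c1} \<union> {h}" "E `` {c1} = {c0, hM} \<union> {h}"
        using E1[OF cV(1)] E1[OF cV(2)] one[of c0] one[of c1] 1 pr(3,4) As ne1
        unfolding n0 n1 d[symmetric] df by auto
      then show ?thesis using 1 e by (simp add: insert_commute)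
    next
      case 2
      have "E `` {c3} = {lM, q} \<union> {h}" "E `` {q} = {c3, b} \<union> {h}"
        using E1[OF cV(3)] E1[OF cV(4)] one[of c3] one[of q] 2 pr(3,4) As ne1
        unfolding n3 nq d[symmetric] df by auto
      then show ?thesis using 2 e by (simp add: insert_commute)
    qed
  qed
  have inAs: "(u \<in> set As \<or> u = q) \<and> (v \<in> set As \<or> v = q)" if "(u, v) \<in> prs" for u v
    using that As unfolding prs_def by auto
  have prE: "(u, v) \<in> E" if "(u, v) \<in> prs" for u v
  proof -
    have "(c0, c1) \<in> E" "(c3, q) \<in> E"
      using path pe_append[of "?L @ c0 # c1 # M" c3 "[q]"] pe_append[of ?L c0 "c1 # M @ [c3, q]"] unfolding As by auto
    then show ?thesis using that unfolding prs_def by auto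
  qed
  have tri_pair: "tri E"
    if pr: "(u, v) \<in> prs" "h = x \<and> h' = a \<or> h = a \<and> h' = x" "(u, h') \<notin> E" "(v, h') \<notin> E" "card (E `` {h}) \<ge> 4" for u v h h'
  proof -
    have "(u, h) \<in> E" "(v, h) \<in> E" using hub[of u] hub[of v] inAs[OF pr(1)] pr(2-4) by auto
    then show ?thesis using deg3[OF pr(1-4)] prE[OF pr(1)] pr(5) unfolding tri_def by blast
  qed
  show ?thesis
  proof (cases "\<forall>h\<in>{x, a}. ((c0, h) \<in> E \<or> (c1, h) \<in> E) \<and> ((c3, h) \<in> E \<or> (q, h) \<in> E)")
    case True
    have p1: "pe (?L @ [c0, c1] @ M @ [c3, q]) \<subseteq> E" using path unfolding As by simp
    note s1 = path_split[OF p1]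
    have s2: "pe [c0, c1] \<subseteq> E" "pe (M @ [c3, q]) \<subseteq> E" "(c1, hd M) \<in> E" "pe ?L \<subseteq> E" "(last ?L, c0) \<in> E"
      using path_split[OF s1(2)] s1 M by (auto simp: hd_append)
    have s3: "pe M \<subseteq> E" "pe [c3, q] \<subseteq> E" "(last M, c3) \<in> E"
      using path_split[OF s2(2) M] by auto
    have bp: "(b, p) \<in> E" "(b, q) \<in> E" using away[of b p] away[of b q] F(3)[of p] F(3)[of q] F(7) by auto
    have "K24 E"
    proof (rule K24_cert_hub[where M = M and R = "b # ?L" and x = x and a = a])
      show "distinct (concat [[c0, c1], M, [c3, q], b # ?L, [x], [a]])" using dist xn by auto
      show "pe (b # ?L) \<subseteq> E" using s2(4) bp(1) by simp
      show "(last (b # ?L), c0) \<in> E" using s2(5) by simp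
      show "(q, hd (b # ?L)) \<in> E" using sy[OF bp(2)] by simp
      show "(c0, x) \<in> E \<or> (c1, x) \<in> E" "(c0, a) \<in> E \<or> (c1, a) \<in> E"
        "(c3, x) \<in> E \<or> (q, x) \<in> E" "(c3, a) \<in> E \<or> (q, a) \<in> E" using True by blast+
    qed (use S(6,7) M s2 s3 in simp_all)
    then show ?thesis ..
  next
    case False
    then obtain u v h' where uv: "(u, v) \<in> prs" "h' \<in> {x, a}" "(u, h') \<notin> E" "(v, h') \<notin> E"
      unfolding prs_def by blast
    obtain h where h: "h = x \<and> h' = a \<or> h = a \<and> h' = x" using uv(2) by blast
    show ?thesis
    proof (cases "card (E `` {h}) \<ge> 4")
      case True
      then show ?thesis using tri_pair[OF uv(1) h uv(3,4)] by blast
    next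
      \<comment> \<open>The half \<open>h\<close> sees only \<open>u\<close>, \<open>v\<close> and
        \<open>h'\<close>. So the other pair and \<open>hd M\<close> see \<open>h'\<close>, which
        together with \<open>h\<close> gives it degree at least 4.\<close>
      case small: False
      have hV: "h \<in> V" using h S(2)[OF xy] S(3)[OF xy] ya by blast
      have hh: "(h, h') \<in> E" using h xy ya sy by blast
      have hu: "(u, h) \<in> E" "(v, h) \<in> E" using hub[of u] hub[of v] inAs[OF uv(1)] uv h by auto
      have uvd: "u \<noteq> v" "u \<noteq> h'" "v \<noteq> h'" using uv(1) h dist xn unfolding prs_def by auto
      have "card (E `` {h}) = 3" using small con3_deg[OF c3 sg hV] by linarith
      then have Eh: "E `` {h} = {u, v, h'}"
        by (rule card3_eq) (use hu hh sy uvd in auto)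
      obtain u' v' where uv': "(u', v') \<in> prs" "{u', v'} \<inter> {u, v} = {}" "u' \<noteq> v'"
        using uv(1) dist unfolding prs_def by auto
      have hd: "hd M \<notin> {u, v, u', v'}" using uv(1) uv'(1) dist l(2) unfolding prs_def by auto
      have h'n: "h' \<notin> set (?L @ c0 # c1 # M @ [c3, q])" using h dist xn by auto
      have no: "(c, h) \<notin> E" if "c \<notin> {u, v, h'}" for c using Eh that sy by blast
      have n1: "(u', h) \<notin> E" "(v', h) \<notin> E" "(hd M, h) \<notin> E"
        using no uv' hd h'n l(2) unfolding prs_def by auto
      have "(u', h') \<in> E" "(v', h') \<in> E" "(hd M, h') \<in> E"
        using hub[of u'] hub[of v'] hub[of "hd M"] inAs[OF uv'(1)] n1 h l(2) As by auto
      then have "{u', v', hd M, h} \<subseteq> E `` {h'}" using sy hh by blast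
      moreover have "finite (E `` {h'})" using S(7) by (rule finite_Image)
      ultimately have "card {u', v', hd M, h} \<le> card (E `` {h'})" by (simp only: card_mono)
      moreover have "h \<notin> {u', v', hd M}" using h dist xn uv'(1) l(2) unfolding prs_def by auto
      then have "card {u', v', hd M, h} = 4" using uv'(3) hd by auto
      ultimately show ?thesis using tri_pair[OF uv'(1), of h' h] h n1 by auto
    qed
  qed
qed

end

context split_of_fam
begin

lemma hub_tri:
  assumes "y = a" "card (V - {x}) \<ge> 10" shows "K24 E \<or> tri E"
proof (cases "length Bs \<ge> 2")
  case True
  then obtain B B' Bs' where Bs: "Bs = [] @ B # B' # Bs'" by (cases Bs; cases "tl Bs") auto
  have "hd (Bs' @ Os @ As @ [q]) \<in> set (Bs' @ Os @ As @ [q])" by (intro hd_in_set) simp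
  moreover have "a \<notin> set (b # p # B # B' # Bs' @ Os @ As @ [q])" using F(7) Bs by auto
  ultimately show ?thesis using inner_triangle[OF Bs] assms(1) by auto
next
  case False
  \<comment> \<open>\<open>Bs\<close> and \<open>Os\<close> now have at most one element each, so
    ten vertices leave at least four in \<open>As\<close>.\<close>
  then show ?thesis using hub_split[OF assms(1)] assms(2) card_vertices F(9) by simp
qed

text \<open>The triangle and the path neighbours of its two vertices of degree 3 occupy only the
  path positions 0, 1 and 2, so \<open>y\<close> at a position from 3 on does no harm.\<close>

lemma first_triangle':
  assumes "Bs \<noteq> []" "length Bs + length Os \<ge> 2" "y = (p # Bs @ Os @ As @ [q]) ! k" "3 \<le> k" "k < length (p # Bs @ Os @ As @ [q])"
  shows "tri E"
proof -
  let ?ps = "p # Bs @ Os @ As @ [q]"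
  obtain B Bs' where Bs: "Bs = B # Bs'" using assms(1) by (cases Bs) auto
  have d: "distinct ?ps" and ab: "a \<notin> set ?ps" "b \<notin> set ?ps" using F(7) by auto
  have n: "?ps ! 0 = p" "?ps ! 1 = B" "?ps ! 2 = hd (Bs' @ Os @ As @ [q])"
    using Bs by (auto simp: hd_conv_nth)
  have ne: "y \<noteq> ?ps ! i" if "i < 3" for i
    unfolding assms(3) using nth_eq_iff_index_eq[OF d assms(5), of i] that assms(4,5) by auto
  have "y \<in> set ?ps" using assms(3,5) nth_mem by metis
  then have "y \<noteq> a" "y \<noteq> b" using ab by blast+
  then show ?thesis using first_triangle[OF Bs assms(2)] ne[of 0] ne[of 1] ne[of 2] n by simp
qed

text \<open>The triangle is taken at the last two members of \<open>Bs\<close>. If \<open>Bs\<close>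
  has five members, these two and their path neighbours occupy positions from 3 on, away from
  \<open>y\<close>.\<close>

lemma inner_triangle':
  assumes "length Bs \<ge> 5" "y = (p # Bs @ Os @ As @ [q]) ! k" "k < 3"
  shows "tri E"
proof -
  let ?ps = "p # Bs @ Os @ As @ [q]"
  obtain C B B' where Bs: "Bs = C @ [B, B']"
  proof -
    obtain R B' where "Bs = R @ [B']" using assms(1) by (cases Bs rule: rev_cases) auto
    moreover from this obtain C B where "R = C @ [B]" using assms(1) by (cases R rule: rev_cases) auto
    ultimately show ?thesis using that by simp
  qed
  have d: "distinct ?ps" and ab: "a \<notin> set ?ps" "b \<notin> set ?ps" using F(7) by auto
  have lC: "length C \<ge> 3" using assms(1) Bs by simp
  let ?c = "length C"
  have n: "?ps ! (?c + 1) = B" "?ps ! (?c + 2) = B'" "?ps ! ?c = last (p # C)" "?ps ! (?c + 3) = hd (Os @ As @ [q])"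
    using Bs lC by (auto simp: nth_append nth_Cons' last_conv_nth hd_conv_nth)
  have k: "k < length ?ps" using assms(1,3) by simp
  have ne: "y \<noteq> ?ps ! i" if "i \<ge> ?c" "i \<le> ?c + 3" for i
    unfolding assms(2) using nth_eq_iff_index_eq[OF d k, of i] that assms(3) lC Bs by auto
  have "y \<in> set ?ps" using assms(2) k nth_mem by metis
  then have "y \<noteq> a" "y \<noteq> b" using ab by blast+
  moreover have "Bs = C @ B # B' # []" using Bs by simp
  ultimately show ?thesis using inner_triangle[of C B B' "[]"] ne[of ?c] ne[of "?c + 1"] ne[of "?c + 2"] ne[of "?c + 3"] n by simp
qed

end

text \<open>\<open>k\<close> and \<open>r\<close> are the distances of \<open>y\<close> from the two
  ends of the path; ten vertices make their sum at least 7, so one of them is at least 3. If both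
  sides have at most four vertices, each end carries a triangle and the one far from
  \<open>y\<close> survives. A side with five vertices has triangles at both of its ends, of which
  one survives.\<close>

theorem split_of_large_fam:
  assumes "split_of_fam V E x y a b p Bs Os As q ab" "card (V - {x}) \<ge> 10"
  shows "K24 E \<or> tri E"
proof -
  interpret A: split_of_fam V E x y a b p Bs Os As q ab by fact
  interpret R: split_of_fam V E x y b a q "rev As" "rev Os" "rev Bs" p ab by (rule split_of_fam_rev) fact
  let ?ps = "p # Bs @ Os @ As @ [q]"
  have rps: "q # rev As @ rev Os @ rev Bs @ [p] = rev ?ps" by simp
  have c: "length Bs + length Os + length As \<ge> 6" "length Os \<le> 1" using A.card_vertices assms(2) A.F(9) by auto
  have "y \<in> V - {x}" using A.x_neq_y A.S(3)[OF A.xy] by auto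
  then consider "y = a" | "y = b" | "y \<in> set ?ps" using A.F(8) by auto
  then show ?thesis
  proof cases
    case 1 then show ?thesis using A.hub_tri assms(2) by blast
  next
    case 2 then show ?thesis using R.hub_tri assms(2) by blast
  next
    case 3
    then obtain k where k: "k < length ?ps" "y = ?ps ! k" by (metis in_set_conv_nth)
    define r where "r = length ?ps - Suc k"
    have r: "r < length (q # rev As @ rev Os @ rev Bs @ [p])" "y = (q # rev As @ rev Os @ rev Bs @ [p]) ! r"
    proof -
      show "r < length (q # rev As @ rev Os @ rev Bs @ [p])" using k(1) unfolding r_def by simp
      have "rev ?ps ! r = ?ps ! (length ?ps - Suc r)" by (rule rev_nth) (use k(1) r_def in simp)
      moreover have "length ?ps - Suc r = k" using k(1) unfolding r_def by simp
      ultimately show "y = (q # rev As @ rev Os @ rev Bs @ [p]) ! r" using k(2) unfolding rps by simp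
    qed
    have kr: "k + r = length Bs + length Os + length As + 1" using k(1) unfolding r_def by simp
    have left: "tri E" if "length Bs \<ge> 1" "length Bs + length Os \<ge> 2" "k \<ge> 3"
    proof -
      have "Bs \<noteq> []" using that(1) by (metis list.size(3) not_one_le_zero)
      then show ?thesis using A.first_triangle'[OF _ that(2) k(2) that(3) k(1)] by blast
    qed
    have right: "tri E" if "length As \<ge> 1" "length As + length Os \<ge> 2" "r \<ge> 3"
    proof -
      have "rev As \<noteq> []" using that(1) by (metis list.size(3) not_one_le_zero rev_is_Nil_conv)
      then show ?thesis using R.first_triangle'[OF _ _ r(2) that(3) r(1)] that(2) by simp
    qed
    have left': "tri E" if "length Bs \<ge> 5" "k < 3" using A.inner_triangle'[OF that(1) k(2) that(2)] .
    have right': "tri E" if "length As \<ge> 5" "r < 3" using R.inner_triangle'[OF _ r(2) that(2)] that(1) by simp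
    consider "length Bs \<ge> 5" | "length As \<ge> 5" | "length Bs \<le> 4" "length As \<le> 4" by linarith
    then show ?thesis
    proof cases
      case 1
      then show ?thesis using left left' by (cases "k < 3") auto
    next
      case 2
      then show ?thesis using right right' by (cases "r < 3") auto
    next
      case 3
      then have "length Bs \<ge> 1" "length Bs + length Os \<ge> 2" "length As \<ge> 1" "length As + length Os \<ge> 2"
        using c by linarith+
      moreover have "k \<ge> 3 \<or> r \<ge> 3" using kr c by linarith
      ultimately show ?thesis using left right by blast
    qed
  qed
qed

text \<open>The representative with \<open>i\<close>, \<open>k\<close>, \<open>j\<close> vertices in
  \<open>Bs\<close>, \<open>Os\<close>, \<open>As\<close>: the path is numbered 0 to
  \<open>m - 1\<close>, the hub \<open>a\<close> is \<open>m\<close>, and the hub \<open>b\<close>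
  is \<open>Suc m\<close>.\<close>

definition fam_edges :: "nat \<Rightarrow> nat \<Rightarrow> nat \<Rightarrow> bool \<Rightarrow> edges" where
  "fam_edges i k j ab = (let m = i + k + j + 2 in
     map (\<lambda>v. (v, Suc v)) [0..<m - 1] @
     map (Pair m) (0 # (m - 1) # [Suc i..<m - 1]) @
     map (Pair (Suc m)) (0 # (m - 1) # [1..<Suc (i + k)]) @
     (if ab then [(m, Suc m)] else []))"

definition e_K5 :: edges where
  "e_K5 = [(0,1), (0,2), (0,3), (0,4), (1,2), (1,3), (1,4), (2,3), (2,4), (3,4)]"

definition e_K33 :: edges where
  "e_K33 = [(0,3), (0,4), (0,5), (1,3), (1,4), (1,5), (2,3), (2,4), (2,5)]"

definition e_A :: edges where
  "e_A = (0,1) # e_K33"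

definition e_A_plus :: edges where
  "e_A_plus = (3,4) # e_A"

text \<open>The vertices w, v2, v3, v4, v5, v6, v8 are numbered 0 to 6 in this order.\<close>

definition e_B :: edges where
  "e_B = [(0,1), (0,2), (1,2), (0,3), (0,4), (3,5), (3,6), (4,5), (4,6), (2,5), (1,6)]"

definition e_B_plus :: edges where
  "e_B_plus = (3,4) # e_B"

definition e_C :: edges where
  "e_C = [(0,1), (0,2), (1,2), (0,6), (1,7), (2,5), (3,5), (3,6), (3,7), (4,5), (4,6), (4,7)]"

definition e_C_plus :: edges where
  "e_C_plus = (3,4) # e_C"

definition e_D :: edges where
  "e_D = [(0,1), (1,2), (0,2), (3,4), (4,5), (3,5), (0,3), (1,4), (2,5), (6,0), (6,1), (6,2)]"

lemma pe_upt: "pe [0..<n] = {(v, Suc v) | v. Suc v < n}"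
proof (induction n)
  case (Suc n)
  show ?case
  proof (cases n)
    case (Suc k)
    then have "pe [0..<Suc n] = insert (k, n) (pe [0..<n])" using pe_snoc[of "[0..<n]" n] by simp
    then show ?thesis using Suc.IH Suc by (auto simp: less_Suc_eq)
  qed simp
qed simp

lemma fam_edges_path:
  "0 # [1..<Suc i] @ [Suc i..<Suc (i + k)] @ [Suc (i + k)..<i + k + j + 1] @ [i + k + j + 1] = [0..<i + k + j + 2]"
proof -
  have "[0..<i + k + j + 2] = [0..<i + k + j + 1] @ [i + k + j + 1]" by simp
  also have "[0..<i + k + j + 1] = [0..<Suc (i + k)] @ [Suc (i + k)..<i + k + j + 1]"
    using upt_add_eq_append[of 0 "Suc (i + k)" j] by simp
  also have "[0..<Suc (i + k)] = [0..<Suc i] @ [Suc i..<Suc (i + k)]"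
    using upt_add_eq_append[of 0 "Suc i" k] by simp
  also have "[0..<Suc i] = 0 # [1..<Suc i]" using upt_conv_Cons[of 0 "Suc i"] by simp
  finally show ?thesis by simp
qed

lemma adj_fam_edges:
  "(u, v) \<in> set (fam_edges i k j ab) \<longleftrightarrow> (let m = i + k + j + 2 in
     (v = Suc u \<and> u < m - 1) \<or> (u = m \<and> (v = 0 \<or> v = m - 1 \<or> (Suc i \<le> v \<and> v < m - 1))) \<or>
     (u = Suc m \<and> (v = 0 \<or> v = m - 1 \<or> (1 \<le> v \<and> v \<le> i + k))) \<or> (ab \<and> u = m \<and> v = Suc m))"
proof -
  have 1: "(u, v) \<in> set (map (\<lambda>v. (v, Suc v)) [0..<l]) \<longleftrightarrow> v = Suc u \<and> u < l" for l by auto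
  have 2: "(u, v) \<in> set (map (Pair h) l) \<longleftrightarrow> u = h \<and> v \<in> set l" for h l by auto
  have 3: "v \<in> set (0 # l # [c..<d]) \<longleftrightarrow> v = 0 \<or> v = l \<or> (c \<le> v \<and> v < d)" for l c d by auto
  have 4: "(u, v) \<in> set (if ab then [(c, d)] else []) \<longleftrightarrow> ab \<and> u = c \<and> v = d" for c d by auto
  show ?thesis
    unfolding fam_edges_def Let_def set_append Un_iff 1 2 3 4 less_Suc_eq_le by blast
qed

lemma fam_edges_is_fam:
  assumes "k \<le> 1"
  shows "is_fam {0..<i + k + j + 4} (symc (set (fam_edges i k j ab))) (i + k + j + 2) (i + k + j + 3) 0
    [1..<Suc i] [Suc i..<Suc (i + k)] [Suc (i + k)..<i + k + j + 1] (i + k + j + 1) ab"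
  unfolding is_fam_def
proof (intro conjI)
  show "distinct ((i + k + j + 2) # (i + k + j + 3) # 0 # [1..<Suc i] @ [Suc i..<Suc (i + k)] @ [Suc (i + k)..<i + k + j + 1] @ [i + k + j + 1])"
    unfolding fam_edges_path by simp
  show "length [Suc i..<Suc (i + k)] \<le> 1" using assms by simp
  show "{0..<i + k + j + 4} = set ((i + k + j + 2) # (i + k + j + 3) # 0 # [1..<Suc i] @ [Suc i..<Suc (i + k)] @ [Suc (i + k)..<i + k + j + 1] @ [i + k + j + 1])"
    unfolding fam_edges_path by auto
  have "set (fam_edges i k j ab) = famR (i + k + j + 2) (i + k + j + 3) 0
    [1..<Suc i] [Suc i..<Suc (i + k)] [Suc (i + k)..<i + k + j + 1] (i + k + j + 1) ab"
  proof (rule set_eqI, clarify)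
    fix u v
    let ?m = "i + k + j + 2"
    have 1: "(u, v) \<in> pe (0 # [1..<Suc i] @ [Suc i..<Suc (i + k)] @ [Suc (i + k)..<i + k + j + 1] @ [i + k + j + 1]) \<longleftrightarrow>
        v = Suc u \<and> u < ?m - 1"
      unfolding fam_edges_path pe_upt by auto
    have 2: "v \<in> set (0 # [Suc i..<Suc (i + k)] @ [Suc (i + k)..<i + k + j + 1] @ [i + k + j + 1]) \<longleftrightarrow>
        v = 0 \<or> v = ?m - 1 \<or> (Suc i \<le> v \<and> v < ?m - 1)"
      by auto
    have 3: "v \<in> set (0 # [1..<Suc i] @ [Suc i..<Suc (i + k)] @ [i + k + j + 1]) \<longleftrightarrow>
        v = 0 \<or> v = ?m - 1 \<or> (1 \<le> v \<and> v \<le> i + k)"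
      by auto
    show "(u, v) \<in> set (fam_edges i k j ab) \<longleftrightarrow> (u, v) \<in> famR (i + k + j + 2) (i + k + j + 3) 0
      [1..<Suc i] [Suc i..<Suc (i + k)] [Suc (i + k)..<i + k + j + 1] (i + k + j + 1) ab"
    proof -
      have 5: "i + k + j + 3 = Suc ?m" by simp
      have 6: "(u, v) \<in> (if ab then {(c, d)} else {}) \<longleftrightarrow> ab \<and> u = c \<and> v = d" for c d by simp
      show ?thesis
        unfolding famR_def Un_iff 1 mem_Sigma_iff singleton_iff 2 3 adj_fam_edges Let_def 5 6 by blast
    qed
  qed
  then show "symc (set (fam_edges i k j ab)) = symc (famR (i + k + j + 2) (i + k + j + 3) 0
    [1..<Suc i] [Suc i..<Suc (i + k)] [Suc (i + k)..<i + k + j + 1] (i + k + j + 1) ab)" by simp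
qed

lemma Fam_fam_edges: "k \<le> 1 \<Longrightarrow> Fam {0..<i + k + j + 4} (symc (set (fam_edges i k j ab)))"
  using fam_edges_is_fam unfolding Fam_def by blast

lemma is_fam_sgraph:
  assumes "is_fam V E a b p Bs Os As q ab" shows "sgraph V E"
proof -
  note F = is_fam_facts[OF assms]
  have "pe (p # Bs @ Os @ As @ [q]) \<subseteq> set (p # Bs @ Os @ As @ [q]) \<times> set (p # Bs @ Os @ As @ [q])"
    by (rule subrelI) (drule pe_set, blast)
  moreover have V: "set (p # Bs @ Os @ As @ [q]) \<subseteq> V" "a \<in> V" "b \<in> V" using F(8) by auto
  ultimately have "pe (p # Bs @ Os @ As @ [q]) \<subseteq> V \<times> V" by blast
  moreover have "set (p # Os @ As @ [q]) \<subseteq> V" "set (p # Bs @ Os @ [q]) \<subseteq> V" using V(1) by auto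
  ultimately have "famR a b p Bs Os As q ab \<subseteq> V \<times> V"
    unfolding famR_def using V(2,3) by (intro Un_least Sigma_mono) auto
  moreover have "irrefl (famR a b p Bs Os As q ab)"
  proof -
    have "(z, z) \<notin> pe ps" if "distinct ps" for z and ps :: "'a list"
      using that by (induction ps rule: pe.induct) auto
    then have "(z, z) \<notin> pe (p # Bs @ Os @ As @ [q])" for z using F(7) by simp
    moreover have "a \<notin> set (p # Os @ As @ [q])" "b \<notin> set (p # Bs @ Os @ [q])" "a \<noteq> b" using F(7) by auto
    then have "(z, z) \<notin> {a} \<times> set (p # Os @ As @ [q])" "(z, z) \<notin> {b} \<times> set (p # Bs @ Os @ [q])"
      "(z, z) \<notin> (if ab then {(a, b)} else {})" for z by auto
    ultimately show ?thesis unfolding famR_def irrefl_def by blast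
  qed
  moreover have "E = symc (famR a b p Bs Os As q ab)" using assms unfolding is_fam_def by blast
  moreover have "finite V" using F(8) by simp
  ultimately show ?thesis unfolding sgraph_def symc_def irrefl_def sym_def by blast
qed

lemma map_nth_segment: "map ((!) (xs @ ys @ zs)) [length xs..<length xs + length ys] = ys"
  by (rule nth_equalityI) (auto simp: nth_append)

text \<open>The order \<open>p\<close>, \<open>Bs\<close>, \<open>Os\<close>, \<open>As\<close>,
  \<open>q\<close>, \<open>a\<close>, \<open>b\<close> numbers the vertices as in
  \<open>fam_edges\<close>. So three lengths and the presence of the edge between the hubs determine
  a member up to isomorphism.\<close>

lemma is_fam_giso_edges:
  assumes "is_fam V E a b p Bs Os As q ab"
  shows "giso V E {0..<card V} (symc (set (fam_edges (length Bs) (length Os) (length As) ab)))"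
proof -
  note F = is_fam_facts[OF assms]
  let ?i = "length Bs" and ?k = "length Os" and ?j = "length As"
  let ?m = "?i + ?k + ?j + 2" and ?zs = "p # Bs @ Os @ As @ [q, a, b]"
  define g where "g = (!) ?zs"
  have cV: "card V = ?m + 2" using distinct_card[OF F(7)] F(8) by simp
  have fam: "is_fam {0..<?m + 2} (symc (set (fam_edges ?i ?k ?j ab))) ?m (?m + 1) 0
    [1..<Suc ?i] [Suc ?i..<Suc (?i + ?k)] [Suc (?i + ?k)..<?m - 1] (?m - 1) ab"
    using fam_edges_is_fam[OF F(9), of ?i ?j ab] by (simp add: numeral_eq_Suc)
  have dz: "distinct ?zs" and sz: "set ?zs = V" and lz: "length ?zs = ?m + 2" using F(7,8) by auto
  have bij: "bij_betw g {0..<?m + 2} V" unfolding g_def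
  proof (rule bij_betw_nth[OF dz])
    show "{0..<?m + 2} = {..<length ?zs}" by (simp only: lz lessThan_atLeast0)
    show "V = set ?zs" by (rule sz[symmetric])
  qed
  then have inj: "inj_on g {0..<?m + 2}" and im: "g ` {0..<?m + 2} = V" by (auto simp: bij_betw_def)
  have "map g [1..<Suc ?i] = Bs" unfolding g_def using map_nth_segment[of "[p]" Bs "Os @ As @ [q, a, b]"] by simp
  moreover have "map g [Suc ?i..<Suc (?i + ?k)] = Os"
    unfolding g_def using map_nth_segment[of "p # Bs" Os "As @ [q, a, b]"] by simp
  moreover have "map g [Suc (?i + ?k)..<?m - 1] = As"
    unfolding g_def using map_nth_segment[of "p # Bs @ Os" As "[q, a, b]"] by (simp add: add.assoc)
  moreover have "g 0 = p" "g (?m - 1) = q" "g ?m = a" "g (?m + 1) = b"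
    unfolding g_def by (auto simp: nth_append nth_Cons')
  ultimately have "is_fam V (map_prod g g ` symc (set (fam_edges ?i ?k ?j ab))) a b p Bs Os As q ab"
    using is_fam_map[OF fam inj] unfolding im by simp
  then have E: "E = map_prod g g ` symc (set (fam_edges ?i ?k ?j ab))" using assms unfolding is_fam_def by simp
  show ?thesis unfolding E cV
    by (rule giso_sym) (rule giso_image(2)[OF is_fam_sgraph[OF fam] bij])
qed

lemma Gnrs_arcs:
  assumes "n \<ge> 3" "r \<le> n - 3"
  shows "parcs (Gnrs n r s) = symc {(u, v). (v = Suc u \<and> 1 \<le> u \<and> u < n) \<or> (u = 1 \<and> n - r \<le> v \<and> v < n) \<or> (u = n \<and> 2 \<le> v \<and> v \<le> Suc s)}"
proof -
  have "{(1::nat, n - i) | i. 1 \<le> i \<and> i \<le> r} = {(u, v). u = 1 \<and> n - r \<le> v \<and> v < n}"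
  proof (intro equalityI subsetI)
    fix z :: "nat \<times> nat" assume "z \<in> {(u, v). u = 1 \<and> n - r \<le> v \<and> v < n}"
    then show "z \<in> {(1::nat, n - i) | i. 1 \<le> i \<and> i \<le> r}"
      using assms by (intro CollectI exI[of _ "n - snd z"]) auto
  qed (use assms in auto)
  moreover have "{(n, 1 + j) | j. 1 \<le> j \<and> j \<le> s} = {(u, v). u = n \<and> 2 \<le> v \<and> v \<le> Suc s}"
  proof (intro equalityI subsetI)
    fix z :: "nat \<times> nat" assume "z \<in> {(u, v). u = n \<and> 2 \<le> v \<and> v \<le> Suc s}"
    then show "z \<in> {(n, 1 + j) | j. 1 \<le> j \<and> j \<le> s}"
      by (intro CollectI exI[of _ "snd z - 1"]) auto
  qed auto
  moreover have "{(i, i + 1) | i. 1 \<le> i \<and> i < n} = {(u, v). v = Suc u \<and> 1 \<le> u \<and> u < n}" by auto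
  ultimately have "{(i, i + 1) | i. 1 \<le> i \<and> i < n} \<union> {(1, n - i) | i. 1 \<le> i \<and> i \<le> r} \<union> {(n, 1 + j) | j. 1 \<le> j \<and> j \<le> s} =
      {(u, v). (v = Suc u \<and> 1 \<le> u \<and> u < n) \<or> (u = 1 \<and> n - r \<le> v \<and> v < n) \<or> (u = n \<and> 2 \<le> v \<and> v \<le> Suc s)}"
    by (simp only: Un_def mem_Collect_eq split_def disj_assoc)
  then show ?thesis unfolding Gnrs_def graph_of_def symc_def by simp
qed

text \<open>The hub \<open>a\<close> is the vertex 1, the hub \<open>b\<close> is \<open>n\<close>,
  and path positions are shifted by 2. The edges from 1 to \<open>p\<close> and from
  \<open>n\<close> to \<open>q\<close> already belong to the Hamiltonian path, so the parameter r
  counts \<open>Os\<close>, \<open>As\<close> and \<open>q\<close>, and s counts \<open>p\<close>,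
  \<open>Bs\<close> and \<open>Os\<close>.\<close>

lemma fam_edges_giso_Gnrs:
  assumes n: "n = i + k + j + 4" and k: "k \<le> 1" and H: "H = (if ab then Gnrs_plus n (k + j + 1) (i + k + 1) else Gnrs n (k + j + 1) (i + k + 1))"
  shows "giso {0..<n} (symc (set (fam_edges i k j ab))) (pverts H) (parcs H)"
  unfolding giso_def
proof (intro exI[of _ "\<lambda>v. if v = i + k + j + 2 then 1 else if v = i + k + j + 3 then n else v + 2"] conjI ballI)
  let ?f = "\<lambda>v. if v = i + k + j + 2 then 1 else if v = i + k + j + 3 then n else v + 2"
  have pv: "pverts H = {1..n}" unfolding H Gnrs_plus_def add_edge_def Gnrs_def graph_of_def by simp
  have inj: "inj_on ?f {0..<n}" unfolding inj_on_def using n by auto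
  have sub: "?f ` {0..<n} \<subseteq> {1..n}" using n by auto
  have "card (?f ` {0..<n}) = card {1..n}" using card_image[OF inj] by simp
  then have "?f ` {0..<n} = {1..n}" using sub by (intro card_subset_eq) auto
  then show "bij_betw ?f {0..<n} (pverts H)"
    unfolding pv bij_betw_def using inj by blast
  have arcs: "(x, y) \<in> parcs H \<longleftrightarrow> P x y \<or> P y x \<or> (ab \<and> (x = 1 \<and> y = n \<or> x = n \<and> y = 1))"
    if P: "P = (\<lambda>u v. (v = Suc u \<and> 1 \<le> u \<and> u < n) \<or> (u = 1 \<and> i + 3 \<le> v \<and> v < n) \<or> (u = n \<and> 2 \<le> v \<and> v \<le> i + k + 2))"
    for x y P
  proof -
    have e: "n - (k + j + 1) = i + 3" "n \<ge> 3" "k + j + 1 \<le> n - 3" "Suc (i + k + 1) = i + k + 2" using n by simp_all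
    have "(x, y) \<in> parcs (Gnrs n (k + j + 1) (i + k + 1)) \<longleftrightarrow> P x y \<or> P y x"
      unfolding Gnrs_arcs[OF e(2,3)] symc_iff mem_Collect_eq prod.case e(1,4) P by blast
    then show ?thesis unfolding H Gnrs_plus_def add_edge_def by auto
  qed
  fix u v assume "u \<in> {0..<n}" "v \<in> {0..<n}"
  then have uv: "u < i + k + j + 4" "v < i + k + j + 4" using n by auto
  show "(u, v) \<in> symc (set (fam_edges i k j ab)) \<longleftrightarrow> (?f u, ?f v) \<in> parcs H"
    unfolding arcs[OF HOL.refl] symc_iff adj_fam_edges Let_def n using uv
    by (cases ab; simp split del: if_split; cases "u = i + k + j + 2"; cases "u = i + k + j + 3"; cases "v = i + k + j + 2"; cases "v = i + k + j + 3";
        simp; presburger)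
qed

text \<open>Degree at least 3 makes a graph on four vertices complete, and
  \<open>fam_edges 0 0 0 True\<close> is the complete graph.\<close>

lemma base_4:
  assumes "sgraph V E" "con3 V E" "card V = 4"
  shows "giso V E {0..<4} (symc (set (fam_edges 0 0 0 True)))"
proof -
  note S = sgraphD[OF assms(1)]
  obtain f where f: "bij_betw f V {0..<4::nat}" using ex_bij_betw_finite_nat[OF S(1)] assms(3) by auto
  have E: "(u, v) \<in> E \<longleftrightarrow> u \<noteq> v" if "u \<in> V" "v \<in> V" for u v
  proof -
    have "E `` {u} \<subseteq> V - {u}" using S(3,5) by blast
    moreover have "card (V - {u}) = 3" using assms(3) that(1) S(1) by simp
    ultimately have "E `` {u} = V - {u}"
      using con3_deg[OF assms(2,1) that(1)] S(1) by (intro card_seteq) auto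
    then show ?thesis using that by blast
  qed
  have "list_all (\<lambda>a. list_all (\<lambda>b. adj (fam_edges 0 0 0 True) a b = (a \<noteq> b)) [0..<4]) [0..<4]" by code_simp
  then have Q: "(a, b) \<in> symc (set (fam_edges 0 0 0 True)) \<longleftrightarrow> a \<noteq> b" if "a < 4" "b < 4" for a b
    using that unfolding list_all_iff adj_iff by auto
  show ?thesis unfolding giso_def
  proof (intro exI[of _ f] conjI ballI f)
    fix u v assume uv: "u \<in> V" "v \<in> V"
    then have "f u < 4" "f v < 4" using f by (auto simp: bij_betw_def)
    moreover have "f u = f v \<longleftrightarrow> u = v" using f uv by (auto simp: bij_betw_def dest: inj_onD)
    ultimately show "(u, v) \<in> E \<longleftrightarrow> (f u, f v) \<in> symc (set (fam_edges 0 0 0 True))" using E[OF uv] Q by auto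
  qed
qed

text \<open>One vertex more: a contractible edge is contracted, the result is recognised in
  \<open>L\<close>, and the certificates for its splits identify the graph in
  \<open>L'\<close>.\<close>

lemma base_step:
  assumes prev: "\<And>(W :: 'a set) F. sgraph W F \<Longrightarrow> con3 W F \<Longrightarrow> \<not> K24 F \<Longrightarrow> card W = n \<Longrightarrow>
      \<exists>Q\<in>set L. giso W F {0..<n} (symc (set Q))"
    and chk: "\<And>Q. Q \<in> set L \<Longrightarrow> \<exists>ts. graph_check False n L' Q ts" and n: "n \<ge> 4"
    and V: "sgraph V E" "con3 V E" "\<not> K24 E" "card V = Suc n"
  shows "\<exists>Q\<in>set L'. giso (V :: 'a set) E {0..<Suc n} (symc (set Q))"
proof -
  note S = sgraphD[OF V(1)]
  obtain x y where xy: "(x, y) \<in> E" "con3 (V - {x}) (contr E x y)"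
    using contractible_edge[OF V(2,1)] V(4) n by auto
  have xV: "x \<in> V" "y \<in> V" "x \<noteq> y" using S(2,3,5) xy(1) by metis+
  have "\<not> K24 (contr E x y)" using K24_contr[OF V(1) xy(1)] V(3) by blast
  moreover have "card (V - {x}) = n" using V(4) xV(1) S(1) by simp
  ultimately obtain Q where Q: "Q \<in> set L" "giso (V - {x}) (contr E x y) {0..<n} (symc (set Q))"
    using prev[OF sgraph_contr[OF V(1) xV(2,3)] xy(2)] by blast
  obtain ts where "graph_check False n L' Q ts" using chk[OF Q(1)] by blast
  then have "good False L' V E" using split_sound[OF V(1,2) xy(1) Q(2)] by blast
  then show ?thesis using V(3,4) unfolding good_def by simp
qed

section \<open>Graphs on at most eight vertices\<close>

definition fam4 :: "edges list" where
  "fam4 = [fam_edges 0 0 0 True]"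

definition fam5 :: "edges list" where
  "fam5 = [fam_edges 0 0 1 True, fam_edges 0 1 0 True, e_K5]"

text \<open>Reversal allows \<open>i\<close> to be at most \<open>j\<close>. The graph
  \<open>fam_edges 0 1 1 False\<close> appears as \<open>fam_edges 1 0 1 True\<close>, of which it
  is a copy by \<open>is_fam_small_b\<close>.\<close>

definition fam6 :: "edges list" where
  "fam6 = [fam_edges 0 0 2 True, fam_edges 1 0 1 True, fam_edges 1 0 1 False, fam_edges 0 1 1 True, e_K33, e_A, e_A_plus]"

definition fam7 :: "edges list" where
  "fam7 = [fam_edges 0 0 3 True, fam_edges 1 0 2 True, fam_edges 1 0 2 False, fam_edges 0 1 2 True, fam_edges 1 1 1 True, fam_edges 1 1 1 False, e_B, e_B_plus, e_D]"

definition fam8 :: "edges list" where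
  "fam8 = [fam_edges 0 0 4 True, fam_edges 1 0 3 True, fam_edges 1 0 3 False, fam_edges 2 0 2 True, fam_edges 2 0 2 False, fam_edges 0 1 3 True, fam_edges 0 1 3 False, fam_edges 1 1 2 True, fam_edges 1 1 2 False, e_C, e_C_plus]"

section \<open>Splits of the graphs on four to seven vertices\<close>

lemma check_4_0: "graph_check False 4 fam5 (fam_edges 0 0 0 True) [
     Br 4 1 (Br 0 2 (Br 4 2 (Br 0 3 (Br 4 3 (I 2 [0,1,2,3,4]) (I 1 [1,3,4,0,2])) (I 1 [0,1,3,2,4])) (Br 4 3 (Br 0 3 (I 1 [1,3,0,4,2]) (I 0
     [0,3,1,2,4])) (D 4))) (Br 0 3 (Br 4 3 (I 1 [0,1,2,3,4]) (I 0 [0,3,2,1,4])) (D 0))) (Br 4 2 (Br 4 3 (Br 0 2 (Br 0 3 (I 1 [1,0,3,4,2]) (I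
     0 [0,1,3,2,4])) (Br 0 3 (I 0 [0,1,2,3,4]) (D 0))) (D 4)) (D 4)),
     Br 4 0 (Br 1 2 (Br 4 2 (Br 1 3 (Br 4 3 (I 2 [0,1,2,3,4]) (I 1 [1,3,4,0,2])) (I 1 [1,0,3,2,4])) (Br 4 3 (Br 1 3 (I 1 [1,3,0,4,2]) (I 0
     [3,0,1,2,4])) (D 4))) (Br 1 3 (Br 4 3 (I 1 [1,0,2,3,4]) (I 0 [3,0,2,1,4])) (D 1))) (Br 4 2 (Br 4 3 (Br 1 2 (Br 1 3 (I 1 [0,1,3,4,2]) (I
     0 [0,1,3,4,2])) (Br 1 3 (I 0 [0,1,4,3,2]) (D 1))) (D 4)) (D 4)),
     Br 4 0 (Br 2 1 (Br 4 1 (Br 2 3 (Br 4 3 (I 2 [0,1,2,3,4]) (I 1 [1,3,4,0,2])) (I 1 [1,3,0,2,4])) (Br 4 3 (Br 2 3 (I 1 [1,0,3,4,2]) (I 0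
     [3,0,1,4,2])) (D 4))) (Br 2 3 (Br 4 3 (I 1 [1,0,2,3,4]) (I 0 [3,0,2,1,4])) (D 2))) (Br 4 1 (Br 4 3 (Br 2 1 (Br 2 3 (I 1 [0,1,3,4,2]) (I
     0 [0,3,1,4,2])) (Br 2 3 (I 0 [0,1,4,3,2]) (D 2))) (D 4)) (D 4)),
     Br 4 0 (Br 3 1 (Br 4 1 (Br 3 2 (Br 4 2 (I 2 [0,1,2,3,4]) (I 1 [1,3,0,4,2])) (I 1 [1,3,0,2,4])) (Br 4 2 (Br 3 2 (I 1 [1,0,3,4,2]) (I 0
     [3,0,1,4,2])) (D 4))) (Br 3 2 (Br 4 2 (I 1 [1,0,3,2,4]) (I 0 [3,0,1,2,4])) (D 3))) (Br 4 1 (Br 4 2 (Br 3 1 (Br 3 2 (I 1 [0,1,3,4,2]) (I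
     0 [0,3,1,4,2])) (Br 3 2 (I 0 [0,1,3,4,2]) (D 3))) (D 4)) (D 4))]"
  by code_simp

lemma check_5_0: "graph_check False 5 fam6 (fam_edges 0 0 1 True) [
     Br 5 1 (Br 0 3 (Br 5 3 (Br 0 4 (Br 5 4 (K [1] [4]) (I 3 [1,5,3,4,2,0])) (I 3 [0,1,2,4,3,5])) (Br 5 4 (Br 0 4 (K [1] [4]) (I 1
     [0,5,3,4,2,1])) (D 5))) (Br 0 4 (Br 5 4 (K [1] [4]) (I 1 [1,5,3,4,2,0])) (D 0))) (Br 5 3 (Br 5 4 (Br 0 3 (Br 0 4 (I 3 [1,2,3,4,5,0]) (I
     0 [0,1,2,4,3,5])) (Br 0 4 (I 1 [1,2,3,4,5,0]) (D 0))) (D 5)) (D 5)),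
     Br 5 0 (Br 1 2 (Br 5 2 (K [0] [2]) (Br 5 3 (Br 1 3 (I 3 [1,5,3,4,2,0]) (I 1 [4,2,1,5,0,3])) (D 5))) (Br 1 3 (Br 5 3 (I 3 [1,0,3,4,2,5])
     (I 1 [4,3,1,5,0,2])) (D 1))) (Br 5 2 (Br 5 3 (Br 1 2 (Br 1 3 (I 3 [2,1,5,4,3,0]) (I 1 [1,2,4,5,0,3])) (Br 1 3 (I 0 [0,1,3,4,5,2]) (D
     1))) (D 5)) (D 5)),
     Br 5 1 (Br 2 3 (Br 5 3 (Br 2 4 (Br 5 4 (K [1] [4]) (I 3 [2,1,5,4,3,0])) (I 3 [2,1,0,4,3,5])) (Br 5 4 (Br 2 4 (K [1] [4]) (I 1
     [0,4,3,5,1,2])) (D 5))) (Br 2 4 (Br 5 4 (K [1] [4]) (I 1 [0,4,2,5,1,3])) (D 2))) (Br 5 3 (Br 5 4 (Br 2 3 (Br 2 4 (I 3 [2,3,5,4,1,0]) (I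
     0 [0,1,2,4,5,3])) (Br 2 4 (I 1 [0,1,2,5,4,3]) (D 2))) (D 5)) (D 5)),
     Br 5 0 (Br 3 1 (Br 5 1 (Br 3 2 (Br 5 2 (K [0] [2]) (Br 3 4 (Br 5 4 (K [1] [4]) (I 3 [1,5,3,4,2,0])) (I 6 [0,3,2,4,5,1]))) (Br 3 4 (Br 5
     4 (K [1] [4]) (I 6 [0,3,2,1,5,4])) (I 3 [1,5,3,0,2,4]))) (Br 3 2 (Br 5 2 (K [0] [2]) (Br 5 4 (Br 3 4 (I 3 [1,2,3,4,5,0]) (I 1
     [4,0,1,5,2,3])) (D 5))) (Br 3 4 (Br 5 4 (I 6 [0,5,2,1,3,4]) (I 5 [0,3,2,1,4,5])) (I 1 [4,2,1,3,0,5])))) (Br 3 2 (Br 5 2 (K [0] [2]) (Br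
     3 4 (Br 5 4 (I 6 [0,5,2,3,4,1]) (I 1 [4,2,1,5,0,3])) (I 5 [0,3,2,4,5,1]))) (Br 3 4 (Br 5 4 (I 3 [1,2,3,0,5,4]) (I 1 [4,0,1,3,2,5])) (D
     3)))) (Br 3 1 (Br 5 1 (Br 3 2 (Br 5 2 (Br 3 4 (Br 5 4 (K [1] [4]) (I 3 [2,1,5,4,3,0])) (I 6 [2,3,0,4,5,1])) (Br 5 4 (Br 3 4 (K [1] [4])
     (I 5 [3,0,4,1,2,5])) (D 5))) (Br 3 4 (Br 5 4 (K [1] [4]) (I 1 [0,4,2,5,1,3])) (I 1 [1,5,3,0,2,4]))) (Br 5 2 (Br 5 4 (Br 3 2 (Br 3 4 (I
     3 [2,3,5,4,1,0]) (I 1 [1,0,4,5,2,3])) (Br 3 4 (I 1 [0,1,2,5,4,3]) (I 2 [0,1,2,5,4,3]))) (D 5)) (D 5))) (Br 3 2 (Br 5 2 (Br 3 4 (Br 5 4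
     (I 6 [2,5,0,3,4,1]) (I 1 [1,2,4,5,0,3])) (I 5 [2,3,0,4,5,1])) (Br 5 4 (Br 3 4 (I 5 [3,2,4,0,1,5]) (I 4 [0,3,1,4,5,2])) (D 5))) (Br 3 4
     (Br 5 4 (I 1 [1,2,3,0,5,4]) (I 2 [0,4,2,5,1,3])) (D 3)))),
     Br 5 0 (Br 4 2 (Br 5 2 (K [0] [2]) (Br 5 3 (Br 4 3 (I 3 [1,2,3,4,5,0]) (I 1 [4,0,1,5,2,3])) (D 5))) (Br 4 3 (Br 5 3 (I 3 [1,2,3,4,0,5])
     (I 1 [4,0,1,5,3,2])) (D 4))) (Br 5 2 (Br 5 3 (Br 4 2 (Br 4 3 (I 3 [2,3,5,4,1,0]) (I 1 [1,0,4,5,2,3])) (Br 4 3 (I 0 [0,1,2,4,5,3]) (D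
     4))) (D 5)) (D 5))]"
  by code_simp

lemma check_5_1: "graph_check False 5 fam6 (fam_edges 0 1 0 True) [
     Br 5 1 (Br 0 3 (Br 5 3 (K [1] [3]) (Br 5 4 (Br 0 4 (K [1] [4]) (I 3 [2,4,0,1,5,3])) (D 5))) (Br 0 4 (Br 5 4 (K [1] [4]) (I 3 [2,4,0,5,1,3]))
     (D 0))) (Br 5 3 (Br 5 4 (Br 0 3 (Br 0 4 (K [3] [4]) (I 3 [2,1,0,4,5,3])) (Br 0 4 (I 3 [2,1,0,5,4,3]) (D 0))) (D 5)) (D 5)),
     Br 5 0 (Br 1 2 (Br 5 2 (K [0] [2]) (Br 1 3 (Br 1 4 (Br 5 3 (K [1] [3]) (Br 5 4 (K [1] [4]) (D 5))) (K [1] [4])) (Br 1 4 (K [1] [3]) (I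
     6 [0,5,2,3,4,1])))) (Br 1 3 (Br 1 4 (Br 5 3 (K [4] [5]) (Br 5 4 (K [3] [5]) (I 6 [0,1,2,3,4,5]))) (K [3] [5])) (Br 1 4 (K [4] [5]) (D
     1)))) (Br 1 2 (Br 5 2 (Br 1 3 (Br 1 4 (Br 5 3 (K [1] [3]) (Br 5 4 (K [1] [4]) (D 5))) (K [1] [4])) (Br 1 4 (K [1] [3]) (I 6
     [2,5,0,3,4,1]))) (Br 5 3 (Br 1 4 (K [1] [3]) (Br 1 3 (K [1] [4]) (I 5 [3,2,4,0,1,5]))) (D 5))) (Br 1 3 (Br 5 3 (Br 1 4 (Br 5 4 (K [3]
     [4]) (I 3 [0,1,3,4,5,2])) (I 3 [2,3,0,4,1,5])) (Br 5 4 (Br 1 4 (I 3 [0,1,3,5,4,2]) (I 1 [0,1,3,5,4,2])) (D 5))) (Br 1 4 (Br 5 4 (I 3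
     [2,3,0,1,4,5]) (I 1 [0,1,3,4,5,2])) (D 1)))),
     Br 5 1 (Br 2 3 (Br 5 3 (K [1] [3]) (Br 5 4 (Br 2 4 (K [1] [4]) (I 3 [0,4,2,1,5,3])) (D 5))) (Br 2 4 (Br 5 4 (K [1] [4]) (I 3
     [0,4,2,5,1,3])) (D 2))) (Br 5 3 (Br 5 4 (Br 2 3 (Br 2 4 (K [3] [4]) (I 3 [0,1,2,4,5,3])) (Br 2 4 (I 3 [0,1,2,5,4,3]) (D 2))) (D 5)) (D
     5)),
     Br 5 0 (Br 3 1 (Br 5 1 (Br 3 2 (Br 3 4 (K [1] [3]) (K [3] [4])) (Br 3 4 (K [4] [5]) (K [1] [5]))) (Br 3 2 (Br 5 2 (K [0] [2]) (Br 5 4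
     (K [3] [4]) (D 5))) (Br 3 4 (Br 5 4 (K [1] [5]) (I 6 [0,3,2,1,4,5])) (K [1] [5])))) (Br 3 2 (Br 5 2 (K [0] [2]) (Br 3 4 (K [1] [3]) (I
     6 [0,3,2,5,4,1]))) (Br 3 4 (K [4] [5]) (D 3)))) (Br 3 1 (Br 5 1 (Br 3 2 (Br 3 4 (K [1] [3]) (K [3] [4])) (Br 3 4 (Br 5 4 (K [1] [4]) (I
     3 [0,4,2,5,1,3])) (I 3 [2,4,0,3,1,5]))) (Br 5 2 (Br 5 4 (Br 3 2 (K [3] [4]) (Br 3 4 (I 3 [0,1,2,5,4,3]) (I 1 [0,5,3,1,4,2]))) (D 5)) (D
     5))) (Br 3 2 (Br 3 4 (K [1] [3]) (Br 5 2 (I 6 [2,3,0,5,4,1]) (I 5 [3,0,4,2,1,5]))) (Br 3 4 (Br 5 4 (I 3 [2,1,0,3,4,5]) (I 1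
     [0,4,3,1,5,2])) (D 3)))),
     Br 5 0 (Br 4 1 (Br 5 1 (Br 4 2 (Br 4 3 (K [1] [4]) (K [3] [4])) (Br 4 3 (K [3] [5]) (K [1] [5]))) (Br 4 2 (Br 5 2 (K [0] [2]) (Br 5 3
     (K [3] [4]) (D 5))) (Br 4 3 (Br 5 3 (K [1] [5]) (I 6 [0,3,2,4,1,5])) (K [1] [5])))) (Br 4 2 (Br 5 2 (K [0] [2]) (Br 4 3 (K [1] [4]) (I
     6 [0,3,2,4,5,1]))) (Br 4 3 (K [3] [5]) (D 4)))) (Br 4 1 (Br 5 1 (Br 4 2 (Br 4 3 (K [1] [4]) (K [3] [4])) (Br 4 3 (Br 5 3 (K [1] [3]) (I
     3 [0,4,2,1,5,3])) (I 3 [2,4,0,1,3,5]))) (Br 5 2 (Br 5 3 (Br 4 2 (K [3] [4]) (Br 4 3 (I 3 [0,1,2,4,5,3]) (I 1 [0,5,3,4,1,2]))) (D 5)) (D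
     5))) (Br 4 2 (Br 4 3 (K [1] [4]) (Br 5 2 (I 6 [2,3,0,4,5,1]) (I 5 [3,0,4,1,2,5]))) (Br 4 3 (Br 5 3 (I 3 [2,1,0,4,3,5]) (I 1
     [0,4,3,5,1,2])) (D 4))))]"
  by code_simp

lemma check_K5: "graph_check False 5 fam6 (e_K5) [
     Br 5 1 (Br 0 2 (Br 5 2 (K [1] [2]) (Br 0 3 (Br 0 4 (K [0] [1]) (K [0] [4])) (Br 0 4 (K [0] [3]) (K [2] [5])))) (Br 0 3 (Br 0 4 (K [0] [2])
     (K [3] [5])) (Br 0 4 (K [4] [5]) (D 0)))) (Br 0 2 (Br 5 2 (Br 0 3 (Br 0 4 (K [0] [2]) (K [0] [4])) (Br 0 4 (K [0] [3]) (K [1] [5])))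
     (Br 5 3 (Br 0 4 (K [0] [3]) (Br 0 3 (K [0] [4]) (I 6 [2,3,4,0,1,5]))) (D 5))) (Br 0 3 (Br 0 4 (K [0] [2]) (Br 5 3 (K [1] [5]) (I 6
     [2,3,0,4,1,5]))) (Br 0 4 (Br 5 4 (K [1] [5]) (I 6 [2,3,0,1,4,5])) (D 0)))),
     Br 5 0 (Br 1 2 (Br 5 2 (K [0] [2]) (Br 1 3 (Br 1 4 (K [0] [1]) (K [1] [4])) (Br 1 4 (K [1] [3]) (K [2] [5])))) (Br 1 3 (Br 1 4 (K [1]
     [2]) (K [3] [5])) (Br 1 4 (K [4] [5]) (D 1)))) (Br 1 2 (Br 5 2 (Br 1 3 (Br 1 4 (K [1] [2]) (K [1] [4])) (Br 1 4 (K [1] [3]) (K [0]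
     [5]))) (Br 5 3 (Br 1 4 (K [1] [3]) (Br 1 3 (K [1] [4]) (I 6 [0,5,1,3,4,2]))) (D 5))) (Br 1 3 (Br 1 4 (K [1] [2]) (Br 5 3 (K [0] [5]) (I
     6 [0,5,3,1,4,2]))) (Br 1 4 (Br 5 4 (K [0] [5]) (I 6 [0,5,3,4,1,2])) (D 1)))),
     Br 5 0 (Br 2 1 (Br 5 1 (K [0] [1]) (Br 2 3 (Br 2 4 (K [0] [2]) (K [2] [4])) (Br 2 4 (K [2] [3]) (K [1] [5])))) (Br 2 3 (Br 2 4 (K [1]
     [2]) (K [3] [5])) (Br 2 4 (K [4] [5]) (D 2)))) (Br 2 1 (Br 5 1 (Br 2 3 (Br 2 4 (K [1] [2]) (K [2] [4])) (Br 2 4 (K [2] [3]) (K [0]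
     [5]))) (Br 5 3 (Br 2 4 (K [2] [3]) (Br 2 3 (K [2] [4]) (I 6 [0,1,5,3,4,2]))) (D 5))) (Br 2 3 (Br 2 4 (K [1] [2]) (Br 5 3 (K [0] [5]) (I
     6 [0,3,5,1,4,2]))) (Br 2 4 (Br 5 4 (K [0] [5]) (I 6 [0,3,5,4,1,2])) (D 2)))),
     Br 5 0 (Br 3 1 (Br 5 1 (K [0] [1]) (Br 3 2 (Br 3 4 (K [0] [3]) (K [3] [4])) (Br 3 4 (K [2] [3]) (K [1] [5])))) (Br 3 2 (Br 3 4 (K [1]
     [3]) (K [2] [5])) (Br 3 4 (K [4] [5]) (D 3)))) (Br 3 1 (Br 5 1 (Br 3 2 (Br 3 4 (K [1] [3]) (K [3] [4])) (Br 3 4 (K [2] [3]) (K [0]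
     [5]))) (Br 5 2 (Br 3 4 (K [2] [3]) (Br 3 2 (K [3] [4]) (I 6 [0,1,3,5,4,2]))) (D 5))) (Br 3 2 (Br 3 4 (K [1] [3]) (Br 5 2 (K [0] [5]) (I
     6 [0,3,1,5,4,2]))) (Br 3 4 (Br 5 4 (K [0] [5]) (I 6 [0,3,4,5,1,2])) (D 3)))),
     Br 5 0 (Br 4 1 (Br 5 1 (K [0] [1]) (Br 4 2 (Br 4 3 (K [0] [4]) (K [3] [4])) (Br 4 3 (K [2] [4]) (K [1] [5])))) (Br 4 2 (Br 4 3 (K [1]
     [4]) (K [2] [5])) (Br 4 3 (K [3] [5]) (D 4)))) (Br 4 1 (Br 5 1 (Br 4 2 (Br 4 3 (K [1] [4]) (K [3] [4])) (Br 4 3 (K [2] [4]) (K [0]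
     [5]))) (Br 5 2 (Br 4 3 (K [2] [4]) (Br 4 2 (K [3] [4]) (I 6 [0,1,3,4,5,2]))) (D 5))) (Br 4 2 (Br 4 3 (K [1] [4]) (Br 5 2 (K [0] [5]) (I
     6 [0,3,1,4,5,2]))) (Br 4 3 (Br 5 3 (K [0] [5]) (I 6 [0,3,4,1,5,2])) (D 4))))]"
  by code_simp

lemma check_6_0: "graph_check False 6 fam7 (fam_edges 0 0 2 True) [
     Br 6 1 (Br 0 4 (Br 6 4 (Br 0 5 (Br 6 5 (K [5] [1,2]) (I 3 [1,6,4,3,5,2,0])) (I 3 [0,1,2,3,5,4,6])) (Br 6 5 (Br 0 5 (K [5] [1,2]) (I 1
     [0,6,4,3,5,2,1])) (D 6))) (Br 0 5 (Br 6 5 (K [5] [1,2]) (I 1 [1,6,4,3,5,2,0])) (D 0))) (Br 6 4 (Br 6 5 (Br 0 4 (Br 0 5 (I 3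
     [1,2,3,4,5,6,0]) (I 0 [0,1,2,3,5,4,6])) (Br 0 5 (I 1 [1,2,3,4,5,6,0]) (D 0))) (D 6)) (D 6)),
     Br 6 0 (Br 1 2 (Br 6 2 (K [0] [2,3]) (Br 6 4 (Br 1 4 (I 3 [1,6,4,3,5,2,0]) (I 1 [6,1,2,3,5,4,0])) (D 6))) (Br 1 4 (Br 6 4 (I 3
     [1,0,4,3,5,2,6]) (I 1 [6,0,2,3,5,4,1])) (D 1))) (Br 6 2 (Br 6 4 (Br 1 2 (Br 1 4 (I 3 [2,1,6,4,5,3,0]) (I 1 [2,1,6,4,5,3,0])) (Br 1 4 (I
     0 [0,1,3,4,5,6,2]) (D 1))) (D 6)) (D 6)),
     Br 6 1 (Br 2 3 (Br 6 3 (K [3] [0,1]) (Br 6 4 (Br 2 4 (I 3 [2,1,6,4,5,3,0]) (I 1 [4,6,1,2,5,3,0])) (D 6))) (Br 2 4 (Br 6 4 (I 3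
     [2,1,0,4,5,3,6]) (I 1 [4,6,0,2,5,3,1])) (D 2))) (Br 6 3 (Br 6 4 (Br 2 3 (Br 2 4 (I 3 [3,2,1,6,5,4,0]) (I 1 [3,2,1,6,5,4,0])) (Br 2 4 (I
     0 [0,1,2,4,5,6,3]) (D 2))) (D 6)) (D 6)),
     Br 6 2 (Br 3 4 (Br 6 4 (Br 3 5 (Br 6 5 (K [5] [1,2]) (I 3 [3,2,1,6,5,4,0])) (I 3 [3,2,1,0,5,4,6])) (Br 6 5 (Br 3 5 (K [5] [1,2]) (I 1
     [3,4,6,0,5,2,1])) (D 6))) (Br 3 5 (Br 6 5 (K [5] [1,2]) (I 1 [3,4,6,1,5,2,0])) (D 3))) (Br 6 4 (Br 6 5 (Br 3 4 (Br 3 5 (I 3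
     [2,3,4,6,5,1,0]) (I 0 [0,1,2,3,5,6,4])) (Br 3 5 (I 1 [4,3,2,1,5,6,0]) (D 3))) (D 6)) (D 6)),
     Br 6 0 (Br 4 1 (Br 6 1 (Br 4 2 (Br 6 2 (K [0] [2,3]) (Br 4 3 (Br 6 3 (K [3] [0,1]) (Br 4 5 (Br 6 5 (K [5] [1,2]) (I 3 [1,6,4,3,5,2,0]))
     (K [1] [3,5]))) (K [0] [2,3]))) (Br 4 3 (K [0] [2,3]) (Br 4 5 (K [1] [3,5]) (I 3 [1,6,4,3,0,2,5])))) (Br 4 2 (Br 6 2 (K [0] [2,3]) (Br
     4 3 (Br 6 3 (K [3] [0,1]) (Br 6 5 (Br 4 5 (I 3 [1,2,3,4,5,6,0]) (I 1 [6,4,3,2,5,1,0])) (D 6))) (K [0] [2,3]))) (Br 4 3 (K [0] [2,3])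
     (Br 4 5 (Br 6 5 (K [5] [1,2]) (I 7 [3,5,2,1,4,6,0])) (I 1 [6,1,2,3,0,4,5]))))) (Br 4 2 (Br 6 2 (K [0] [2,3]) (Br 4 3 (Br 6 3 (K [3]
     [0,1]) (Br 4 5 (Br 6 5 (K [5] [1,2]) (I 1 [6,1,2,3,5,4,0])) (I 7 [3,5,2,1,0,6,4]))) (K [0] [2,3]))) (Br 4 3 (K [0] [2,3]) (Br 4 5 (Br 6
     5 (I 3 [1,2,3,4,0,6,5]) (I 1 [6,4,3,2,0,1,5])) (D 4))))) (Br 4 1 (Br 6 1 (Br 4 2 (Br 6 2 (Br 4 5 (Br 4 3 (Br 6 3 (K [3] [0,1]) (Br 6 5
     (K [5] [1,2]) (I 3 [2,1,6,4,5,3,0]))) (K [1] [3,5])) (K [2] [0,5])) (Br 4 3 (Br 6 3 (K [3] [0,1]) (Br 6 5 (K [1] [3,5]) (D 6))) (Br 4 5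
     (K [1] [3,5]) (I 7 [5,3,6,1,4,2,0])))) (Br 4 3 (Br 6 3 (K [3] [0,1]) (Br 4 5 (Br 6 5 (K [5] [1,2]) (I 1 [4,6,1,2,5,3,0])) (K [1]
     [3,5]))) (Br 4 5 (K [1] [3,5]) (I 1 [1,6,4,3,0,2,5])))) (Br 4 2 (Br 6 2 (Br 4 5 (Br 6 5 (K [5] [1,2]) (Br 6 3 (Br 4 3 (I 3
     [3,2,1,6,5,4,0]) (I 1 [3,4,6,1,5,2,0])) (D 6))) (K [2] [0,5])) (Br 6 3 (Br 6 5 (Br 4 3 (Br 4 5 (I 3 [2,3,4,6,5,1,0]) (I 1
     [2,3,4,6,5,1,0])) (Br 4 5 (I 1 [4,3,2,1,5,6,0]) (I 2 [2,3,4,6,5,1,0]))) (D 6)) (D 6))) (Br 4 3 (Br 6 3 (Br 4 5 (Br 6 5 (K [5] [1,2]) (I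
     1 [3,2,1,6,5,4,0])) (I 7 [1,2,5,3,0,6,4])) (Br 6 5 (Br 4 5 (K [5] [1,2]) (I 6 [1,2,5,3,0,6,4])) (D 6))) (Br 4 5 (Br 6 5 (K [5] [1,2])
     (I 2 [3,2,1,6,5,4,0])) (I 2 [1,6,4,3,0,2,5]))))) (Br 4 2 (Br 6 2 (Br 4 5 (Br 6 5 (K [5] [1,2]) (Br 4 3 (Br 6 3 (K [3] [0,1]) (I 1
     [2,1,6,4,5,3,0])) (I 7 [1,6,3,5,0,2,4]))) (K [2] [0,5])) (Br 4 3 (Br 6 3 (K [3] [0,1]) (Br 6 5 (Br 4 5 (K [5] [1,2]) (I 6
     [3,5,2,1,0,6,4])) (D 6))) (Br 4 5 (Br 6 5 (K [5] [1,2]) (I 6 [1,6,3,5,0,2,4])) (I 6 [5,3,6,1,4,2,0])))) (Br 4 3 (Br 6 3 (K [3] [0,1])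
     (Br 4 5 (Br 6 5 (I 7 [5,2,1,6,3,4,0]) (I 2 [2,1,6,4,5,3,0])) (I 6 [5,2,1,6,3,4,0]))) (Br 4 5 (Br 6 5 (I 1 [1,2,3,4,0,6,5]) (I 2
     [1,2,3,4,0,6,5])) (D 4))))),
     Br 6 0 (Br 5 3 (Br 6 3 (K [3] [0,1]) (Br 6 4 (Br 5 4 (I 3 [1,2,3,4,5,6,0]) (I 1 [6,4,3,2,5,1,0])) (D 6))) (Br 5 4 (Br 6 4 (I 3
     [1,2,3,4,5,0,6]) (I 1 [6,4,3,2,5,0,1])) (D 5))) (Br 6 3 (Br 6 4 (Br 5 3 (Br 5 4 (I 3 [2,3,4,6,5,1,0]) (I 1 [2,3,4,6,5,1,0])) (Br 5 4 (I
     0 [0,1,2,3,5,6,4]) (D 5))) (D 6)) (D 6))]"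
  by code_simp

lemma check_6_1: "graph_check False 6 fam7 (fam_edges 1 0 1 True) [
     Br 6 1 (Br 0 4 (Br 6 4 (K [1] [4]) (Br 6 5 (Br 0 5 (K [5] [1,2]) (I 5 [0,6,4,3,5,2,1])) (D 6))) (Br 0 5 (Br 6 5 (K [5] [1,2]) (I 5
     [1,6,4,3,5,2,0])) (D 0))) (Br 6 4 (Br 6 5 (Br 0 4 (K [4] [1,5]) (Br 0 5 (I 1 [3,2,1,0,6,5,4]) (D 0))) (D 6)) (D 6)),
     Br 6 0 (Br 1 2 (Br 6 2 (K [0] [2,3]) (Br 6 5 (K [5] [1,2]) (D 6))) (Br 1 5 (K [5] [2,6]) (D 1))) (Br 6 2 (Br 6 5 (Br 1 2 (K [5] [1,2])
     (Br 1 5 (I 1 [4,3,1,0,6,5,2]) (D 1))) (D 6)) (D 6)),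
     Br 6 1 (Br 2 3 (Br 6 3 (K [3] [0,1]) (Br 6 4 (K [4] [1,2]) (D 6))) (Br 2 4 (K [1] [3,4]) (D 2))) (Br 6 3 (Br 6 4 (Br 2 3 (K [4] [1,2])
     (Br 2 4 (I 1 [0,1,2,4,5,6,3]) (D 2))) (D 6)) (D 6)),
     Br 6 2 (Br 3 4 (Br 6 4 (K [4] [1,2]) (Br 6 5 (Br 3 5 (K [2] [5]) (I 5 [1,0,5,3,2,6,4])) (D 6))) (Br 3 5 (Br 6 5 (K [2] [5]) (I 5
     [1,0,5,4,2,6,3])) (D 3))) (Br 6 4 (Br 6 5 (Br 3 5 (K [5] [2,4]) (Br 3 4 (I 1 [0,1,2,3,5,6,4]) (D 3))) (D 6)) (D 6)),
     Br 6 0 (Br 4 2 (Br 6 2 (K [0] [2,3]) (Br 4 3 (Br 6 3 (K [3] [0,1]) (Br 6 5 (K [5] [2,4]) (D 6))) (K [0] [2,3]))) (Br 4 3 (K [0] [2,3])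
     (Br 4 5 (K [6] [1,5]) (D 4)))) (Br 4 2 (Br 4 5 (Br 6 5 (K [5] [2,4]) (Br 6 2 (Br 4 3 (K [4] [1,2]) (I 5 [1,0,5,4,2,6,3])) (D 6))) (K
     [5] [2,4])) (Br 4 3 (Br 4 5 (K [4] [1,2]) (Br 6 3 (I 7 [1,2,5,3,6,0,4]) (I 6 [1,2,5,3,6,0,4]))) (Br 4 5 (Br 6 5 (I 1 [3,2,1,0,4,5,6])
     (I 2 [3,2,1,0,4,5,6])) (D 4)))),
     Br 6 0 (Br 5 1 (Br 6 1 (Br 5 3 (Br 5 4 (K [5] [1,2]) (K [5] [2,4])) (Br 5 4 (K [6] [2,4]) (K [6] [1,2]))) (Br 5 3 (Br 6 3 (K [3] [0,1])
     (Br 6 4 (K [5] [2,4]) (D 6))) (Br 5 4 (Br 6 4 (K [6] [1,2]) (I 7 [3,5,2,1,0,4,6])) (K [6] [1,2])))) (Br 5 3 (Br 6 3 (K [3] [0,1]) (Br 5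
     4 (K [5] [1,2]) (I 7 [3,5,2,1,0,6,4]))) (Br 5 4 (K [6] [2,4]) (D 5)))) (Br 5 1 (Br 6 1 (Br 5 3 (Br 5 4 (K [5] [1,2]) (K [5] [2,4])) (Br
     5 4 (K [1] [3,4]) (I 5 [0,6,4,3,5,1,2]))) (Br 6 3 (Br 6 4 (Br 5 3 (K [5] [2,4]) (Br 5 4 (I 1 [0,1,2,3,5,6,4]) (I 2 [0,1,2,3,5,6,4])))
     (D 6)) (D 6))) (Br 5 3 (Br 6 3 (K [3] [0,1]) (Br 5 4 (K [5] [1,2]) (I 6 [3,5,2,1,0,6,4]))) (Br 5 4 (K [4] [1,6]) (D 5))))]"
  by code_simp

lemma check_6_2: "graph_check False 6 fam7 (fam_edges 1 0 1 False) [
     Br 6 1 (Br 0 4 (Br 6 4 (K [1] [3,4]) (Br 6 5 (Br 0 5 (I 8 [0,1,4,5,3,2,6]) (I 2 [2,5,0,6,1,4,3])) (D 6))) (Br 0 5 (Br 6 5 (I 8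
     [6,0,3,4,5,1,2]) (I 2 [3,5,0,1,6,2,4])) (D 0))) (Br 6 4 (Br 6 5 (Br 0 4 (K [4] [1,5]) (Br 0 5 (I 2 [3,2,1,0,6,5,4]) (D 0))) (D 6)) (D
     6)),
     Br 6 0 (Br 1 2 (Br 6 2 (K [0] [2,3]) (Br 6 5 (Br 1 5 (I 8 [0,1,4,5,3,2,6]) (I 2 [5,2,1,6,0,4,3])) (D 6))) (Br 1 5 (Br 6 5 (I 8
     [0,6,4,5,3,2,1]) (I 2 [5,3,1,6,0,4,2])) (D 1))) (Br 6 2 (Br 6 5 (Br 1 2 (K [2] [0,5]) (Br 1 5 (I 2 [2,3,6,0,1,5,4]) (D 1))) (D 6)) (D
     6)),
     Br 6 1 (Br 2 3 (Br 6 3 (K [3] [0,1]) (Br 6 4 (K [1] [3,4]) (D 6))) (Br 2 4 (K [1] [3,4]) (D 2))) (Br 6 3 (Br 6 4 (Br 2 3 (Br 2 4 (I 8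
     [3,4,1,2,0,5,6]) (I 2 [1,6,4,5,2,0,3])) (Br 2 4 (I 2 [0,1,2,4,5,6,3]) (D 2))) (D 6)) (D 6)),
     Br 6 2 (Br 3 4 (Br 6 4 (Br 3 5 (Br 6 5 (K [5] [2,4]) (I 8 [3,4,1,2,0,5,6])) (I 8 [3,4,1,6,0,5,2])) (Br 6 5 (Br 3 5 (K [5] [2,4]) (I 2
     [1,0,5,3,2,6,4])) (D 6))) (Br 3 5 (Br 6 5 (K [5] [2,4]) (I 2 [1,0,5,4,2,6,3])) (D 3))) (Br 6 4 (Br 6 5 (Br 3 5 (K [5] [2,4]) (Br 3 4 (I
     2 [0,1,2,3,5,6,4]) (D 3))) (D 6)) (D 6)),
     Br 6 0 (Br 4 2 (Br 6 2 (K [0] [2,3]) (Br 6 3 (K [0] [2,3]) (D 6))) (Br 4 3 (K [0] [2,3]) (D 4))) (Br 6 2 (Br 6 3 (Br 4 2 (Br 4 3 (I 8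
     [3,4,1,2,0,5,6]) (I 2 [1,0,5,4,2,6,3])) (Br 4 3 (I 2 [1,6,4,5,2,0,3]) (D 4))) (D 6)) (D 6)),
     Br 6 0 (Br 5 1 (Br 6 1 (Br 5 3 (Br 6 3 (K [3] [0,1]) (I 8 [0,1,4,5,3,2,6])) (I 8 [0,1,4,5,3,6,2])) (Br 6 3 (Br 5 3 (K [3] [0,1]) (I 2
     [5,2,1,6,0,3,4])) (D 6))) (Br 5 3 (Br 6 3 (K [3] [0,1]) (I 2 [5,2,1,6,0,4,3])) (D 5))) (Br 6 1 (Br 6 3 (Br 5 3 (K [3] [0,1]) (Br 5 1 (I
     2 [2,5,0,6,1,3,4]) (D 5))) (D 6)) (D 6))]"
  by code_simp

lemma check_6_3: "graph_check False 6 fam7 (fam_edges 0 1 1 True) [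
     Br 6 1 (Br 0 4 (Br 6 4 (K [1] [4]) (Br 6 5 (Br 0 5 (K [5] [1,2]) (I 4 [0,6,4,3,5,2,1])) (D 6))) (Br 0 5 (Br 6 5 (K [5] [1,2]) (I 4
     [1,6,4,3,5,2,0])) (D 0))) (Br 6 4 (Br 6 5 (Br 0 4 (K [4] [1,5]) (Br 0 5 (I 4 [1,2,3,4,5,6,0]) (D 0))) (D 6)) (D 6)),
     Br 6 0 (Br 1 2 (Br 6 2 (K [0] [2,3]) (Br 1 5 (Br 1 4 (Br 6 4 (K [1] [4]) (Br 6 5 (K [5] [1,2]) (D 6))) (K [1] [4])) (K [5] [1,2]))) (Br
     1 5 (K [5] [2,6]) (Br 1 4 (K [4] [6]) (D 1)))) (Br 1 2 (Br 1 5 (Br 1 4 (Br 6 4 (K [1] [4]) (Br 6 5 (K [5] [1,2]) (D 6))) (K [1] [4]))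
     (K [5] [1,2])) (Br 1 4 (Br 1 5 (Br 6 5 (K [5] [2,4]) (Br 6 4 (I 3 [0,1,3,4,5,6,2]) (D 6))) (K [4] [5,6])) (Br 1 5 (Br 6 5 (I 4
     [0,1,3,4,5,6,2]) (I 1 [0,1,3,4,5,6,2])) (D 1)))),
     Br 6 1 (Br 2 3 (Br 6 3 (K [1] [3]) (Br 6 4 (K [4] [1,2]) (D 6))) (Br 2 4 (K [1] [3,4]) (D 2))) (Br 6 3 (Br 6 4 (Br 2 3 (K [4] [1,2])
     (Br 2 4 (I 3 [0,1,2,4,5,6,3]) (D 2))) (D 6)) (D 6)),
     Br 6 2 (Br 3 4 (Br 6 4 (K [4] [1,2]) (Br 6 5 (K [4] [5,6]) (D 6))) (Br 3 5 (K [4] [3,5]) (D 3))) (Br 6 4 (Br 3 5 (K [4] [3,5]) (Br 3 4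
     (I 3 [0,1,2,3,5,6,4]) (D 3))) (D 6)),
     Br 6 0 (Br 4 1 (Br 4 3 (Br 6 1 (K [1] [3,4]) (Br 4 2 (Br 6 2 (K [0] [2,3]) (Br 6 3 (K [3] [0,1]) (Br 6 5 (K [4] [5]) (D 6)))) (K [0]
     [2,3]))) (K [1] [3,6])) (Br 4 3 (K [1] [3,4]) (Br 4 2 (K [0] [2,3]) (Br 4 5 (K [5] [6]) (D 4))))) (Br 4 1 (Br 6 1 (Br 4 3 (K [1] [3,4])
     (Br 4 2 (K [4] [3,5]) (Br 4 5 (K [1] [3,5]) (I 4 [1,6,4,3,0,2,5])))) (Br 4 2 (Br 4 3 (Br 6 3 (K [4] [3,5]) (Br 6 5 (K [4] [5]) (D 6)))
     (K [4] [3,5])) (Br 4 3 (Br 4 5 (K [4] [1,2]) (K [4] [5])) (Br 4 5 (Br 6 5 (K [5] [1,2]) (I 8 [6,0,3,4,2,1,5])) (I 5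
     [1,6,4,3,0,2,5]))))) (Br 4 3 (K [1] [3,4]) (Br 4 2 (Br 4 5 (K [1] [4]) (K [5] [2,4])) (Br 4 5 (Br 6 5 (I 4 [1,2,3,4,0,6,5]) (I 5
     [1,2,3,4,0,6,5])) (D 4))))),
     Br 6 0 (Br 5 1 (Br 5 3 (Br 6 1 (K [1] [3,5]) (Br 6 3 (K [3] [0,1]) (Br 6 4 (K [4] [5]) (D 6)))) (K [1] [3,6])) (Br 5 3 (K [1] [3,5])
     (Br 5 4 (K [4] [6]) (D 5)))) (Br 5 1 (Br 6 1 (Br 5 3 (K [1] [3,5]) (Br 5 4 (K [1] [3,4]) (I 4 [0,6,4,3,5,1,2]))) (Br 6 3 (Br 6 4 (Br 5
     3 (K [4] [5]) (Br 5 4 (I 3 [0,1,2,3,5,6,4]) (I 1 [0,6,4,3,5,1,2]))) (D 6)) (D 6))) (Br 5 3 (K [1] [3,5]) (Br 5 4 (K [4] [1,6]) (D 5))))]"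
  by code_simp

lemma check_K33: "graph_check False 6 fam7 (e_K33) [
     Br 6 3 (Br 0 4 (Br 6 4 (K [3] [4]) (Br 6 5 (Br 0 5 (K [3] [5]) (I 6 [1,3,4,0,6,5,2])) (D 6))) (Br 0 5 (Br 6 5 (K [3] [5]) (I 6
     [1,3,4,0,5,6,2])) (D 0))) (Br 6 4 (Br 6 5 (Br 0 4 (Br 0 5 (K [4] [5]) (I 6 [1,3,4,6,0,5,2])) (Br 0 5 (I 6 [1,3,4,6,5,0,2]) (D 0))) (D
     6)) (D 6)),
     Br 6 3 (Br 1 4 (Br 6 4 (K [3] [4]) (Br 6 5 (Br 1 5 (K [3] [5]) (I 6 [3,1,4,0,6,5,2])) (D 6))) (Br 1 5 (Br 6 5 (K [3] [5]) (I 6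
     [3,1,4,0,5,6,2])) (D 1))) (Br 6 4 (Br 6 5 (Br 1 4 (Br 1 5 (K [4] [5]) (I 6 [3,1,4,6,0,5,2])) (Br 1 5 (I 6 [3,1,4,6,5,0,2]) (D 1))) (D
     6)) (D 6)),
     Br 6 3 (Br 2 4 (Br 6 4 (K [3] [4]) (Br 6 5 (Br 2 5 (K [3] [5]) (I 6 [3,4,1,0,6,5,2])) (D 6))) (Br 2 5 (Br 6 5 (K [3] [5]) (I 6
     [3,4,1,0,5,6,2])) (D 2))) (Br 6 4 (Br 6 5 (Br 2 4 (Br 2 5 (K [4] [5]) (I 6 [3,4,1,6,0,5,2])) (Br 2 5 (I 6 [3,4,1,6,5,0,2]) (D 2))) (D
     6)) (D 6)),
     Br 6 0 (Br 3 1 (Br 6 1 (K [0] [1]) (Br 6 2 (Br 3 2 (K [0] [2]) (I 6 [0,5,6,2,3,4,1])) (D 6))) (Br 3 2 (Br 6 2 (K [0] [2]) (I 6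
     [0,5,6,1,3,4,2])) (D 3))) (Br 6 1 (Br 6 2 (Br 3 1 (Br 3 2 (K [1] [2]) (I 6 [5,0,6,2,3,4,1])) (Br 3 2 (I 6 [5,6,0,2,3,4,1]) (D 3))) (D
     6)) (D 6)),
     Br 6 0 (Br 4 1 (Br 6 1 (K [0] [1]) (Br 6 2 (Br 4 2 (K [0] [2]) (I 6 [0,5,6,3,2,4,1])) (D 6))) (Br 4 2 (Br 6 2 (K [0] [2]) (I 6
     [0,5,6,3,1,4,2])) (D 4))) (Br 6 1 (Br 6 2 (Br 4 1 (Br 4 2 (K [1] [2]) (I 6 [5,0,6,3,2,4,1])) (Br 4 2 (I 6 [5,6,0,3,2,4,1]) (D 4))) (D
     6)) (D 6)),
     Br 6 0 (Br 5 1 (Br 6 1 (K [0] [1]) (Br 6 2 (Br 5 2 (K [0] [2]) (I 6 [0,5,6,3,4,2,1])) (D 6))) (Br 5 2 (Br 6 2 (K [0] [2]) (I 6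
     [0,5,6,3,4,1,2])) (D 5))) (Br 6 1 (Br 6 2 (Br 5 1 (Br 5 2 (K [1] [2]) (I 6 [5,0,6,3,4,2,1])) (Br 5 2 (I 6 [5,6,0,3,4,2,1]) (D 5))) (D
     6)) (D 6))]"
  by code_simp

lemma check_A: "graph_check False 6 fam7 (e_A) [
     Br 6 1 (Br 0 3 (Br 6 3 (K [1] [2,3]) (Br 0 4 (Br 0 5 (K [0] [1]) (K [0] [2,5])) (Br 0 5 (K [0] [2,4]) (K [6] [2,3])))) (Br 0 4 (Br 0 5 (K
     [0] [2,3]) (K [6] [2,4])) (Br 0 5 (K [6] [2,5]) (D 0)))) (Br 0 3 (Br 6 3 (Br 0 4 (Br 0 5 (K [0] [2,3]) (K [0] [2,5])) (Br 0 5 (K [0]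
     [2,4]) (K [1] [6]))) (Br 6 4 (Br 0 5 (K [0] [2,4]) (Br 0 4 (K [0] [2,5]) (I 6 [1,0,5,2,3,4,6]))) (D 6))) (Br 0 4 (Br 0 5 (K [0] [2,3])
     (Br 6 4 (K [1] [6]) (I 6 [1,0,5,3,2,4,6]))) (Br 0 5 (Br 6 5 (K [1] [6]) (I 6 [1,0,5,3,4,2,6])) (D 0)))),
     Br 6 0 (Br 1 3 (Br 6 3 (K [0] [2,3]) (Br 1 4 (Br 1 5 (K [0] [1]) (K [1] [2,5])) (Br 1 5 (K [1] [2,4]) (K [6] [2,3])))) (Br 1 4 (Br 1 5
     (K [1] [2,3]) (K [6] [2,4])) (Br 1 5 (K [6] [2,5]) (D 1)))) (Br 1 3 (Br 6 3 (Br 1 4 (Br 1 5 (K [1] [2,3]) (K [1] [2,5])) (Br 1 5 (K [1]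
     [2,4]) (K [0] [6]))) (Br 6 4 (Br 1 5 (K [1] [2,4]) (Br 1 4 (K [1] [2,5]) (I 6 [0,1,5,2,3,4,6]))) (D 6))) (Br 1 4 (Br 1 5 (K [1] [2,3])
     (Br 6 4 (K [0] [6]) (I 6 [0,1,5,3,2,4,6]))) (Br 1 5 (Br 6 5 (K [0] [6]) (I 6 [0,1,5,3,4,2,6])) (D 1)))),
     Br 6 3 (Br 2 4 (Br 6 4 (K [3] [4]) (Br 6 5 (Br 2 5 (K [3] [5]) (I 7 [3,4,1,0,6,5,2])) (D 6))) (Br 2 5 (Br 6 5 (K [3] [5]) (I 7
     [3,4,1,0,5,6,2])) (D 2))) (Br 6 4 (Br 6 5 (Br 2 4 (Br 2 5 (K [4] [5]) (I 7 [3,4,1,6,0,5,2])) (Br 2 5 (I 7 [3,4,1,6,5,0,2]) (D 2))) (D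
     6)) (D 6)),
     Br 6 0 (Br 3 1 (Br 3 2 (K [0] [2,3]) (K [1] [2,6])) (Br 3 2 (K [1] [2,3]) (D 3))) (Br 6 1 (Br 3 2 (K [1] [2,3]) (K [0] [2,6])) (D 6)),
     Br 6 0 (Br 4 1 (Br 4 2 (K [0] [2,4]) (K [1] [2,6])) (Br 4 2 (K [1] [2,4]) (D 4))) (Br 6 1 (Br 4 2 (K [1] [2,4]) (K [0] [2,6])) (D 6)),
     Br 6 0 (Br 5 1 (Br 5 2 (K [0] [2,5]) (K [1] [2,6])) (Br 5 2 (K [1] [2,5]) (D 5))) (Br 6 1 (Br 5 2 (K [1] [2,5]) (K [0] [2,6])) (D 6))]"
  by code_simp

lemma check_A_plus: "graph_check False 6 fam7 (e_A_plus) [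
     Br 6 1 (Br 0 3 (Br 6 3 (K [1] [2,3]) (Br 0 4 (Br 0 5 (K [0] [1]) (K [0] [2,5])) (Br 0 5 (K [0] [2,4]) (K [6] [2,3])))) (Br 0 4 (Br 0 5 (K
     [0] [2,3]) (K [6] [2,4])) (Br 0 5 (K [6] [2,5]) (D 0)))) (Br 0 3 (Br 6 3 (Br 0 5 (Br 0 4 (K [0] [2,3]) (K [0] [2,4])) (K [3] [1,5]))
     (Br 6 4 (Br 0 5 (K [0] [2,4]) (K [3] [5,6])) (D 6))) (Br 0 4 (Br 0 5 (K [0] [2,3]) (K [4] [5,6])) (Br 0 5 (Br 6 5 (K [1] [6]) (I 7
     [1,0,5,3,4,2,6])) (D 0)))),
     Br 6 0 (Br 1 3 (Br 6 3 (K [0] [2,3]) (Br 1 4 (Br 1 5 (K [0] [1]) (K [1] [2,5])) (Br 1 5 (K [1] [2,4]) (K [6] [2,3])))) (Br 1 4 (Br 1 5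
     (K [1] [2,3]) (K [6] [2,4])) (Br 1 5 (K [6] [2,5]) (D 1)))) (Br 1 3 (Br 6 3 (Br 1 5 (Br 1 4 (K [1] [2,3]) (K [1] [2,4])) (K [3] [0,5]))
     (Br 6 4 (Br 1 5 (K [1] [2,4]) (K [3] [5,6])) (D 6))) (Br 1 4 (Br 1 5 (K [1] [2,3]) (K [4] [5,6])) (Br 1 5 (Br 6 5 (K [0] [6]) (I 7
     [0,1,5,3,4,2,6])) (D 1)))),
     Br 6 3 (Br 2 4 (Br 2 5 (K [3] [2,5]) (K [4] [5,6])) (Br 2 5 (K [4] [2,5]) (D 2))) (Br 6 4 (Br 2 5 (K [4] [2,5]) (K [3] [5,6])) (D 6)),
     Br 6 0 (Br 3 1 (Br 3 2 (K [0] [2,3]) (K [1] [2,6])) (Br 3 2 (K [1] [2,3]) (K [0] [2,6]))) (Br 3 1 (Br 6 1 (Br 3 2 (K [1] [2,3]) (K [0]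
     [2,6])) (Br 6 2 (Br 3 4 (K [3] [2,5]) (Br 3 2 (K [3] [4]) (I 7 [3,4,1,5,0,6,2]))) (D 6))) (Br 3 2 (K [1] [2,3]) (K [0] [2,6]))),
     Br 6 0 (Br 4 1 (Br 4 2 (K [0] [2,4]) (K [1] [2,6])) (Br 4 2 (K [1] [2,4]) (K [0] [2,6]))) (Br 4 1 (Br 6 1 (Br 4 2 (K [1] [2,4]) (K [0]
     [2,6])) (Br 6 2 (Br 4 3 (K [4] [2,5]) (Br 4 2 (K [3] [4]) (I 7 [3,4,1,0,5,6,2]))) (D 6))) (Br 4 2 (K [1] [2,4]) (K [0] [2,6]))),
     Br 6 0 (Br 5 1 (Br 5 2 (K [0] [2,5]) (K [1] [2,6])) (Br 5 2 (K [1] [2,5]) (D 5))) (Br 6 1 (Br 5 2 (K [1] [2,5]) (K [0] [2,6])) (D 6))]"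
  by code_simp

lemma check_7_0: "graph_check False 7 fam8 (fam_edges 0 0 3 True) [
     Br 7 1 (Br 0 5 (Br 7 5 (Br 0 6 (Br 7 6 (K [1,2] [4,6]) (I 5 [1,7,5,4,3,6,2,0])) (I 5 [0,1,2,3,4,6,5,7])) (Br 7 6 (Br 0 6 (K [1,2] [4,6]) (I
     1 [0,7,5,4,3,6,2,1])) (D 7))) (Br 0 6 (Br 7 6 (K [1,2] [4,6]) (I 1 [1,7,5,4,3,6,2,0])) (D 0))) (Br 7 5 (Br 7 6 (Br 0 5 (Br 0 6 (I 5
     [1,2,3,4,5,6,7,0]) (I 0 [0,1,2,3,4,6,5,7])) (Br 0 6 (I 1 [1,2,3,4,5,6,7,0]) (D 0))) (D 7)) (D 7)),
     Br 7 0 (Br 1 2 (Br 7 2 (K [2,3] [0,6]) (Br 7 5 (Br 1 5 (I 5 [1,7,5,4,3,6,2,0]) (I 1 [7,1,2,3,4,6,5,0])) (D 7))) (Br 1 5 (Br 7 5 (I 5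
     [1,0,5,4,3,6,2,7]) (I 1 [7,0,2,3,4,6,5,1])) (D 1))) (Br 7 2 (Br 7 5 (Br 1 2 (Br 1 5 (I 5 [2,1,7,5,4,6,3,0]) (I 1 [2,1,7,5,4,6,3,0]))
     (Br 1 5 (I 0 [0,1,3,4,5,6,7,2]) (D 1))) (D 7)) (D 7)),
     Br 7 1 (Br 2 3 (Br 7 3 (K [0,1] [3,4]) (Br 7 5 (Br 2 5 (I 5 [2,1,7,5,4,6,3,0]) (I 1 [5,7,1,2,3,6,4,0])) (D 7))) (Br 2 5 (Br 7 5 (I 5
     [2,1,0,5,4,6,3,7]) (I 1 [5,7,0,2,3,6,4,1])) (D 2))) (Br 7 3 (Br 7 5 (Br 2 3 (Br 2 5 (I 5 [3,2,1,7,5,6,4,0]) (I 1 [3,2,1,7,5,6,4,0]))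
     (Br 2 5 (I 0 [0,1,2,4,5,6,7,3]) (D 2))) (D 7)) (D 7)),
     Br 7 2 (Br 3 4 (Br 7 4 (K [1,2] [4,6]) (Br 7 5 (Br 3 5 (I 5 [3,2,1,7,5,6,4,0]) (I 1 [4,5,7,1,2,6,3,0])) (D 7))) (Br 3 5 (Br 7 5 (I 5
     [3,2,1,0,5,6,4,7]) (I 1 [4,5,7,0,2,6,3,1])) (D 3))) (Br 7 4 (Br 7 5 (Br 3 4 (Br 3 5 (I 5 [3,4,5,7,1,6,2,0]) (I 1 [4,3,2,1,7,6,5,0]))
     (Br 3 5 (I 0 [0,1,2,3,5,6,7,4]) (D 3))) (D 7)) (D 7)),
     Br 7 3 (Br 4 5 (Br 7 5 (Br 4 6 (Br 7 6 (K [2,3] [0,6]) (I 5 [3,4,5,7,1,6,2,0])) (I 5 [3,4,5,7,0,6,2,1])) (Br 7 6 (Br 4 6 (K [2,3]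
     [0,6]) (I 1 [3,4,5,7,0,6,2,1])) (D 7))) (Br 4 6 (Br 7 6 (K [2,3] [0,6]) (I 1 [3,4,5,7,1,6,2,0])) (D 4))) (Br 7 5 (Br 7 6 (Br 4 5 (Br 4
     6 (I 5 [2,3,4,5,7,6,1,0]) (I 0 [0,1,2,3,4,6,7,5])) (Br 4 6 (I 1 [5,4,3,2,1,6,7,0]) (D 4))) (D 7)) (D 7)),
     Br 7 0 (Br 5 1 (Br 7 1 (Br 5 2 (Br 7 2 (K [2,3] [0,6]) (Br 5 3 (Br 7 3 (K [0,1] [3,4]) (Br 5 4 (Br 7 4 (K [0,1] [3,4]) (Br 5 6 (Br 7 6
     (K [1,2] [4,6]) (I 5 [1,7,5,4,3,6,2,0])) (K [1,2] [4,6]))) (K [0,1] [3,4]))) (K [2,3] [0,6]))) (Br 5 3 (K [2,3] [0,6]) (Br 5 4 (K [0,1]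
     [3,4]) (Br 5 6 (K [1,2] [4,6]) (I 5 [1,7,5,4,3,0,2,6]))))) (Br 5 2 (Br 7 2 (K [2,3] [0,6]) (Br 5 3 (Br 7 3 (K [0,1] [3,4]) (Br 5 4 (Br
     7 4 (K [0,1] [3,4]) (Br 7 6 (Br 5 6 (I 5 [1,2,3,4,5,6,7,0]) (I 1 [7,5,4,3,2,6,1,0])) (D 7))) (K [0,1] [3,4]))) (K [2,3] [0,6]))) (Br 5
     3 (K [2,3] [0,6]) (Br 5 4 (K [0,1] [3,4]) (Br 5 6 (K [1,2] [4,6]) (I 1 [7,1,2,3,4,0,5,6])))))) (Br 5 2 (Br 7 2 (K [2,3] [0,6]) (Br 5 3
     (Br 7 3 (K [0,1] [3,4]) (Br 5 4 (Br 7 4 (K [0,1] [3,4]) (Br 5 6 (Br 7 6 (K [1,2] [4,6]) (I 1 [7,1,2,3,4,6,5,0])) (K [1,2] [4,6]))) (K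
     [0,1] [3,4]))) (K [2,3] [0,6]))) (Br 5 3 (K [2,3] [0,6]) (Br 5 4 (K [0,1] [3,4]) (Br 5 6 (Br 7 6 (I 5 [1,2,3,4,5,0,7,6]) (I 1
     [7,5,4,3,2,0,1,6])) (D 5)))))) (Br 5 1 (Br 7 1 (Br 5 2 (Br 7 2 (Br 5 4 (Br 5 3 (Br 7 3 (K [0,1] [3,4]) (Br 7 4 (K [0,1] [3,4]) (Br 5 6
     (Br 7 6 (K [2,3] [0,6]) (I 5 [2,1,7,5,4,6,3,0])) (K [2,3] [0,6])))) (K [0,1] [3,4])) (K [2] [0,6,4])) (Br 5 3 (Br 7 3 (K [0,1] [3,4])
     (Br 5 4 (Br 7 4 (K [0,1] [3,4]) (Br 7 6 (K [1,2] [4,6]) (D 7))) (K [0,1] [3,4]))) (Br 5 6 (K [1] [3,4,6]) (K [2,3] [0,6])))) (Br 5 3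
     (Br 7 3 (K [0,1] [3,4]) (Br 5 4 (Br 7 4 (K [0,1] [3,4]) (Br 5 6 (Br 7 6 (K [2,3] [0,6]) (I 1 [5,7,1,2,3,6,4,0])) (K [2,3] [0,6]))) (K
     [0,1] [3,4]))) (Br 5 4 (K [0,1] [3,4]) (Br 5 6 (K [1,2] [4,6]) (I 1 [1,7,5,4,3,0,2,6]))))) (Br 5 2 (Br 7 2 (Br 5 4 (Br 7 4 (K [1,2]
     [4,6]) (Br 5 6 (Br 7 6 (K [2,3] [0,6]) (Br 7 3 (Br 5 3 (I 5 [3,2,1,7,5,6,4,0]) (I 1 [4,5,7,1,2,6,3,0])) (D 7))) (K [2,3] [0,6]))) (K
     [2] [0,6,4])) (Br 5 3 (Br 7 3 (Br 5 6 (Br 7 6 (K [2,3] [0,6]) (Br 7 4 (Br 5 4 (I 5 [3,4,5,7,1,6,2,0]) (I 1 [3,4,5,7,1,6,2,0])) (D 7)))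
     (K [2,3] [0,6])) (Br 7 4 (Br 7 6 (Br 5 4 (Br 5 6 (I 5 [2,3,4,5,7,6,1,0]) (I 1 [2,3,4,5,7,6,1,0])) (Br 5 6 (I 1 [5,4,3,2,1,6,7,0]) (I 2
     [2,3,4,5,7,6,1,0]))) (D 7)) (D 7))) (Br 5 6 (Br 7 6 (K [2,3] [0,6]) (Br 7 4 (Br 5 4 (I 1 [4,3,2,1,7,6,5,0]) (I 2 [3,4,5,7,1,6,2,0])) (D
     7))) (K [2,3] [0,6])))) (Br 5 3 (Br 5 6 (Br 5 4 (Br 7 4 (K [1,2] [4,6]) (Br 7 6 (K [2,3] [0,6]) (Br 7 3 (I 1 [3,2,1,7,5,6,4,0]) (D
     7)))) (K [1,2] [4,6])) (K [2,3] [0,6])) (Br 5 4 (Br 7 4 (K [1,2] [4,6]) (Br 5 6 (Br 7 6 (K [1,2] [4,6]) (I 2 [3,2,1,7,5,6,4,0])) (K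
     [1,2] [4,6]))) (Br 5 6 (K [1,2] [4,6]) (I 2 [1,7,5,4,3,0,2,6])))))) (Br 5 2 (Br 7 2 (Br 5 4 (Br 5 3 (Br 7 3 (K [0,1] [3,4]) (Br 7 4 (K
     [0,1] [3,4]) (Br 5 6 (Br 7 6 (K [2,3] [0,6]) (I 1 [2,1,7,5,4,6,3,0])) (K [2,3] [0,6])))) (K [0,1] [3,4])) (K [2] [0,6,4])) (Br 5 3 (Br
     7 3 (K [0,1] [3,4]) (Br 5 4 (Br 7 4 (K [0,1] [3,4]) (Br 7 6 (K [1,2] [4,6]) (D 7))) (K [0,1] [3,4]))) (Br 5 4 (K [0,1] [3,4]) (Br 5 6
     (K [1,2] [4,6]) (K [2,3] [0,6]))))) (Br 5 3 (Br 7 3 (K [0,1] [3,4]) (Br 5 4 (Br 7 4 (K [0,1] [3,4]) (Br 5 6 (Br 7 6 (K [2,3] [0,6]) (I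
     2 [2,1,7,5,4,6,3,0])) (K [2,3] [0,6]))) (K [0,1] [3,4]))) (Br 5 4 (K [0,1] [3,4]) (Br 5 6 (Br 7 6 (I 1 [1,2,3,4,5,0,7,6]) (I 2
     [1,2,3,4,5,0,7,6])) (D 5)))))),
     Br 7 0 (Br 6 4 (Br 7 4 (K [0,1] [3,4]) (Br 7 5 (Br 6 5 (I 5 [1,2,3,4,5,6,7,0]) (I 1 [7,5,4,3,2,6,1,0])) (D 7))) (Br 6 5 (Br 7 5 (I 5
     [1,2,3,4,5,6,0,7]) (I 1 [7,5,4,3,2,6,0,1])) (D 6))) (Br 7 4 (Br 7 5 (Br 6 4 (Br 6 5 (I 5 [2,3,4,5,7,6,1,0]) (I 1 [2,3,4,5,7,6,1,0]))
     (Br 6 5 (I 0 [0,1,2,3,4,6,7,5]) (D 6))) (D 7)) (D 7))]"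
  by code_simp

lemma check_7_1: "graph_check False 7 fam8 (fam_edges 1 0 2 True) [
     Br 7 1 (Br 0 5 (Br 7 5 (K [1] [5]) (Br 7 6 (Br 0 6 (K [1,2] [4,6]) (I 8 [0,7,5,4,3,6,2,1])) (D 7))) (Br 0 6 (Br 7 6 (K [1,2] [4,6]) (I 8
     [1,7,5,4,3,6,2,0])) (D 0))) (Br 7 5 (Br 7 6 (Br 0 5 (K [5] [1,6]) (Br 0 6 (I 3 [1,2,3,4,5,6,7,0]) (D 0))) (D 7)) (D 7)),
     Br 7 0 (Br 1 2 (Br 7 2 (K [2,3] [0,6]) (Br 7 6 (K [1,2] [4,6]) (D 7))) (Br 1 6 (K [4,6] [2,7]) (D 1))) (Br 7 2 (Br 7 6 (Br 1 2 (K [2,3]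
     [0,6]) (Br 1 6 (I 3 [0,1,3,4,5,6,7,2]) (D 1))) (D 7)) (D 7)),
     Br 7 1 (Br 2 3 (Br 7 3 (K [0,1] [3,4]) (Br 7 5 (K [5] [1,2]) (D 7))) (Br 2 5 (K [1] [3,5]) (D 2))) (Br 7 3 (Br 7 5 (Br 2 3 (K [5]
     [1,2]) (Br 2 5 (I 1 [0,1,2,4,5,6,7,3]) (D 2))) (D 7)) (D 7)),
     Br 7 2 (Br 3 4 (Br 7 4 (K [4] [1,2]) (Br 7 5 (K [1,2] [4,5]) (D 7))) (Br 3 5 (K [1,2] [4,5]) (D 3))) (Br 7 4 (Br 7 5 (Br 3 4 (K [2,5]
     [4,6]) (Br 3 5 (I 1 [0,1,2,3,5,6,7,4]) (D 3))) (D 7)) (D 7)),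
     Br 7 3 (Br 4 5 (Br 7 5 (K [5] [1,2,3]) (Br 7 6 (K [2,5] [6,7]) (D 7))) (Br 4 6 (K [2,5] [4,6]) (D 4))) (Br 7 5 (Br 4 6 (K [2,5] [4,6])
     (Br 4 5 (I 1 [0,1,2,3,4,6,7,5]) (D 4))) (D 7)),
     Br 7 0 (Br 5 2 (Br 7 2 (K [2,3] [0,6]) (Br 5 3 (Br 7 3 (K [0,1] [3,4]) (Br 5 4 (Br 7 4 (K [0,1] [3,4]) (Br 7 6 (K [6] [2,5]) (D 7))) (K
     [0,1] [3,4]))) (K [2,3] [0,6]))) (Br 5 3 (K [2,3] [0,6]) (Br 5 4 (K [0,1] [3,4]) (Br 5 6 (K [7] [1,6]) (D 5))))) (Br 5 2 (Br 5 4 (Br 7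
     2 (K [1,2] [4,5]) (Br 7 4 (K [2,5] [4,6]) (Br 7 6 (K [6] [2,5]) (D 7)))) (K [2,5] [4,6])) (Br 5 4 (K [1,2] [4,5]) (Br 5 3 (Br 5 6 (K
     [5] [1,2]) (K [2,3] [0,6])) (Br 5 6 (Br 7 6 (I 3 [1,2,3,4,5,0,7,6]) (I 4 [1,2,3,4,5,0,7,6])) (D 5))))),
     Br 7 0 (Br 6 1 (Br 6 4 (Br 7 1 (K [1,2] [4,6]) (Br 7 4 (K [0,1] [3,4]) (Br 7 5 (K [6] [2,5]) (D 7)))) (K [1,2] [4,7])) (Br 6 4 (K [1,2]
     [4,6]) (Br 6 5 (K [7] [2,5]) (D 6)))) (Br 6 1 (Br 7 1 (Br 6 4 (K [1,2] [4,6]) (Br 6 5 (K [1] [4,5]) (I 8 [0,7,5,4,3,6,1,2]))) (Br 7 4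
     (Br 7 5 (Br 6 4 (K [6] [2,5]) (Br 6 5 (I 1 [0,1,2,3,4,6,7,5]) (I 2 [0,1,2,3,4,6,7,5]))) (D 7)) (D 7))) (Br 6 4 (K [1,2] [4,6]) (Br 6 5
     (K [5] [1,7]) (D 6))))]"
  by code_simp

lemma check_7_2: "graph_check False 7 fam8 (fam_edges 1 0 2 False) [
     Br 7 1 (Br 0 5 (Br 7 5 (K [1] [4,5]) (Br 7 6 (Br 0 6 (K [1,2] [4,6]) (I 4 [0,7,5,4,3,6,2,1])) (D 7))) (Br 0 6 (Br 7 6 (K [1,2] [4,6]) (I 4
     [1,7,5,4,3,6,2,0])) (D 0))) (Br 7 5 (Br 7 6 (Br 0 5 (K [5] [1,6]) (Br 0 6 (I 4 [1,2,3,4,5,6,7,0]) (D 0))) (D 7)) (D 7)),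
     Br 7 0 (Br 1 2 (Br 7 2 (K [2,3] [0,6]) (Br 7 6 (K [1,2] [4,6]) (D 7))) (Br 1 6 (K [4,6] [2,7]) (D 1))) (Br 7 2 (Br 7 6 (Br 1 2 (K [2,3]
     [0,6]) (Br 1 6 (I 4 [0,1,3,4,5,6,7,2]) (D 1))) (D 7)) (D 7)),
     Br 7 1 (Br 2 3 (Br 7 3 (K [0,1] [3,4]) (Br 7 5 (K [1,2] [4,5]) (D 7))) (Br 2 5 (K [3,5] [1,6]) (D 2))) (Br 7 3 (Br 7 5 (Br 2 3 (K [1,2]
     [4,5]) (Br 2 5 (I 2 [0,1,2,4,5,6,7,3]) (D 2))) (D 7)) (D 7)),
     Br 7 2 (Br 3 4 (Br 7 4 (K [4] [1,2]) (Br 7 5 (K [1,2] [4,5]) (D 7))) (Br 3 5 (K [1,2] [4,5]) (D 3))) (Br 7 4 (Br 7 5 (Br 3 4 (K [2,5]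
     [4,6]) (Br 3 5 (I 2 [0,1,2,3,5,6,7,4]) (D 3))) (D 7)) (D 7)),
     Br 7 3 (Br 4 5 (Br 4 6 (Br 7 5 (K [2,5] [4,6]) (Br 7 6 (K [2,3] [0,6]) (D 7))) (K [2,5] [6,7])) (Br 4 6 (K [2,5] [4,6]) (D 4))) (Br 7 5
     (Br 4 6 (K [2,5] [4,6]) (Br 4 5 (I 2 [0,1,2,3,4,6,7,5]) (D 4))) (D 7)),
     Br 7 0 (Br 5 2 (Br 7 2 (K [2,3] [0,6]) (Br 5 3 (Br 7 3 (K [0,1] [3,4]) (Br 7 4 (K [0,1] [3,4]) (D 7))) (K [2,3] [0,6]))) (Br 5 3 (K
     [2,3] [0,6]) (Br 5 4 (K [0,1] [3,4]) (D 5)))) (Br 5 2 (Br 5 4 (Br 7 2 (K [1,2] [4,5]) (Br 7 4 (K [2,5] [4,6]) (D 7))) (K [2,5] [4,6]))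
     (Br 5 4 (K [1,2] [4,5]) (Br 5 3 (Br 7 3 (I 10 [0,1,7,3,5,6,2,4]) (I 9 [0,1,7,3,5,6,2,4])) (D 5)))),
     Br 7 0 (Br 6 1 (Br 6 4 (Br 7 1 (K [1,2] [4,6]) (Br 7 4 (K [0,1] [3,4]) (D 7))) (K [1,2] [4,7])) (Br 6 4 (K [1,2] [4,6]) (D 6))) (Br 7 1
     (Br 6 4 (K [1,2] [4,6]) (Br 6 1 (I 4 [0,7,5,4,3,6,1,2]) (D 6))) (D 7))]"
  by code_simp

lemma check_7_3: "graph_check False 7 fam8 (fam_edges 0 1 2 True) [
     Br 7 1 (Br 0 5 (Br 7 5 (K [1] [5]) (Br 7 6 (Br 0 6 (K [1,2] [4,6]) (I 7 [0,7,5,4,3,6,2,1])) (D 7))) (Br 0 6 (Br 7 6 (K [1,2] [4,6]) (I 7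
     [1,7,5,4,3,6,2,0])) (D 0))) (Br 7 5 (Br 7 6 (Br 0 5 (K [5] [1,6]) (Br 0 6 (I 7 [1,2,3,4,5,6,7,0]) (D 0))) (D 7)) (D 7)),
     Br 7 0 (Br 1 2 (Br 7 2 (K [2,3] [0,6]) (Br 1 6 (Br 1 5 (Br 7 5 (K [1] [5]) (Br 7 6 (K [1,2] [4,6]) (D 7))) (K [1] [5])) (K [1,2]
     [4,6]))) (Br 1 6 (K [4,6] [2,7]) (Br 1 5 (K [5] [7]) (D 1)))) (Br 1 2 (Br 1 6 (Br 1 5 (Br 7 5 (K [1] [5]) (Br 7 6 (K [1,2] [4,6]) (D
     7))) (K [1] [5])) (K [1,2] [4,6])) (Br 1 5 (Br 1 6 (Br 7 6 (K [6] [2,5]) (Br 7 5 (I 5 [0,1,3,4,5,6,7,2]) (D 7))) (K [5] [6,7])) (Br 1 6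
     (Br 7 6 (I 7 [0,1,3,4,5,6,7,2]) (I 1 [0,1,3,4,5,6,7,2])) (D 1)))),
     Br 7 1 (Br 2 3 (Br 7 3 (K [1] [3,4]) (Br 7 5 (K [5] [1,2]) (D 7))) (Br 2 5 (K [1] [3,5]) (D 2))) (Br 7 3 (Br 7 5 (Br 2 3 (K [5] [1,2])
     (Br 2 5 (I 5 [0,1,2,4,5,6,7,3]) (D 2))) (D 7)) (D 7)),
     Br 7 2 (Br 3 4 (Br 7 4 (K [4] [1,2]) (Br 7 5 (K [1,2] [4,5]) (D 7))) (Br 3 5 (K [1,2] [4,5]) (D 3))) (Br 7 4 (Br 7 5 (Br 3 4 (K [2,5]
     [4,6]) (Br 3 5 (I 5 [0,1,2,3,5,6,7,4]) (D 3))) (D 7)) (D 7)),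
     Br 7 3 (Br 4 5 (Br 7 5 (K [5] [1,2,3]) (Br 7 6 (K [5] [6,7]) (D 7))) (Br 4 6 (K [5] [4,6]) (D 4))) (Br 7 5 (Br 4 6 (K [5] [4,6]) (Br 4
     5 (I 5 [0,1,2,3,4,6,7,5]) (D 4))) (D 7)),
     Br 7 0 (Br 5 1 (Br 5 3 (Br 7 1 (K [3,5] [1,6]) (Br 5 2 (Br 7 2 (K [2,3] [0,6]) (Br 7 3 (K [0,1] [3,4]) (Br 5 4 (Br 7 4 (K [0,1] [3,4])
     (Br 7 6 (K [5] [6]) (D 7))) (K [0,1] [3,4])))) (K [2,3] [0,6]))) (K [1,6] [3,7])) (Br 5 3 (K [3,5] [1,6]) (Br 5 2 (K [2,3] [0,6]) (Br 5
     4 (K [0,1] [3,4]) (Br 5 6 (K [6] [7]) (D 5)))))) (Br 5 1 (Br 7 1 (Br 5 3 (K [3,5] [1,6]) (Br 5 2 (K [5] [3,4,6]) (Br 5 4 (K [1] [3,4])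
     (Br 5 6 (K [1,2] [4,6]) (I 7 [1,7,5,4,3,0,2,6]))))) (Br 5 2 (Br 5 3 (Br 7 3 (K [5] [3,4,6]) (Br 5 4 (Br 7 2 (K [1,2] [4,5]) (Br 7 4 (K
     [5] [4,6]) (D 7))) (K [5] [4,6]))) (K [5] [3,4,6])) (Br 5 4 (K [1,2] [4,5]) (Br 5 3 (K [5] [4,6]) (Br 5 6 (K [1,2] [4,6]) (I 8
     [1,7,5,4,3,0,2,6])))))) (Br 5 3 (K [3,5] [1,6]) (Br 5 4 (K [0,1] [3,4]) (Br 5 2 (K [2,5] [4,6]) (Br 5 6 (Br 7 6 (I 7 [1,2,3,4,5,0,7,6])
     (I 8 [1,2,3,4,5,0,7,6])) (D 5)))))),
     Br 7 0 (Br 6 1 (Br 6 4 (Br 7 1 (K [1,2] [4,6]) (Br 7 4 (K [0,1] [3,4]) (Br 7 5 (K [5] [6]) (D 7)))) (K [1,2] [4,7])) (Br 6 4 (K [1,2]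
     [4,6]) (Br 6 5 (K [5] [7]) (D 6)))) (Br 6 1 (Br 7 1 (Br 6 4 (K [1,2] [4,6]) (Br 6 5 (K [1] [4,5]) (I 7 [0,7,5,4,3,6,1,2]))) (Br 7 4 (Br
     7 5 (Br 6 4 (K [5] [6]) (Br 6 5 (I 5 [0,1,2,3,4,6,7,5]) (I 1 [0,7,5,4,3,6,1,2]))) (D 7)) (D 7))) (Br 6 4 (K [1,2] [4,6]) (Br 6 5 (K [5]
     [1,7]) (D 6))))]"
  by code_simp

lemma check_7_4: "graph_check False 7 fam8 (fam_edges 1 1 1 True) [
     Br 7 1 (Br 0 5 (Br 7 5 (K [1] [5]) (Br 7 6 (K [6] [0,5]) (D 7))) (Br 0 6 (K [6] [5,7]) (D 0))) (Br 7 5 (Br 7 6 (Br 0 5 (K [6] [0,5]) (Br 0 6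
     (I 7 [4,3,2,1,0,7,6,5]) (D 0))) (D 7)) (D 7)),
     Br 7 0 (Br 1 2 (Br 7 2 (K [0] [2]) (Br 7 6 (K [0,5] [2,6]) (D 7))) (Br 1 6 (K [0,5] [2,6]) (D 1))) (Br 7 2 (Br 7 6 (Br 1 2 (K [2,3]
     [0,6]) (Br 1 6 (I 7 [5,4,2,1,0,7,6,3]) (D 1))) (D 7)) (D 7)),
     Br 7 1 (Br 2 3 (Br 7 3 (K [0,1] [3,4]) (Br 2 5 (Br 7 5 (K [1] [5]) (Br 7 6 (K [6] [2,3]) (D 7))) (K [5] [1,2]))) (Br 2 5 (K [1] [3,5])
     (Br 2 6 (K [7] [4,6]) (D 2)))) (Br 2 3 (Br 2 5 (Br 7 5 (K [5] [1,2]) (Br 7 6 (K [6] [2,3]) (D 7))) (K [5] [1,2])) (Br 2 5 (Br 2 6 (Br 7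
     6 (K [6] [2,5]) (Br 7 5 (I 7 [0,1,2,4,5,6,7,3]) (D 7))) (K [6] [2,5])) (Br 2 6 (Br 7 6 (I 7 [5,4,3,1,0,7,6,2]) (I 3 [0,1,2,4,5,6,7,3]))
     (D 2)))),
     Br 7 2 (Br 3 4 (Br 7 4 (K [2] [4]) (Br 7 5 (K [2,3] [0,5]) (D 7))) (Br 3 5 (K [1,2] [4,5]) (D 3))) (Br 7 4 (Br 7 5 (Br 3 4 (K [2,3]
     [0,5]) (Br 3 5 (I 7 [0,1,2,3,5,6,7,4]) (D 3))) (D 7)) (D 7)),
     Br 7 3 (Br 4 5 (Br 7 5 (K [2,3] [0,5]) (Br 7 6 (K [5] [6,7]) (D 7))) (Br 4 6 (K [5] [4,6]) (D 4))) (Br 7 5 (Br 4 6 (K [5] [4,6]) (Br 4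
     5 (I 7 [0,1,2,3,4,6,7,5]) (D 4))) (D 7)),
     Br 7 0 (Br 5 2 (Br 7 2 (K [0] [2]) (Br 5 3 (Br 7 3 (K [0] [2,3]) (Br 5 4 (Br 7 4 (K [0,1] [3,4]) (Br 7 6 (K [5] [6]) (D 7))) (K [0,1]
     [3,4]))) (K [0] [2,3]))) (Br 5 3 (K [0] [2,3]) (Br 5 4 (K [0,1] [3,4]) (Br 5 6 (K [6] [7]) (D 5))))) (Br 5 2 (Br 5 4 (Br 7 2 (K [2,3]
     [0,5]) (Br 5 3 (Br 7 3 (K [2,3] [0,5]) (Br 7 4 (K [5] [4,6]) (D 7))) (K [2,3] [0,5]))) (K [2,5] [4,6])) (Br 5 3 (K [2] [0,5]) (Br 5 4
     (K [2,3] [0,5]) (Br 5 6 (Br 7 6 (I 7 [4,3,2,1,0,5,6,7]) (I 8 [4,3,2,1,0,5,6,7])) (D 5))))),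
     Br 7 0 (Br 6 1 (Br 6 4 (Br 6 2 (K [6] [0,5]) (K [6] [2,5])) (K [1,2] [4,7])) (Br 6 4 (K [1,2] [4,6]) (Br 6 2 (K [7] [2,5]) (K [7]
     [0,5])))) (Br 6 1 (Br 7 1 (Br 6 4 (K [1,2] [4,6]) (Br 6 2 (K [2] [4,7]) (K [7] [0,5]))) (Br 6 2 (Br 7 2 (Br 6 4 (K [6] [2,5]) (K [0,5]
     [2,7])) (Br 7 4 (Br 7 5 (Br 6 4 (K [5] [6]) (Br 6 5 (I 7 [0,1,2,3,4,6,7,5]) (I 8 [0,1,2,3,4,6,7,5]))) (D 7)) (D 7))) (Br 6 4 (K [6]
     [2,5]) (K [0,5] [2,7])))) (Br 6 4 (K [1,2] [4,6]) (Br 6 2 (K [2] [4,7]) (K [7] [0,5]))))]"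
  by code_simp

lemma check_7_5: "graph_check False 7 fam8 (fam_edges 1 1 1 False) [
     Br 7 1 (Br 0 5 (Br 7 5 (K [1] [4,5]) (Br 7 6 (K [6] [0,5]) (D 7))) (Br 0 6 (K [6] [5,7]) (D 0))) (Br 7 5 (Br 7 6 (Br 0 5 (K [6] [0,5]) (Br 0
     6 (I 8 [4,3,2,1,0,7,6,5]) (D 0))) (D 7)) (D 7)),
     Br 7 0 (Br 1 2 (Br 7 2 (K [0] [2]) (Br 7 6 (K [0,5] [2,6]) (D 7))) (Br 1 6 (K [0,5] [2,6]) (D 1))) (Br 7 2 (Br 7 6 (Br 1 2 (K [2,3]
     [0,6]) (Br 1 6 (I 8 [5,4,2,1,0,7,6,3]) (D 1))) (D 7)) (D 7)),
     Br 7 1 (Br 2 3 (Br 7 3 (K [0,1] [3,4]) (Br 2 5 (Br 7 5 (K [1] [4,5]) (Br 7 6 (K [6] [2,5]) (D 7))) (K [1,2] [4,5]))) (Br 2 5 (K [3,5]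
     [1,6]) (Br 2 6 (K [7] [4,6]) (D 2)))) (Br 2 3 (Br 2 5 (Br 7 5 (K [1,2] [4,5]) (Br 7 6 (K [6] [2,5]) (D 7))) (K [1,2] [4,5])) (Br 2 5
     (Br 2 6 (Br 7 6 (K [6] [2,5]) (Br 7 5 (I 8 [0,1,2,4,5,6,7,3]) (D 7))) (K [6] [2,5])) (Br 2 6 (Br 7 6 (I 8 [5,4,3,1,0,7,6,2]) (I 4
     [0,1,2,4,5,6,7,3])) (D 2)))),
     Br 7 2 (Br 3 4 (Br 7 4 (K [2] [4]) (Br 7 5 (K [2,3] [0,5]) (D 7))) (Br 3 5 (K [1,2] [4,5]) (D 3))) (Br 7 4 (Br 7 5 (Br 3 4 (K [2,3]
     [0,5]) (Br 3 5 (I 8 [0,1,2,3,5,6,7,4]) (D 3))) (D 7)) (D 7)),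
     Br 7 3 (Br 4 5 (Br 7 5 (K [2,3] [0,5]) (Br 7 6 (K [5] [6,7]) (D 7))) (Br 4 6 (K [5] [4,6]) (D 4))) (Br 7 5 (Br 4 6 (K [5] [4,6]) (Br 4
     5 (I 8 [0,1,2,3,4,6,7,5]) (D 4))) (D 7)),
     Br 7 0 (Br 5 2 (Br 7 2 (K [0] [2]) (Br 5 3 (Br 7 3 (K [0] [2,3]) (Br 7 4 (K [0,1] [3,4]) (D 7))) (K [0] [2,3]))) (Br 5 3 (K [0] [2,3])
     (Br 5 4 (K [0,1] [3,4]) (D 5)))) (Br 5 2 (Br 5 4 (Br 7 2 (K [2,3] [0,5]) (Br 7 3 (K [2,3] [0,5]) (D 7))) (K [2,5] [4,6])) (Br 5 3 (K
     [2] [0,5]) (Br 5 4 (K [2,3] [0,5]) (D 5)))),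
     Br 7 0 (Br 6 1 (Br 6 4 (Br 6 2 (K [6] [0,5]) (K [6] [2,5])) (K [1,2] [4,7])) (Br 6 4 (K [1,2] [4,6]) (Br 6 2 (K [7] [2,5]) (D 6)))) (Br
     6 1 (Br 7 1 (Br 6 4 (K [1,2] [4,6]) (Br 6 2 (K [2] [4,7]) (K [7] [0,5]))) (Br 7 2 (Br 6 4 (K [6] [2,5]) (K [0,5] [2,7])) (D 7))) (Br 6
     4 (K [1,2] [4,6]) (Br 6 2 (K [2] [4,7]) (D 6))))]"
  by code_simp

lemma check_B: "graph_check False 7 fam8 (e_B) [
     Br 7 1 (Br 0 2 (Br 7 2 (K [2,5] [1,6]) (Br 0 3 (Br 0 4 (K [0] [1,6]) (K [0,1] [4,5])) (Br 0 4 (K [0,1] [3,5]) (K [7] [2,5])))) (Br 0 3 (Br 0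
     4 (K [0] [2,5]) (K [0,1] [4,5])) (Br 0 4 (K [0,1] [3,5]) (D 0)))) (Br 0 2 (Br 7 2 (Br 0 3 (Br 0 4 (K [0] [2,5]) (K [0,1] [4,5])) (Br 0
     4 (K [0,1] [3,5]) (K [7] [1,6]))) (Br 7 3 (Br 0 4 (K [0,1] [3,5]) (Br 0 3 (K [0,1] [4,5]) (I 9 [0,1,2,3,4,5,7,6]))) (D 7))) (Br 0 3 (Br
     0 4 (K [0] [2,5]) (K [0,1] [4,5])) (Br 0 4 (K [0,1] [3,5]) (D 0)))),
     Br 7 0 (Br 1 2 (Br 1 6 (K [0] [1,6]) (K [2,5] [6,7])) (Br 1 6 (K [2,5] [1,6]) (D 1))) (Br 7 2 (Br 1 6 (K [2,5] [1,6]) (K [0] [6,7])) (D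
     7)),
     Br 7 0 (Br 2 1 (Br 2 5 (K [0] [2,5]) (K [1,6] [5,7])) (Br 2 5 (K [2,5] [1,6]) (D 2))) (Br 7 1 (Br 2 5 (K [2,5] [1,6]) (K [0] [5,7])) (D
     7)),
     Br 7 0 (Br 3 5 (Br 3 6 (K [0,1] [3,5]) (K [3,5] [1,6])) (Br 3 6 (K [2,5] [3,6]) (D 3))) (Br 7 5 (Br 3 6 (K [2,5] [3,6]) (K [0,1]
     [5,7])) (D 7)),
     Br 7 0 (Br 4 5 (Br 4 6 (K [0,1] [4,5]) (K [4,5] [1,6])) (Br 4 6 (K [2,5] [4,6]) (D 4))) (Br 7 5 (Br 4 6 (K [2,5] [4,6]) (K [0,1]
     [5,7])) (D 7)),
     Br 7 2 (Br 5 3 (Br 7 3 (K [3] [1,2]) (Br 7 4 (K [2,5] [4,6]) (D 7))) (Br 5 4 (K [2,5] [3,6]) (D 5))) (Br 7 3 (Br 5 4 (K [2,5] [3,6])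
     (Br 5 3 (K [2,5] [4,6]) (D 5))) (D 7)),
     Br 7 1 (Br 6 3 (Br 7 3 (K [3] [1,2]) (Br 7 4 (K [4,5] [1,6]) (D 7))) (Br 6 4 (K [3,5] [1,6]) (D 6))) (Br 7 3 (Br 6 4 (K [3,5] [1,6])
     (Br 6 3 (K [4,5] [1,6]) (D 6))) (D 7))]"
  by code_simp

lemma check_B_plus: "graph_check False 7 fam8 (e_B_plus) [
     Br 7 1 (Br 0 2 (Br 7 2 (K [2,5] [1,6]) (Br 0 3 (Br 0 4 (K [0] [1,6]) (K [1,2] [3,4])) (Br 0 4 (K [1,2] [3,4]) (K [7] [2,5])))) (Br 0 3 (Br 0
     4 (K [0] [2,5]) (K [1,2] [3,4])) (Br 0 4 (K [1,2] [3,4]) (D 0)))) (Br 0 2 (Br 7 2 (Br 0 3 (Br 0 4 (K [0] [2,5]) (K [1,2] [3,4])) (Br 0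
     4 (K [1,2] [3,4]) (K [7] [1,6]))) (Br 7 3 (Br 0 4 (K [0,1] [3,5]) (Br 0 3 (K [0,1] [4,5]) (I 10 [0,1,2,3,4,5,7,6]))) (D 7))) (Br 0 3
     (Br 0 4 (K [0] [2,5]) (K [1,2] [3,4])) (Br 0 4 (K [1,2] [3,4]) (D 0)))),
     Br 7 0 (Br 1 2 (Br 1 6 (K [0] [1,6]) (K [2,5] [6,7])) (Br 1 6 (K [2,5] [1,6]) (D 1))) (Br 7 2 (Br 1 6 (K [2,5] [1,6]) (K [0] [6,7])) (D
     7)),
     Br 7 0 (Br 2 1 (Br 2 5 (K [0] [2,5]) (K [1,6] [5,7])) (Br 2 5 (K [2,5] [1,6]) (D 2))) (Br 7 1 (Br 2 5 (K [2,5] [1,6]) (K [0] [5,7])) (D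
     7)),
     Br 7 0 (Br 3 4 (Br 7 4 (K [0,1] [4,5]) (Br 3 5 (Br 3 6 (K [0,1] [3,5]) (K [3,5] [1,6])) (K [0,1] [4,5]))) (Br 3 5 (K [0,1] [4,5]) (Br 3
     6 (K [2,5] [3,6]) (D 3)))) (Br 3 4 (Br 7 4 (Br 3 5 (Br 3 6 (K [3] [4]) (K [3,5] [1,6])) (Br 3 6 (K [2,5] [3,6]) (K [0,1] [5,7]))) (Br 7
     5 (Br 3 6 (K [2,5] [3,6]) (K [0,1] [5,7])) (D 7))) (Br 3 5 (Br 3 6 (K [3] [4]) (K [3,5] [1,6])) (Br 3 6 (K [2,5] [3,6]) (D 3)))),
     Br 7 0 (Br 4 3 (Br 7 3 (K [0,1] [3,5]) (Br 4 5 (Br 4 6 (K [0,1] [4,5]) (K [4,5] [1,6])) (K [0,1] [3,5]))) (Br 4 5 (K [0,1] [3,5]) (Br 4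
     6 (K [0,2] [3,6]) (D 4)))) (Br 4 3 (Br 7 3 (Br 4 5 (Br 4 6 (K [3] [4]) (K [4,5] [1,6])) (Br 4 6 (K [2,5] [4,6]) (K [0,1] [5,7]))) (Br 7
     5 (Br 4 6 (K [2,5] [4,6]) (K [0,1] [5,7])) (D 7))) (Br 4 5 (Br 4 6 (K [3] [4]) (K [4,5] [1,6])) (Br 4 6 (K [2,5] [4,6]) (D 4)))),
     Br 7 2 (Br 5 3 (Br 7 3 (K [3] [1,2]) (Br 7 4 (K [1,2] [3,4]) (D 7))) (Br 5 4 (K [1,2] [3,4]) (D 5))) (Br 7 3 (Br 5 4 (K [2,5] [3,6])
     (Br 5 3 (K [2,5] [4,6]) (D 5))) (D 7)),
     Br 7 1 (Br 6 3 (Br 7 3 (K [3] [1,2]) (Br 7 4 (K [1,2] [3,4]) (D 7))) (Br 6 4 (K [1,2] [3,4]) (D 6))) (Br 7 3 (Br 6 4 (K [3,5] [1,6])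
     (Br 6 3 (K [4,5] [1,6]) (D 6))) (D 7))]"
  by code_simp

lemma check_D: "graph_check False 7 fam8 (e_D) [
     Br 7 1 (Br 0 2 (Br 0 3 (K [0,2] [1,4]) (K [2,5] [1,7])) (Br 0 3 (K [0,1] [2,5]) (K [1,4] [2,7]))) (Br 0 2 (Br 7 2 (Br 0 3 (K [0,1] [2,5]) (K
     [1,4] [2,7])) (Br 7 3 (Br 7 6 (K [1,2] [3,7]) (D 7)) (D 7))) (Br 0 3 (K [0,1] [2,5]) (K [1,4] [2,7]))),
     Br 7 0 (Br 1 2 (Br 1 4 (K [1,2] [0,3]) (K [2,5] [0,7])) (Br 1 4 (K [0,1] [2,5]) (K [0,3] [2,7]))) (Br 1 2 (Br 7 2 (Br 1 4 (K [0,1]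
     [2,5]) (K [0,3] [2,7])) (Br 7 4 (Br 7 6 (K [0,2] [4,7]) (D 7)) (D 7))) (Br 1 4 (K [0,1] [2,5]) (K [0,3] [2,7]))),
     Br 7 0 (Br 2 1 (Br 2 5 (K [1,2] [0,3]) (K [1,4] [0,7])) (Br 2 5 (K [0,2] [1,4]) (K [0,3] [1,7]))) (Br 2 1 (Br 7 1 (Br 2 5 (K [0,2]
     [1,4]) (K [0,3] [1,7])) (Br 7 5 (Br 7 6 (K [0,1] [5,7]) (D 7)) (D 7))) (Br 2 5 (K [0,2] [1,4]) (K [0,3] [1,7]))),
     Br 7 0 (Br 3 4 (Br 7 4 (K [4] [0,2]) (Br 7 5 (K [0,3] [2,5]) (D 7))) (Br 3 5 (K [0,3] [1,4]) (D 3))) (Br 7 4 (Br 3 5 (K [0,3] [1,4])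
     (Br 3 4 (K [0,3] [2,5]) (D 3))) (D 7)),
     Br 7 1 (Br 4 3 (Br 7 3 (K [3] [1,2]) (Br 7 5 (K [1,4] [2,5]) (D 7))) (Br 4 5 (K [0,3] [1,4]) (D 4))) (Br 7 3 (Br 4 5 (K [0,3] [1,4])
     (Br 4 3 (K [1,4] [2,5]) (D 4))) (D 7)),
     Br 7 2 (Br 5 3 (Br 7 3 (K [3] [1,2]) (Br 7 4 (K [2] [3,4]) (D 7))) (Br 5 4 (K [2] [3,4]) (D 5))) (Br 7 3 (Br 5 4 (K [0,3] [2,5]) (Br 5
     3 (K [1,4] [2,5]) (D 5))) (D 7)),
     Br 7 0 (Br 6 1 (Br 7 1 (K [1] [0,3]) (Br 7 2 (K [1,2] [0,3]) (D 7))) (Br 6 2 (K [1,2] [0,3]) (D 6))) (Br 7 1 (Br 7 2 (Br 6 1 (K [0,2]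
     [1,4]) (Br 6 2 (K [0,1] [2,5]) (D 6))) (D 7)) (D 7))]"
  by code_simp

section \<open>Splits of the graphs on eight and nine vertices\<close>

lemma check_8_0: "graph_check True 8 [] (fam_edges 0 0 4 True) [
     T 6 3 2,
     T 6 4 3,
     T 6 5 4,
     T 6 1 0,
     T 6 1 0,
     T 6 1 0,
     Br 8 0 (Br 6 1 (Br 8 1 (Br 6 2 (Br 8 2 (K [0,7] [2,3,4]) (Br 8 3 (K [0,7] [2,3,4]) (T 6 3 2))) (Br 6 3 (K [0,7] [2,3,4]) (T 8 3 2)))
     (Br 8 2 (Br 6 2 (K [0,7] [2,3,4]) (Br 6 3 (K [0,7] [2,3,4]) (T 8 3 2))) (T 6 2 1))) (Br 6 2 (Br 8 2 (K [0,7] [2,3,4]) (Br 8 3 (K [0,7]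
     [2,3,4]) (T 6 3 2))) (T 8 2 1))) (Br 6 1 (Br 8 7 (Br 8 1 (Br 6 3 (K [1] [3,4,5,7]) (Br 6 2 (K [0,7] [2,3,4]) (T 8 3 2))) (Br 6 2 (T 6 1
     0) (Br 6 3 (K [0,7] [2,3,4]) (T 8 3 2)))) (T 6 7 0)) (Br 6 2 (Br 8 7 (Br 6 4 (K [1,2] [4,5,7]) (K [0,7] [2,3,4])) (T 6 7 0)) (Br 6 3
     (Br 8 7 (K [0,7] [2,3,4]) (T 6 7 0)) (T 8 2 1)))),
     T 6 2 1]"
  by code_simp

lemma check_8_1: "graph_check True 8 [] (fam_edges 1 0 3 True) [
     T 6 3 2,
     T 6 4 3,
     T 6 5 4,
     T 7 1 0,
     T 7 1 0,
     T 6 3 2,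
     Br 8 0 (Br 6 2 (Br 8 2 (K [0,7] [2,3,4]) (Br 8 3 (K [0,7] [2,3,4]) (T 6 3 2))) (Br 6 3 (K [0,7] [2,3,4]) (T 8 3 2))) (Br 6 7 (T 7 1 0)
     (T 7 1 0)),
     T 6 3 2]"
  by code_simp

lemma check_8_2: "graph_check True 8 [] (fam_edges 1 0 3 False) [
     T 6 3 2,
     T 6 4 3,
     T 6 5 4,
     Br 3 4 (Br 8 4 (Br 8 2 (K [1,2] [4,5]) (Br 8 6 (K [5,6] [1,2,3]) (D 8))) (T 6 5 4)) (T 6 5 4),
     Br 8 3 (Br 4 5 (Br 8 5 (K [2,3] [5,7]) (Br 8 6 (K [5,6] [1,2,3]) (D 8))) (Br 4 6 (K [5,6] [1,2,3]) (D 4))) (T 6 3 2),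
     T 6 3 2,
     Br 8 0 (T 0 7 1) (Br 6 2 (Br 6 4 (Br 8 2 (K [1,2] [4,5,6]) (Br 8 3 (Br 6 5 (K [5,6] [1,2,3]) (K [2,6] [5,7])) (T 6 3 2))) (K [2,6]
     [4,5,7])) (Br 6 4 (K [1,2] [4,5,6]) (Br 6 5 (K [4,5] [0,1,2]) (T 8 5 4)))),
     T 6 3 2]"
  by code_simp

lemma check_8_3: "graph_check True 8 [] (fam_edges 2 0 2 True) [
     T 6 4 3,
     T 6 4 3,
     T 6 5 4,
     T 7 1 0,
     T 7 1 0,
     T 7 1 0,
     T 7 2 1,
     T 6 4 3]"
  by code_simp

lemma check_8_4: "graph_check True 8 [] (fam_edges 2 0 2 False) [
     Br 0 6 (T 6 4 3) (T 6 4 3),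
     T 6 4 3,
     T 6 5 4,
     T 7 1 0,
     T 7 1 0,
     Br 5 7 (T 7 1 0) (T 7 1 0),
     T 7 2 1,
     T 6 4 3]"
  by code_simp

lemma check_8_5: "graph_check True 8 [] (fam_edges 0 1 3 True) [
     T 6 3 2,
     T 6 4 3,
     T 6 5 4,
     Br 3 4 (Br 8 4 (Br 8 2 (K [1,2] [4,5]) (Br 8 6 (K [6] [1,2,3]) (D 8))) (T 6 5 4)) (T 6 5 4),
     Br 8 3 (Br 4 5 (Br 8 5 (K [2,3] [5,7]) (Br 8 6 (K [5,6] [1,2,3]) (D 8))) (Br 4 6 (K [5,6] [1,2,3]) (D 4))) (T 6 3 2),
     T 6 3 2,
     Br 8 0 (Br 6 1 (Br 6 3 (Br 8 1 (K [1,7] [3,4,6]) (Br 6 2 (Br 8 2 (K [0,7] [2,3,4]) (Br 8 3 (K [0,7] [2,3,4]) (T 6 3 2))) (K [0,7]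
     [2,3,4]))) (K [3,8] [1,7,5])) (Br 6 3 (K [1,7] [3,4,6]) (Br 6 2 (K [0,7] [2,3,4]) (T 8 3 2)))) (Br 6 1 (Br 8 1 (Br 6 3 (K [1,7]
     [3,4,6]) (Br 6 2 (K [6] [3,4,5,7]) (T 8 3 2))) (Br 6 2 (Br 6 3 (Br 8 3 (K [6] [3,4,5,7]) (Br 8 4 (K [6] [4,5,7]) (T 6 4 3))) (K [6]
     [3,4,5,7])) (Br 6 4 (K [1,2] [4,5,6]) (Br 6 3 (K [6] [4,5,7]) (T 8 3 2))))) (Br 6 3 (K [1,7] [3,4,6]) (Br 6 4 (K [0,1] [3,4,5]) (T 8 4
     3)))),
     T 6 3 2]"
  by code_simp

lemma check_8_6: "graph_check True 8 [] (fam_edges 0 1 3 False) [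
     T 6 3 2,
     T 6 4 3,
     T 6 5 4,
     T 1 7 0,
     T 1 7 0,
     T 6 3 2,
     Br 8 0 (Br 6 1 (Br 6 3 (Br 8 1 (K [1,7] [3,4,6]) (Br 6 2 (Br 8 2 (K [0,7] [2,3,4]) (Br 8 3 (K [0,7] [2,3,4]) (T 6 3 2))) (K [0,7]
     [2,3,4]))) (K [3,8] [1,7,5])) (Br 6 3 (K [1,7] [3,4,6]) (Br 6 2 (K [0,7] [2,3,4]) (T 8 3 2)))) (Br 6 1 (T 1 7 0) (T 1 7 0)),
     T 6 3 2]"
  by code_simp

lemma check_8_7: "graph_check True 8 [] (fam_edges 1 1 2 True) [
     T 6 4 3,
     T 6 4 3,
     T 6 5 4,
     T 7 1 0,
     T 7 1 0,
     T 7 1 0,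
     Br 8 0 (Br 6 2 (Br 8 2 (K [0] [2]) (Br 6 3 (Br 8 3 (K [0] [2,3]) (Br 8 4 (K [3,4] [0,7]) (T 6 4 3))) (K [0] [2,3]))) (Br 6 3 (K [0]
     [2,3]) (Br 6 4 (K [2,3] [0,6]) (T 8 4 3)))) (T 7 1 0),
     T 6 4 3]"
  by code_simp

lemma check_8_8: "graph_check True 8 [] (fam_edges 1 1 2 False) [
     T 6 4 3,
     T 6 4 3,
     T 6 5 4,
     T 7 1 0,
     T 7 1 0,
     Br 5 7 (T 7 1 0) (T 7 1 0),
     Br 8 0 (Br 6 2 (Br 8 2 (K [0] [2]) (Br 6 3 (Br 8 3 (K [0] [2,3]) (Br 8 4 (K [3,4] [0,7]) (T 6 4 3))) (K [0] [2,3]))) (Br 6 3 (K [0]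
     [2,3]) (Br 6 4 (K [2,3] [0,6]) (T 8 4 3)))) (T 7 1 0),
     T 6 4 3]"
  by code_simp

lemma check_C: "graph_check False 8 [] (e_C) [
     Br 8 1 (Br 0 2 (Br 0 6 (K [0,6] [1,7]) (K [2,5] [6,8])) (Br 0 6 (K [2,5] [0,6]) (D 0))) (Br 8 2 (Br 0 6 (K [2,5] [0,6]) (K [1,7] [6,8])) (D
     8)),
     Br 8 0 (Br 1 2 (Br 1 7 (K [0,6] [1,7]) (K [2,5] [7,8])) (Br 1 7 (K [2,5] [1,7]) (D 1))) (Br 8 2 (Br 1 7 (K [2,5] [1,7]) (K [0,6]
     [7,8])) (D 8)),
     Br 8 0 (Br 2 1 (Br 2 5 (K [2,5] [0,6]) (K [1,7] [5,8])) (Br 2 5 (K [2,5] [1,7]) (D 2))) (Br 8 1 (Br 2 5 (K [2,5] [1,7]) (K [0,6]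
     [5,8])) (D 8)),
     Br 8 5 (Br 3 6 (Br 3 7 (K [3,7] [0,2,5]) (K [5,8] [0,1,6])) (Br 3 7 (K [3,5] [0,1,6]) (D 3))) (Br 8 6 (Br 3 7 (K [3,5] [0,1,6]) (K
     [7,8] [0,2,5])) (D 8)),
     Br 8 5 (Br 4 6 (Br 4 7 (K [4,7] [0,2,5]) (K [5,8] [0,1,6])) (Br 4 7 (K [4,5] [0,1,6]) (D 4))) (Br 8 6 (Br 4 7 (K [4,5] [0,1,6]) (K
     [7,8] [0,2,5])) (D 8)),
     Br 8 2 (Br 5 3 (Br 8 3 (K [1,2] [3,6]) (Br 8 4 (K [4,7] [0,2,5]) (D 8))) (Br 5 4 (K [3,7] [0,2,5]) (D 5))) (Br 8 3 (Br 5 4 (K [3,7]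
     [0,2,5]) (Br 5 3 (K [4,7] [0,2,5]) (D 5))) (D 8)),
     Br 8 0 (Br 6 3 (Br 8 3 (K [0,1] [3,5]) (Br 8 4 (K [0,1] [3,5,4]) (D 8))) (Br 6 4 (K [0,1] [3,5,4]) (D 6))) (Br 8 3 (Br 6 4 (K [3,5]
     [0,1,6]) (Br 6 3 (K [4,5] [0,1,6]) (D 6))) (D 8)),
     Br 8 1 (Br 7 3 (Br 8 3 (K [0,1] [3,5]) (Br 8 4 (K [0,1] [3,5,4]) (D 8))) (Br 7 4 (K [0,1] [3,5,4]) (D 7))) (Br 8 3 (Br 7 4 (K [1,7]
     [3,5,6]) (Br 7 3 (K [1,7] [4,5,6]) (D 7))) (D 8))]"
  by code_simp

lemma check_C_plus: "graph_check False 8 [] (e_C_plus) [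
     Br 8 1 (Br 0 2 (Br 0 6 (K [0,6] [1,7]) (K [2,5] [6,8])) (Br 0 6 (K [2,5] [0,6]) (D 0))) (Br 8 2 (Br 0 6 (K [2,5] [0,6]) (K [1,7] [6,8])) (D
     8)),
     Br 8 0 (Br 1 2 (Br 1 7 (K [0,6] [1,7]) (K [2,5] [7,8])) (Br 1 7 (K [2,5] [1,7]) (D 1))) (Br 8 2 (Br 1 7 (K [2,5] [1,7]) (K [0,6]
     [7,8])) (D 8)),
     Br 8 0 (Br 2 1 (Br 2 5 (K [2,5] [0,6]) (K [1,7] [5,8])) (Br 2 5 (K [2,5] [1,7]) (D 2))) (Br 8 1 (Br 2 5 (K [2,5] [1,7]) (K [0,6]
     [5,8])) (D 8)),
     Br 8 4 (Br 3 5 (Br 8 5 (K [4,7] [0,2,5]) (Br 3 6 (Br 3 7 (K [3] [4]) (K [1,7] [3,5,6])) (Br 3 7 (K [3,5] [0,1,6]) (K [7,8] [0,2,5]))))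
     (Br 3 6 (Br 3 7 (K [3,7] [0,2,5]) (K [5,8] [0,1,6])) (Br 3 7 (K [5,8] [0,1,7]) (D 3)))) (Br 3 5 (Br 8 5 (Br 3 6 (Br 3 7 (K [3,7]
     [0,2,5]) (K [4,7] [0,2,5])) (K [4,6] [1,2,5])) (Br 8 6 (Br 3 7 (K [3,5] [0,1,6]) (K [7,8] [0,2,5])) (D 8))) (Br 3 6 (Br 3 7 (K [3,7]
     [0,2,5]) (K [5,8] [0,1,6])) (Br 3 7 (K [5,8] [0,1,7]) (D 3)))),
     Br 8 3 (Br 4 5 (Br 8 5 (K [3,7] [0,2,5]) (Br 4 6 (Br 4 7 (K [3] [4]) (K [1,7] [4,5,6])) (Br 4 7 (K [4,5] [0,1,6]) (K [7,8] [0,2,5]))))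
     (Br 4 6 (Br 4 7 (K [4,7] [0,2,5]) (K [5,8] [0,1,6])) (Br 4 7 (K [5,8] [0,1,7]) (D 4)))) (Br 4 5 (Br 8 5 (Br 4 6 (Br 4 7 (K [4,7]
     [0,2,5]) (K [3,7] [0,2,5])) (K [3,6] [1,2,5])) (Br 8 6 (Br 4 7 (K [4,5] [0,1,6]) (K [7,8] [0,2,5])) (D 8))) (Br 4 6 (Br 4 7 (K [4,7]
     [0,2,5]) (K [5,8] [0,1,6])) (Br 4 7 (K [5,8] [0,1,7]) (D 4)))),
     Br 8 2 (Br 5 3 (Br 8 3 (K [1,2] [3,6]) (Br 8 4 (K [3,4] [0,1,2]) (D 8))) (Br 5 4 (K [3,4] [0,1,2]) (D 5))) (Br 8 3 (Br 5 4 (K [3,7]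
     [0,2,5]) (Br 5 3 (K [4,7] [0,2,5]) (D 5))) (D 8)),
     Br 8 0 (Br 6 3 (Br 8 3 (K [0,1] [3,5]) (Br 8 4 (K [3,4] [0,1,2]) (D 8))) (Br 6 4 (K [3,4] [0,1,2]) (D 6))) (Br 8 3 (Br 6 4 (K [3,5]
     [0,1,6]) (Br 6 3 (K [4,5] [0,1,6]) (D 6))) (D 8)),
     Br 8 1 (Br 7 3 (Br 8 3 (K [0,1] [3,5]) (Br 8 4 (K [3,4] [0,1,2]) (D 8))) (Br 7 4 (K [3,4] [0,1,2]) (D 7))) (Br 8 3 (Br 7 4 (K [1,7]
     [3,5,6]) (Br 7 3 (K [1,7] [4,5,6]) (D 7))) (D 8))]"
  by code_simp

text \<open>Graphs on nine vertices are still split by trees, because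
  \<open>split_of_large_fam\<close> needs ten vertices in the contraction.\<close>

lemma check_9_0: "graph_check True 9 [] (fam_edges 0 0 5 True) [
     T 7 3 2,
     T 7 4 3,
     T 7 5 4,
     T 7 1 0,
     T 7 1 0,
     T 7 1 0,
     T 7 1 0,
     Br 9 0 (Br 7 1 (Br 9 1 (Br 7 2 (Br 9 2 (K [2,3,4] [0,8,6]) (Br 9 3 (K [2,3,4] [0,8,6]) (T 7 3 2))) (Br 7 3 (K [2,3,4] [0,8,6]) (T 9 3
     2))) (Br 9 2 (Br 7 2 (K [2,3,4] [0,8,6]) (Br 7 3 (K [2,3,4] [0,8,6]) (T 9 3 2))) (T 7 2 1))) (Br 7 2 (Br 9 2 (K [2,3,4] [0,8,6]) (Br 9
     3 (K [2,3,4] [0,8,6]) (T 7 3 2))) (T 9 2 1))) (Br 7 1 (Br 9 8 (Br 9 1 (Br 7 3 (K [1] [3,4,5,6,8]) (Br 7 2 (K [2,3,4] [0,8,6]) (T 9 3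
     2))) (Br 7 2 (T 7 1 0) (Br 7 3 (K [2,3,4] [0,8,6]) (T 9 3 2)))) (T 7 8 0)) (Br 7 2 (Br 9 8 (Br 7 4 (K [1,2] [4,5,6,8]) (K [2,3,4]
     [0,8,6])) (T 7 8 0)) (Br 7 3 (Br 9 8 (K [2,3,4] [0,8,6]) (T 7 8 0)) (T 9 2 1)))),
     T 7 2 1]"
  by code_simp

lemma check_9_1: "graph_check True 9 [] (fam_edges 1 0 4 True) [
     T 7 3 2,
     T 7 4 3,
     T 7 5 4,
     T 8 1 0,
     T 8 1 0,
     T 8 1 0,
     T 7 3 2,
     Br 9 0 (Br 7 2 (Br 9 2 (K [2,3,4] [0,8,6]) (Br 9 3 (K [2,3,4] [0,8,6]) (T 7 3 2))) (Br 7 3 (K [2,3,4] [0,8,6]) (T 9 3 2))) (Br 7 8 (T 8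
     1 0) (T 8 1 0)),
     T 7 3 2]"
  by code_simp

lemma check_9_2: "graph_check True 9 [] (fam_edges 1 0 4 False) [
     T 7 3 2,
     T 7 4 3,
     T 7 5 4,
     T 7 6 5,
     Br 9 3 (Br 4 5 (Br 9 5 (K [5,6] [1,2,3]) (T 7 6 5)) (T 7 6 5)) (T 7 3 2),
     T 7 3 2,
     T 7 3 2,
     Br 9 0 (T 0 8 1) (Br 7 2 (Br 7 4 (Br 9 2 (K [4,5,7] [1,2,8]) (Br 9 3 (Br 7 5 (K [1,2,3] [5,6,7]) (K [2,7] [5,6,8])) (T 7 3 2))) (K
     [2,7] [4,5,6,8])) (Br 7 4 (K [4,5,7] [1,2,8]) (Br 7 5 (K [0,1,2] [4,5,6]) (T 9 5 4)))),
     T 7 3 2]"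
  by code_simp

lemma check_9_3: "graph_check True 9 [] (fam_edges 2 0 3 True) [
     T 7 4 3,
     T 7 4 3,
     T 7 5 4,
     T 8 1 0,
     T 8 1 0,
     T 8 1 0,
     T 8 1 0,
     T 8 2 1,
     T 7 4 3]"
  by code_simp

lemma check_9_4: "graph_check True 9 [] (fam_edges 2 0 3 False) [
     T 7 4 3,
     T 7 4 3,
     T 7 5 4,
     T 8 1 0,
     T 8 1 0,
     T 8 1 0,
     T 7 4 3,
     T 8 2 1,
     T 7 4 3]"
  by code_simp

lemma check_9_5: "graph_check True 9 [] (fam_edges 0 1 4 True) [
     T 7 3 2,
     T 7 4 3,
     T 7 5 4,
     T 7 6 5,
     Br 9 3 (Br 4 5 (Br 9 5 (K [5,6] [1,2,3]) (T 7 6 5)) (T 7 6 5)) (T 7 3 2),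
     T 7 3 2,
     T 7 3 2,
     Br 9 0 (Br 7 1 (Br 7 3 (Br 9 1 (K [3,4,7] [1,8,6]) (Br 7 2 (Br 9 2 (K [2,3,4] [0,8,6]) (Br 9 3 (K [3,4,5] [0,1,8]) (T 7 3 2))) (K
     [2,3,4] [0,8,6]))) (K [1,8,6] [3,4,9])) (Br 7 3 (K [3,4,7] [1,8,6]) (Br 7 2 (K [2,3,4] [0,8,6]) (T 9 3 2)))) (Br 7 1 (Br 9 1 (Br 7 3 (K
     [3,4,7] [1,8,6]) (Br 7 2 (K [7] [3,4,5,6,8]) (T 9 3 2))) (Br 7 2 (Br 7 3 (Br 9 3 (K [7] [3,4,5,6,8]) (Br 9 4 (K [7] [4,5,6,8]) (T 7 4
     3))) (K [7] [3,4,5,6,8])) (Br 7 4 (K [4,5,7] [1,2,8]) (Br 7 3 (K [7] [4,5,6,8]) (T 9 3 2))))) (Br 7 3 (K [3,4,7] [1,8,6]) (Br 7 4 (K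
     [3,4,5] [0,1,8]) (T 9 4 3)))),
     T 7 3 2]"
  by code_simp

lemma check_9_6: "graph_check True 9 [] (fam_edges 0 1 4 False) [
     T 7 3 2,
     T 7 4 3,
     T 7 5 4,
     T 7 6 5,
     T 1 8 0,
     T 7 3 2,
     T 7 3 2,
     Br 9 0 (Br 7 1 (Br 7 3 (Br 9 1 (K [3,4,7] [1,8,6]) (Br 7 2 (Br 9 2 (K [2,3,4] [0,8,6]) (Br 9 3 (K [3,4,5] [0,1,8]) (T 7 3 2))) (K
     [2,3,4] [0,8,6]))) (K [1,8,6] [3,4,9])) (Br 7 3 (K [3,4,7] [1,8,6]) (Br 7 2 (K [2,3,4] [0,8,6]) (T 9 3 2)))) (Br 7 1 (T 1 8 0) (T 1 8
     0)),
     T 7 3 2]"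
  by code_simp

lemma check_9_7: "graph_check True 9 [] (fam_edges 1 1 3 True) [
     T 7 4 3,
     T 7 4 3,
     T 7 5 4,
     T 8 1 0,
     T 8 1 0,
     T 8 1 0,
     T 8 1 0,
     Br 9 0 (Br 7 2 (Br 9 2 (K [0] [2]) (Br 7 3 (Br 9 3 (K [0] [2,3]) (Br 9 4 (K [2,3] [0,9]) (T 7 4 3))) (K [0] [2,3]))) (Br 7 3 (K [0]
     [2,3]) (Br 7 4 (K [2,3] [0,7]) (T 9 4 3)))) (T 8 1 0),
     T 7 4 3]"
  by code_simp

lemma check_9_8: "graph_check True 9 [] (fam_edges 1 1 3 False) [
     T 7 4 3,
     T 7 4 3,
     T 7 5 4,
     T 8 1 0,
     T 8 1 0,
     T 8 1 0,
     T 7 4 3,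
     Br 9 0 (Br 7 2 (Br 9 2 (K [0] [2]) (Br 7 3 (Br 9 3 (K [0] [2,3]) (Br 9 4 (K [2,3] [0,9]) (T 7 4 3))) (K [0] [2,3]))) (Br 7 3 (K [0]
     [2,3]) (Br 7 4 (K [2,3] [0,7]) (T 9 4 3)))) (T 8 1 0),
     T 7 4 3]"
  by code_simp

lemma check_9_9: "graph_check True 9 [] (fam_edges 2 1 2 True) [
     T 7 5 4,
     T 7 5 4,
     T 7 5 4,
     T 8 1 0,
     T 8 1 0,
     T 8 1 0,
     T 8 1 0,
     T 8 2 1,
     T 7 5 4]"
  by code_simp

lemma check_9_10: "graph_check True 9 [] (fam_edges 2 1 2 False) [
     T 7 5 4,
     T 7 5 4,
     T 7 5 4,
     T 8 1 0,
     T 8 1 0,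
     T 8 1 0,
     T 8 1 0,
     T 8 2 1,
     T 7 5 4]"
  by code_simp

section \<open>Classification by induction on the number of vertices\<close>

lemma giso_con3:
  assumes "giso V E W F" "con3 V E"
  shows "con3 W F"
proof -
  obtain f where f: "bij_betw f V W" "\<forall>u\<in>V. \<forall>v\<in>V. (u, v) \<in> E \<longleftrightarrow> (f u, f v) \<in> F"
    using assms(1) unfolding giso_def by blast
  have i: "inj_on f V" and W: "f ` V = W" using f(1) by (auto simp: bij_betw_def)
  show ?thesis unfolding con3_def
  proof (intro conjI allI impI)
    show "card W > 3" using assms giso_card[OF assms(1)] unfolding con3_def by simp
    fix T assume T: "T \<subseteq> W \<and> card T < 3"
    define U where "U = {v \<in> V. f v \<in> T}"
    have fU: "f ` U = T" using T W unfolding U_def by auto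
    have "inj_on f U" using i by (rule inj_on_subset) (auto simp: U_def)
    then have "card U < 3" using T fU card_image by metis
    moreover have "U \<subseteq> V" unfolding U_def by blast
    ultimately have c: "conn E (V - U)" using assms(2) unfolding con3_def by blast
    have "conn F (f ` (V - U))" by (rule conn_image[OF c]) (use f(2) in blast)
    moreover have "f ` (V - U) = W - T" using W unfolding U_def by auto
    ultimately show "conn F (W - T)" by simp
  qed
qed

definition exceptional :: "(nat \<times> edges) list" where
  "exceptional = [(5, e_K5), (6, e_K33), (6, e_A), (6, e_A_plus), (7, e_B), (7, e_B_plus), (8, e_C), (8, e_C_plus), (7, e_D)]"

lemma base_5:
  assumes "sgraph V E" "con3 V E" "\<not> K24 E" "card V = 5"
  shows "\<exists>Q\<in>set fam5. giso V E {0..<5} (symc (set Q))"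
proof -
  have "\<exists>Q\<in>set fam5. giso V E {0..<Suc 4} (symc (set Q))"
  proof (rule base_step[where L = fam4])
    show "\<exists>Q\<in>set fam4. giso W F {0..<4} (symc (set Q))"
      if "sgraph W F" "con3 W F" "card W = 4" for W :: "'a set" and F
      using base_4[OF that] unfolding fam4_def by simp
    show "\<exists>ts. graph_check False 4 fam5 Q ts" if "Q \<in> set fam4" for Q
      using that check_4_0 unfolding fam4_def list.set insert_iff empty_iff by blast
  qed (use assms in simp_all)
  then show ?thesis by simp
qed

lemma base_6:
  assumes "sgraph V E" "con3 V E" "\<not> K24 E" "card V = 6"
  shows "\<exists>Q\<in>set fam6. giso V E {0..<6} (symc (set Q))"
proof -
  have "\<exists>Q\<in>set fam6. giso V E {0..<Suc 5} (symc (set Q))"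
  proof (rule base_step[where L = fam5])
    show "\<exists>Q\<in>set fam5. giso W F {0..<5} (symc (set Q))"
      if "sgraph W F" "con3 W F" "\<not> K24 F" "card W = 5" for W :: "'a set" and F
      using base_5[OF that] .
    show "\<exists>ts. graph_check False 5 fam6 Q ts" if "Q \<in> set fam5" for Q
      using that check_5_0 check_5_1 check_K5 unfolding fam5_def list.set insert_iff empty_iff by blast
  qed (use assms in simp_all)
  then show ?thesis by simp
qed

lemma base_7:
  assumes "sgraph V E" "con3 V E" "\<not> K24 E" "card V = 7"
  shows "\<exists>Q\<in>set fam7. giso V E {0..<7} (symc (set Q))"
proof -
  have "\<exists>Q\<in>set fam7. giso V E {0..<Suc 6} (symc (set Q))"
  proof (rule base_step[where L = fam6])
    show "\<exists>Q\<in>set fam6. giso W F {0..<6} (symc (set Q))"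
      if "sgraph W F" "con3 W F" "\<not> K24 F" "card W = 6" for W :: "'a set" and F
      using base_6[OF that] .
    show "\<exists>ts. graph_check False 6 fam7 Q ts" if "Q \<in> set fam6" for Q
      using that check_6_0 check_6_1 check_6_2 check_6_3 check_K33 check_A check_A_plus
      unfolding fam6_def list.set insert_iff empty_iff by blast
  qed (use assms in simp_all)
  then show ?thesis by simp
qed

lemma base_8:
  assumes "sgraph V E" "con3 V E" "\<not> K24 E" "card V = 8"
  shows "\<exists>Q\<in>set fam8. giso V E {0..<8} (symc (set Q))"
proof -
  have "\<exists>Q\<in>set fam8. giso V E {0..<Suc 7} (symc (set Q))"
  proof (rule base_step[where L = fam7])
    show "\<exists>Q\<in>set fam7. giso W F {0..<7} (symc (set Q))"
      if "sgraph W F" "con3 W F" "\<not> K24 F" "card W = 7" for W :: "'a set" and F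
      using base_7[OF that] .
    show "\<exists>ts. graph_check False 7 fam8 Q ts" if "Q \<in> set fam7" for Q
      using that check_7_0 check_7_1 check_7_2 check_7_3 check_7_4 check_7_5 check_B check_B_plus check_D
      unfolding fam7_def list.set insert_iff empty_iff by blast
  qed (use assms in simp_all)
  then show ?thesis by simp
qed

lemma giso_fam_edges_Fam:
  assumes "sgraph V E" "giso V E {0..<n} (symc (set (fam_edges i k j ab)))" "k \<le> 1" "n = i + k + j + 4"
  shows "Fam V E"
proof -
  have "symc (set (fam_edges i k j ab)) \<subseteq> {0..<n} \<times> {0..<n}"
    using is_fam_sgraph[OF fam_edges_is_fam[OF assms(3)]] unfolding assms(4) sgraph_def by blast
  moreover have "Fam {0..<n} (symc (set (fam_edges i k j ab)))" using Fam_fam_edges[OF assms(3)] unfolding assms(4) .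
  ultimately show ?thesis using Fam_giso[OF assms(2)] assms(1) unfolding sgraph_def by blast
qed

lemma Fam_or_exceptional:
  assumes "sgraph V E" "giso V E {0..<n} (symc (set Q))"
    and "(n, Q) \<in> L \<or> (\<exists>i k j ab. Q = fam_edges i k j ab \<and> k \<le> 1 \<and> n = i + k + j + 4)"
  shows "Fam V E \<or> (\<exists>(n, Q)\<in>L. giso V E {0..<n} (symc (set Q)))"
  using assms giso_fam_edges_Fam by (metis case_prodI)

text \<open>On eight vertices the exceptions are named explicitly: they are the ones that the
  induction for larger graphs has to exclude as contractions.\<close>

lemma small_lists:
  "Q \<in> set fam5 \<Longrightarrow> (5, Q) \<in> set exceptional \<or> (\<exists>i k j ab. Q = fam_edges i k j ab \<and> k \<le> 1 \<and> 5 = i + k + j + 4)"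
  "Q \<in> set fam6 \<Longrightarrow> (6, Q) \<in> set exceptional \<or> (\<exists>i k j ab. Q = fam_edges i k j ab \<and> k \<le> 1 \<and> 6 = i + k + j + 4)"
  "Q \<in> set fam7 \<Longrightarrow> (7, Q) \<in> set exceptional \<or> (\<exists>i k j ab. Q = fam_edges i k j ab \<and> k \<le> 1 \<and> 7 = i + k + j + 4)"
  "Q \<in> set fam8 \<Longrightarrow> (8, Q) \<in> {8} \<times> {e_C, e_C_plus} \<or> (\<exists>i k j ab. Q = fam_edges i k j ab \<and> k \<le> 1 \<and> 8 = i + k + j + 4)"
  unfolding fam5_def fam6_def fam7_def fam8_def exceptional_def by force+

text \<open>The premises hold for a contraction after reversal if necessary: \<open>i\<close> is at
  most \<open>j\<close>, and the hubs are adjacent if no inner vertex sees \<open>b\<close>, as its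
  degree would be 2 otherwise.\<close>

lemma check_fam_8:
  assumes "i + k + j = 4" "k \<le> 1" "i \<le> j" "i = 0 \<Longrightarrow> k = 0 \<Longrightarrow> ab"
  shows "\<exists>ts. graph_check True 8 [] (fam_edges i k j ab) ts"
proof -
  have "fam_edges i k j ab \<in> {fam_edges 0 0 4 True, fam_edges 1 0 3 True, fam_edges 1 0 3 False, fam_edges 2 0 2 True,
      fam_edges 2 0 2 False, fam_edges 0 1 3 True, fam_edges 0 1 3 False, fam_edges 1 1 2 True, fam_edges 1 1 2 False}"
  proof -
    have "i = 0 \<or> i = 1 \<or> i = 2" "k = 0 \<or> k = 1" "j = 4 - i - k" using assms(1-3) by linarith+
    then show ?thesis using assms by (cases ab) (elim disjE; simp)+
  qed
  then show ?thesis
    using check_8_0 check_8_1 check_8_2 check_8_3 check_8_4 check_8_5 check_8_6 check_8_7 check_8_8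
    unfolding insert_iff empty_iff by metis
qed

lemma check_fam_9:
  assumes "i + k + j = 5" "k \<le> 1" "i \<le> j" "i = 0 \<Longrightarrow> k = 0 \<Longrightarrow> ab"
  shows "\<exists>ts. graph_check True 9 [] (fam_edges i k j ab) ts"
proof -
  have "fam_edges i k j ab \<in> {fam_edges 0 0 5 True, fam_edges 1 0 4 True, fam_edges 1 0 4 False, fam_edges 2 0 3 True,
      fam_edges 2 0 3 False, fam_edges 0 1 4 True, fam_edges 0 1 4 False, fam_edges 1 1 3 True, fam_edges 1 1 3 False,
      fam_edges 2 1 2 True, fam_edges 2 1 2 False}"
  proof -
    have "i = 0 \<or> i = 1 \<or> i = 2" "k = 0 \<or> k = 1" "j = 5 - i - k" using assms(1-3) by linarith+
    then show ?thesis using assms by (cases ab) (elim disjE; simp)+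
  qed
  then show ?thesis
    using check_9_0 check_9_1 check_9_2 check_9_3 check_9_4 check_9_5 check_9_6 check_9_7 check_9_8 check_9_9 check_9_10
    unfolding insert_iff empty_iff by metis
qed

lemma is_fam_hub_edge:
  assumes "is_fam V E a b p [] [] As q ab" "card (E `` {b}) \<ge> 3"
  shows ab
proof (rule ccontr)
  note F = is_fam_facts[OF assms(1)]
  assume nab: "\<not> ab"
  have "b \<notin> set (p # As @ [q])" using F(7) by auto
  then have "(b, y) \<notin> pe (p # As @ [q])" "(y, b) \<notin> pe (p # As @ [q])" for y
    using pe_set by metis+
  then have "E `` {b} \<subseteq> {p, q}"
    using assms(1) nab unfolding is_fam_def famR_def by auto
  then have "card (E `` {b}) \<le> card {p, q}" by (simp add: card_mono)
  then show False using assms(2) card_lt3(1)[of p q] by linarith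
qed

text \<open>The contraction has at least eight vertices. For eight and nine the split trees apply,
  from ten on the general argument.\<close>

lemma split_of_Fam:
  assumes "sgraph V E" "con3 V E" "(x, y) \<in> E" "con3 (V - {x}) (contr E x y)" "Fam (V - {x}) (contr E x y)" "card V \<ge> 9"
  shows "K24 E \<or> tri E"
proof -
  note S = sgraphD[OF assms(1)]
  have xV: "x \<in> V" "y \<in> V" "x \<noteq> y" using S(2,3,5) assms(3) by metis+
  let ?W = "V - {x}" and ?F = "contr E x y"
  have cW: "card ?W = card V - 1" using xV S(1) by simp
  \<comment> \<open>The representatives with certificates have the shorter side first, hence the
    possible reversal.\<close>
  obtain a b p Bs Os As q ab where "is_fam ?W ?F a b p Bs Os As q ab" "length Bs \<le> length As"
  proof -
    obtain a b p Bs Os As q ab where 1: "is_fam ?W ?F a b p Bs Os As q ab" using assms(5) unfolding Fam_def by blast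
    show ?thesis using that[OF 1] that[OF is_fam_rev[OF 1]] by (cases "length Bs \<le> length As") auto
  qed
  note fam = this
  note F = is_fam_facts[OF fam(1)]
  have c: "card ?W = 4 + length Bs + length Os + length As" using distinct_card[OF F(7)] F(8) by simp
  have hub: ab if "length Bs = 0" "length Os = 0"
    using is_fam_hub_edge[of ?W ?F a b p As q ab] fam(1) that con3_deg[OF assms(4) sgraph_contr[OF assms(1) xV(2,3)], of b] F(8) by auto
  note g = is_fam_giso_edges[OF fam(1)]
  have K: "K24 E \<or> tri E" if "graph_check True (card ?W) [] (fam_edges (length Bs) (length Os) (length As) ab) ts" for ts
    using split_sound[OF assms(1-3) g that] unfolding good_def by simp
  consider "card ?W = 8" | "card ?W = 9" | "card ?W \<ge> 10" using cW assms(6) by linarith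
  then show ?thesis
  proof cases
    case 1
    have "\<exists>ts. graph_check True (card ?W) [] (fam_edges (length Bs) (length Os) (length As) ab) ts"
      unfolding 1 by (rule check_fam_8) (use c 1 F(9) fam(2) hub in auto)
    then show ?thesis using K by blast
  next
    case 2
    have "\<exists>ts. graph_check True (card ?W) [] (fam_edges (length Bs) (length Os) (length As) ab) ts"
      unfolding 2 by (rule check_fam_9) (use c 2 F(9) fam(2) hub in auto)
    then show ?thesis using K by blast
  next
    case 3
    have sf: "split_of_fam V E x y a b p Bs Os As q ab" unfolding split_of_fam_def using assms(1-3) fam(1) by blast
    show ?thesis using split_of_large_fam[OF sf 3] .
  qed
qed

text \<open>A graph on nine vertices could still contract to \<open>e_C\<close> or
  \<open>e_C_plus\<close>, but the splits of these have the minor. So from nine vertices on every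
  3-connected contraction lies in the family, and \<open>split_of_Fam\<close> and
  \<open>tri_Fam\<close> apply.\<close>

lemma classification_large:
  assumes "sgraph V E" "con3 V E" "\<not> K24 E" "card V = n" "n \<ge> 8"
  shows "Fam V E \<or> (n = 8 \<and> (\<exists>Q\<in>{e_C, e_C_plus}. giso V E {0..<8} (symc (set Q))))"
  using assms
proof (induction n arbitrary: V E rule: less_induct)
  case (less n)
  note S = sgraphD[OF less.prems(1)]
  show ?case
  proof (cases "n = 8")
    case True
    then obtain Q where Q: "Q \<in> set fam8" "giso V E {0..<8} (symc (set Q))" using base_8 less.prems by blast
    show ?thesis using Fam_or_exceptional[OF less.prems(1) Q(2) small_lists(4)[OF Q(1)]] True by blast
  next
    case False
    then have n9: "n \<ge> 9" using less.prems(5) by simp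
    \<comment> \<open>Required for all contractible edges: an arbitrary one yields the triangle, and
      \<open>tri_Fam\<close> then contracts an edge of the triangle.\<close>
    have contr_Fam: "Fam (V - {x}) (contr E x y)" if xy: "(x, y) \<in> E" "con3 (V - {x}) (contr E x y)" for x y
    proof -
      have xV: "x \<in> V" "y \<in> V" "x \<noteq> y" using S(2,3,5) xy(1) by metis+
      have nK: "\<not> K24 (contr E x y)" using K24_contr[OF less.prems(1) xy(1)] less.prems(3) by blast
      have c: "card (V - {x}) = n - 1" using less.prems(4) xV S(1) by simp
      have "Fam (V - {x}) (contr E x y) \<or>
          (n - 1 = 8 \<and> (\<exists>Q\<in>{e_C, e_C_plus}. giso (V - {x}) (contr E x y) {0..<8} (symc (set Q))))"
        by (rule less.IH) (use n9 sgraph_contr[OF less.prems(1) xV(2,3)] xy(2) nK c in auto)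
      moreover have "\<not> giso (V - {x}) (contr E x y) {0..<8} (symc (set Q))" if "Q \<in> {e_C, e_C_plus}" for Q
      proof
        assume g: "giso (V - {x}) (contr E x y) {0..<8} (symc (set Q))"
        have "\<exists>ts. graph_check False 8 [] Q ts"
          using that check_C check_C_plus unfolding insert_iff empty_iff by blast
        then obtain ts where "graph_check False 8 [] Q ts" by blast
        then have "good False [] V E" using split_sound[OF less.prems(1,2) xy(1) g] by blast
        then show False using less.prems(3) unfolding good_def by simp
      qed
      ultimately show ?thesis by blast
    qed
    obtain x y where xy: "(x, y) \<in> E" "con3 (V - {x}) (contr E x y)"
      using contractible_edge[OF less.prems(2,1)] less.prems(4) n9 by auto
    have "tri E" using split_of_Fam[OF less.prems(1,2) xy contr_Fam[OF xy]] less.prems(3,4) n9 by blast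
    then have "Fam V E" using tri_Fam[OF less.prems(1-3) _ _ contr_Fam] less.prems(4) n9 by simp
    then show ?thesis ..
  qed
qed

theorem classification:
  assumes "sgraph V E" "con3 V E" "\<not> K24 E"
  shows "Fam V E \<or> (\<exists>(n, Q)\<in>set exceptional. giso V E {0..<n} (symc (set Q)))"
proof -
  have "card V \<ge> 4" using assms(2) unfolding con3_def by simp
  then consider "card V = 4" | "card V = 5" | "card V = 6" | "card V = 7" | "card V \<ge> 8" by linarith
  then show ?thesis
  proof cases
    case 1
    have "giso V E {0..<4} (symc (set (fam_edges 0 0 0 True)))" using base_4[OF assms(1,2) 1] by simp
    then show ?thesis using giso_fam_edges_Fam[OF assms(1), of 4 0 0 0 True] by simp
  next
    case 2
    then show ?thesis using base_5[OF assms] Fam_or_exceptional[OF assms(1) _ small_lists(1)] by blast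
  next
    case 3
    then show ?thesis using base_6[OF assms] Fam_or_exceptional[OF assms(1) _ small_lists(2)] by blast
  next
    case 4
    then show ?thesis using base_7[OF assms] Fam_or_exceptional[OF assms(1) _ small_lists(3)] by blast
  next
    case 5
    then show ?thesis using classification_large[OF assms HOL.refl] unfolding exceptional_def by auto
  qed
qed

section \<open>The exceptional graphs\<close>

text \<open>Bags are only required to have no isolated vertex, which is weaker than connectedness but enough
  to refute a minor in the exceptional graphs.\<close>

definition K24_candidates :: "nat \<Rightarrow> edges \<Rightarrow> nat list list" where
  "K24_candidates n P = filter (\<lambda>A. A \<noteq> [] \<and> length A + 5 \<le> n \<and> (length A = 1 \<or> list_all (adj_set P A) A) \<and>
     length (filter (\<lambda>v. v \<notin> set A \<and> adj_set P A v) [0..<n]) \<ge> 4) (subseqs [0..<n])"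

definition no_K24_check :: "nat \<Rightarrow> edges \<Rightarrow> bool" where
  "no_K24_check n P \<longleftrightarrow> list_all (\<lambda>(u, v). u < n \<and> v < n) P \<and>
     (let S = K24_candidates n P in list_all (\<lambda>A. list_all (\<lambda>B.
         length (filter (\<lambda>v. v \<notin> set A \<and> v \<notin> set B \<and> adj_set P A v \<and> adj_set P B v) [0..<n]) < 4)
       (filter (\<lambda>B. length A + length B + 4 \<le> n \<and> list_all (\<lambda>x. x \<notin> set B) A) S)) S)"

text \<open>The two bags and four common neighbours are disjoint, so \<open>A\<close> and
  \<open>B\<close> together have at most \<open>n - 4\<close> elements and each at most
  \<open>n - 5\<close>; this limits the candidates. Each bag occurs among the sublists of
  \<open>[0..<n]\<close>.\<close>

lemma no_K24_check_sound:
  assumes "no_K24_check n P" shows "\<not> K24 (symc (set P))"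
proof
  let ?E = "symc (set P)"
  assume "K24 ?E"
  then obtain A B where AB: "A \<inter> B = {}" "conn ?E A" "conn ?E B" "card (common ?E A B) \<ge> 4"
    unfolding K24_def by blast
  have P: "?E \<subseteq> {0..<n} \<times> {0..<n}" using assms unfolding no_K24_check_def by (auto simp: list_all_iff)
  have "common ?E A B \<noteq> {}" using AB(4) by auto
  then obtain c where c: "c \<in> common ?E A B" by blast
  have "A \<subseteq> Domain ?E" "B \<subseteq> Domain ?E"
    using c conn_Domain[OF AB(2)] conn_Domain[OF AB(3)] unfolding common_def by blast+
  then have sub: "A \<subseteq> {0..<n}" "B \<subseteq> {0..<n}" "common ?E A B \<subseteq> {0..<n}"
    using P unfolding common_def by blast+
  have fin: "finite A" "finite B" "finite (common ?E A B)" using sub finite_subset by blast+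
  have "card (A \<union> B \<union> common ?E A B) = card A + card B + card (common ?E A B)"
    using AB(1) fin unfolding common_def by (subst card_Un_disjoint, auto)+
  moreover have "card (A \<union> B \<union> common ?E A B) \<le> card {0..<n}" using sub by (intro card_mono) auto
  ultimately have cn: "card A + card B + 4 \<le> n" using AB(4) by simp
  have cand: "\<exists>xs\<in>set (K24_candidates n P). set xs = X \<and> length xs = card X"
    if X: "X \<subseteq> {0..<n}" "conn ?E X" "card X + 5 \<le> n" "\<And>v. v \<in> common ?E A B \<Longrightarrow> v \<notin> X \<and> (\<exists>x\<in>X. (x, v) \<in> ?E)" for X
  proof -
    have "X \<in> set ` set (subseqs [0..<n])" unfolding subseqs_powset using X(1) by auto
    then obtain xs where xs: "xs \<in> set (subseqs [0..<n])" "set xs = X" by blast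
    have l: "length xs = card X" using subseqs_distinctD[OF xs(1)] distinct_card xs(2) by (metis distinct_upt)
    have "adj_set P xs v" if v: "v \<in> X" and n1: "card X \<noteq> 1" for v
    proof -
      have "{v} \<noteq> X" using n1 by auto
      then obtain y where "y \<in> X" "(v, y) \<in> ?E" using connD[OF X(2), of "{v}"] v by blast
      then show ?thesis using xs(2) unfolding adj_set_def list_ex_iff adj_def by auto
    qed
    moreover have "length (filter (\<lambda>v. v \<notin> set xs \<and> adj_set P xs v) [0..<n]) \<ge> 4"
    proof -
      have "common ?E A B \<subseteq> set (filter (\<lambda>v. v \<notin> set xs \<and> adj_set P xs v) [0..<n])"
      proof
        fix v assume v: "v \<in> common ?E A B"
        then have "v < n" using sub(3) by auto
        then show "v \<in> set (filter (\<lambda>v. v \<notin> set xs \<and> adj_set P xs v) [0..<n])"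
          using X(4)[OF v] xs(2) by (auto simp: adj_set_def list_ex_iff adj_def)
      qed
      then have "card (common ?E A B) \<le> length (filter (\<lambda>v. v \<notin> set xs \<and> adj_set P xs v) [0..<n])"
        by (meson card_length card_mono finite_set le_trans)
      then show ?thesis using AB(4) by linarith
    qed
    ultimately have "xs \<in> set (K24_candidates n P)"
      using xs l X(3) conn_nonempty[OF X(2)] unfolding K24_candidates_def by (auto simp: list_all_iff)
    then show ?thesis using xs l by blast
  qed
  have pos: "card A > 0" "card B > 0" using conn_nonempty[OF AB(2)] conn_nonempty[OF AB(3)] fin by (auto simp: card_gt_0_iff)
  obtain xs where xs: "xs \<in> set (K24_candidates n P)" "set xs = A" "length xs = card A"
    using cand[OF sub(1) AB(2)] cn pos unfolding common_def by auto
  obtain ys where ys: "ys \<in> set (K24_candidates n P)" "set ys = B" "length ys = card B"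
    using cand[OF sub(2) AB(3)] cn pos unfolding common_def by auto
  let ?L = "filter (\<lambda>v. v \<notin> set xs \<and> v \<notin> set ys \<and> adj_set P xs v \<and> adj_set P ys v) [0..<n]"
  have "list_all (\<lambda>x. x \<notin> set ys) xs" using AB(1) xs ys by (auto simp: list_all_iff)
  moreover have "length xs + length ys + 4 \<le> n" using cn xs ys by simp
  ultimately have "length ?L < 4"
    using assms xs(1) ys(1) unfolding no_K24_check_def Let_def list_all_iff by auto
  moreover have "common ?E A B \<subseteq> set ?L"
  proof
    fix v assume v: "v \<in> common ?E A B"
    then have "v \<notin> A" "v \<notin> B" "\<exists>x\<in>A. (x, v) \<in> ?E" "\<exists>x\<in>B. (x, v) \<in> ?E" "v < n"
      using sub(3) unfolding common_def by auto
    then show "v \<in> set ?L" using xs(2) ys(2) by (auto simp: adj_set_def list_ex_iff adj_def)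
  qed
  then have "card (common ?E A B) \<le> length ?L"
    by (meson card_length card_mono finite_set le_trans)
  ultimately show False using AB(4) by simp
qed

lemma no_K24_K5: "no_K24_check 5 e_K5" by code_simp
lemma no_K24_A_plus: "no_K24_check 6 e_A_plus" by code_simp
lemma no_K24_B_plus: "no_K24_check 7 e_B_plus" by code_simp
lemma no_K24_C_plus: "no_K24_check 8 e_C_plus" by code_simp
lemma no_K24_D: "no_K24_check 7 e_D" by code_simp

text \<open>Absence of the minor passes to subgraphs, so the search is run only for
  \<open>e_K5\<close>, \<open>e_A_plus\<close>, \<open>e_B_plus\<close>, \<open>e_C_plus\<close> and
  \<open>e_D\<close>.\<close>

lemma no_K24_exceptional:
  assumes "(n, Q) \<in> set exceptional" shows "\<not> K24 (symc (set Q))"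
proof -
  have "set e_K33 \<subseteq> set e_A_plus" "set e_A \<subseteq> set e_A_plus" "set e_B \<subseteq> set e_B_plus" "set e_C \<subseteq> set e_C_plus"
    unfolding e_A_plus_def e_A_def e_B_plus_def e_C_plus_def by auto
  note sub = this[THEN symc_mono]
  note c = no_K24_check_sound[OF no_K24_K5] no_K24_check_sound[OF no_K24_A_plus] no_K24_check_sound[OF no_K24_B_plus]
      no_K24_check_sound[OF no_K24_C_plus] no_K24_check_sound[OF no_K24_D]
  have "\<not> K24 (symc (set e_K33))" "\<not> K24 (symc (set e_A))" "\<not> K24 (symc (set e_B))" "\<not> K24 (symc (set e_C))"
    using K24_mono[OF _ sub(1)] K24_mono[OF _ sub(2)] K24_mono[OF _ sub(3)] K24_mono[OF _ sub(4)] c(2-4) by auto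
  then show ?thesis using assms c unfolding exceptional_def by auto
qed

section \<open>Edge lists as copies of the named graphs\<close>

definition is_copy :: "nat \<Rightarrow> edges \<Rightarrow> 'a pair_pre_digraph \<Rightarrow> bool" where
  "is_copy n Q H \<longleftrightarrow> pair_graph H \<and> giso {0..<n} (symc (set Q)) (pverts H) (parcs H)"

text \<open>The entry of \<open>vs\<close> at a position is the name, in the given graph, of the
  vertex with that number. This absorbs the shift by one and the gap in the vertex names of
  \<open>graph_B\<close>.\<close>

lemma is_copyI:
  assumes "distinct vs" "length vs = n" "list_all (\<lambda>(u, v). u < n \<and> v < n \<and> u \<noteq> v) Q"
    and "pverts H = set vs" "parcs H = symc (set (map (\<lambda>(u, v). (vs ! u, vs ! v)) Q))"
  shows "is_copy n Q H"
proof -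
  have b: "bij_betw ((!) vs) {0..<n} (pverts H)"
    by (rule bij_betw_nth[OF assms(1)]) (use assms in \<open>simp_all add: lessThan_atLeast0\<close>)
  have s: "sgraph {0..<n} (symc (set Q))"
    using assms(3) unfolding sgraph_def list_all_iff by (auto simp: symc_def sym_def irrefl_def)
  have "map_prod ((!) vs) ((!) vs) ` symc (set Q) = parcs H"
    unfolding assms(5) by (auto simp: symc_def image_iff split: prod.splits)
  then show ?thesis unfolding is_copy_def
    using giso_image(1,2)[OF s b] sgraph_pair_graph by metis
qed

lemma parcs_graph_of: "parcs (graph_of V E) = symc E"
  by (simp add: graph_of_def symc_def)

lemma parcs_add_edge: "parcs G = symc E \<Longrightarrow> parcs (add_edge G u v) = symc (insert (u, v) E)"
  by (auto simp: add_edge_def symc_def)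

lemma parcs_delete_edge:
  "parcs G = symc (insert (u, v) E) \<Longrightarrow> (u, v) \<notin> E \<Longrightarrow> (v, u) \<notin> E \<Longrightarrow> parcs (delete_edge G u v) = symc E"
  by (auto simp: delete_edge_def symc_def)

lemma parcs_K33: "parcs graph_K33 = symc {(1, 4), (1, 5), (1, 6), (2, 4), (2, 5), (2, 6), (3, 4), (3, 5), (3, 6)}"
  unfolding graph_K33_def parcs_graph_of by (rule arg_cong[of _ _ symc]) auto

lemma parcs_A: "parcs graph_A = symc {(1, 2), (1, 4), (1, 5), (1, 6), (2, 4), (2, 5), (2, 6), (3, 4), (3, 5), (3, 6)}"
  unfolding graph_A_def by (rule parcs_add_edge[OF parcs_K33])

lemma parcs_A_plus:
  "parcs graph_A_plus = symc {(4, 5), (1, 2), (1, 4), (1, 5), (1, 6), (2, 4), (2, 5), (2, 6), (3, 4), (3, 5), (3, 6)}"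
  unfolding graph_A_plus_def by (rule parcs_add_edge[OF parcs_A[unfolded graph_A_def]])

text \<open>The edge \<open>(4, 5)\<close> comes first, where \<open>parcs_delete_edge\<close>
  expects the edge to be removed.\<close>

lemma parcs_B_plus: "parcs graph_B_plus = symc
  {(4, 5), (1, 2), (1, 3), (2, 3), (1, 4), (1, 5), (4, 6), (4, 8), (5, 6), (5, 8), (3, 6), (2, 8)}"
  unfolding graph_B_plus_def parcs_graph_of by (rule arg_cong[of _ _ symc]) auto

lemma parcs_B: "parcs graph_B = symc
  {(1, 2), (1, 3), (2, 3), (1, 4), (1, 5), (4, 6), (4, 8), (5, 6), (5, 8), (3, 6), (2, 8)}"
  unfolding graph_B_def by (rule parcs_delete_edge[OF parcs_B_plus]) simp_all

lemma parcs_C_plus: "parcs graph_C_plus = symc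
  {(4, 5), (1, 2), (1, 3), (2, 3), (1, 7), (2, 8), (3, 6), (4, 6), (4, 7), (4, 8), (5, 6), (5, 7), (5, 8)}"
  unfolding graph_C_plus_def parcs_graph_of by (rule arg_cong[of _ _ symc]) auto

lemma parcs_C: "parcs graph_C = symc
  {(1, 2), (1, 3), (2, 3), (1, 7), (2, 8), (3, 6), (4, 6), (4, 7), (4, 8), (5, 6), (5, 7), (5, 8)}"
  unfolding graph_C_def by (rule parcs_delete_edge[OF parcs_C_plus]) simp_all

lemma parcs_D: "parcs graph_D = symc
  {(1, 2), (2, 3), (1, 3), (4, 5), (5, 6), (4, 6), (1, 4), (2, 5), (3, 6), (7, 1), (7, 2), (7, 3)}"
  unfolding graph_D_def parcs_graph_of by (rule arg_cong[of _ _ symc]) auto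

lemma pverts_exceptional:
  "pverts graph_A = set [1, 2, 3, 4, 5, 6]" "pverts graph_A_plus = set [1, 2, 3, 4, 5, 6]"
  "pverts graph_B = set [1, 2, 3, 4, 5, 6, 8]" "pverts graph_B_plus = set [1, 2, 3, 4, 5, 6, 8]"
  "pverts graph_C = set [1, 2, 3, 4, 5, 6, 7, 8]" "pverts graph_C_plus = set [1, 2, 3, 4, 5, 6, 7, 8]"
  "pverts graph_D = set [1, 2, 3, 4, 5, 6, 7]"
  unfolding graph_A_plus_def graph_A_def graph_K33_def graph_B_def graph_B_plus_def graph_C_def graph_C_plus_def
    graph_D_def add_edge_def delete_edge_def graph_of_def by auto

lemma is_copy_A: "is_copy 6 e_A graph_A"
  by (rule is_copyI[OF _ _ _ pverts_exceptional(1)])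
    (simp_all add: parcs_A e_A_def e_K33_def)

lemma is_copy_A_plus: "is_copy 6 e_A_plus graph_A_plus"
  by (rule is_copyI[OF _ _ _ pverts_exceptional(2)])
    (simp_all add: parcs_A_plus e_A_plus_def e_A_def e_K33_def)

lemma is_copy_B: "is_copy 7 e_B graph_B"
  by (rule is_copyI[OF _ _ _ pverts_exceptional(3)])
    (simp_all add: parcs_B e_B_def insert_commute)

lemma is_copy_B_plus: "is_copy 7 e_B_plus graph_B_plus"
  by (rule is_copyI[OF _ _ _ pverts_exceptional(4)])
    (simp_all add: parcs_B_plus e_B_plus_def e_B_def insert_commute)

lemma is_copy_C: "is_copy 8 e_C graph_C"
  by (rule is_copyI[OF _ _ _ pverts_exceptional(5)])
    (simp_all add: parcs_C e_C_def insert_commute)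

lemma is_copy_C_plus: "is_copy 8 e_C_plus graph_C_plus"
  by (rule is_copyI[OF _ _ _ pverts_exceptional(6)])
    (simp_all add: parcs_C_plus e_C_plus_def e_C_def insert_commute)

lemma is_copy_D: "is_copy 7 e_D graph_D"
  by (rule is_copyI[OF _ _ _ pverts_exceptional(7)])
    (simp_all add: parcs_D e_D_def)

lemma exceptional_not_K24:
  assumes "sgraph V E" "giso V E {0..<n} (symc (set Q))" "(n, Q) \<in> set exceptional"
  shows "\<not> K24 E"
  using K24_giso[OF assms(2)] no_K24_exceptional[OF assms(3)] assms(1) unfolding sgraph_def by auto

section \<open>Translation to the graphs named in the theorem\<close>

lemma sgraph_Gnrs:
  assumes "n \<ge> 3" "r \<le> n - 3" "s \<le> n - 3"
  shows "sgraph {1..n} (parcs (Gnrs n r s))"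
  unfolding Gnrs_arcs[OF assms(1,2)] using assms by (auto simp: sgraph_def symc_def sym_def irrefl_def)

lemma pair_graph_Gnrs:
  assumes "n \<ge> 3" "r \<le> n - 3" "s \<le> n - 3"
  shows "pair_graph (Gnrs n r s)" "pair_graph (Gnrs_plus n r s)"
proof -
  have v: "pverts (Gnrs n r s) = {1..n}" by (simp add: Gnrs_def graph_of_def)
  note sg = sgraph_Gnrs[OF assms]
  show "pair_graph (Gnrs n r s)" by (rule sgraph_pair_graph) (use sg v in simp)
  have "sgraph {1..n} (parcs (Gnrs n r s) \<union> {(1, n), (n, 1)})"
    using sg assms(1) unfolding sgraph_def by (auto simp: sym_def irrefl_def)
  then show "pair_graph (Gnrs_plus n r s)"
    using v by (intro sgraph_pair_graph) (simp add: Gnrs_plus_def add_edge_def)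
qed

lemma complete_5_iff:
  assumes "pair_graph G"
  shows "K\<^bsub>5\<^esub> (with_proj G) \<longleftrightarrow> giso (pverts G) (parcs G) {0..<5} (symc (set e_K5))"
proof
  have "list_all (\<lambda>a. list_all (\<lambda>b. adj e_K5 a b = (a \<noteq> b)) [0..<5]) [0..<5]" by code_simp
  then have Q: "(a, b) \<in> symc (set e_K5) \<longleftrightarrow> a \<noteq> b" if "a < 5" "b < 5" for a b
    using that unfolding list_all_iff adj_iff by auto
  note S = sgraphD[OF pair_graph_sgraph[OF assms]]
  {
    assume "K\<^bsub>5\<^esub> (with_proj G)"
    then have G: "card (pverts G) = 5" "parcs G = {(u, v). (u, v) \<in> pverts G \<times> pverts G \<and> u \<noteq> v}"
      unfolding complete_digraph_pair_def by blast+
    obtain f where f: "bij_betw f (pverts G) {0..<5::nat}" using ex_bij_betw_finite_nat[OF S(1)] G(1) by auto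
    show "giso (pverts G) (parcs G) {0..<5} (symc (set e_K5))"
      unfolding giso_def
    proof (intro exI[of _ f] conjI ballI f)
      fix u v assume uv: "u \<in> pverts G" "v \<in> pverts G"
      then have "f u < 5" "f v < 5" using f by (auto simp: bij_betw_def)
      moreover have "f u = f v \<longleftrightarrow> u = v" using f uv by (auto simp: bij_betw_def dest: inj_onD)
      ultimately show "(u, v) \<in> parcs G \<longleftrightarrow> (f u, f v) \<in> symc (set e_K5)" using G(2) uv Q by auto
    qed
  next
    assume g: "giso (pverts G) (parcs G) {0..<5} (symc (set e_K5))"
    then obtain f where f: "bij_betw f (pverts G) {0..<5}"
      "\<forall>u\<in>pverts G. \<forall>v\<in>pverts G. (u, v) \<in> parcs G \<longleftrightarrow> (f u, f v) \<in> symc (set e_K5)"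
      unfolding giso_def by blast
    have "(u, v) \<in> parcs G \<longleftrightarrow> u \<noteq> v" if uv: "u \<in> pverts G" "v \<in> pverts G" for u v
    proof -
      have "f u < 5" "f v < 5" using f(1) uv by (auto simp: bij_betw_def)
      moreover have "f u = f v \<longleftrightarrow> u = v" using f(1) uv by (auto simp: bij_betw_def dest: inj_onD)
      ultimately show ?thesis using f(2) uv Q by auto
    qed
    then have "parcs G = {(u, v). (u, v) \<in> pverts G \<times> pverts G \<and> u \<noteq> v}" using S(2,3) by blast
    then show "K\<^bsub>5\<^esub> (with_proj G)"
      unfolding complete_digraph_pair_def using S(1) giso_card[OF g] by simp
  }
qed

text \<open>Two numbers are adjacent in \<open>e_K33\<close> exactly if one of them is below 3 and
  the other is not; so the parts are numbered 0 to 2 and 3 to 5, and recovered by comparison with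
  3.\<close>

lemma complete_bipartite_3_3_iff:
  assumes "pair_graph G"
  shows "K\<^bsub>3,3\<^esub> (with_proj G) \<longleftrightarrow> giso (pverts G) (parcs G) {0..<6} (symc (set e_K33))"
proof
  have "list_all (\<lambda>a. list_all (\<lambda>b. adj e_K33 a b = ((a < 3) \<noteq> (b < 3))) [0..<6]) [0..<6]" by code_simp
  then have Q: "(a, b) \<in> symc (set e_K33) \<longleftrightarrow> (a < 3) \<noteq> (b < 3)" if "a < 6" "b < 6" for a b
    using that unfolding list_all_iff adj_iff by auto
  note S = sgraphD[OF pair_graph_sgraph[OF assms]]
  {
    assume "K\<^bsub>3,3\<^esub> (with_proj G)"
    then obtain U W where G: "pverts G = U \<union> W" "U \<inter> W = {}" "card U = 3" "card W = 3" "parcs G = U \<times> W \<union> W \<times> U"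
      unfolding complete_bipartite_digraph_pair_def by blast
    have fin: "finite U" "finite W" using G(1) S(1) by auto
    obtain g where g: "bij_betw g U {0..<3::nat}" using ex_bij_betw_finite_nat[OF fin(1)] G(3) by auto
    obtain h where h: "bij_betw h W {0..<3::nat}" using ex_bij_betw_finite_nat[OF fin(2)] G(4) by auto
    define f where "f v = (if v \<in> U then g v else h v + 3)" for v
    have "bij_betw f U {0..<3}" using g by (rule bij_betw_cong[THEN iffD1, rotated]) (simp add: f_def)
    moreover have "bij_betw f W {3..<6}"
    proof -
      have "bij_betw (\<lambda>v. v + 3) {0..<3::nat} {3..<6}" by (rule bij_betwI[where g = "\<lambda>v. v - 3"]) auto
      then have "bij_betw ((\<lambda>v. v + 3) \<circ> h) W {3..<6}" using h by (rule bij_betw_trans[rotated])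
      then show ?thesis by (rule bij_betw_cong[THEN iffD1, rotated]) (use G(2) in \<open>auto simp: f_def\<close>)
    qed
    ultimately have "bij_betw f (U \<union> W) ({0..<3} \<union> {3..<6})" by (rule bij_betw_combine) auto
    moreover have "{0..<3} \<union> {3..<6} = {0..<6::nat}" by auto
    ultimately have f: "bij_betw f (pverts G) {0..<6}" unfolding G(1) by simp
    have fU: "f v < 3 \<longleftrightarrow> v \<in> U" if "v \<in> pverts G" for v
      using g that unfolding f_def by (auto simp: bij_betw_def)
    show "giso (pverts G) (parcs G) {0..<6} (symc (set e_K33))"
      unfolding giso_def
    proof (intro exI[of _ f] conjI ballI f)
      fix u v assume uv: "u \<in> pverts G" "v \<in> pverts G"
      then have "f u < 6" "f v < 6" using f by (auto simp: bij_betw_def)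
      then show "(u, v) \<in> parcs G \<longleftrightarrow> (f u, f v) \<in> symc (set e_K33)"
        using Q fU uv G(1,2,5) by auto
    qed
  next
    assume "giso (pverts G) (parcs G) {0..<6} (symc (set e_K33))"
    then obtain f where f: "bij_betw f (pverts G) {0..<6}"
      "\<forall>u\<in>pverts G. \<forall>v\<in>pverts G. (u, v) \<in> parcs G \<longleftrightarrow> (f u, f v) \<in> symc (set e_K33)"
      unfolding giso_def by blast
    define U W where "U = {v \<in> pverts G. f v < 3}" and "W = {v \<in> pverts G. \<not> f v < 3}"
    have "inj_on f U" "inj_on f W" using f(1) unfolding bij_betw_def U_def W_def by (auto intro: inj_on_subset)
    moreover have "f ` U = {0..<3}" "f ` W = {3..<6}"
    proof -
      have im: "f ` pverts G = {0..<6}" using f(1) by (simp add: bij_betw_def)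
      have "f ` U = f ` pverts G \<inter> {..<3}" "f ` W = f ` pverts G \<inter> {3..}" unfolding U_def W_def by auto
      then show "f ` U = {0..<3}" "f ` W = {3..<6}" unfolding im by auto
    qed
    ultimately have c: "card U = 3" "card W = 3" using card_image[of f U] card_image[of f W] by simp_all
    have E: "(u, v) \<in> parcs G \<longleftrightarrow> (f u < 3) \<noteq> (f v < 3)" if uv: "u \<in> pverts G" "v \<in> pverts G" for u v
    proof -
      have "f u < 6" "f v < 6" using f(1) uv by (auto simp: bij_betw_def)
      then show ?thesis using f(2) uv Q by auto
    qed
    have "parcs G = U \<times> W \<union> W \<times> U"
    proof (rule set_eqI, clarify)
      fix u v
      show "(u, v) \<in> parcs G \<longleftrightarrow> (u, v) \<in> U \<times> W \<union> W \<times> U"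
        using E[of u v] S(2)[of u v] S(3)[of u v] unfolding U_def W_def by auto
    qed
    moreover have "pverts G = U \<union> W" "U \<inter> W = {}" unfolding U_def W_def by auto
    ultimately show "K\<^bsub>3,3\<^esub> (with_proj G)"
      unfolding complete_bipartite_digraph_pair_def using S(1) c by blast
  }
qed

lemma exceptional_iff:
  assumes "pair_graph G"
  shows "(\<exists>(n, Q)\<in>set exceptional. giso (pverts G) (parcs G) {0..<n} (symc (set Q))) \<longleftrightarrow>
    K\<^bsub>5\<^esub> (with_proj G) \<or> K\<^bsub>3,3\<^esub> (with_proj G) \<or>
    (\<exists>H \<in> {graph_A, graph_A_plus, graph_B, graph_B_plus, graph_C, graph_C_plus, graph_D}.
       digraph_iso (with_proj G) (with_proj H))"
proof -
  have iso: "digraph_iso (with_proj G) (with_proj H) \<longleftrightarrow> giso (pverts G) (parcs G) {0..<n} (symc (set Q))"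
    if "is_copy n Q H" for H :: "nat pair_pre_digraph" and n Q
    using that digraph_iso_iff_giso[OF assms] giso_trans giso_sym unfolding is_copy_def by metis
  show ?thesis
    unfolding exceptional_def complete_5_iff[OF assms] complete_bipartite_3_3_iff[OF assms]
    by (simp add: iso[OF is_copy_A] iso[OF is_copy_A_plus] iso[OF is_copy_B] iso[OF is_copy_B_plus]
      iso[OF is_copy_C] iso[OF is_copy_C_plus] iso[OF is_copy_D])
qed

text \<open>\<open>family_G\<close> demands that its members be 3-connected and minor-free; the
  graph \<open>H\<close> inherits both from \<open>G\<close> along the isomorphism.\<close>

lemma Fam_family_G_tilde:
  assumes "pair_graph G" "k_connected 3 G" "K24_minor_free G" "Fam (pverts G) (parcs G)"
  shows "G \<in> family_G_tilde"
proof -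
  note sG = pair_graph_sgraph[OF assms(1)]
  obtain a b p Bs Os As q ab where fam: "is_fam (pverts G) (parcs G) a b p Bs Os As q ab"
    using assms(4) unfolding Fam_def by blast
  note F = is_fam_facts[OF fam]
  let ?i = "length Bs" and ?k = "length Os" and ?j = "length As"
  define n where "n = ?i + ?k + ?j + 4"
  define H where "H = (if ab then Gnrs_plus n (?k + ?j + 1) (?i + ?k + 1) else Gnrs n (?k + ?j + 1) (?i + ?k + 1))"
  have card: "card (pverts G) = n" using distinct_card[OF F(7)] F(8) unfolding n_def by simp
  have g: "giso (pverts G) (parcs G) (pverts H) (parcs H)"
    using giso_trans[OF is_fam_giso_edges[OF fam, unfolded card] fam_edges_giso_Gnrs[OF n_def F(9) H_def]] .
  have bounds: "n \<ge> 3" "?k + ?j + 1 \<le> n - 3" "?i + ?k + 1 \<le> n - 3" unfolding n_def by simp_all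
  have pH: "pair_graph H" unfolding H_def using pair_graph_Gnrs[OF bounds] by simp
  note sH = pair_graph_sgraph[OF pH]
  have "k_connected 3 H"
    using giso_con3[OF g] assms(2) unfolding k_connected_iff_con3[OF assms(1)] k_connected_iff_con3[OF pH] by blast
  moreover have "K24_minor_free H"
    using giso_K24[OF g sG] sH assms(3) unfolding K24_minor_free_iff[OF assms(1)] K24_minor_free_iff[OF pH] sgraph_def by blast
  moreover have "H = Gnrs n (?k + ?j + 1) (?i + ?k + 1) \<or> H = Gnrs_plus n (?k + ?j + 1) (?i + ?k + 1)"
    unfolding H_def by simp
  ultimately have "H \<in> family_G" unfolding family_G_def using bounds by (metis (mono_tags, lifting) atLeastAtMost_iff le0 mem_Collect_eq)
  moreover have "digraph_iso (with_proj G) (with_proj H)" using digraph_iso_iff_giso[OF assms(1) pH] g by blast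
  ultimately show ?thesis unfolding family_G_tilde_def by blast
qed

text \<open>Freeness is part of the definition of \<open>family_G\<close> and only has to be carried
  along the isomorphism.\<close>

lemma family_G_tilde_K24_minor_free:
  assumes "pair_graph G" "G \<in> family_G_tilde"
  shows "K24_minor_free G"
proof -
  obtain H where H: "H \<in> family_G" "digraph_iso (with_proj G) (with_proj H)"
    using assms(2) unfolding family_G_tilde_def by blast
  then obtain n r s where "n \<ge> 3" "r \<le> n - 3" "s \<le> n - 3" "H = Gnrs n r s \<or> H = Gnrs_plus n r s"
    unfolding family_G_def by auto
  then have pH: "pair_graph H" using pair_graph_Gnrs by blast
  have g: "giso (pverts H) (parcs H) (pverts G) (parcs G)"
    using digraph_iso_iff_giso[OF assms(1) pH] H(2) giso_sym by blast
  show ?thesis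
    using giso_K24[OF g pair_graph_sgraph[OF pH]] pair_graph_sgraph[OF assms(1)] H(1)
    unfolding K24_minor_free_iff[OF assms(1)] family_G_def sgraph_def using K24_minor_free_iff[OF pH] by blast
qed

theorem theorem2p12:
  fixes G :: "'a pair_pre_digraph"
  assumes "pair_graph G"
    and "k_connected 3 G"
  shows "K24_minor_free G \<longleftrightarrow>
    G \<in> family_G_tilde \<or>
    K\<^bsub>5\<^esub> (with_proj G) \<or> K\<^bsub>3,3\<^esub> (with_proj G) \<or>
    (\<exists>H \<in> {graph_A, graph_A_plus, graph_B, graph_B_plus, graph_C, graph_C_plus, graph_D}.
       digraph_iso (with_proj G) (with_proj H))"
proof -
  note sG = pair_graph_sgraph[OF assms(1)]
  let ?exc = "\<exists>(n, Q)\<in>set exceptional. giso (pverts G) (parcs G) {0..<n} (symc (set Q))"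
  have "K24_minor_free G \<longleftrightarrow> G \<in> family_G_tilde \<or> ?exc"
  proof
    assume mf: "K24_minor_free G"
    have "Fam (pverts G) (parcs G) \<or> ?exc"
      using classification[OF sG] assms(2) mf
      unfolding k_connected_iff_con3[OF assms(1)] K24_minor_free_iff[OF assms(1)] by blast
    then show "G \<in> family_G_tilde \<or> ?exc" using Fam_family_G_tilde[OF assms mf] by blast
  next
    assume "G \<in> family_G_tilde \<or> ?exc"
    then show "K24_minor_free G"
      using family_G_tilde_K24_minor_free[OF assms(1)] exceptional_not_K24[OF sG]
      unfolding K24_minor_free_iff[OF assms(1)] by blast
  qed
  then show ?thesis unfolding exceptional_iff[OF assms(1)] .
qed

end
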